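(* For every integer $n \ge 2$, both $Z_n$ and $\mathrm{Bd}_n$ are characteristic subgroups of the pure braid group $P_n$ (i.e. $f(Z_n)=Z_n$ and $f(\mathrm{Bd}_n)=\mathrm{Bd}_n$ for every $f\in\mathrm{Aut}(P_n)$). Hence every automorphism of $P_n$ induces an automorphism of $Z_n/\mathrm{Bd}_n\cong\pi_n(S^2)$.
   Context: $B_n$ is the Artin braid group on $n$ strands with standard generators $\sigma_1,\dots,\sigma_{n-1}$, and $P_n$ is the pure braid group, the kernel of the homomorphism $B_n\to\Sigma_n$, $\sigma_i\mapsto (i\ i{+}1)$; $P_1$ is trivial. $P_n$ is generated by $A_{i,j}=\sigma_{j-1}\sigma_{j-2}\cdots\sigma_{i+1}\sigma_i^2\sigma_{i+1}^{-1}\cdots\sigma_{j-2}^{-1}\sigma_{j-1}^{-1}$ for $1\le i<j\le n$. Put $A_{j,i}=A_{i,j}$, $A_{i,i}=1$, and $A_{0,j}=(A_{1,j}A_{2,j}\cdots A_{n,j})^{-1}\in P_n$ for $1\le j\le n$. For $1\le k\le n$, $d_k\colon P_n\to P_{n-1}$ is the homomorphism removing the $k$th strand: $d_k(A_{i,j})=1$ if $k\in\{i,j\}$, and otherwise $d_k(A_{i,j})=A_{i',j'}$ where each index larger than $k$ is decreased by $1$. The automorphism $\theta_n$ of $P_n$ is given by $\theta_n(A_{i,j})=A_{i,j}$ for $2\le i<j\le n$ and $\theta_n(A_{1,j})=A_{1,j}^{-1}A_{0,j}A_{1,j}$ for $2\le j\le n$ (it is known that this is a well-defined automorphism). Put $\partial_n=d_1\circ\theta_n\colon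 P_n\to P_{n-1}$. $\mathrm{Brun}_n=\bigcap_{k=1}^n\ker(d_k)$ is the group of Brunnian braids, $Z_n=\mathrm{Brun}_n\cap\ker(\partial_n)$, and $\mathrm{Bd}_n=\partial_{n+1}(\mathrm{Brun}_{n+1})$. It is known (Berrick, Cohen, Wong, Wu) that $\mathrm{Bd}_n$ is a normal subgroup of $Z_n$ and $Z_n/\mathrm{Bd}_n\cong\pi_n(S^2)$ for $n\ge2$. *)

theory Defs
  imports "HOL-Analysis.Analysis" "HOL-Algebra.Bij" "HOL-Algebra.Sym_Groups"
begin

section \<open>Braid groups and pure braid groups\<close>

text \<open>A letter \<open>(i, True)\<close> stands for the generator \<open>\<sigma>\<^sub>i\<close> and \<open>(i, False)\<close> for its inverse.\<close>

type_synonym braid_word = "(nat \<times> bool) list"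

definition braid_words :: "nat \<Rightarrow> braid_word set" where
  "braid_words n = lists ({1..<n} \<times> UNIV)"

inductive braid_eq :: "nat \<Rightarrow> braid_word \<Rightarrow> braid_word \<Rightarrow> bool" for n where
  refl: "w \<in> braid_words n \<Longrightarrow> braid_eq n w w"
| sym: "braid_eq n v w \<Longrightarrow> braid_eq n w v"
| trans: "braid_eq n u v \<Longrightarrow> braid_eq n v w \<Longrightarrow> braid_eq n u w"
| cong: "braid_eq n v w \<Longrightarrow> x \<in> braid_words n \<Longrightarrow> y \<in> braid_words n \<Longrightarrow>
    braid_eq n (x @ v @ y) (x @ w @ y)"
| cancel: "i \<in> {1..<n} \<Longrightarrow> braid_eq n [(i, b), (i, \<not> b)] []"
| far: "i \<in> {1..<n} \<Longrightarrow> j \<in> {1..<n} \<Longrightarrow> i + 2 \<le> j \<Longrightarrow>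
    braid_eq n [(i, True), (j, True)] [(j, True), (i, True)]"
| braid: "i \<in> {1..<n} \<Longrightarrow> i + 1 \<in> {1..<n} \<Longrightarrow>
    braid_eq n [(i, True), (i + 1, True), (i, True)]
               [(i + 1, True), (i, True), (i + 1, True)]"

definition braid_class :: "nat \<Rightarrow> braid_word \<Rightarrow> braid_word set" where
  "braid_class n w = {v. braid_eq n w v}"

definition braid_group :: "nat \<Rightarrow> braid_word set monoid" where
  "braid_group n =
     \<lparr> carrier = braid_class n ` braid_words n,
       mult = (\<lambda>X Y. \<Union>x\<in>X. \<Union>y\<in>Y. braid_class n (x @ y)),
       one = braid_class n [] \<rparr>"

definition word_perm :: "braid_word \<Rightarrow> nat \<Rightarrow> nat" where
  "word_perm w = foldr (\<lambda>(i, b) p. Transposition.transpose i (i + 1) \<circ> p) w id"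

text \<open>All words in a braid class have the same permutation, so the image below is a singleton.\<close>

definition braid_perm :: "braid_word set \<Rightarrow> nat \<Rightarrow> nat" where
  "braid_perm X = the_elem (word_perm ` X)"

definition pure_braid_group :: "nat \<Rightarrow> braid_word set monoid" where
  "pure_braid_group n =
     (braid_group n)\<lparr>carrier := kernel (braid_group n) (sym_group n) braid_perm\<rparr>"

definition pure_gen_word :: "nat \<Rightarrow> nat \<Rightarrow> braid_word" where
  "pure_gen_word i j =
     map (\<lambda>k. (k, True)) (rev [i + 1..<j]) @ [(i, True), (i, True)] @
     map (\<lambda>k. (k, False)) [i + 1..<j]"

text \<open>The elements \<open>A\<^sub>i\<^sub>j\<close> for \<open>1 \<le> i, j \<le> n\<close>, with \<open>A\<^sub>j\<^sub>i = A\<^sub>i\<^sub>j\<close> and \<open>A\<^sub>i\<^sub>i = 1\<close>,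
  and the element \<open>A\<^sub>0\<^sub>j\<close>.\<close>

definition pure_gen :: "nat \<Rightarrow> nat \<Rightarrow> nat \<Rightarrow> braid_word set" where
  "pure_gen n i j =
     (if i = j then \<one>\<^bsub>pure_braid_group n\<^esub>
      else braid_class n (pure_gen_word (min i j) (max i j)))"

definition pure_gen0 :: "nat \<Rightarrow> nat \<Rightarrow> braid_word set" where
  "pure_gen0 n j =
     inv\<^bsub>pure_braid_group n\<^esub>
       (foldr (\<lambda>i x. pure_gen n i j \<otimes>\<^bsub>pure_braid_group n\<^esub> x) [1..<n + 1] \<one>\<^bsub>pure_braid_group n\<^esub>)"


section \<open>Strand deletion, the automorphism \<open>\<theta>\<close>, and the groups \<open>Z\<close> and \<open>Bd\<close>\<close>

text \<open>The \<open>A\<^sub>i\<^sub>j\<close> generate the pure braid group, so a homomorphism on it is determined by its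
  values on them; extensionality fixes the value outside the carrier, as in \<^const>\<open>auto\<close>.\<close>

definition shift_index :: "nat \<Rightarrow> nat \<Rightarrow> nat" where
  "shift_index k i = (if k < i then i - 1 else i)"

definition del_strand :: "nat \<Rightarrow> nat \<Rightarrow> braid_word set \<Rightarrow> braid_word set" where
  "del_strand n k =
     (THE d. d \<in> hom (pure_braid_group n) (pure_braid_group (n - 1)) \<and>
             d \<in> extensional (carrier (pure_braid_group n)) \<and>
             (\<forall>i j. 1 \<le> i \<and> i < j \<and> j \<le> n \<longrightarrow>
                d (pure_gen n i j) =
                  (if k \<in> {i, j} then \<one>\<^bsub>pure_braid_group (n - 1)\<^esub>
                   else pure_gen (n - 1) (shift_index k i) (shift_index k j))))"

definition theta :: "nat \<Rightarrow> braid_word set \<Rightarrow> braid_word set" where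
  "theta n =
     (THE t. t \<in> auto (pure_braid_group n) \<and>
             (\<forall>i j. 2 \<le> i \<and> i < j \<and> j \<le> n \<longrightarrow> t (pure_gen n i j) = pure_gen n i j) \<and>
             (\<forall>j. 2 \<le> j \<and> j \<le> n \<longrightarrow>
                t (pure_gen n 1 j) =
                  inv\<^bsub>pure_braid_group n\<^esub> (pure_gen n 1 j)
                    \<otimes>\<^bsub>pure_braid_group n\<^esub> pure_gen0 n j
                    \<otimes>\<^bsub>pure_braid_group n\<^esub> pure_gen n 1 j))"

definition bdry_hom :: "nat \<Rightarrow> braid_word set \<Rightarrow> braid_word set" where
  "bdry_hom n = del_strand n 1 \<circ> theta n"

definition Brun :: "nat \<Rightarrow> braid_word set set" where
  "Brun n = (\<Inter>k\<in>{1..n}. kernel (pure_braid_group n) (pure_braid_group (n - 1)) (del_strand n k))"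

definition Z :: "nat \<Rightarrow> braid_word set set" where
  "Z n = Brun n \<inter> kernel (pure_braid_group n) (pure_braid_group (n - 1)) (bdry_hom n)"

definition Bd :: "nat \<Rightarrow> braid_word set set" where
  "Bd n = bdry_hom (n + 1) ` Brun (n + 1)"

definition Z_mod_Bd :: "nat \<Rightarrow> braid_word set set monoid" where
  "Z_mod_Bd n = (pure_braid_group n)\<lparr>carrier := Z n\<rparr> Mod Bd n"

definition characteristic_subgroup :: "'a set \<Rightarrow> ('a, 'b) monoid_scheme \<Rightarrow> bool" where
  "characteristic_subgroup H G \<longleftrightarrow> subgroup H G \<and> (\<forall>f\<in>auto G. f ` H = H)"


section \<open>Homotopy groups\<close>

definition cube :: "nat \<Rightarrow> (nat \<Rightarrow> real) topology" where
  "cube n = subtopology (Euclidean_space n) {x. \<forall>i<n. 0 \<le> x i \<and> x i \<le> 1}"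

definition cube_boundary :: "nat \<Rightarrow> (nat \<Rightarrow> real) set" where
  "cube_boundary n = {x \<in> topspace (cube n). \<exists>i<n. x i = 0 \<or> x i = 1}"

definition cube_maps :: "nat \<Rightarrow> 'a topology \<Rightarrow> 'a \<Rightarrow> ((nat \<Rightarrow> real) \<Rightarrow> 'a) set" where
  "cube_maps n X p = {f. continuous_map (cube n) X f \<and> f ` cube_boundary n \<subseteq> {p}}"

definition cube_map_class ::
    "nat \<Rightarrow> 'a topology \<Rightarrow> 'a \<Rightarrow> ((nat \<Rightarrow> real) \<Rightarrow> 'a) \<Rightarrow> ((nat \<Rightarrow> real) \<Rightarrow> 'a) set" where
  "cube_map_class n X p f =
     {g. homotopic_with (\<lambda>h. h ` cube_boundary n \<subseteq> {p}) (cube n) X f g}"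

definition cube_concat ::
    "((nat \<Rightarrow> real) \<Rightarrow> 'a) \<Rightarrow> ((nat \<Rightarrow> real) \<Rightarrow> 'a) \<Rightarrow> (nat \<Rightarrow> real) \<Rightarrow> 'a" where
  "cube_concat f g =
     (\<lambda>x. if x 0 \<le> 1/2 then f (x(0 := 2 * x 0)) else g (x(0 := 2 * x 0 - 1)))"

text \<open>The \<open>n\<close>-th homotopy group of \<open>X\<close> at the base point \<open>p\<close>, meaningful for \<open>n \<ge> 1\<close>.\<close>

definition homotopy_group ::
    "nat \<Rightarrow> 'a topology \<Rightarrow> 'a \<Rightarrow> ((nat \<Rightarrow> real) \<Rightarrow> 'a) set monoid" where
  "homotopy_group n X p =
     \<lparr> carrier = cube_map_class n X p ` cube_maps n X p,
       mult = (\<lambda>F G. \<Union>f\<in>F. \<Union>g\<in>G. cube_map_class n X p (cube_concat f g)),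
       one = cube_map_class n X p (\<lambda>_. p) \<rparr>"

end

theory Submission
  imports Defs
begin

text \<open>Write \<open>K 0\<close> for the kernel of \<open>\<partial>\<close> and \<open>K k\<close> for the kernel of \<open>d k\<close>; the index \<open>0\<close> plays the role of
  a strand at infinity. On the vertices \<open>{0..n}\<close>, homomorphisms from the pure braid group to the integers that
  kill the full twist are edge weights with vanishing vertex sums. Two such homomorphisms are called
  isotropic if they pair trivially on commuting pairs of braids. A combinatorial argument shows that
  independent isotropic pairs live on four vertices, so an automorphism permutes the four-element
  subsets of \<open>{0..n}\<close>; for \<open>n \<ge> 4\<close> this permutation comes from a permutation \<open>\<kappa>\<close> of the vertices.
  By this choice of \<open>\<kappa>\<close>, the image of \<open>f (K (\<kappa> k))\<close> under the \<open>k\<close>-th deletion has vanishing linking numbers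
  up to the center. It is also normal and finitely generated, so it is central: by combing this reduces to free
  groups, where a nontrivial finitely generated normal subgroup has finite index. Hence \<open>f\<close> permutes the
  \<open>K k\<close> modulo the center. The group \<open>Z n\<close> is the intersection of all \<open>K k\<close>, and \<open>Bd n\<close> is generated
  by the symmetric iterated commutators of the \<open>K b \<inter> K k\<close>, \<open>k \<noteq> b\<close>; both descriptions are insensitive to
  the permutation and to the center. For \<open>n = 3\<close>, \<open>Bd n\<close> is the third term of the lower central series.\<close>

section \<open>The infinite braid group\<close>

text \<open>Modulo its center the pure braid group is the pure mapping class group of the sphere
  with \<open>n\<close> + 1 punctures. This is why infinity is on a par with the strands: \<theta>
  exchanges it with strand 1, and the square of \<theta> is inner. An isotropic plane is the
  cohomology of a free group of rank two, pulled back by forgetting all but four punctures.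
  Cohomology sees only linking numbers; the argument on finitely generated normal subgroups leads
  back from homology to the group itself. Automorphisms may change a braid by central elements, so
  the kernels can be followed only up to the center; commutators do not notice this, and for
  \<open>Z n\<close> a linking number excludes it. On three strands there is a single four-element
  subset, hence no permutation to find; the group modulo its center is free of rank two, with many
  automorphisms, and \<open>Bd n\<close> needs another description. Homomorphisms out of pure
  braids, such as \<theta> and the free coordinates of the kernel of \<open>del 1\<close>, are all
  obtained from the presentation of the braids fixing one strand, whose relations are far fewer than
  those between the pure generators.\<close>

lemma braid_eq_words: "braid_eq n v w \<Longrightarrow> v \<in> braid_words n \<and> w \<in> braid_words n"
  by (induction rule: braid_eq.induct) (auto simp: braid_words_def)

lemma Nil_braid_words [simp]: "[] \<in> braid_words n"
  by (simp add: braid_words_def)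

lemma append_braid_words [simp]: "u @ v \<in> braid_words n \<longleftrightarrow> u \<in> braid_words n \<and> v \<in> braid_words n"
  by (auto simp: braid_words_def)

lemma Cons_braid_words [simp]: "(i, b) # v \<in> braid_words n \<longleftrightarrow> 1 \<le> i \<and> i < n \<and> v \<in> braid_words n"
  by (auto simp: braid_words_def)

lemma braid_words_mono: "n \<le> m \<Longrightarrow> w \<in> braid_words n \<Longrightarrow> w \<in> braid_words m"
  by (force simp: braid_words_def)

lemma braid_eq_mono: "braid_eq n v w \<Longrightarrow> n \<le> m \<Longrightarrow> braid_eq m v w"
proof (induction rule: braid_eq.induct)
  case (trans u v w) then show ?case by (blast intro: braid_eq.trans)
next
  case (far i j) then show ?case by (intro braid_eq.far) auto
next
  case (braid i) then show ?case by (intro braid_eq.braid) auto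
qed (auto intro: braid_eq.intros braid_words_mono)

lemma braid_eq_append:
  assumes "braid_eq n u u'" "braid_eq n v v'"
  shows "braid_eq n (u @ v) (u' @ v')"
proof -
  have "braid_eq n ([] @ u @ v) ([] @ u' @ v)"
    using assms braid_eq_words by (intro braid_eq.cong) auto
  moreover have "braid_eq n (u' @ v @ []) (u' @ v' @ [])"
    using assms braid_eq_words by (intro braid_eq.cong) auto
  ultimately show ?thesis by (auto intro: braid_eq.trans)
qed

definition inv_word :: "braid_word \<Rightarrow> braid_word" where
  "inv_word w = rev (map (\<lambda>(i, b). (i, \<not> b)) w)"

lemma inv_word_simps [simp]:
  "inv_word [] = []" "inv_word ((i, b) # w) = inv_word w @ [(i, \<not> b)]"
  "inv_word (u @ v) = inv_word v @ inv_word u"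
  by (auto simp: inv_word_def)

lemma inv_word_braid_words [simp]: "inv_word w \<in> braid_words n \<longleftrightarrow> w \<in> braid_words n"
  by (induction w) auto

lemma inv_word_inv_word [simp]: "inv_word (inv_word w) = w"
  by (induction w) auto

lemma braid_eq_left_inverse:
  assumes "w \<in> braid_words n" shows "braid_eq n (inv_word w @ w) []"
  using assms
proof (induction w)
  case Nil then show ?case by (simp add: braid_eq.refl)
next
  case (Cons a w)
  obtain i b where a: "a = (i, b)" by force
  have "braid_eq n (inv_word w @ [(i, \<not> b), (i, \<not> \<not> b)] @ w) (inv_word w @ [] @ w)"
    using Cons a by (intro braid_eq.cong braid_eq.cancel) auto
  then show ?case using Cons a by (auto intro: braid_eq.trans)
qed

lemma braid_eq_inv_word:
  assumes "braid_eq n u v" shows "braid_eq n (inv_word u) (inv_word v)"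
proof -
  have w: "u \<in> braid_words n" "v \<in> braid_words n" using assms braid_eq_words by auto
  have "braid_eq n (inv_word u @ (v @ inv_word v)) (inv_word u @ [])"
    using w braid_eq_left_inverse[of "inv_word v" n]
    by (intro braid_eq_append) (auto intro: braid_eq.refl)
  moreover have "braid_eq n ((inv_word u @ v) @ inv_word v) ((inv_word u @ u) @ inv_word v)"
    using w assms by (intro braid_eq_append) (auto intro: braid_eq.refl braid_eq.sym)
  moreover have "braid_eq n ((inv_word u @ u) @ inv_word v) ([] @ inv_word v)"
    using w by (intro braid_eq_append braid_eq_left_inverse) (auto intro: braid_eq.refl)
  ultimately show ?thesis by (simp, blast intro: braid_eq.trans braid_eq.sym)
qed

text \<open>Ignoring the number of strands gives the union of all braid groups, so one type of class
  \<open>group_add\<close> serves every \<open>n\<close>; the group law is written additively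
  although it is not commutative. The relation is only partially reflexive: a word containing the
  letter index 0 lies in no \<open>braid_words n\<close>.\<close>

definition beq :: "braid_word \<Rightarrow> braid_word \<Rightarrow> bool" where
  "beq u v \<longleftrightarrow> (\<exists>n. braid_eq n u v)"

lemma beqI: "braid_eq n u v \<Longrightarrow> beq u v"
  by (auto simp: beq_def)

lemma beq_append: "beq u u' \<Longrightarrow> beq v v' \<Longrightarrow> beq (u @ v) (u' @ v')"
proof -
  assume "beq u u'" "beq v v'"
  then obtain n m where "braid_eq n u u'" "braid_eq m v v'" by (auto simp: beq_def)
  then have "braid_eq (max n m) (u @ v) (u' @ v')"
    by (intro braid_eq_append) (auto elim: braid_eq_mono)
  then show ?thesis by (rule beqI)
qed

lemma beq_refl_iff: "beq w w \<longleftrightarrow> (\<exists>n. w \<in> braid_words n)"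
  using braid_eq_words braid_eq.refl unfolding beq_def by blast

lemma beq_sym: "beq u v \<Longrightarrow> beq v u"
  unfolding beq_def by (blast intro: braid_eq.sym)

lemma beq_trans: "beq u v \<Longrightarrow> beq v w \<Longrightarrow> beq u w"
proof -
  assume "beq u v" "beq v w"
  then obtain n m where "braid_eq n u v" "braid_eq m v w" by (auto simp: beq_def)
  then have "braid_eq (max n m) u v" "braid_eq (max n m) v w"
    by (auto elim: braid_eq_mono)
  then show ?thesis by (blast intro: braid_eq.trans beqI)
qed

quotient_type braid = braid_word / partial: beq
proof (rule part_equivpI)
  show "\<exists>x. beq x x" by (auto simp: beq_refl_iff intro: exI[of _ "[]"])
qed (auto intro: sympI transpI beq_sym beq_trans)

instantiation braid :: group_add
begin

lift_definition zero_braid :: braid is "[]"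
  by (auto simp: beq_refl_iff)

lift_definition plus_braid :: "braid \<Rightarrow> braid \<Rightarrow> braid" is "(@)"
  by (rule beq_append)

lift_definition uminus_braid :: "braid \<Rightarrow> braid" is inv_word
  by (auto simp: beq_def dest: braid_eq_inv_word)

definition minus_braid :: "braid \<Rightarrow> braid \<Rightarrow> braid" where
  "minus_braid a b = a + - b"

instance
proof
  fix a b c :: braid
  show "a + b + c = a + (b + c)" by transfer (simp add: beq_append)
  show "0 + a = a" by transfer simp
  show "a + 0 = a" by transfer simp
  show "- a + a = 0"
    by transfer (auto simp: beq_refl_iff intro: braid_eq_left_inverse beqI)
  show "a + - b = a - b" by (simp add: minus_braid_def)
qed

end

definition of_word :: "braid_word \<Rightarrow> braid" where
  "of_word = abs_braid"

definition \<sigma> :: "nat \<Rightarrow> braid" where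
  "\<sigma> i = of_word [(i, True)]"

definition sletter :: "nat \<Rightarrow> bool \<Rightarrow> braid" where
  "sletter i b = (if b then \<sigma> i else - \<sigma> i)"

lemma of_word_Nil [simp]: "of_word [] = 0"
  by (simp add: of_word_def zero_braid_def)

lemma of_word_append:
  assumes "u \<in> braid_words n" "v \<in> braid_words n"
  shows "of_word (u @ v) = of_word u + of_word v"
  unfolding of_word_def using assms
  by (subst plus_braid.abs_eq) (auto simp: beq_refl_iff)

lemma of_word_inv_word: "w \<in> braid_words n \<Longrightarrow> of_word (inv_word w) = - of_word w"
  unfolding of_word_def by (subst uminus_braid.abs_eq) (auto simp: beq_refl_iff)

lemma of_word_eqI: "braid_eq n u v \<Longrightarrow> of_word u = of_word v"
  unfolding of_word_def using beqI Quotient3_rel_abs[OF Quotient3_braid] by blast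

lemma of_word_eqD:
  assumes "u \<in> braid_words n" "v \<in> braid_words n" "of_word u = of_word v"
  shows "beq u v"
  using assms Quotient3_rel[OF Quotient3_braid, of u v] by (auto simp: of_word_def beq_refl_iff)

lemma of_word_letter: "1 \<le> i \<Longrightarrow> of_word [(i, b)] = sletter i b"
proof (cases b)
  case False
  assume "1 \<le> i"
  then have "[(i, True)] \<in> braid_words (Suc i)" by simp
  from of_word_inv_word[OF this] False show ?thesis by (simp add: sletter_def \<sigma>_def)
qed (simp add: sletter_def \<sigma>_def)

lemma of_word_Cons: 
  assumes "(i, b) # w \<in> braid_words n" shows "of_word ((i, b) # w) = sletter i b + of_word w"
  using of_word_append[of "[(i, b)]" n w] assms by (simp add: of_word_letter)

definition braids :: "nat \<Rightarrow> braid set" where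
  "braids n = of_word ` braid_words n"

lemma braids_zero [simp]: "0 \<in> braids n"
  unfolding braids_def by (metis Nil_braid_words image_eqI of_word_Nil)

lemma braids_add: "a \<in> braids n \<Longrightarrow> b \<in> braids n \<Longrightarrow> a + b \<in> braids n"
  unfolding braids_def by (auto simp flip: of_word_append)

lemma braids_uminus: "a \<in> braids n \<Longrightarrow> - a \<in> braids n"
  unfolding braids_def by (auto simp flip: of_word_inv_word)

lemma braids_sigma: "1 \<le> i \<Longrightarrow> i < n \<Longrightarrow> \<sigma> i \<in> braids n"
  unfolding braids_def \<sigma>_def by auto

lemma braids_sletter: "1 \<le> i \<Longrightarrow> i < n \<Longrightarrow> sletter i b \<in> braids n"
  by (simp add: sletter_def braids_sigma braids_uminus)

lemma braids_mono: "n \<le> m \<Longrightarrow> braids n \<subseteq> braids m"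
  unfolding braids_def using braid_words_mono by blast

lemma braids_induct [consumes 1, case_names zero add]:
  assumes "a \<in> braids n" "P 0"
    "\<And>i b a. 1 \<le> i \<Longrightarrow> i < n \<Longrightarrow> a \<in> braids n \<Longrightarrow> P a \<Longrightarrow> P (sletter i b + a)"
  shows "P a"
proof -
  obtain w where w: "w \<in> braid_words n" "a = of_word w" using assms(1) by (auto simp: braids_def)
  have "P (of_word w)" using w(1)
  proof (induction w)
    case (Cons x w)
    obtain i b where "x = (i, b)" by force
    with Cons show ?case by (auto simp: of_word_Cons[of _ _ _ n] braids_def intro!: assms(3))
  qed (simp add: assms)
  then show ?thesis by (simp add: w)
qed

lemma braid_in_braids: "\<exists>n. (a :: braid) \<in> braids n"
proof -
  have "beq (rep_braid a) (rep_braid a)" "of_word (rep_braid a) = a"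
    unfolding of_word_def
    using Quotient3_rep_reflp[OF Quotient3_braid] Quotient3_abs_rep[OF Quotient3_braid] by auto
  then show ?thesis by (metis braids_def beq_refl_iff imageI)
qed

lemma sigma_far:
  assumes "1 \<le> i" "i + 2 \<le> j" shows "\<sigma> i + \<sigma> j = \<sigma> j + \<sigma> i"
proof -
  have "braid_eq (Suc j) [(i, True), (j, True)] [(j, True), (i, True)]"
    using assms by (intro braid_eq.far) auto
  from of_word_eqI[OF this] show ?thesis using assms
    by (simp add: of_word_Cons[of _ _ _ "Suc j"] sletter_def)
qed

lemma sigma_braid:
  assumes "1 \<le> i" shows "\<sigma> i + \<sigma> (i + 1) + \<sigma> i = \<sigma> (i + 1) + \<sigma> i + \<sigma> (i + 1)"
proof -
  have "braid_eq (i + 2) [(i, True), (i + 1, True), (i, True)] [(i + 1, True), (i, True), (i + 1, True)]"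
    using assms by (intro braid_eq.braid) auto
  from of_word_eqI[OF this] show ?thesis using assms
    by (simp add: of_word_Cons[of _ _ _ "i+2"] sletter_def add.assoc)
qed

subsection \<open>Crossed evaluation of words\<close>

text \<open>A word acts on states letter by letter; \<open>cross\<close> collects the values read off on the way.\<close>

primrec run :: "(nat \<times> bool \<Rightarrow> 's \<Rightarrow> 's) \<Rightarrow> 's \<Rightarrow> braid_word \<Rightarrow> 's" where
  "run \<delta> s [] = s"
| "run \<delta> s (l # w) = run \<delta> (\<delta> l s) w"

primrec cross :: "(nat \<times> bool \<Rightarrow> 's \<Rightarrow> 's) \<Rightarrow> (nat \<times> bool \<Rightarrow> 's \<Rightarrow> 'g::monoid_add) \<Rightarrow> 's \<Rightarrow> braid_word \<Rightarrow> 'g" where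
  "cross \<delta> \<phi> s [] = 0"
| "cross \<delta> \<phi> s (l # w) = \<phi> l s + cross \<delta> \<phi> (\<delta> l s) w"

lemma run_append [simp]: "run \<delta> s (u @ v) = run \<delta> (run \<delta> s u) v"
  by (induction u arbitrary: s) auto

lemma cross_append [simp]: "cross \<delta> \<phi> s (u @ v) = cross \<delta> \<phi> s u + cross \<delta> \<phi> (run \<delta> s u) v"
  by (induction u arbitrary: s) (auto simp: add.assoc)

text \<open>Invariance has to be checked on the defining relators only, but at every state: a
  relator inside a longer word is read from the state reached after the prefix, and \<open>S\<close>
  is closed under letters.\<close>

lemma cross_braid_eq:
  assumes "braid_eq n u v" "s \<in> S"
    and closed: "\<And>i b s. s \<in> S \<Longrightarrow> 1 \<le> i \<Longrightarrow> i < n \<Longrightarrow> \<delta> (i, b) s \<in> S"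
    and "\<And>i b s. s \<in> S \<Longrightarrow> 1 \<le> i \<Longrightarrow> i < n \<Longrightarrow> run \<delta> s [(i, b), (i, \<not> b)] = s \<and> cross \<delta> \<phi> s [(i, b), (i, \<not> b)] = 0"
    and "\<And>i j s. s \<in> S \<Longrightarrow> 1 \<le> i \<Longrightarrow> i + 2 \<le> j \<Longrightarrow> j < n \<Longrightarrow>
       run \<delta> s [(i, True), (j, True)] = run \<delta> s [(j, True), (i, True)] \<and>
       cross \<delta> \<phi> s [(i, True), (j, True)] = cross \<delta> \<phi> s [(j, True), (i, True)]"
    and "\<And>i s. s \<in> S \<Longrightarrow> 1 \<le> i \<Longrightarrow> i + 1 < n \<Longrightarrow>
       run \<delta> s [(i, True), (i + 1, True), (i, True)] = run \<delta> s [(i + 1, True), (i, True), (i + 1, True)] \<and>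
       cross \<delta> \<phi> s [(i, True), (i + 1, True), (i, True)] = cross \<delta> \<phi> s [(i + 1, True), (i, True), (i + 1, True)]"
  shows "run \<delta> s u = run \<delta> s v \<and> cross \<delta> \<phi> s u = cross \<delta> \<phi> s v"
  using assms(1,2)
proof (induction arbitrary: s rule: braid_eq.induct)
  case (cong v w x y)
  have "run \<delta> s x \<in> S" using \<open>x \<in> braid_words n\<close> \<open>s \<in> S\<close>
    by (induction x arbitrary: s) (auto simp: closed)
  with cong show ?case by simp
next
  case (cancel i b) with assms(4)[of s i b] show ?case by (simp only: run.simps cross.simps) simp
next
  case (far i j) with assms(5)[of s i j] show ?case by (simp only: run.simps cross.simps) simp
next
  case (braid i) with assms(6)[of s i] show ?case by (simp only: run.simps cross.simps) simp
qed auto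

subsection \<open>Positions of strands and deletion of a strand\<close>

definition tr :: "nat \<times> bool \<Rightarrow> nat \<Rightarrow> nat" where
  "tr l k = Transposition.transpose (fst l) (Suc (fst l)) k"

lemma tr_simps:
  "tr (i, b) i = Suc i" "tr (i, b) (Suc i) = i" "k < i \<Longrightarrow> tr (i, b) k = k" "Suc i < k \<Longrightarrow> tr (i, b) k = k"
  by (auto simp: tr_def Transposition.transpose_def)

lemma tr_range: "1 \<le> i \<Longrightarrow> i < n \<Longrightarrow> k \<in> {1..n} \<Longrightarrow> tr (i, b) k \<in> {1..n}"
  by (auto simp: tr_def Transposition.transpose_def)

primrec del_word :: "nat \<Rightarrow> braid_word \<Rightarrow> braid_word" where
  "del_word k [] = []"
| "del_word k (l # w) =
     (if k = fst l \<or> k = Suc (fst l) then [] else [(if k < fst l then fst l - 1 else fst l, snd l)])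
     @ del_word (tr l k) w"

lemma del_word_append [simp]: "del_word k (u @ v) = del_word k u @ del_word (run tr k u) v"
  by (induction u arbitrary: k) auto

lemma del_word_braid_words:
  "w \<in> braid_words n \<Longrightarrow> k \<in> {1..n} \<Longrightarrow> del_word k w \<in> braid_words (n - 1) \<and> run tr k w \<in> {1..n}"
proof (induction w arbitrary: k)
  case (Cons l w)
  obtain i b where l: "l = (i, b)" by force
  have "tr l k \<in> {1..n}" using Cons.prems l tr_range[of i n k b] by simp
  then have "del_word (tr l k) w \<in> braid_words (n - 1) \<and> run tr (tr l k) w \<in> {1..n}"
    using Cons.prems l by (intro Cons.IH) auto
  then show ?case using Cons.prems l by (cases "k = i \<or> k = Suc i \<or> k < i") auto
qed simp

text \<open>A relator keeps its shape when the deleted strand takes no part in its crossings.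
  Otherwise both sides lose the crossings of that strand and become the same shorter word.\<close>

lemma del_word_braid_eq:
  assumes "braid_eq n u v" "k \<in> {1..n}"
  shows "run tr k u = run tr k v \<and> braid_eq (n - 1) (del_word k u) (del_word k v)"
  using assms
proof (induction arbitrary: k rule: braid_eq.induct)
  case (refl w)
  then show ?case using del_word_braid_words braid_eq.refl by auto
next
  case (sym v w) then show ?case by (metis braid_eq.sym)
next
  case (trans u v w) then show ?case by (metis braid_eq.trans)
next
  case (cong v w x y)
  then have "run tr k x \<in> {1..n}" "run tr (run tr k x) v \<in> {1..n}"
    using del_word_braid_words braid_eq_words by meson+
  with cong show ?case using del_word_braid_words
    by (simp add: braid_eq.cong)
next
  case (cancel i b)
  then consider "k < i" | "k = i" | "k = Suc i" | "Suc i < k" by linarith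
  then show ?case using cancel
    by cases (auto simp: tr_simps intro!: braid_eq.cancel braid_eq.refl)
next
  case (far i j)
  then consider "k < i" | "k = i" | "k = Suc i" | "Suc i < k" "k < j" | "k = j" | "k = Suc j" | "Suc j < k"
    by linarith
  then show ?case using far
    by cases (auto simp: tr_simps intro!: braid_eq.far braid_eq.refl)
next
  case (braid i)
  then consider "k < i" | "k = i" | "k = Suc i" | "k = Suc (Suc i)" | "Suc (Suc i) < k" by linarith
  then show ?case
  proof cases
    case 1
    then have "braid_eq (n - 1) [(i - 1, True), ((i - 1) + 1, True), (i - 1, True)]
               [((i - 1) + 1, True), (i - 1, True), ((i - 1) + 1, True)]"
      using braid by (intro braid_eq.braid) auto
    with 1 show ?thesis by (simp add: tr_simps)
  next
    case 5
    then have "braid_eq (n - 1) [(i, True), (i + 1, True), (i, True)]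
               [(i + 1, True), (i, True), (i + 1, True)]"
      using braid by (intro braid_eq.braid) auto
    with 5 show ?thesis by (simp add: tr_simps)
  qed (use braid in \<open>auto simp: tr_simps intro!: braid_eq.refl\<close>)
qed

lemma del_word_last: "w \<in> braid_words n \<Longrightarrow> n < k \<Longrightarrow> del_word k w = w \<and> run tr k w = k"
  by (induction w) (auto simp: tr_simps)

text \<open>The braid group on \<open>n\<close> strands embeds into those on more strands: deleting
  the last strand \<open>Suc N\<close> turns an equality on \<open>Suc N\<close> strands into one on
  \<open>N\<close> strands and fixes the words that do not reach that strand.\<close>

lemma braid_eq_restrict:
  assumes "braid_eq N u v" "u \<in> braid_words n" "v \<in> braid_words n"
  shows "braid_eq n u v"
  using assms(1)
proof (induction N)
  case 0
  then show ?case by (rule braid_eq_mono) simp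
next
  case (Suc N)
  show ?case
  proof (cases "n \<le> N")
    case True
    with del_word_braid_eq[OF Suc.prems, of "Suc N"] show ?thesis
      using Suc.IH assms del_word_last[of _ n "Suc N"] by auto
  next
    case False with Suc.prems show ?thesis by (auto elim: braid_eq_mono)
  qed
qed

lemma of_word_eq_iff:
  assumes "u \<in> braid_words n" "v \<in> braid_words n"
  shows "of_word u = of_word v \<longleftrightarrow> braid_eq n u v"
  using assms of_word_eqD braid_eq_restrict of_word_eqI unfolding beq_def by metis

lemma beq_rep_of_word: "w \<in> braid_words n \<Longrightarrow> beq (rep_braid (of_word w)) w"
  using Quotient3_rep_abs[OF Quotient3_braid] beq_refl_iff unfolding of_word_def by blast

definition pos :: "braid \<Rightarrow> nat \<Rightarrow> nat" where
  "pos a k = run tr k (rep_braid a)"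

definition del :: "nat \<Rightarrow> braid \<Rightarrow> braid" where
  "del k a = of_word (del_word k (rep_braid a))"

lemma run_tr_zero: "w \<in> braid_words n \<Longrightarrow> run tr 0 w = 0"
  by (induction w) (auto simp: tr_simps)

lemma pos_del_of_word:
  assumes "w \<in> braid_words n"
  shows "pos (of_word w) k = run tr k w" "1 \<le> k \<Longrightarrow> del k (of_word w) = of_word (del_word k w)"
proof -
  obtain m where "braid_eq m (rep_braid (of_word w)) w"
    using beq_rep_of_word[OF assms] by (auto simp: beq_def)
  then have m: "braid_eq (max m k) (rep_braid (of_word w)) w" by (rule braid_eq_mono) simp
  { assume "1 \<le> k"
    then have "braid_eq (max m k - 1) (del_word k (rep_braid (of_word w))) (del_word k w)"
      using del_word_braid_eq[OF m, of k] by simp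
    from of_word_eqI[OF this] show "del k (of_word w) = of_word (del_word k w)"
      by (simp only: del_def) }
  show "pos (of_word w) k = run tr k w"
    using del_word_braid_eq[OF m, of k] run_tr_zero braid_eq_words[OF m] 
    by (cases "k = 0") (auto simp: pos_def)
qed

lemma pos_zero [simp]: "pos 0 k = k"
  using pos_del_of_word(1)[of "[]" 0 k] by simp

lemma common_words:
  obtains n u v where "u \<in> braid_words n" "v \<in> braid_words n" "a = of_word u" "b = of_word v"
proof -
  obtain n m where "a \<in> braids n" "b \<in> braids m" using braid_in_braids by blast
  then have "a \<in> braids (max n m)" "b \<in> braids (max n m)"
    using braids_mono[of n "max n m"] braids_mono[of m "max n m"] by auto
  then obtain u v where "u \<in> braid_words (max n m)" "v \<in> braid_words (max n m)" "a = of_word u" "b = of_word v"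
    unfolding braids_def by blast
  then show ?thesis by (rule that)
qed

text \<open>Braids are read from left to right, so positions act on the right. The same bookkeeping
  makes \<open>del\<close> a crossed homomorphism in \<open>del_add\<close>, and a homomorphism on
  pure braids.\<close>

lemma pos_add: "pos (a + b) k = pos b (pos a k)"
proof -
  obtain n u v where "u \<in> braid_words n" "v \<in> braid_words n" "a = of_word u" "b = of_word v"
    by (rule common_words)
  then show ?thesis
    by (simp add: of_word_append[of u n v, symmetric] pos_del_of_word(1)[of _ n])
qed

lemma pos_uminus [simp]: "pos (- a) (pos a k) = k" "pos a (pos (- a) k) = k"
  by (simp_all flip: pos_add)

lemma pos_inj: "pos a k = pos a j \<longleftrightarrow> k = j"
  by (metis pos_uminus(1))

lemma pos_sletter: "1 \<le> i \<Longrightarrow> pos (sletter i b) k = Transposition.transpose i (Suc i) k"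
  by (simp flip: of_word_letter add: pos_del_of_word[of _ "Suc i"] tr_def)

lemma pos_range: "a \<in> braids n \<Longrightarrow> k \<in> {1..n} \<Longrightarrow> pos a k \<in> {1..n}"
  unfolding braids_def using del_word_braid_words by (auto simp: pos_del_of_word simp del: atLeastAtMost_iff)

lemma del_zero [simp]: "1 \<le> k \<Longrightarrow> del k 0 = 0"
  using pos_del_of_word(2)[of "[]" 0 k] by simp

lemma pos_ge_1: "1 \<le> k \<Longrightarrow> 1 \<le> pos a k"
proof -
  assume "1 \<le> k"
  obtain n where "a \<in> braids n" using braid_in_braids by blast
  then have "a \<in> braids (max n k)" using braids_mono[of n "max n k"] by auto
  from pos_range[OF this, of k] \<open>1 \<le> k\<close> show ?thesis by auto
qed

lemma del_add:
  assumes "1 \<le> k" shows "del k (a + b) = del k a + del (pos a k) b"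
proof -
  obtain n u v where *: "u \<in> braid_words n" "v \<in> braid_words n" "a = of_word u" "b = of_word v"
    by (rule common_words)
  define m where "m = max n k"
  have **: "u \<in> braid_words m" "v \<in> braid_words m" "k \<in> {1..m}"
    using * braid_words_mono[of n m] assms by (auto simp: m_def)
  then have "del_word k u \<in> braid_words (m - 1)" "run tr k u \<in> {1..m}"
    "del_word (run tr k u) v \<in> braid_words (m - 1)" 
    using del_word_braid_words by blast+
  with ** assms show ?thesis unfolding *(3,4)
    by (simp add: of_word_append[of u m v, symmetric] pos_del_of_word[of _ m] of_word_append[of _ "m - 1"])
qed

lemma del_uminus: "1 \<le> k \<Longrightarrow> del k (- a) = - del (pos (- a) k) a"
  using del_add[of k "- a" a] by (simp add: eq_neg_iff_add_eq_0)

lemma del_sletter: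
  assumes "1 \<le> i" "1 \<le> k"
  shows "del k (sletter i b) = (if k = i \<or> k = Suc i then 0 else if k < i then sletter (i - 1) b else sletter i b)"
  using assms by (auto simp flip: of_word_letter simp: pos_del_of_word[of _ "Suc i"])

lemma del_braids: "a \<in> braids n \<Longrightarrow> k \<in> {1..n} \<Longrightarrow> del k a \<in> braids (n - 1)"
  unfolding braids_def using del_word_braid_words by (auto simp: pos_del_of_word)

lemma del_last: "a \<in> braids n \<Longrightarrow> n < k \<Longrightarrow> del k a = a"
  unfolding braids_def using del_word_last by (auto simp: pos_del_of_word)

subsection \<open>Linking numbers\<close>

definition tr2 :: "nat \<times> bool \<Rightarrow> nat \<times> nat \<Rightarrow> nat \<times> nat" where
  "tr2 l s = (tr l (fst s), tr l (snd s))"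

text \<open>Only the crossings entered (or, for a negative crossing, left) with strand \<open>p\<close> to the left
  of strand \<open>q\<close> are counted; on a pure braid this is half of all their crossings.\<close>

definition lnk_letter :: "nat \<times> bool \<Rightarrow> nat \<times> nat \<Rightarrow> int" where
  "lnk_letter l s =
     (if snd l then (if s = (fst l, Suc (fst l)) then 1 else 0)
      else (if s = (Suc (fst l), fst l) then - 1 else 0))"

definition lnk :: "nat \<Rightarrow> nat \<Rightarrow> braid \<Rightarrow> int" where
  "lnk p q a = cross tr2 lnk_letter (p, q) (rep_braid a)"

lemma run_tr2: "run tr2 s w = (run tr (fst s) w, run tr (snd s) w)"
  by (induction w arbitrary: s) (auto simp: tr2_def)

lemma tr_far: "i + 2 \<le> j \<Longrightarrow> tr (i, b) (tr (j, c) k) = tr (j, c) (tr (i, b) k)"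
  by (auto simp: tr_def Transposition.transpose_def)

lemma tr_braid: "tr (i, b) (tr (Suc i, c) (tr (i, d) k)) = tr (Suc i, c) (tr (i, d) (tr (Suc i, e) k))"
  by (auto simp: tr_def Transposition.transpose_def)

lemma tr_tr [simp]: "tr (i, b) (tr (i, c) k) = k"
  by (auto simp: tr_def Transposition.transpose_def)

lemma lnk_braid_eq:
  assumes "braid_eq n u v"
  shows "cross tr2 lnk_letter s u = cross tr2 lnk_letter s v"
proof -
  have "run tr2 s u = run tr2 s v \<and> cross tr2 lnk_letter s u = cross tr2 lnk_letter s v"
  proof (rule cross_braid_eq[OF assms, of s UNIV], goal_cases)
    case (3 i b s)
    obtain p q where "s = (p, q)" by force
    with 3 show ?case by (auto simp: tr2_def lnk_letter_def tr_def Transposition.transpose_def)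
  next
    case (4 i j s)
    obtain p q where "s = (p, q)" by force
    with 4 show ?case by (auto simp: tr2_def tr_far lnk_letter_def tr_def Transposition.transpose_def)
  next
    case (5 i s)
    have *: "run tr2 s [(i, True), (i + 1, True), (i, True)] = run tr2 s [(i + 1, True), (i, True), (i + 1, True)]"
      by (simp add: tr2_def tr_braid)
    obtain p q where "s = (p, q)" by force
    with this * show ?case by (auto simp: tr2_def lnk_letter_def tr_def Transposition.transpose_def)
  qed auto
  then show ?thesis by simp
qed

lemma lnk_of_word: "w \<in> braid_words n \<Longrightarrow> lnk p q (of_word w) = cross tr2 lnk_letter (p, q) w"
  using beq_rep_of_word lnk_braid_eq unfolding lnk_def beq_def by blast

lemma lnk_add: "lnk p q (a + b) = lnk p q a + lnk (pos a p) (pos a q) b"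
proof -
  obtain n u v where "u \<in> braid_words n" "v \<in> braid_words n" "a = of_word u" "b = of_word v"
    by (rule common_words)
  then show ?thesis
    by (simp add: of_word_append[of u n v, symmetric] lnk_of_word[of _ n] run_tr2 pos_del_of_word[of _ n])
qed

lemma lnk_zero [simp]: "lnk p q 0 = 0"
  using lnk_of_word[of "[]" 0] by simp

lemma lnk_uminus: "lnk p q (- a) = - lnk (pos (- a) p) (pos (- a) q) a"
  using lnk_add[of p q "- a" a] by simp

lemma lnk_sletter:
  "1 \<le> i \<Longrightarrow> lnk p q (sletter i b) = (if b \<and> p = i \<and> q = Suc i then 1 else if \<not> b \<and> p = Suc i \<and> q = i then - 1 else 0)"
  by (auto simp flip: of_word_letter simp: lnk_of_word[of _ "Suc i"] lnk_letter_def)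

subsection \<open>Commuting elements\<close>

definition commute :: "'a::group_add \<Rightarrow> 'a \<Rightarrow> bool" where
  "commute a b \<longleftrightarrow> a + b = b + a"

lemmas grp = diff_conv_add_uminus minus_add add.assoc

lemma commute_sym: "commute a b \<Longrightarrow> commute b a"
  by (simp add: commute_def)

lemma commute_self [simp]: "commute a a" "commute 0 a" "commute a 0"
  by (simp_all add: commute_def)

lemma commute_add: "commute a b \<Longrightarrow> commute a c \<Longrightarrow> commute a (b + c)"
  unfolding commute_def by (metis add.assoc)

lemma commute_uminus: "commute a b \<Longrightarrow> commute a (- b)"
proof -
  assume "commute a b"
  then have "- b + (a + b) - b = - b + (b + a) - b" by (simp add: commute_def)
  then show ?thesis by (simp add: commute_def diff_conv_add_uminus add.assoc del: add_uminus_conv_diff)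
qed

lemma commute_diff: "commute a b \<Longrightarrow> commute a c \<Longrightarrow> commute a (b - c)"
  using commute_add[OF _ commute_uminus] by fastforce

lemma commute_add_left: "commute b a \<Longrightarrow> commute c a \<Longrightarrow> commute (b + c) a"
  by (blast intro: commute_add commute_sym)

lemma commute_uminus_left: "commute b a \<Longrightarrow> commute (- b) a"
  by (blast intro: commute_uminus commute_sym)

lemma commute_diff_left: "commute b a \<Longrightarrow> commute c a \<Longrightarrow> commute (b - c) a"
  by (blast intro: commute_diff commute_sym)

lemma commute_conj_iff: "commute a b \<longleftrightarrow> a + b - a = b"
  by (simp add: commute_def eq_diff_eq[symmetric] diff_eq_eq)

lemma conj_add: "g + (a + b) - g = (g + a - g) + (g + b - (g::'a::group_add))"
  by (simp add: grp del: add_uminus_conv_diff)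

lemma conj_uminus: "g + (- a) - g = - (g + a - (g::'a::group_add))"
  by (simp add: grp del: add_uminus_conv_diff)

lemma conj_conj: "g + (h + a - h) - g = (g + h) + a - (g + (h::'a::group_add))"
  by (simp add: grp del: add_uminus_conv_diff)

lemma conj_zero [simp]: "g + 0 - g = (0::'a::group_add)"
  by simp

lemma commute_conj: "commute a b \<Longrightarrow> commute (g + a - g) (g + b - g)"
  unfolding commute_def by (metis conj_add)

subsection \<open>Crossed homomorphisms out of the braids fixing a strand\<close>

text \<open>The braids on \<open>n\<close> strands that fix one strand form an Artin group of type \<open>B\<close>; the next
  locale lists its defining relations, with \<open>s i\<close> the generators of the braid group on the other strands and
  \<open>y m\<close> the image of the marked strand encircling the \<open>m\<close>-th of the others. \<open>Phi k\<close> is the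
  resulting homomorphism, extended to a crossed homomorphism by tracking the position \<open>k\<close> of the marked strand.\<close>

locale braid_data =
  fixes n :: nat and s y :: "nat \<Rightarrow> 'g::group_add"
  assumes far: "1 \<le> i \<Longrightarrow> i + 2 \<le> j \<Longrightarrow> j + 1 < n \<Longrightarrow> commute (s i) (s j)"
    and braid: "1 \<le> i \<Longrightarrow> i + 2 < n \<Longrightarrow> s i + s (i + 1) + s i = s (i + 1) + s i + s (i + 1)"
    and y_step: "1 \<le> m \<Longrightarrow> m + 1 < n \<Longrightarrow> y (m + 1) = s m + y m - s m"
    and y_far1: "2 \<le> i \<Longrightarrow> i + 1 < n \<Longrightarrow> commute (s i) (y 1)"
    and y_braid1: "2 < n \<Longrightarrow> commute (s 1) (y 1 + y 2)"
begin

lemma far': "1 \<le> i \<Longrightarrow> 1 \<le> j \<Longrightarrow> i + 2 \<le> j \<or> j + 2 \<le> i \<Longrightarrow> i + 1 < n \<Longrightarrow> j + 1 < n \<Longrightarrow> commute (s i) (s j)"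
  using far commute_sym by metis

text \<open>Beyond the axiom for \<open>y 1\<close>, only the case \<open>m\<close> =
  \<open>i\<close> + 2 is more than a reduction to a smaller index. There \<open>y m\<close> is
  \<open>y i\<close> conjugated by \<open>s k + s i\<close> with \<open>k\<close> = \<open>i\<close>
  + 1; conjugating by \<open>s i\<close> turns the conjugator into \<open>s k + s i + s k\<close>,
  whose last summand commutes with \<open>y i\<close>.\<close>

lemma y_far:
  "1 \<le> i \<Longrightarrow> i + 1 < n \<Longrightarrow> 1 \<le> m \<Longrightarrow> m < n \<Longrightarrow> i \<noteq> m \<Longrightarrow> i + 1 \<noteq> m \<Longrightarrow> commute (s i) (y m)"
proof (induction m arbitrary: i rule: less_induct)
  case (less m)
  show ?case
  proof (cases "m = 1")
    case True then show ?thesis using less y_far1 by auto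
  next
    case False
    then obtain k where k: "m = k + 1" "1 \<le> k" using less by (metis add.commute le_add1 le_neq_implies_less less_imp_add_positive less_one not_less add_diff_inverse_nat)
    then have y: "y m = s k + y k - s k" using y_step less by auto
    show ?thesis
    proof (cases "i + 1 = k")
      case False
      then show ?thesis unfolding y using less k
        by (intro commute_add commute_diff far' less.IH) auto
    next
      case True
      then have k2: "2 \<le> k" using less by simp
      have y': "y k = s i + y i - s i" using y_step[of i] less k True by auto
      have c: "commute (s k) (y i)" using less k True by (intro less.IH) auto
      have b: "s i + s k + s i = s k + s i + s k" using braid[of i] less k True by auto
      have "s i + y m - s i = (s i + s k + s i) + y i - (s i + s k + s i)"
        unfolding y y' by (simp add: grp del: add_uminus_conv_diff)
      also have "\<dots> = s k + s i + (s k + y i - s k) - (s k + s i)"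
        unfolding b by (simp add: grp del: add_uminus_conv_diff)
      also have "s k + y i - s k = y i" using c by (simp add: commute_conj_iff)
      finally show ?thesis unfolding y y' by (simp add: conj_conj commute_conj_iff)
    qed
  qed
qed

text \<open>Conjugation by \<open>s m + s (m + 1)\<close> raises the index of \<open>s m\<close>,
  \<open>y m\<close> and \<open>y (m + 1)\<close> by one simultaneously, so the relation travels
  from the axiom at 1 to all \<open>m\<close>.\<close>

lemma y_braid: "1 \<le> m \<Longrightarrow> m + 1 < n \<Longrightarrow> commute (s m) (y m + y (m + 1))"
proof (induction m rule: nat_induct_at_least)
  case base then show ?case using y_braid1 by (simp add: numeral_2_eq_2)
next
  case (Suc m)
  let ?g = "s m + s (m + 1)"
  have b: "s m + s (m + 1) + s m = s (m + 1) + s m + s (m + 1)" using braid[of m] Suc by auto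
  have 1: "?g + s m - ?g = s (m + 1)" using b by (simp add: diff_eq_eq add.assoc)
  have c: "commute (s (m + 1)) (y m)" using Suc by (intro y_far) auto
  have 2: "?g + y m - ?g = y (m + 1)" 
    using y_step[of m] Suc c by (simp add: commute_conj_iff flip: conj_conj)
  have "?g + y (m + 1) - ?g = (s m + s (m + 1) + s m) + y m - (s m + s (m + 1) + s m)"
    using y_step[of m] Suc by (simp add: grp del: add_uminus_conv_diff)
  also have "\<dots> = s (m + 1) + (s m + (s (m + 1) + y m - s (m + 1)) - s m) - s (m + 1)"
    unfolding b by (simp add: grp del: add_uminus_conv_diff)
  also have "\<dots> = y (m + 2)"
    using c y_step[of m] y_step[of "m + 1"] Suc by (simp add: commute_conj_iff)
  finally have 3: "?g + y (m + 1) - ?g = y (m + 2)" .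
  have "commute (?g + s m - ?g) (?g + (y m + y (m + 1)) - ?g)"
    using Suc by (intro commute_conj) auto
  then show ?case unfolding conj_add[of ?g "y m"] 1 2 3 by simp
qed

text \<open>A full turn of the marked strand around its right neighbour is the square of one
  generator. The value \<open>y\<close> is charged to the half that moves the marked strand to the
  right and 0 to the half that moves it back; negative crossings carry the inverses of these halves.
  Crossings of two other strands are read with the marked strand removed.\<close>

definition phi :: "nat \<times> bool \<Rightarrow> nat \<Rightarrow> 'g" where
  "phi l k =
     (if k = fst l then (if snd l then y (fst l) else 0)
      else if k = Suc (fst l) then (if snd l then 0 else - y (fst l))
      else let g = s (if k < fst l then fst l - 1 else fst l) in if snd l then g else - g)"

definition Phi :: "nat \<Rightarrow> braid \<Rightarrow> 'g" where
  "Phi k a = cross tr phi k (SOME w. w \<in> braid_words n \<and> of_word w = a)"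

text \<open>For each position of the marked strand a braid relator becomes one relation of the
  locale: \<open>far\<close> or \<open>braid\<close> when the strand stays aside,
  \<open>y_far\<close>, \<open>y_step\<close> or \<open>y_braid\<close> when it takes part.\<close>

lemma cross_phi_eq:
  assumes "braid_eq n u v" "k \<in> {1..n}"
  shows "cross tr phi k u = cross tr phi k v"
proof -
  have "run tr k u = run tr k v \<and> cross tr phi k u = cross tr phi k v"
  proof (rule cross_braid_eq[OF assms(1), of k "{1..n}"], goal_cases)
    case (2 i b k) then show ?case by (rule tr_range[rotated 2])
  next
    case (3 i b k)
    then consider "k < i" | "k = i" | "k = Suc i" | "Suc i < k" by linarith
    then show ?case by cases (auto simp: phi_def tr_simps Let_def)
  next
    case (4 i j k)
    have s1: "s i + s (j - Suc 0) = s (j - Suc 0) + s i" if "Suc i < k" "k < j"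
      using far[of i "j - 1"] 4 that by (simp add: commute_def)
    have s2: "s (i - Suc 0) + s (j - Suc 0) = s (j - Suc 0) + s (i - Suc 0)" if "k < i"
      using far[of "i - 1" "j - 1"] 4 that by (simp add: commute_def)
    have s3: "s i + s j = s j + s i" if "Suc j < k"
      using far[of i j] 4 that by (simp add: commute_def)
    have s4: "y i + s (j - Suc 0) = s (j - Suc 0) + y i"
      using y_far[of "j - 1" i] 4 by (simp add: commute_def)
    have s5: "s i + y j = y j + s i" 
      using y_far[of i j] 4 by (simp add: commute_def)
    consider "k < i" | "k = i" | "k = Suc i" | "Suc i < k" "k < j" | "k = j" | "k = Suc j" | "Suc j < k"
      by linarith
    then show ?case using 4
      by cases (auto simp: phi_def tr_simps s1 s2 s3 s4 s5)
  next
    case (5 i k)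
    have s1: "s (i - Suc 0) + (s i + s (i - Suc 0)) = s i + (s (i - Suc 0) + s i)" if "k < i"
      using braid[of "i - 1"] 5 that by (simp add: add.assoc)
    have s2: "s i + (s (Suc i) + s i) = s (Suc i) + (s i + s (Suc i))" if "Suc (Suc i) < k"
      using braid[of i] 5 that by (simp add: add.assoc)
    have s3: "y i + (y (Suc i) + s i) = s i + (y i + y (Suc i))"
      using y_braid[of i] 5 by (simp add: commute_def add.assoc)
    have s4: "s i + y i = y (Suc i) + s i"
      using y_step[of i] 5 by simp
    consider "k < i" | "k = i" | "k = Suc i" | "k = Suc (Suc i)" | "Suc (Suc i) < k" by linarith
    then show ?case using 5
      by cases (auto simp: phi_def tr_simps s1 s2 s3 s4)
  qed (use assms in auto)
  then show ?thesis by simp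
qed

lemma Phi_of_word:
  assumes "w \<in> braid_words n" "k \<in> {1..n}"
  shows "Phi k (of_word w) = cross tr phi k w"
proof -
  define v where "v = (SOME v. v \<in> braid_words n \<and> of_word v = of_word w)"
  have "v \<in> braid_words n \<and> of_word v = of_word w"
    unfolding v_def by (rule someI[of _ w]) (simp add: assms)
  then have "braid_eq n v w" using of_word_eq_iff assms by blast
  from cross_phi_eq[OF this assms(2)] show ?thesis by (simp add: Phi_def v_def)
qed

lemma Phi_zero: "k \<in> {1..n} \<Longrightarrow> Phi k 0 = 0"
  using Phi_of_word[of "[]" k] by simp

lemma Phi_add:
  assumes "a \<in> braids n" "b \<in> braids n" "k \<in> {1..n}"
  shows "Phi k (a + b) = Phi k a + Phi (pos a k) b"
proof -
  obtain u v where "u \<in> braid_words n" "v \<in> braid_words n" "a = of_word u" "b = of_word v"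
    using assms unfolding braids_def by blast
  moreover from this have "run tr k u \<in> {1..n}" using del_word_braid_words assms by blast
  ultimately show ?thesis using assms(3)
    by (simp add: of_word_append[of u n v, symmetric] Phi_of_word pos_del_of_word[of _ n] del: atLeastAtMost_iff)
qed

lemma Phi_uminus:
  assumes "a \<in> braids n" "k \<in> {1..n}"
  shows "Phi k (- a) = - Phi (pos (- a) k) a"
  using Phi_add[of "- a" a k] assms Phi_zero by (simp add: braids_uminus eq_neg_iff_add_eq_0)

lemma Phi_sletter:
  "1 \<le> i \<Longrightarrow> i < n \<Longrightarrow> k \<in> {1..n} \<Longrightarrow> Phi k (sletter i b) = phi (i, b) k"
  by (simp flip: of_word_letter add: Phi_of_word)

lemma Phi_sigma:
  assumes "1 \<le> i" "i < n" "k \<in> {1..n}"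
  shows "Phi k (\<sigma> i) = (if k = i then y i else if k = Suc i then 0 else if k < i then s (i - 1) else s i)"
  using Phi_sletter[OF assms, of True] by (simp add: sletter_def phi_def)

end

subsection \<open>Generated subgroups\<close>

inductive_set gen :: "'a::group_add set \<Rightarrow> 'a set" for S where
  zero: "0 \<in> gen S"
| incl: "x \<in> S \<Longrightarrow> x \<in> gen S"
| add: "x \<in> gen S \<Longrightarrow> y \<in> gen S \<Longrightarrow> x + y \<in> gen S"
| uminus: "x \<in> gen S \<Longrightarrow> - x \<in> gen S"

lemma gen_diff: "x \<in> gen S \<Longrightarrow> y \<in> gen S \<Longrightarrow> x - y \<in> gen S"
  using gen.add[OF _ gen.uminus] by fastforce

lemma gen_conj_closed:
  assumes "\<And>x. x \<in> S \<Longrightarrow> g + x - g \<in> gen T" "a \<in> gen S"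
  shows "g + a - g \<in> gen T"
  using assms(2)
proof induction
  case (add x y) show ?case unfolding conj_add using add.IH by (rule gen.add)
next
  case (uminus x) show ?case unfolding conj_uminus using uminus.IH by (rule gen.uminus)
qed (auto intro: assms(1) gen.zero)

lemma gen_mono: "S \<subseteq> gen T \<Longrightarrow> a \<in> gen S \<Longrightarrow> a \<in> gen T"
  using gen_conj_closed[of S 0 T a] by auto

lemma neg_conj: "- g + x + g = (- g) + x - (- (g::'a::group_add))"
  by simp

context braid_data
begin

text \<open>This is Artin's action of the other strands on the loops. The cases that are not a mere
  renaming come from \<open>y_braid\<close>, by which \<open>y i + y (i + 1)\<close> is
  fixed.\<close>

lemma y_conj:
  assumes "1 \<le> i" "i + 1 < n" "1 \<le> m" "m < n"
  shows "s i + y m - s i = (if m = i then y (i + 1) else if m = i + 1 then - y (i + 1) + y i + y (i + 1) else y m)"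
    and "- s i + y m + s i = (if m = i + 1 then y i else if m = i then y i + y (i + 1) - y i else y m)"
proof -
  have 1: "s i + y i - s i = y (i + 1)" using y_step assms by simp
  then have 2: "- s i + y (i + 1) + s i = y i" unfolding 1[symmetric] by (simp add: grp del: add_uminus_conv_diff)
  have c: "commute (s i) (y i + y (i + 1))" using y_braid assms by simp
  then have "s i + y i - s i + (s i + y (i + 1) - s i) = y i + y (i + 1)"
    by (simp add: commute_conj_iff flip: conj_add)
  then have 3: "s i + y (i + 1) - s i = - y (i + 1) + y i + y (i + 1)"
    unfolding 1 by (simp add: grp eq_neg_iff_add_eq_0 add_eq_0_iff2 minus_equation_iff del: add_uminus_conv_diff) (metis add_minus_cancel minus_add_cancel)
  have "commute (- s i) (y i + y (i + 1))" using c by (rule commute_uminus_left)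
  then have "- s i + y i + s i + (- s i + y (i + 1) + s i) = y i + y (i + 1)"
    unfolding neg_conj by (simp add: commute_conj_iff del: diff_minus_eq_add flip: conj_add)
  then have 4: "- s i + y i + s i = y i + y (i + 1) - y i"
    unfolding 2 by (simp add: eq_diff_eq)
  have 5: "commute (s i) (y m)" if "m \<noteq> i" "m \<noteq> i + 1"
    using y_far assms that by auto
  have 6: "- s i + (y m + s i) = y m" if "m \<noteq> i" "m \<noteq> i + 1"
    using 5[OF that] unfolding commute_def by (metis minus_add_cancel)
  show "s i + y m - s i = (if m = i then y (i + 1) else if m = i + 1 then - y (i + 1) + y i + y (i + 1) else y m)"
    using 1 3 5 by (auto simp: commute_conj_iff)
  show "- s i + y m + s i = (if m = i + 1 then y i else if m = i then y i + y (i + 1) - y i else y m)"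
    using 2 4 6 by (auto simp: add.assoc)
qed

lemma gen_y_conj:
  assumes "a \<in> gen (y ` {1..<n})" "1 \<le> i" "i + 1 < n"
  shows "s i + a - s i \<in> gen (y ` {1..<n})" "- s i + a + s i \<in> gen (y ` {1..<n})"
proof -
  have y: "y m \<in> gen (y ` {1..<n})" if "1 \<le> m" "m < n" for m
    using that by (intro gen.incl) auto
  have "s i + x - s i \<in> gen (y ` {1..<n})" if "x \<in> y ` {1..<n}" for x
    using that assms y y_conj(1)[of i] by (auto intro!: gen.add gen.uminus simp del: add_uminus_conv_diff)
  from gen_conj_closed[OF this assms(1)] show "s i + a - s i \<in> gen (y ` {1..<n})" .
  have "- s i + x - - s i \<in> gen (y ` {1..<n})" if x: "x \<in> y ` {1..<n}" for x
  proof -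
    obtain m where "x = y m" "1 \<le> m" "m < n" using x by auto
    then have "- s i + x + s i = (if m = i + 1 then y i else if m = i then y i + y (i + 1) - y i else y m)"
      using y_conj(2) assms by simp
    with \<open>1 \<le> m\<close> \<open>m < n\<close> assms y show ?thesis
      by (auto intro!: gen.add gen_diff)
  qed
  from gen_conj_closed[OF this assms(1)]
  have "- s i + a - - s i \<in> gen (y ` {1..<n})" .
  then show "- s i + a + s i \<in> gen (y ` {1..<n})" by simp
qed

end

subsection \<open>Pure braids\<close>

definition pures :: "nat \<Rightarrow> braid set" where
  "pures n = {a \<in> braids n. \<forall>k. pos a k = k}"

lemma pures_zero [simp]: "0 \<in> pures n"
  by (simp add: pures_def)

lemma pures_add: "a \<in> pures n \<Longrightarrow> b \<in> pures n \<Longrightarrow> a + b \<in> pures n"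
  by (simp add: pures_def braids_add pos_add)

lemma pos_neg_pure: "a \<in> pures n \<Longrightarrow> pos (- a) k = k"
  using pos_uminus(1)[of a k] by (simp add: pures_def)

lemma pures_uminus: "a \<in> pures n \<Longrightarrow> - a \<in> pures n"
  using pos_neg_pure[of a n] by (simp add: pures_def braids_uminus)

lemma pures_diff: "a \<in> pures n \<Longrightarrow> b \<in> pures n \<Longrightarrow> a - b \<in> pures n"
  using pures_add[OF _ pures_uminus] by simp

lemma pos_pure: "a \<in> pures n \<Longrightarrow> pos a k = k"
  by (simp add: pures_def)

lemma pures_braids: "a \<in> pures n \<Longrightarrow> a \<in> braids n"
  by (simp add: pures_def)

lemma pures_conj: "a \<in> pures n \<Longrightarrow> g \<in> braids n \<Longrightarrow> g + a - g \<in> pures n"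
  unfolding pures_def diff_conv_add_uminus by (auto simp: braids_add braids_uminus pos_add simp del: add_uminus_conv_diff)

lemma gen_pures: "S \<subseteq> pures n \<Longrightarrow> a \<in> gen S \<Longrightarrow> a \<in> pures n"
  by (rotate_tac, induction rule: gen.induct) (auto intro: pures_add pures_uminus)

lemma del_pure_add: "a \<in> pures n \<Longrightarrow> 1 \<le> k \<Longrightarrow> del k (a + b) = del k a + del k b"
  by (simp add: del_add pos_pure)

lemma del_pure_uminus: "a \<in> pures n \<Longrightarrow> 1 \<le> k \<Longrightarrow> del k (- a) = - del k a"
  by (simp add: del_uminus pos_neg_pure)

lemma del_conj:
  assumes "a \<in> pures n" "1 \<le> k"
  shows "del k (g + a - g) = del k g + del (pos g k) a - del k g"
  using assms pos_ge_1[of k g] pos_pure[OF assms(1)]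
  by (simp add: del_add del_uminus pos_add diff_conv_add_uminus del: add_uminus_conv_diff)

lemma lnk_pure_add: "a \<in> pures n \<Longrightarrow> lnk p q (a + b) = lnk p q a + lnk p q b"
  by (simp add: lnk_add pos_pure)

lemma lnk_pure_uminus: "a \<in> pures n \<Longrightarrow> lnk p q (- a) = - lnk p q a"
  by (simp add: lnk_uminus pos_neg_pure)

lemma lnk_conj:
  assumes "a \<in> pures n"
  shows "lnk p q (g + a - g) = lnk (pos g p) (pos g q) a"
  using pos_pure[OF assms(1)]
  by (simp add: lnk_add lnk_uminus pos_add diff_conv_add_uminus del: add_uminus_conv_diff)

text \<open>This is \<open>\<sigma> (j - 1) + ... + \<sigma> (i + 1)\<close>, empty for
  \<open>j \<le> i + 1\<close>. It carries the strand at position \<open>j\<close> to position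
  \<open>i + 1\<close>; besides conjugating in \<open>pgen\<close>, it serves to bring a chosen
  strand to the front.\<close>

primrec up :: "nat \<Rightarrow> nat \<Rightarrow> braid" where
  "up i 0 = 0"
| "up i (Suc j) = (if i < j then \<sigma> j + up i j else 0)"

definition pgen :: "nat \<Rightarrow> nat \<Rightarrow> braid" where
  "pgen i j = up i j + (\<sigma> i + \<sigma> i) - up i j"

lemma up_eq_0 [simp]: "j \<le> Suc i \<Longrightarrow> up i j = 0"
  by (induction j) auto

lemma pgen_Suc: "pgen i (Suc i) = \<sigma> i + \<sigma> i"
  by (simp add: pgen_def)

lemma pgen_step: "i < j \<Longrightarrow> pgen i (Suc j) = \<sigma> j + pgen i j - \<sigma> j"
  by (simp add: pgen_def grp del: add_uminus_conv_diff)

lemma pos_sigma: "1 \<le> i \<Longrightarrow> pos (\<sigma> i) k = Transposition.transpose i (Suc i) k"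
  using pos_sletter[of i True] by (simp add: sletter_def)

lemma pgen_pures: "1 \<le> i \<Longrightarrow> i < j \<Longrightarrow> j \<le> n \<Longrightarrow> pgen i j \<in> pures n"
proof (induction j)
  case (Suc j)
  show ?case
  proof (cases "i = j")
    case True
    then show ?thesis using Suc
      by (auto simp: pgen_Suc pures_def braids_add braids_sigma pos_add pos_sigma)
  next
    case False
    then show ?thesis using Suc by (auto simp: pgen_step intro!: pures_conj braids_sigma)
  qed
qed simp

lemma del_sigma:
  "1 \<le> i \<Longrightarrow> 1 \<le> k \<Longrightarrow> del k (\<sigma> i) = (if k = i \<or> k = Suc i then 0 else if k < i then \<sigma> (i - 1) else \<sigma> i)"
  using del_sletter[of i k True] by (simp add: sletter_def)

lemma lnk_sigma: "1 \<le> i \<Longrightarrow> lnk p q (\<sigma> i) = (if p = i \<and> q = Suc i then 1 else 0)"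
  using lnk_sletter[of i p q True] by (simp add: sletter_def)

lemma del_pgen:
  assumes "1 \<le> i" "i < j" "1 \<le> k"
  shows "del k (pgen i j) = (if k = i \<or> k = j then 0 else pgen (shift_index k i) (shift_index k j))"
  using assms
proof (induction j arbitrary: k)
  case (Suc j)
  show ?case
  proof (cases "i = j")
    case True
    then show ?thesis using Suc.prems pgen_Suc[of "j - 1"]
      by (auto simp: pgen_Suc del_add del_sigma pos_sigma shift_index_def)
  next
    case False
    then have ij: "i < j" "i \<le> j" using Suc.prems by auto
    have p: "pgen i j \<in> pures j" using ij Suc.prems by (intro pgen_pures) auto
    have "del k (pgen i (Suc j)) =
        del k (\<sigma> j) + del (Transposition.transpose j (Suc j) k) (pgen i j) - del k (\<sigma> j)"
      using ij Suc.prems p by (simp add: pgen_step del_conj pos_sigma)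
    also have "del (Transposition.transpose j (Suc j) k) (pgen i j) =
        (if k = i \<or> k = Suc j then 0 else pgen (shift_index (Transposition.transpose j (Suc j) k) i)
         (shift_index (Transposition.transpose j (Suc j) k) j))"
      using ij Suc.prems
      by (subst Suc.IH) (auto simp: Transposition.transpose_def)
    finally have *: "del k (pgen i (Suc j)) = \<dots>" if "k = j \<or> k = Suc j"
      using that ij Suc.prems by (auto simp: del_sigma)
    have "del k (pgen i (Suc j)) =
        del k (\<sigma> j) + del (Transposition.transpose j (Suc j) k) (pgen i j) - del k (\<sigma> j)"
      using ij Suc.prems p by (simp add: pgen_step del_conj pos_sigma)
    then have **: "del k (pgen i (Suc j)) = del k (\<sigma> j) + (if k = i then 0 else pgen (shift_index k i)
         (shift_index k j)) - del k (\<sigma> j)" if "k < j \<or> Suc j < k"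
      using that ij Suc.prems Suc.IH[of k] by (auto simp: Transposition.transpose_def)
    consider "k = j" | "k = Suc j" | "k < i" | "k = i" | "i < k" "k < j" | "Suc j < k" using ij by linarith
    then show ?thesis
    proof cases
      case 3
      then have "pgen (i - 1) (Suc (j - 1)) = \<sigma> (j - 1) + pgen (i - 1) (j - 1) - \<sigma> (j - 1)"
        using ij Suc.prems by (intro pgen_step) auto
      with 3 ** ij Suc.prems show ?thesis by (auto simp: shift_index_def del_sigma)
    next
      case 5
      then have "pgen i (Suc (j - 1)) = \<sigma> (j - 1) + pgen i (j - 1) - \<sigma> (j - 1)"
        using ij Suc.prems by (intro pgen_step) auto
      with 5 ** ij Suc.prems show ?thesis by (auto simp: shift_index_def del_sigma)
    qed (use * ** ij Suc.prems in \<open>auto simp: shift_index_def del_sigma pgen_step\<close>)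
  qed
qed simp

lemma lnk_pgen:
  assumes "1 \<le> i" "i < j"
  shows "lnk p q (pgen i j) = (if p = i \<and> q = j \<or> p = j \<and> q = i then 1 else 0)"
  using assms
proof (induction j arbitrary: p q)
  case (Suc j)
  show ?case
  proof (cases "i = j")
    case True
    then show ?thesis using Suc.prems
      by (auto simp: pgen_Suc lnk_add lnk_sigma pos_sigma Transposition.transpose_def)
  next
    case False
    then have ij: "i < j" using Suc.prems by auto
    have p: "pgen i j \<in> pures j" using ij Suc.prems by (intro pgen_pures) auto
    show ?thesis using ij Suc.prems p Suc.IH
      by (auto simp: pgen_step lnk_conj pos_sigma Transposition.transpose_def)
  qed
qed simp

subsection \<open>Shifting all strands by one\<close>

text \<open>An unmoved strand is added in front. On braids this splits \<open>del 1\<close>, and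
  later also \<open>bd n\<close>, which turns combing into a semidirect decomposition.\<close>

definition shift_word :: "braid_word \<Rightarrow> braid_word" where
  "shift_word = map (\<lambda>(i, b). (Suc i, b))"

lemma shift_word_simps [simp]:
  "shift_word [] = []" "shift_word (u @ v) = shift_word u @ shift_word v"
  "shift_word ((i, b) # w) = (Suc i, b) # shift_word w"
  by (auto simp: shift_word_def)

lemma shift_word_braid_words: "w \<in> braid_words n \<Longrightarrow> shift_word w \<in> braid_words (Suc n)"
  by (induction w) auto

lemma shift_word_braid_eq: "braid_eq n u v \<Longrightarrow> braid_eq (Suc n) (shift_word u) (shift_word v)"
proof (induction rule: braid_eq.induct)
  case (refl w) then show ?case by (intro braid_eq.refl shift_word_braid_words)
next
  case (sym v w) show ?case by (rule braid_eq.sym[OF sym.IH])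
next
  case (trans u v w) show ?case by (rule braid_eq.trans[OF trans.IH])
next
  case (cong v w x y) then show ?case by (auto intro: braid_eq.cong shift_word_braid_words)
next
  case (cancel i b) then show ?case by (auto intro: braid_eq.cancel)
next
  case (far i j) then show ?case by (auto intro: braid_eq.far)
next
  case (braid i) then show ?case using braid_eq.braid[of "Suc i" "Suc n"] by auto
qed

definition shift :: "braid \<Rightarrow> braid" where
  "shift a = of_word (shift_word (rep_braid a))"

lemma shift_of_word: "w \<in> braid_words n \<Longrightarrow> shift (of_word w) = of_word (shift_word w)"
  using beq_rep_of_word[of w n] shift_word_braid_eq of_word_eqI unfolding shift_def beq_def by blast

lemma shift_add: "shift (a + b) = shift a + shift b"
proof -
  obtain n u v where *: "u \<in> braid_words n" "v \<in> braid_words n" "a = of_word u" "b = of_word v"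
    by (rule common_words)
  then show ?thesis using shift_word_braid_words[OF *(1)] shift_word_braid_words[OF *(2)]
    by (simp add: of_word_append[of u n v, symmetric] shift_of_word[of _ n] of_word_append[of _ "Suc n"])
qed

lemma shift_zero [simp]: "shift 0 = 0"
  using shift_of_word[of "[]" 0] by simp

lemma shift_uminus: "shift (- a) = - shift a"
  using shift_add[of "- a" a] by (simp add: eq_neg_iff_add_eq_0)

lemma shift_diff: "shift (a - b) = shift a - shift b"
  using shift_add[of a "- b"] by (simp add: shift_uminus)

lemma shift_sigma: "1 \<le> i \<Longrightarrow> shift (\<sigma> i) = \<sigma> (Suc i)"
  unfolding \<sigma>_def by (subst shift_of_word[of _ "Suc i"]) auto

lemma shift_sletter: "1 \<le> i \<Longrightarrow> shift (sletter i b) = sletter (Suc i) b"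
  by (simp add: sletter_def shift_sigma shift_uminus)

lemma shift_braids: "a \<in> braids n \<Longrightarrow> shift a \<in> braids (Suc n)"
  unfolding braids_def using shift_word_braid_words by (auto simp: shift_of_word)

lemma pos_shift: "pos (shift a) (Suc k) = Suc (pos a k)" "pos (shift a) 1 = 1" "pos (shift a) 0 = 0"
  and del_1_shift: "del 1 (shift a) = a"
proof -
  obtain n where "a \<in> braids n" using braid_in_braids by blast
  then have "pos (shift a) 1 = 1 \<and> (\<forall>k. pos (shift a) (Suc k) = Suc (pos a k)) \<and> pos (shift a) 0 = 0 \<and> del 1 (shift a) = a"
  proof (induction rule: braids_induct)
    case (add i b a)
    then show ?case
      by (auto simp: shift_add shift_sletter pos_add del_add pos_sletter del_sletter Transposition.transpose_def)
  qed auto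
  then show "pos (shift a) (Suc k) = Suc (pos a k)" "pos (shift a) 1 = 1" "pos (shift a) 0 = 0" "del 1 (shift a) = a"
    by auto
qed

lemma shift_pures: "a \<in> pures n \<Longrightarrow> shift a \<in> pures (Suc n)"
  unfolding pures_def using pos_shift shift_braids by (auto, metis not0_implies_Suc)

lemma pures_of_shift:
  assumes "shift a \<in> pures (Suc n)" "a \<in> braids n"
  shows "a \<in> pures n"
  using assms pos_shift(1)[of a] unfolding pures_def by auto

lemma shift_up: "1 \<le> i \<Longrightarrow> shift (up i j) = up (Suc i) (Suc j)"
  by (induction j) (auto simp: shift_add shift_sigma)

lemma shift_pgen: "1 \<le> i \<Longrightarrow> shift (pgen i j) = pgen (Suc i) (Suc j)"
  by (simp add: pgen_def shift_diff shift_add shift_up shift_sigma)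

subsection \<open>The central element and the encircling elements\<close>

lemma braid_square_commute:
  assumes "s + t + s = t + s + (t::'a::group_add)"
  shows "commute t (s + s + (t + (s + s) - t))"
proof -
  have "s + s + (t + (s + s) - t) = s + (s + t + s) + s - t" by (simp add: grp del: add_uminus_conv_diff)
  also have "\<dots> = s + (t + s + t) + s - t" by (simp only: assms)
  also have "\<dots> = s + t + (s + t + s) - t" by (simp add: grp del: add_uminus_conv_diff)
  also have "\<dots> = s + t + (t + s + t) - t" by (simp only: assms)
  also have "\<dots> = s + t + t + s" by (simp add: grp del: add_uminus_conv_diff)
  finally have *: "s + s + (t + (s + s) - t) = s + t + t + s" .
  have "t + (s + t + t + s) = (t + s + t) + t + s" by (simp add: add.assoc)
  also have "\<dots> = s + t + (s + t + s)" unfolding assms[symmetric] by (simp add: add.assoc)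
  also have "\<dots> = s + t + t + s + t" unfolding assms by (simp add: add.assoc)
  finally show ?thesis unfolding * commute_def .
qed

text \<open>The relation of length four between the doubly bonded generators of type B. In the
  applications \<open>x\<close> is the loop of one strand around a block of neighbours and
  \<open>s\<close> the next crossing.\<close>

definition brel :: "'a::group_add \<Rightarrow> 'a \<Rightarrow> bool" where
  "brel x s \<longleftrightarrow> x + s + x + s = s + x + s + x"

lemma brel_step:
  assumes "brel x s" "commute t x" "s + t + s = t + s + (t::'a::group_add)"
  shows "brel (s + x + s) t"
proof -
  have 1: "s + (t + (s + u)) = t + (s + (t + u))" for u by (simp only: add.assoc[symmetric] assms(3))
  have 2: "t + (x + u) = x + (t + u)" for u using assms(2) unfolding commute_def by (simp only: add.assoc[symmetric])
  have 3: "x + (s + (x + (s + u))) = s + (x + (s + (x + u)))" for u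
    using assms(1) unfolding brel_def by (simp only: add.assoc[symmetric])
  have "s + (x + (s + (t + (s + (x + (s + (t + 0))))))) = s + (x + (t + (s + (t + (x + (s + (t + 0)))))))" by (simp only: 1)
  also have "\<dots> = s + (t + (x + (s + (x + (t + (s + (t + 0)))))))" by (simp only: 2)
  also have "\<dots> = s + (t + (x + (s + (x + (s + (t + (s + 0)))))))" by (simp only: 1)
  also have "\<dots> = s + (t + (s + (x + (s + (x + (t + (s + 0)))))))" by (simp only: 3)
  also have "\<dots> = t + (s + (t + (x + (s + (x + (t + (s + 0)))))))" by (simp only: 1)
  also have "\<dots> = t + (s + (x + (t + (s + (t + (x + (s + 0)))))))" by (simp only: 2)
  also have "\<dots> = t + (s + (x + (s + (t + (s + (x + (s + 0)))))))" by (simp only: 1)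
  finally show ?thesis by (simp add: brel_def add.assoc)
qed

text \<open>The Jucys-Murphy element \<open>\<sigma> (j - 1) + ... + \<sigma> 1 + \<sigma> 1 + ... +
  \<sigma> (j - 1)\<close>: strand \<open>j\<close> encircles all strands to its left. The first
  strand has nothing to encircle, whence the value 0.\<close>

primrec lsum :: "nat \<Rightarrow> braid" where
  "lsum 0 = 0"
| "lsum (Suc j) = (if j = 0 then 0 else \<sigma> j + lsum j + \<sigma> j)"

lemma sigma_braid': "1 \<le> i \<Longrightarrow> \<sigma> i + \<sigma> (Suc i) + \<sigma> i = \<sigma> (Suc i) + \<sigma> i + \<sigma> (Suc i)"
  using sigma_braid by simp

lemma sigma_commute: "1 \<le> i \<Longrightarrow> 1 \<le> j \<Longrightarrow> i + 2 \<le> j \<or> j + 2 \<le> i \<Longrightarrow> commute (\<sigma> i) (\<sigma> j)"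
  using sigma_far unfolding commute_def by metis

lemma lsum_far: "j < i \<Longrightarrow> commute (\<sigma> i) (lsum j)"
  by (induction j) (auto intro!: commute_add sigma_commute)

lemma conj_braid_commute:
  assumes "s + t + s = t + s + (t::'a::group_add)" "commute t x"
  shows "commute s (t + (s + x + s) + t)" 
proof -
  have 1: "s + (t + (s + u)) = t + (s + (t + u))" for u by (simp only: add.assoc[symmetric] assms(1))
  have 2: "t + (x + u) = x + (t + u)" for u using assms(2) unfolding commute_def by (simp only: add.assoc[symmetric])
  have "s + (t + (s + (x + (s + (t + 0))))) = t + (s + (t + (x + (s + (t + 0)))))" by (simp only: 1)
  also have "\<dots> = t + (s + (x + (t + (s + (t + 0)))))" by (simp only: 2)
  also have "\<dots> = t + (s + (x + (s + (t + (s + 0)))))" by (simp only: 1)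
  finally show ?thesis by (simp add: commute_def add.assoc)
qed

lemma lsum_commute: "1 \<le> i \<Longrightarrow> i + 1 < j \<Longrightarrow> commute (\<sigma> i) (lsum j)"
proof (induction j)
  case (Suc j)
  show ?case
  proof (cases "i + 1 < j")
    case True then show ?thesis using Suc by (auto intro!: commute_add sigma_commute)
  next
    case False
    then have j: "j = Suc i" using Suc by simp
    have "commute (\<sigma> i) (\<sigma> (Suc i) + (\<sigma> i + lsum i + \<sigma> i) + \<sigma> (Suc i))"
      using Suc by (intro conj_braid_commute sigma_braid' lsum_far) auto
    then show ?thesis using Suc j by simp
  qed
qed simp

lemma lsum_brel: "1 \<le> j \<Longrightarrow> brel (lsum j) (\<sigma> j)"
proof (induction j rule: nat_induct_at_least)
  case base show ?case by (simp add: brel_def)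
next
  case (Suc j)
  then have "brel (\<sigma> j + lsum j + \<sigma> j) (\<sigma> (Suc j))"
    by (intro brel_step sigma_braid' lsum_far) auto
  then show ?case using Suc by simp
qed

text \<open>The full twist on \<open>n\<close> strands, as the product of the Jucys-Murphy
  elements.\<close>

primrec zn :: "nat \<Rightarrow> braid" where
  "zn 0 = 0"
| "zn (Suc n) = zn n + lsum (Suc n)"

lemma zn_far: "n < i \<Longrightarrow> commute (\<sigma> i) (zn n)"
  by (induction n) (auto simp del: lsum.simps intro!: commute_add lsum_far)

text \<open>\<open>\<sigma> i\<close> commutes with every summand except \<open>lsum i\<close> and
  \<open>lsum (i + 1)\<close>, and \<open>lsum_brel\<close> says exactly that it commutes with the
  sum of these two.\<close>

lemma zn_sigma: "1 \<le> i \<Longrightarrow> i < n \<Longrightarrow> commute (\<sigma> i) (zn n)"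
proof (induction n)
  case (Suc n)
  show ?case
  proof (cases "i = n")
    case False then show ?thesis using Suc by (auto intro!: commute_add lsum_commute simp del: lsum.simps)
  next
    case True
    then obtain m where m: "n = Suc m" using Suc by (cases n) auto
    have "lsum n + \<sigma> n + lsum n + \<sigma> n = \<sigma> n + lsum n + \<sigma> n + lsum n" using lsum_brel[of n] m by (simp add: brel_def)
    then have "commute (\<sigma> n) (lsum n + (\<sigma> n + lsum n + \<sigma> n))"
      by (simp add: commute_def add.assoc del: lsum.simps)
    then have "commute (\<sigma> n) (lsum n + lsum (Suc n))" using m by simp
    moreover have "commute (\<sigma> n) (zn m)" using m by (intro zn_far) auto
    ultimately show ?thesis using True m by (simp add: add.assoc commute_add del: lsum.simps)
  qed
qed simp

lemma commute_sletter: "commute (\<sigma> i) x \<Longrightarrow> commute (sletter i b) x"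
  by (simp add: sletter_def commute_uminus_left)

lemma commute_braids:
  assumes "a \<in> braids n" "\<And>i. 1 \<le> i \<Longrightarrow> i < n \<Longrightarrow> commute (\<sigma> i) x"
  shows "commute a x"
  using assms(1)
proof (induction rule: braids_induct)
  case (add i b a) then show ?case by (intro commute_add_left commute_sletter assms(2))
qed simp

lemma zn_commute: "a \<in> braids n \<Longrightarrow> commute a (zn n)"
  by (erule commute_braids) (rule zn_sigma)

lemma pgen_lsum: "1 \<le> j \<Longrightarrow> sum_list (map (\<lambda>i. pgen i j) [1..<j]) = lsum j"
proof (induction j rule: nat_induct_at_least)
  case (Suc j)
  have "sum_list (map (\<lambda>i. pgen i (Suc j)) xs) = \<sigma> j + sum_list (map (\<lambda>i. pgen i j) xs) - \<sigma> j"
    if "set xs \<subseteq> {1..<j}" for xs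
    using that by (induction xs) (auto simp: pgen_step grp simp del: add_uminus_conv_diff)
  from this[of "[1..<j]"] have "sum_list (map (\<lambda>i. pgen i (Suc j)) [1..<j]) = \<sigma> j + lsum j - \<sigma> j"
    using Suc by simp
  then show ?case using Suc by (simp add: pgen_Suc grp del: add_uminus_conv_diff)
qed simp

lemma lsum_pures: "j \<le> n \<Longrightarrow> lsum j \<in> pures n"
proof -
  assume "j \<le> n"
  have *: "sum_list xs \<in> pures n" if "set xs \<subseteq> pures n" for xs
    using that by (induction xs) (auto intro: pures_add)
  show ?thesis
  proof (cases "1 \<le> j")
    case True
    then show ?thesis using \<open>j \<le> n\<close>
      by (subst pgen_lsum[symmetric]) (auto intro!: * pgen_pures)
  qed (cases j; simp)
qed

lemma zn_pures: "m \<le> n \<Longrightarrow> zn m \<in> pures n"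
  by (induction m) (auto intro: pures_add lsum_pures simp del: lsum.simps)

text \<open>Counterpart of \<open>pgen_step\<close>, which raises the second index by conjugation:
  here it is the first. The base case is the braid relation for two neighbouring crossings.\<close>

lemma pgen_conj_left:
  assumes "1 \<le> j" "Suc j < i"
  shows "pgen (Suc j) i = \<sigma> j + pgen j i - \<sigma> j"
proof -
  have "Suc (Suc j) \<le> i" using assms by simp
  then show ?thesis
  proof (induction i rule: nat_induct_at_least)
    case base
    let ?s = "\<sigma> j" and ?t = "\<sigma> (Suc j)"
    have b: "?s + ?t + ?s = ?t + ?s + ?t" using assms by (intro sigma_braid')
    have "?s + (?t + (?s + ?s) - ?t) - ?s = (?s + ?t + ?s) + (?s - ?t - ?s)"
      by (simp add: grp del: add_uminus_conv_diff)
    also have "?s - ?t - ?s = - (?s + ?t - ?s)" by (simp add: grp del: add_uminus_conv_diff)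
    also have "?s + ?t - ?s = - ?t + (?s + ?t)"
    proof -
      have "?t + (?s + ?t - ?s) = ?s + ?t" using b by (simp add: diff_eq_eq add_diff_eq[symmetric] grp del: add_uminus_conv_diff) (metis add.assoc add.right_neutral add.right_inverse)
      then show ?thesis by (metis minus_add_cancel)
    qed
    also have "?s + ?t + ?s + - (- ?t + (?s + ?t)) = ?t + ?t"
      unfolding b by (simp add: grp del: add_uminus_conv_diff)
    finally show ?case using assms by (simp add: pgen_step pgen_Suc add_diff_eq)
  next
    case (Suc i)
    have c: "commute (\<sigma> i) (\<sigma> j)" using Suc assms by (intro sigma_commute) auto
    have "pgen (Suc j) (Suc i) = \<sigma> i + (\<sigma> j + pgen j i - \<sigma> j) - \<sigma> i"
      using Suc assms by (simp add: pgen_step)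
    also have "\<dots> = (\<sigma> i + \<sigma> j) + pgen j i - (\<sigma> i + \<sigma> j)" by (rule conj_conj)
    also have "\<dots> = (\<sigma> j + \<sigma> i) + pgen j i - (\<sigma> j + \<sigma> i)" using c by (simp add: commute_def)
    finally show ?case using Suc assms by (simp add: pgen_step conj_conj)
  qed
qed

text \<open>The mirror image of \<open>lsum\<close>: strand \<open>j\<close> encircles all strands
  to its right up to \<open>n\<close>. Inductions therefore run downwards from
  \<open>n\<close>.\<close>

definition rsum :: "nat \<Rightarrow> nat \<Rightarrow> braid" where
  "rsum n j = sum_list (map (pgen j) [Suc j..<Suc n])"

lemma rsum_self [simp]: "n \<le> j \<Longrightarrow> rsum n j = 0"
  by (simp add: rsum_def)

lemma rsum_step:
  assumes "1 \<le> j" "j < n" shows "rsum n j = \<sigma> j + rsum n (Suc j) + \<sigma> j"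
proof -
  have *: "sum_list (map (pgen j) xs) = - \<sigma> j + sum_list (map (pgen (Suc j)) xs) + \<sigma> j"
    if "set xs \<subseteq> {Suc (Suc j)..}" for xs
    using that
  proof (induction xs)
    case (Cons i xs)
    then have "pgen j i = - \<sigma> j + pgen (Suc j) i + \<sigma> j"
      using pgen_conj_left[of j i] assms by (auto simp: grp simp del: add_uminus_conv_diff)
    with Cons show ?case by (auto simp: add.assoc)
  qed simp
  have "[Suc j..<Suc n] = Suc j # [Suc (Suc j)..<Suc n]" using assms by (simp add: upt_conv_Cons)
  then have "rsum n j = pgen j (Suc j) + sum_list (map (pgen j) [Suc (Suc j)..<Suc n])"
    by (simp add: rsum_def)
  also have "sum_list (map (pgen j) [Suc (Suc j)..<Suc n]) = - \<sigma> j + rsum n (Suc j) + \<sigma> j"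
    unfolding rsum_def by (rule *) auto
  finally show ?thesis by (simp add: pgen_Suc add.assoc)
qed

lemma rsum_induct [consumes 1, case_names top step]:
  assumes "1 \<le> j" "\<And>j. n \<le> j \<Longrightarrow> P j" "\<And>j. 1 \<le> j \<Longrightarrow> j < n \<Longrightarrow> P (Suc j) \<Longrightarrow> P j"
  shows "P j"
  using assms(1)
proof (induction "n - j" arbitrary: j)
  case (Suc d) then show ?case using assms(3)[of j] Suc(1)[of "Suc j"] by auto
qed (simp add: assms(2))

lemma rsum_far: "1 \<le> j \<Longrightarrow> 1 \<le> i \<Longrightarrow> i + 1 < j \<Longrightarrow> commute (\<sigma> i) (rsum n j)"
  by (induction j rule: rsum_induct[where n = n]) (auto simp: rsum_step intro!: commute_add sigma_commute)

lemma rsum_commute: "1 \<le> j \<Longrightarrow> j < i \<Longrightarrow> i < n \<Longrightarrow> commute (\<sigma> i) (rsum n j)"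
proof (induction j rule: rsum_induct[where n = n])
  case (step j)
  show ?case
  proof (cases "i = Suc j")
    case False then show ?thesis using step by (auto simp: rsum_step intro!: commute_add sigma_commute)
  next
    case True
    have "commute (\<sigma> (Suc j)) (\<sigma> j + (\<sigma> (Suc j) + rsum n (Suc (Suc j)) + \<sigma> (Suc j)) + \<sigma> j)"
      using step sigma_braid'[of j] by (intro conj_braid_commute rsum_far) auto
    then show ?thesis using step True by (simp add: rsum_step)
  qed
qed simp

lemma rsum_brel: "1 \<le> j \<Longrightarrow> brel (rsum n (Suc j)) (\<sigma> j)"
proof (induction j rule: rsum_induct[where n = "n - 1"])
  case (top j) then show ?case by (simp add: brel_def)
next
  case (step j)
  then have "brel (\<sigma> (Suc j) + rsum n (Suc (Suc j)) + \<sigma> (Suc j)) (\<sigma> j)"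
    using sigma_braid'[of j] by (intro brel_step rsum_far) auto
  then show ?case using step by (simp add: rsum_step)
qed

definition gg :: "nat \<Rightarrow> nat \<Rightarrow> braid" where
  "gg i j = (if i = j then 0 else pgen (min i j) (max i j))"

lemma gg_same [simp]: "gg i i = 0"
  by (simp add: gg_def)

text \<open>\<open>tsum n j\<close> is the inverse of the element written \<open>A\<^sub>0\<^sub>j\<close> in the paper.\<close>

definition tsum :: "nat \<Rightarrow> nat \<Rightarrow> braid" where
  "tsum n j = sum_list (map (\<lambda>i. gg i j) [1..<n + 1])"

lemma tsum_eq: "1 \<le> j \<Longrightarrow> j \<le> n \<Longrightarrow> tsum n j = lsum j + rsum n j"
proof -
  assume j: "1 \<le> j" "j \<le> n"
  then have "[1..<n + 1] = [1..<j] @ j # [Suc j..<Suc n]"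
    by (metis Suc_eq_plus1 le_imp_less_Suc less_imp_le_nat upt_add_eq_append upt_conv_Cons le_Suc_ex add.commute)
  moreover have "(\<Sum>i\<leftarrow>[1..<j]. gg i j) = (\<Sum>i\<leftarrow>[1..<j]. pgen i j)"
    by (intro arg_cong[where f = sum_list] map_cong) (auto simp: gg_def)
  moreover have "(\<Sum>i\<leftarrow>[Suc j..<Suc n]. gg i j) = sum_list (map (pgen j) [Suc j..<Suc n])"
    by (intro arg_cong[where f = sum_list] map_cong) (auto simp: gg_def)
  ultimately have "tsum n j = sum_list (map (\<lambda>i. pgen i j) [1..<j]) + sum_list (map (pgen j) [Suc j..<Suc n])"
    unfolding tsum_def by (simp del: upt_Suc)
  then show ?thesis using pgen_lsum[OF j(1)] by (simp add: rsum_def del: upt_Suc)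
qed

lemma tsum_step: "1 \<le> j \<Longrightarrow> j < n \<Longrightarrow> tsum n (Suc j) = \<sigma> j + tsum n j - \<sigma> j"
  by (simp add: tsum_eq rsum_step grp del: add_uminus_conv_diff)

lemma gg_pures: "1 \<le> i \<Longrightarrow> 1 \<le> j \<Longrightarrow> i \<le> n \<Longrightarrow> j \<le> n \<Longrightarrow> gg i j \<in> pures n"
  by (auto simp: gg_def intro!: pgen_pures)

lemma sum_list_pures: "set xs \<subseteq> pures n \<Longrightarrow> sum_list xs \<in> pures n"
  by (induction xs) (auto intro: pures_add)

lemma tsum_pures: "1 \<le> j \<Longrightarrow> j \<le> n \<Longrightarrow> tsum n j \<in> pures n"
  unfolding tsum_def by (intro sum_list_pures) (auto intro!: gg_pures)

subsection \<open>Combing\<close>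

declare One_nat_def [simp del] Suc_eq_plus1 [symmetric, simp]

lemma pgen_1_2 [simp]: "pgen 1 2 = \<sigma> 1 + \<sigma> 1"
  using pgen_Suc[of 1] by simp

lemma sigma_pgen_braid: "commute (\<sigma> 2) (pgen 1 2 + pgen 1 3)"
proof -
  have "pgen 1 2 = \<sigma> 1 + \<sigma> 1" "pgen 1 3 = \<sigma> 2 + (\<sigma> 1 + \<sigma> 1) - \<sigma> 2"
    using pgen_Suc[of 1] pgen_step[of 1 2] by simp_all
  then show ?thesis using braid_square_commute[OF sigma_braid'[of 1]] by simp
qed

text \<open>With the loops of the first strand themselves as \<open>y\<close>, the target of
  \<open>Phi\<close> is the braid group again, and \<open>Phi\<close> takes values among the braids
  fixing the first strand.\<close>

interpretation comb: braid_data n "\<lambda>i. \<sigma> (Suc i)" "\<lambda>m. pgen 1 (Suc m)" for n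
proof
  show "commute (\<sigma> (Suc i)) (pgen 1 (Suc 1))" if "2 \<le> i" for i
    using that by (auto simp: pgen_Suc simp del: Suc_1 intro!: commute_add sigma_commute)
  show "commute (\<sigma> (Suc 1)) (pgen 1 (Suc 1) + pgen 1 (Suc 2))"
    using sigma_pgen_braid by simp
  show "\<sigma> (Suc i) + \<sigma> (Suc (i + 1)) + \<sigma> (Suc i) = \<sigma> (Suc (i + 1)) + \<sigma> (Suc i) + \<sigma> (Suc (i + 1))"
    for i using sigma_braid'[of "Suc i"] by (simp only: Suc_eq_plus1)
qed (auto simp: pgen_step intro!: sigma_commute)

lemma up_far: "j < k \<Longrightarrow> commute (\<sigma> k) (up i j)"
  by (induction j) (auto intro!: commute_add sigma_commute)

lemma up_slide: "1 \<le> i \<Longrightarrow> i + 1 < k \<Longrightarrow> \<sigma> i + up 0 k = up 0 k + \<sigma> (Suc i)"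
proof (induction k)
  case (Suc k)
  show ?case
  proof (cases "Suc i = k")
    case False
    then have c: "\<sigma> i + \<sigma> k = \<sigma> k + \<sigma> i" using Suc sigma_commute[of i k] by (simp add: commute_def)
    have "\<sigma> i + up 0 (Suc k) = \<sigma> k + (\<sigma> i + up 0 k)" using Suc by (simp add: add.assoc[symmetric] c)
    also have "\<dots> = up 0 (Suc k) + \<sigma> (Suc i)" using Suc False by (simp add: add.assoc)
    finally show ?thesis .
  next
    case True
    have c: "up 0 i + \<sigma> (Suc i) = \<sigma> (Suc i) + up 0 i" using up_far[of i "Suc i" 0] by (simp add: commute_def)
    have b: "\<sigma> i + (\<sigma> (Suc i) + (\<sigma> i + x)) = \<sigma> (Suc i) + (\<sigma> i + (\<sigma> (Suc i) + x))" for x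
      using sigma_braid'[of i] Suc by (simp add: add.assoc[symmetric])
    show ?thesis using Suc True[symmetric] by (simp add: add.assoc b c)
  qed
qed simp

lemma pgen_1_alt: "1 \<le> k \<Longrightarrow> pgen 1 (Suc k) = - up 0 k + (\<sigma> k + \<sigma> k) + up 0 k"
proof (induction k rule: nat_induct_at_least)
  case base show ?case by (simp add: pgen_Suc)
next
  case (Suc k)
  have c: "\<sigma> (Suc k) + up 0 k - \<sigma> (Suc k) = up 0 k"
    using up_far[of k "Suc k" 0] by (simp add: commute_conj_iff)
  have b: "\<sigma> k + \<sigma> (Suc k) + \<sigma> k = \<sigma> (Suc k) + \<sigma> k + \<sigma> (Suc k)"
    using sigma_braid'[of k] Suc by simp
  have "pgen 1 (Suc (Suc k)) = \<sigma> (Suc k) + (- up 0 k + (\<sigma> k + \<sigma> k) + up 0 k) - \<sigma> (Suc k)"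
    using Suc by (simp add: pgen_step)
  also have "\<dots> = - up 0 k + (\<sigma> (Suc k) + (\<sigma> k + \<sigma> k) - \<sigma> (Suc k)) + up 0 k"
    unfolding conj_add conj_uminus c ..
  also have "\<sigma> (Suc k) + (\<sigma> k + \<sigma> k) - \<sigma> (Suc k) = - \<sigma> k + (\<sigma> (Suc k) + \<sigma> (Suc k)) + \<sigma> k"
  proof -
    have "\<sigma> k + (\<sigma> (Suc k) + (\<sigma> k + \<sigma> k) - \<sigma> (Suc k))
        = (\<sigma> k + \<sigma> (Suc k) + \<sigma> k) + \<sigma> k - \<sigma> (Suc k)" by (simp add: grp del: add_uminus_conv_diff)
    also have "\<dots> = (\<sigma> (Suc k) + \<sigma> k + \<sigma> (Suc k)) + \<sigma> k - \<sigma> (Suc k)" by (simp only: b)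
    also have "\<dots> = \<sigma> (Suc k) + (\<sigma> k + \<sigma> (Suc k) + \<sigma> k) - \<sigma> (Suc k)" by (simp only: add.assoc)
    also have "\<dots> = \<sigma> (Suc k) + (\<sigma> (Suc k) + \<sigma> k + \<sigma> (Suc k)) - \<sigma> (Suc k)" by (simp only: b)
    also have "\<dots> = \<sigma> (Suc k) + \<sigma> (Suc k) + \<sigma> k" by (simp add: grp del: add_uminus_conv_diff)
    finally have "- \<sigma> k + (\<sigma> k + (\<sigma> (Suc k) + (\<sigma> k + \<sigma> k) - \<sigma> (Suc k))) = - \<sigma> k + (\<sigma> (Suc k) + \<sigma> (Suc k) + \<sigma> k)"
      by (simp only:)
    then show ?thesis by (simp only: minus_add_cancel add.assoc)
  qed
  finally show ?case using Suc by (simp add: grp del: add_uminus_conv_diff)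
qed

text \<open>Schreier rewriting: the braids \<open>up 0 k\<close> supply coset representatives for
  the stabiliser of the first strand, and \<open>Phi\<close> is the resulting rewriting map. For
  pure \<open>a\<close> and \<open>k\<close> = 1 both representatives are trivial, so
  \<open>Phi\<close> fixes \<open>a\<close>.\<close>

lemma comb_formula:
  assumes "a \<in> braids n" "k \<in> {1..n}"
  shows "- up 0 k + a = comb.Phi n k a - up 0 (pos a k)"
  using assms
proof (induction arbitrary: k rule: braids_induct)
  case zero then show ?case by (simp add: comb.Phi_zero)
next
  case (add i b a)
  let ?k = "Transposition.transpose i (Suc i) k"
  have "- up 0 k + sletter i b = comb.phi (i, b) k - up 0 ?k"
  proof -
    consider "k < i" | "k = i" | "k = Suc i" | "Suc i < k" by linarith
    then show ?thesis
    proof cases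
      case 1
      then have "commute (- up 0 k) (sletter i b)"
        by (intro commute_uminus_left commute_sym[OF commute_sletter] up_far)
      with 1 show ?thesis by (simp add: commute_def comb.phi_def sletter_def)
    next
      case 2
      then show ?thesis using add.hyps(1)
        by (auto simp: comb.phi_def sletter_def pgen_1_alt grp simp del: add_uminus_conv_diff One_nat_def)
    next
      case 3
      then show ?thesis using add.hyps(1)
        by (auto simp: comb.phi_def sletter_def pgen_1_alt grp simp del: add_uminus_conv_diff One_nat_def)
    next
      case 4
      have "\<sigma> i + up 0 k = up 0 k + \<sigma> (Suc i)" using 4 add.hyps by (intro up_slide) auto
      then have "- up 0 k + \<sigma> i = \<sigma> (Suc i) - up 0 k"
        by (metis add.assoc add_minus_cancel diff_eq_eq minus_add_cancel)
      moreover from this have "- up 0 k - \<sigma> i = - \<sigma> (Suc i) - up 0 k"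
        by (metis add.assoc add_minus_cancel diff_eq_eq minus_add_cancel diff_conv_add_uminus)
      ultimately show ?thesis using 4 by (auto simp: comb.phi_def sletter_def)
    qed
  qed
  moreover have "?k \<in> {1..n}" using tr_range[of i n k b] add by (simp add: tr_def)
  ultimately have "- up 0 k + (sletter i b + a) = comb.phi (i, b) k + (comb.Phi n ?k a - up 0 (pos a ?k))"
    by (simp only: add.assoc[symmetric] add.IH[symmetric]) (simp add: grp del: add_uminus_conv_diff)
  then show ?case using add
    by (simp add: comb.Phi_add braids_sletter comb.Phi_sletter pos_add pos_sletter add_diff_eq)
qed

lemma image_pgen_1: "(\<lambda>m. pgen 1 (Suc m)) ` {1..<n} = pgen 1 ` {2..n}"
proof -
  have "Suc ` {1..<n} = {2..n}" by (auto simp: image_iff)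
  then show ?thesis by (metis image_image)
qed

lemma gen_pgen_1_conj:
  assumes "a \<in> gen (pgen 1 ` {2..n})" "g \<in> braids (n - 1)"
  shows "shift g + a - shift g \<in> gen (pgen 1 ` {2..n})"
  using assms(2,1)
proof (induction arbitrary: a rule: braids_induct)
  case (add i b g)
  have "sletter (Suc i) b + (shift g + a - shift g) - sletter (Suc i) b \<in> gen (pgen 1 ` {2..n})"
    using comb.gen_y_conj[of "shift g + a - shift g" n i] add
    by (auto simp: image_pgen_1 sletter_def simp del: One_nat_def)
  then show ?case using add by (simp add: shift_add shift_sletter conj_conj)
qed simp

text \<open>For a single letter the two terms differ by at most one loop \<open>pgen 1 j\<close>.
  The loops generate a subgroup normalised by shifted braids, so the errors of a whole word collect
  in it.\<close>

lemma Phi_comb_del: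
  assumes "a \<in> braids n" "k \<in> {1..n}"
  shows "comb.Phi n k a - shift (del k a) \<in> gen (pgen 1 ` {2..n})"
  using assms
proof (induction arbitrary: k rule: braids_induct)
  case zero then show ?case by (simp add: comb.Phi_zero gen.zero)
next
  case (add i b a)
  let ?k = "Transposition.transpose i (Suc i) k" and ?F = "gen (pgen 1 ` {2..n})"
  have k: "?k \<in> {1..n}" using tr_range[of i n k b] add by (simp add: tr_def)
  define u where "u = comb.phi (i, b) k"
  define v where "v = shift (del k (sletter i b))"
  have "pgen 1 (Suc i) \<in> ?F" using add.hyps by (intro gen.incl) auto
  then have uv: "u - v \<in> ?F"
    unfolding u_def v_def using add.hyps add.prems
    by (cases "k = i \<or> k = Suc i \<or> k < i")
      (auto simp: comb.phi_def del_sletter shift_sletter gen.zero, auto simp: sletter_def gen.zero intro: gen.uminus)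
  have "del k (sletter i b) \<in> braids (n - 1)" using add.hyps add.prems by (intro del_braids braids_sletter) auto
  then have "v + (comb.Phi n ?k a - shift (del ?k a)) - v \<in> ?F"
    unfolding v_def using add.IH[OF k] by (intro gen_pgen_1_conj) auto
  with uv have "(u - v) + (v + (comb.Phi n ?k a - shift (del ?k a)) - v) \<in> ?F" by (rule gen.add)
  also have "(u - v) + (v + (comb.Phi n ?k a - shift (del ?k a)) - v) = (u + comb.Phi n ?k a) - (v + shift (del ?k a))"
    by (simp add: grp del: add_uminus_conv_diff)
  finally show ?case using add
    by (simp add: u_def v_def comb.Phi_add braids_sletter comb.Phi_sletter pos_sletter del_add shift_add)
qed

lemma pgen_1_pures: "pgen 1 ` {2..n} \<subseteq> pures n"
  by (auto intro!: pgen_pures)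

lemma pure_decomp:
  assumes "a \<in> pures n" "1 \<le> n"
  shows "a - shift (del 1 a) \<in> gen (pgen 1 ` {2..n})" "del 1 a \<in> pures (n - 1)"
proof -
  have a: "a \<in> braids n" "1 \<in> {1..n}" using assms by (auto simp: pures_def)
  from comb_formula[OF this] have "a = comb.Phi n 1 a" using assms by (simp add: pos_pure)
  with Phi_comb_del[OF a] show *: "a - shift (del 1 a) \<in> gen (pgen 1 ` {2..n})" by simp
  then have "- (a - shift (del 1 a)) \<in> pures n" 
    using gen_pures[OF pgen_1_pures] pures_uminus by blast
  then have "- (a - shift (del 1 a)) + a \<in> pures n" using assms by (intro pures_add)
  then show "del 1 a \<in> pures (n - 1)"
    using pures_of_shift[of "del 1 a" "n - 1"] del_braids[OF a] assms(2) by simp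
qed

definition pgens :: "nat \<Rightarrow> braid set" where
  "pgens n = {pgen i j | i j. 1 \<le> i \<and> i < j \<and> j \<le> n}"

lemma pgens_pures: "pgens n \<subseteq> pures n"
  by (auto simp: pgens_def intro: pgen_pures)

lemma gen_shift: "a \<in> gen S \<Longrightarrow> (\<And>x. x \<in> S \<Longrightarrow> shift x \<in> gen U) \<Longrightarrow> shift a \<in> gen U"
  by (induction rule: gen.induct) (auto simp: shift_add shift_uminus intro: gen.intros)

theorem pures_eq_gen: "pures n = gen (pgens n)"
proof
  show "gen (pgens n) \<subseteq> pures n" using gen_pures[OF pgens_pures] by blast
  show "pures n \<subseteq> gen (pgens n)"
  proof (induction n)
    case 0
    show ?case by (auto simp: pures_def braids_def braid_words_def gen.zero)
  next
    case (Suc n)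
    show ?case
    proof
      fix a assume a: "a \<in> pures (Suc n)"
      have "del 1 a \<in> gen (pgens n)" using Suc pure_decomp(2)[OF a] by auto
      moreover have "shift x \<in> gen (pgens (Suc n))" if x: "x \<in> pgens n" for x
      proof -
        obtain i j where "x = pgen i j" "1 \<le> i" "i < j" "j \<le> n" using x unfolding pgens_def by blast
        then have "shift x = pgen (Suc i) (Suc j)" "1 \<le> Suc i" "Suc i < Suc j" "Suc j \<le> Suc n"
          by (auto simp: shift_pgen)
        then have "shift x \<in> pgens (Suc n)" unfolding pgens_def by blast
        then show ?thesis by (rule gen.incl)
      qed
      ultimately have "shift (del 1 a) \<in> gen (pgens (Suc n))" by (rule gen_shift)
      moreover have "a - shift (del 1 a) \<in> gen (pgens (Suc n))"
      proof (rule gen_mono)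
        have "pgen 1 ` {2..Suc n} \<subseteq> pgens (Suc n)"
        proof (rule image_subsetI)
          fix j assume "j \<in> {2..Suc n}"
          then show "pgen 1 j \<in> pgens (Suc n)"
            unfolding pgens_def by (intro CollectI exI[of _ 1] exI[of _ j]) auto
        qed
        then show "pgen 1 ` {2..Suc n} \<subseteq> gen (pgens (Suc n))"
          by (rule subset_trans) (rule subsetI, rule gen.incl)
        show "a - shift (del 1 a) \<in> gen (pgen 1 ` {2..Suc n})" using pure_decomp(1)[OF a] by simp
      qed
      ultimately have "(a - shift (del 1 a)) + shift (del 1 a) \<in> gen (pgens (Suc n))" by (intro gen.add)
      then show "a \<in> gen (pgens (Suc n))" by simp
    qed
  qed
qed

definition additive_on :: "'a::group_add set \<Rightarrow> ('a \<Rightarrow> 'b::group_add) \<Rightarrow> bool" where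
  "additive_on S f \<longleftrightarrow> (\<forall>a\<in>S. \<forall>b\<in>S. f (a + b) = f a + f b)"

lemma additive_on_pures_uminus:
  assumes "additive_on (pures n) f"
  shows "f 0 = 0" "a \<in> pures n \<Longrightarrow> f (- a) = - f a"
proof -
  have "f 0 + f 0 = f 0" using assms unfolding additive_on_def by (metis pures_zero add.right_neutral)
  then have "f 0 + f 0 = f 0 + 0" by (simp only: add.right_neutral)
  then show *: "f 0 = 0" by (simp only: add_left_cancel)
  assume "a \<in> pures n"
  then have "f (- a) + f a = f (- a + a)" using assms pures_uminus unfolding additive_on_def by metis
  then show "f (- a) = - f a" using * by (simp add: eq_neg_iff_add_eq_0)
qed

lemma additive_on_eqI:
  assumes "additive_on (pures n) f" "additive_on (pures n) g"
    "\<And>i j. 1 \<le> i \<Longrightarrow> i < j \<Longrightarrow> j \<le> n \<Longrightarrow> f (pgen i j) = g (pgen i j)" "a \<in> pures n"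
  shows "f a = g a"
proof -
  have "a \<in> gen (pgens n)" using assms(4) pures_eq_gen by simp
  then have "a \<in> pures n \<and> f a = g a"
  proof induction
    case zero then show ?case using assms(1,2) additive_on_pures_uminus(1) by (metis pures_zero)
  next
    case (incl x) then show ?case using assms(3) pgens_pures by (fastforce simp: pgens_def)
  next
    case (add x y) then show ?case using assms(1,2) by (simp add: pures_add additive_on_def)
  next
    case (uminus x) then show ?case by (simp add: pures_uminus additive_on_pures_uminus(2)[OF assms(1)] additive_on_pures_uminus(2)[OF assms(2)])
  qed
  then show ?thesis ..
qed

lemma additive_on_range:
  assumes "additive_on (pures n) f"
    "\<And>i j. 1 \<le> i \<Longrightarrow> i < j \<Longrightarrow> j \<le> n \<Longrightarrow> f (pgen i j) \<in> pures m" "a \<in> pures n"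
  shows "f a \<in> pures m"
proof -
  have "a \<in> gen (pgens n)" using assms(3) pures_eq_gen by simp
  then have "a \<in> pures n \<and> f a \<in> pures m"
  proof induction
    case zero then show ?case using assms(1,2) additive_on_pures_uminus(1) by (metis pures_zero)
  next
    case (incl x) then show ?case using assms(2) pgens_pures by (fastforce simp: pgens_def)
  next
    case (add x y) then show ?case using assms(1) by (simp add: pures_add additive_on_def)
  next
    case (uminus x) then show ?case by (simp add: pures_uminus additive_on_pures_uminus(2)[OF assms(1)])
  qed
  then show ?thesis ..
qed

lemma additive_del: "1 \<le> k \<Longrightarrow> additive_on (pures n) (del k)"
  by (auto simp: additive_on_def del_pure_add)

lemma additive_lnk: "additive_on (pures n) (lnk p q)"
  by (auto simp: additive_on_def lnk_pure_add)

lemma shift_index_less: "i < j \<Longrightarrow> k \<noteq> i \<Longrightarrow> k \<noteq> j \<Longrightarrow> shift_index k i < shift_index k j"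
  by (auto simp: shift_index_def)

lemma shift_index_range: "1 \<le> i \<Longrightarrow> i \<le> n \<Longrightarrow> 1 \<le> k \<Longrightarrow> k \<le> n \<Longrightarrow> k \<noteq> i \<Longrightarrow> 1 \<le> shift_index k i \<and> shift_index k i \<le> n - 1"
  by (auto simp: shift_index_def)

lemma del_pures: "a \<in> pures n \<Longrightarrow> 1 \<le> k \<Longrightarrow> k \<le> n \<Longrightarrow> del k a \<in> pures (n - 1)"
proof (rule additive_on_range[OF additive_del], assumption)
  fix i j assume *: "1 \<le> k" "k \<le> n" "1 \<le> i" "i < j" "j \<le> n"
  have "shift_index k j \<le> n - 1" if "k \<noteq> j" using shift_index_range[of j n k] * that by auto
  then show "del k (pgen i j) \<in> pures (n - 1)" using * shift_index_range[of i n k]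
    by (auto simp: del_pgen intro!: pgen_pures shift_index_less)
qed

lemma lnk_sym: "a \<in> pures n \<Longrightarrow> lnk p q a = lnk q p a"
  by (rule additive_on_eqI[OF additive_lnk additive_lnk, of n]) (auto simp: lnk_pgen)

lemma additive_on_comp:
  "additive_on S f \<Longrightarrow> additive_on U g \<Longrightarrow> (\<And>x. x \<in> S \<Longrightarrow> f x \<in> U) \<Longrightarrow> additive_on S (\<lambda>x. g (f x))"
  by (auto simp: additive_on_def)

lemma lnk_del:
  assumes "a \<in> pures n" "1 \<le> k" "k \<le> n" "k \<noteq> p" "k \<noteq> q"
  shows "lnk (shift_index k p) (shift_index k q) (del k a) = lnk p q a"
proof (rule additive_on_eqI[OF _ additive_lnk _ assms(1)])
  show "additive_on (pures n) (\<lambda>a. lnk (shift_index k p) (shift_index k q) (del k a))"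
    using assms by (auto intro!: additive_on_comp[OF additive_del additive_lnk] del_pures)
  fix i j assume ij: "1 \<le> i" "i < j" "j \<le> n"
  have inj: "shift_index k u = shift_index k v \<longleftrightarrow> u = v" if "u \<noteq> k" "v \<noteq> k" for u v
    using that by (auto simp: shift_index_def)
  show "lnk (shift_index k p) (shift_index k q) (del k (pgen i j)) = lnk p q (pgen i j)"
  proof (cases "k = i \<or> k = j")
    case False
    have "1 \<le> shift_index k i" using shift_index_range[of i n k] ij False assms by auto
    then show ?thesis using False ij assms
      by (simp add: del_pgen lnk_pgen shift_index_less inj)
  qed (use ij assms in \<open>auto simp: del_pgen lnk_pgen\<close>)
qed

subsection \<open>The automorphism exchanging the first strand with infinity\<close>

context braid_data
begin

lemma Phi_1_pure_add: "a \<in> pures n \<Longrightarrow> b \<in> braids n \<Longrightarrow> 1 \<le> n \<Longrightarrow> Phi 1 (a + b) = Phi 1 a + Phi 1 b"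
  by (simp add: Phi_add pures_braids pos_pure)

lemma Phi_1_add: "a \<in> braids n \<Longrightarrow> b \<in> braids n \<Longrightarrow> 1 \<le> n \<Longrightarrow> pos a 1 = 1 \<Longrightarrow> Phi 1 (a + b) = Phi 1 a + Phi 1 b"
  by (simp add: Phi_add)

lemma Phi_1_uminus: "a \<in> braids n \<Longrightarrow> 1 \<le> n \<Longrightarrow> pos a 1 = 1 \<Longrightarrow> Phi 1 (- a) = - Phi 1 a"
  using pos_uminus(1)[of a 1] by (simp add: Phi_uminus)

lemma Phi_1_sigma: "2 \<le> i \<Longrightarrow> i < n \<Longrightarrow> Phi 1 (\<sigma> i) = s (i - 1)"
  by (simp add: Phi_sigma)

lemma Phi_1_conj_sigma:
  assumes "a \<in> pures n" "2 \<le> i" "i < n"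
  shows "Phi 1 (\<sigma> i + a - \<sigma> i) = s (i - 1) + Phi 1 a - s (i - 1)"
proof -
  have p: "pos (\<sigma> i) 1 = 1" using assms by (simp add: pos_sigma Transposition.transpose_def)
  then have q: "pos (- \<sigma> i) 1 = 1" using pos_uminus(1)[of "\<sigma> i" 1] by simp
  have "Phi 1 (\<sigma> i + (a + - \<sigma> i)) = Phi 1 (\<sigma> i) + (Phi 1 a + Phi 1 (- \<sigma> i))"
    using assms p q by (simp add: Phi_1_add Phi_1_pure_add braids_add braids_sigma braids_uminus pures_braids del: add_uminus_conv_diff)
  also have "Phi 1 (- \<sigma> i) = - Phi 1 (\<sigma> i)" using assms p by (simp add: Phi_1_uminus braids_sigma)
  finally show ?thesis using assms by (simp add: Phi_1_sigma grp del: add_uminus_conv_diff)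
qed

lemma Phi_1_pgen: "1 \<le> m \<Longrightarrow> m < n \<Longrightarrow> Phi 1 (pgen 1 (Suc m)) = y m"
proof (induction m rule: nat_induct_at_least)
  case base
  then show ?case by (simp add: Phi_add braids_sigma Phi_sigma pos_sigma)
next
  case (Suc m)
  then have "Phi 1 (pgen 1 (Suc (Suc m))) = s m + y m - s m"
    using Phi_1_conj_sigma[of "pgen 1 (Suc m)" "Suc m"] pgen_pures[of 1 "Suc m" n] by (simp add: pgen_step)
  then show ?case using y_step[of m] Suc by simp
qed

lemma additive_Phi_1: "1 \<le> n \<Longrightarrow> additive_on (pures n) (Phi 1)"
  by (auto simp: additive_on_def Phi_1_pure_add pures_braids)

end

text \<open>The value prescribed for \<theta> on \<open>pgen 1 (Suc m)\<close>;
  \<open>- tsum n (Suc m)\<close> is the loop of strand \<open>Suc m\<close> around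
  infinity.\<close>

definition thy :: "nat \<Rightarrow> nat \<Rightarrow> braid" where
  "thy n m = - pgen 1 (Suc m) + - tsum n (Suc m) + pgen 1 (Suc m)"

lemma thy_step: "1 \<le> m \<Longrightarrow> Suc m < n \<Longrightarrow> thy n (Suc m) = \<sigma> (Suc m) + thy n m - \<sigma> (Suc m)"
  unfolding thy_def conj_add conj_uminus by (simp add: pgen_step tsum_step)

lemma lsum_1: "lsum 1 = 0"
  by (simp add: One_nat_def)

lemma thy_1: "2 \<le> n \<Longrightarrow> thy n 1 = - (rsum n 2 + (\<sigma> 1 + \<sigma> 1))"
proof -
  assume n: "2 \<le> n"
  have "lsum 2 = \<sigma> 1 + \<sigma> 1" using lsum.simps(2)[of 1] lsum_1 by (simp del: lsum.simps)
  then have "tsum n 2 = (\<sigma> 1 + \<sigma> 1) + rsum n 2" using n by (simp add: tsum_eq)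
  then show ?thesis unfolding thy_def by (simp add: grp del: add_uminus_conv_diff)
qed

text \<open>Used with \<open>s = \<sigma> 2\<close>, \<open>a = \<sigma> 1 + \<sigma> 1\<close> and
  \<open>r = rsum n 3\<close>, so that \<open>- x\<close> and \<open>s + - x - s\<close> are the
  first two values of \<open>thy\<close>. Each relation of length four says that \<open>s\<close>
  commutes with a sum of four terms, and the two sums together give
  \<open>x + (- s + x + s)\<close>.\<close>

lemma theta_braid_rel:
  assumes "brel a s" "brel r s" "commute a r" and x: "x = s + r + s + (a :: 'a::group_add)"
  shows "commute s (- x + (s + - x - s))"
proof -
  have "s + (r + s + r + s) = s + (s + r + s + r)" using assms(2) by (simp only: brel_def)
  then have c1: "commute s (s + r + s + r)" by (simp only: commute_def add.assoc)
  have "(a + s + a + s) + s = (s + a + s + a) + s" using assms(1) by (simp only: brel_def)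
  then have c2: "commute s (a + s + a + s)" by (simp only: commute_def add.assoc)
  have ar: "a + (r + u) = r + (a + u)" for u using assms(3) by (simp add: commute_def add.assoc[symmetric])
  have "commute s ((s + r + s + r) + (a + s + a + s))" using c1 c2 by (rule commute_add)
  also have "(s + r + s + r) + (a + s + a + s) = x + (- s + x + s)"
    unfolding x by (simp add: add.assoc ar)
  finally have "commute s (s + (x + (- s + x + s)) - s)" by (metis commute_conj commute_self(1) add_diff_cancel)
  also have "s + (x + (- s + x + s)) - s = (s + x - s) + x" by (simp add: grp del: add_uminus_conv_diff)
  finally have "commute s (- ((s + x - s) + x))" by (rule commute_uminus)
  also have "- ((s + x - s) + x) = - x + (s + - x - s)" by (simp add: grp del: add_uminus_conv_diff)
  finally show ?thesis .
qed

text \<open>This gives the well-definedness of \<theta>: the relations of type B are verified for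
  the prescribed values, which at once extends \<theta> to all braids fixing the first
  strand.\<close>

interpretation th: braid_data n "\<lambda>i. \<sigma> (Suc i)" "thy n" for n
proof
  show "commute (\<sigma> (Suc i)) (thy n 1)" if "2 \<le> i" "i + 1 < n" for i
    using that by (auto simp: thy_1 intro!: commute_uminus commute_add sigma_commute rsum_commute)
  show "commute (\<sigma> (Suc 1)) (thy n 1 + thy n 2)" if n: "2 < n"
  proof -
    have A: "commute (\<sigma> 1 + \<sigma> 1) (rsum n 3)" by (intro commute_add_left rsum_far) auto
    have b: "brel (\<sigma> 1 + \<sigma> 1) (\<sigma> 2)" using lsum_brel[of 2] lsum.simps(2)[of 1] lsum_1 by simp
    have r: "brel (rsum n 3) (\<sigma> 2)" using rsum_brel[of 2 n] by simp
    have x: "rsum n 2 + (\<sigma> 1 + \<sigma> 1) = \<sigma> 2 + rsum n 3 + \<sigma> 2 + (\<sigma> 1 + \<sigma> 1)" using rsum_step[of 2 n] n by simp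
    have "thy n 2 = \<sigma> 2 + thy n 1 - \<sigma> 2" using thy_step[of 1 n] n by simp
    then show ?thesis using theta_braid_rel[OF b r A x] n by (simp add: thy_1)
  qed
qed (use sigma_braid' in \<open>auto simp: thy_step intro!: sigma_commute\<close>)

definition tht :: "nat \<Rightarrow> braid \<Rightarrow> braid" where
  "tht n a = th.Phi n 1 a"

lemma additive_tht: "1 \<le> n \<Longrightarrow> additive_on (pures n) (tht n)"
  unfolding tht_def by (rule th.additive_Phi_1)

lemma tht_pgen_1: "2 \<le> j \<Longrightarrow> j \<le> n \<Longrightarrow> tht n (pgen 1 j) = - pgen 1 j + - tsum n j + pgen 1 j"
  using th.Phi_1_pgen[of "j - 1" n] by (simp add: tht_def thy_def)

lemma tht_shift: "a \<in> braids (n - 1) \<Longrightarrow> 1 \<le> n \<Longrightarrow> tht n (shift a) = shift a"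
proof (induction rule: braids_induct)
  case zero then show ?case by (simp add: tht_def th.Phi_zero)
next
  case (add i b a)
  have "pos (shift (sletter i b)) 1 = 1" by (rule pos_shift)
  moreover have "shift (sletter i b) \<in> braids n" "shift a \<in> braids n"
    using shift_braids[of _ "n - 1"] add by (auto simp: braids_sletter)
  ultimately show ?case using add
    by (simp add: tht_def shift_add th.Phi_1_add)
      (auto simp: shift_sletter th.Phi_sletter th.phi_def, auto simp: sletter_def)
qed

lemma tht_pgen: "2 \<le> i \<Longrightarrow> i < j \<Longrightarrow> j \<le> n \<Longrightarrow> tht n (pgen i j) = pgen i j"
proof -
  assume *: "2 \<le> i" "i < j" "j \<le> n"
  then have "shift (pgen (i - 1) (j - 1)) = pgen i j" by (simp add: shift_pgen)
  moreover have "pgen (i - 1) (j - 1) \<in> braids (n - 1)" using * by (intro pures_braids pgen_pures) auto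
  ultimately show ?thesis using tht_shift[of "pgen (i - 1) (j - 1)" n] * by simp
qed

lemma tht_pures:
  assumes "a \<in> pures n" "1 \<le> n" shows "tht n a \<in> pures n"
proof (rule additive_on_range[OF additive_tht _ assms(1)])
  fix i j assume *: "1 \<le> i" "i < j" "j \<le> n"
  then have "tht n (pgen i j) = (if i = 1 then - pgen 1 j + - tsum n j + pgen 1 j else pgen i j)"
    by (auto simp: tht_pgen_1 tht_pgen)
  then show "tht n (pgen i j) \<in> pures n" using *
    by (auto intro!: pures_add pures_uminus pgen_pures tsum_pures simp del: add_uminus_conv_diff)
qed (use assms in auto)

lemma zn_1: "zn 1 = 0"
  by (simp add: One_nat_def)

text \<open>The full twist is also the loop of the first strand around all others followed by the
  full twist of the others. Since \<open>zn\<close> is built from the last strand, an induction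
  exchanges the two decompositions.\<close>

lemma zn_shift: "1 \<le> m \<Longrightarrow> zn m = rsum m 1 + shift (zn (m - 1))"
proof (induction m rule: nat_induct_at_least)
  case base show ?case by (simp add: zn_1)
next
  case (Suc m)
  have lsum: "lsum (Suc m) = pgen 1 (Suc m) + shift (lsum m)"
  proof -
    have "[1..<Suc m] = 1 # map Suc [1..<m]"
      using Suc by (simp add: map_Suc_upt upt_conv_Cons del: upt_Suc)
    then have "lsum (Suc m) = pgen 1 (Suc m) + sum_list (map (\<lambda>i. pgen (Suc i) (Suc m)) [1..<m])"
      using pgen_lsum[of "Suc m"] by (simp add: comp_def del: upt_Suc)
    also have "sum_list (map (\<lambda>i. pgen (Suc i) (Suc m)) xs) = shift (sum_list (map (\<lambda>i. pgen i m) xs))"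
      if "set xs \<subseteq> {1..}" for xs using that by (induction xs) (auto simp: shift_add shift_pgen)
    from this[of "[1..<m]"] have "sum_list (map (\<lambda>i. pgen (Suc i) (Suc m)) [1..<m]) = shift (lsum m)"
      using Suc.hyps pgen_lsum[of m] by (simp add: atLeastLessThan_subset_iff subset_iff)
    finally show ?thesis .
  qed
  have "commute (shift a) (pgen 1 (Suc m))" if "a \<in> braids (m - 1)" for a
    using that
  proof (induction rule: braids_induct)
    case (add i b a)
    have "commute (\<sigma> (Suc i)) (pgen 1 (Suc m))"
      using comb.y_far[of i "Suc m" m] add by auto
    with add show ?case by (simp add: shift_add shift_sletter commute_add_left commute_sletter)
  qed simp
  from this[OF pures_braids[OF zn_pures[of "m - 1"]]]
  have c: "commute (shift (zn (m - 1))) (pgen 1 (Suc m))" by simp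
  have "zn (Suc m) = rsum m 1 + (shift (zn (m - 1)) + pgen 1 (Suc m)) + shift (lsum m)"
    using Suc lsum by (simp add: add.assoc del: lsum.simps)
  also have "\<dots> = (rsum m 1 + pgen 1 (Suc m)) + (shift (zn (m - 1)) + shift (lsum m))"
    using c by (simp add: commute_def add.assoc)
  also have "rsum m 1 + pgen 1 (Suc m) = rsum (Suc m) 1"
    using Suc by (simp add: rsum_def)
  also have "shift (zn (m - 1)) + shift (lsum m) = shift (zn m)"
    using Suc zn.simps(2)[of "m - 1"] by (simp flip: shift_add del: zn.simps)
  finally show ?case by simp
qed

lemma rsum_shift: "1 \<le> j \<Longrightarrow> shift (rsum n j) = rsum (Suc n) (Suc j)"
proof -
  assume "1 \<le> j"
  have "shift (sum_list (map (pgen j) xs)) = sum_list (map (pgen (Suc j)) (map Suc xs))" for xs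
    using \<open>1 \<le> j\<close> by (induction xs) (auto simp: shift_add shift_pgen)
  then show ?thesis by (simp only: rsum_def map_Suc_upt)
qed

text \<open>Exchanging the first strand with infinity twice leaves a full twist of the remaining
  strands. Bijectivity of \<open>tht n\<close> follows, and later \<open>tht n\<close> acts as its
  own inverse up to conjugation.\<close>

lemma tht_tht:
  assumes "a \<in> pures n" "1 \<le> n"
  shows "tht n (tht n a) = shift (zn (n - 1)) + a - shift (zn (n - 1))"
proof (rule additive_on_eqI[OF _ _ _ assms(1)])
  let ?c = "shift (zn (n - 1))"
  have zb: "zn (n - 1) \<in> braids (n - 1)" by (intro pures_braids zn_pures) simp
  show "additive_on (pures n) (\<lambda>a. tht n (tht n a))"
    using assms by (intro additive_on_comp[OF additive_tht additive_tht] tht_pures) auto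
  show "additive_on (pures n) (\<lambda>a. ?c + a - ?c)"
    by (simp add: additive_on_def conj_add)
  fix i j assume ij: "1 \<le> i" "i < j" "j \<le> n"
  have cs: "commute ?c (shift a)" if "a \<in> braids (n - 1)" for a
  proof -
    have "commute (zn (n - 1)) a" using zn_commute[OF that] by (rule commute_sym)
    then show ?thesis by (simp add: commute_def flip: shift_add)
  qed
  show "tht n (tht n (pgen i j)) = ?c + pgen i j - ?c"
  proof (cases "i = 1")
    case False
    then have *: "2 \<le> i" using ij by simp
    have "shift (pgen (i - 1) (j - 1)) = pgen i j" using ij * by (simp add: shift_pgen)
    moreover have "pgen (i - 1) (j - 1) \<in> braids (n - 1)" using * ij by (intro pures_braids pgen_pures) auto
    ultimately have "commute ?c (pgen i j)" using cs[of "pgen (i - 1) (j - 1)"] by simp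
    then show ?thesis using * ij by (simp add: tht_pgen commute_conj_iff)
  next
    case True
    have "2 \<le> j" using True ij by simp
    \<comment> \<open>Only \<open>pgen 1 2\<close> has to be computed: the next loop arises by
      conjugation with \<open>\<sigma> j\<close>, which is respected by \<open>tht n\<close> and
      commutes with \<open>?c\<close>.\<close>
    then have "tht n (tht n (pgen 1 j)) = ?c + pgen 1 j - ?c" using \<open>j \<le> n\<close>
    proof (induction j rule: nat_induct_at_least)
      case base
      let ?A = "\<sigma> 1 + \<sigma> 1"
      have A: "?A \<in> pures n" using pgen_pures[of 1 2 n] base by simp
      have Rs: "rsum n 2 = shift (rsum (n - 1) 1)" using rsum_shift[of 1 "n - 1"] base by simp
      have Rb: "rsum (n - 1) 1 \<in> pures (n - 1)"
        unfolding rsum_def by (intro sum_list_pures) (auto intro!: pgen_pures)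
      then have rsum: "rsum n 2 \<in> pures n" using shift_pures[of "rsum (n - 1) 1" "n - 1"] Rs base by simp
      have tR: "tht n (rsum n 2) = rsum n 2" using tht_shift[OF pures_braids[OF Rb]] Rs base by simp
      have tA: "tht n ?A = - (rsum n 2 + ?A)"
        using th.Phi_1_pgen[of 1 n] thy_1[of n] base by (simp add: tht_def)
      have "tht n (- (rsum n 2 + ?A)) = - (tht n (rsum n 2) + tht n ?A)"
        using additive_on_pures_uminus(2)[OF additive_tht, of n "rsum n 2 + ?A"] additive_tht[of n] A rsum base
        by (simp add: pures_add additive_on_def)
      then have 1: "tht n (tht n ?A) = rsum n 2 + ?A - rsum n 2"
        unfolding tA tR by (simp add: grp del: add_uminus_conv_diff)
      have "zn (n - 1) = rsum (n - 1) 1 + shift (zn (n - 2))" using zn_shift[of "n - 1"] base by (simp add: diff_diff_eq)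
      then have c: "?c = rsum n 2 + shift (shift (zn (n - 2)))" by (simp add: shift_add Rs)
      have "commute (shift (shift a)) ?A" if "a \<in> braids (n - 2)" for a
        using that
      proof (induction rule: braids_induct)
        case (add i b a)
        then have "commute (sletter (Suc (Suc i)) b) ?A"
          by (intro commute_sletter commute_add sigma_commute) auto
        then have "commute (sletter (Suc (Suc i)) b + shift (shift a)) ?A"
          using add by (intro commute_add_left)
        with add show ?case by (simp add: shift_add shift_sletter)
      qed simp
      from this[OF pures_braids[OF zn_pures[of "n - 2"]]]
      have "shift (shift (zn (n - 2))) + ?A - shift (shift (zn (n - 2))) = ?A" by (simp add: commute_conj_iff)
      then have "?c + ?A - ?c = rsum n 2 + ?A - rsum n 2" unfolding c conj_conj[symmetric] by simp
      with 1 show ?case by simp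
    next
      case (Suc j)
      have j: "1 < j" "j \<ge> 1" using Suc by auto
      have p: "pgen 1 j \<in> pures n" using Suc by (intro pgen_pures) auto
      have t: "tht n (\<sigma> j + a - \<sigma> j) = \<sigma> j + tht n a - \<sigma> j" if "a \<in> pures n" for a
        using th.Phi_1_conj_sigma[OF that, of j] Suc by (simp add: tht_def)
      have "tht n (tht n (pgen 1 (Suc j))) = \<sigma> j + (?c + pgen 1 j - ?c) - \<sigma> j"
        using Suc j p by (simp add: pgen_step t tht_pures)
      moreover have "commute ?c (\<sigma> j)"
        using cs[of "\<sigma> (j - 1)"] Suc by (simp add: shift_sigma braids_sigma)
      ultimately show ?case using j by (simp add: pgen_step conj_conj commute_def)
    qed
    with True show ?thesis by simp
  qed
qed

lemma tht_inj:
  assumes "a \<in> pures n" "b \<in> pures n" "1 \<le> n" "tht n a = tht n b" shows "a = b"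
proof -
  have "shift (zn (n - 1)) + a - shift (zn (n - 1)) = shift (zn (n - 1)) + b - shift (zn (n - 1))"
    using tht_tht[of a n] tht_tht[of b n] assms by metis
  then show ?thesis by (simp only: diff_conv_add_uminus add_right_cancel add_left_cancel)
qed

lemma shift_zn_pures: "1 \<le> n \<Longrightarrow> shift (zn (n - 1)) \<in> pures n"
  using shift_pures[OF zn_pures[of "n - 1" "n - 1"]] by simp

lemma tht_surj:
  assumes "a \<in> pures n" "1 \<le> n" obtains b where "b \<in> pures n" "tht n b = a"
proof
  let ?c = "shift (zn (n - 1))"
  have "- ?c + a - - ?c \<in> pures n" using assms shift_zn_pures by (intro pures_conj pures_braids pures_uminus)
  then show "tht n (- ?c + a - - ?c) \<in> pures n" "tht n (tht n (- ?c + a - - ?c)) = a"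
    using assms by (simp_all only: tht_pures tht_tht) (simp add: add.assoc)
qed

lemma bij_tht: "1 \<le> n \<Longrightarrow> bij_betw (tht n) (pures n) (pures n)"
proof (rule bij_betw_imageI)
  assume n: "1 \<le> n"
  show "inj_on (tht n) (pures n)" using n tht_inj by (auto intro!: inj_onI)
  show "tht n ` pures n = pures n"
  proof
    show "tht n ` pures n \<subseteq> pures n" using n tht_pures by auto
    show "pures n \<subseteq> tht n ` pures n" using n by (auto elim: tht_surj)
  qed
qed

definition bd :: "nat \<Rightarrow> braid \<Rightarrow> braid" where
  "bd n a = del 1 (tht n a)"

lemma del_gg:
  "1 \<le> i \<Longrightarrow> 1 \<le> j \<Longrightarrow> 1 \<le> k \<Longrightarrow> del k (gg i j) = (if k = i \<or> k = j then 0 else gg (shift_index k i) (shift_index k j))"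
  by (auto simp: gg_def del_pgen min_def max_def shift_index_def)

lemma del_sum_list: "set xs \<subseteq> pures n \<Longrightarrow> 1 \<le> k \<Longrightarrow> del k (sum_list xs) = sum_list (map (del k) xs)"
  by (induction xs) (auto simp: del_pure_add)

lemma del_tsum:
  assumes "1 \<le> j" "j \<le> n" "1 \<le> k" "k \<le> n"
  shows "del k (tsum n j) = (if k = j then 0 else tsum (n - 1) (shift_index k j))"
proof -
  have l: "[1..<n + 1] = [1..<k] @ k # [Suc k..<Suc n]"
    using assms by (metis Suc_eq_plus1 le_imp_less_Suc less_imp_le_nat upt_add_eq_append upt_conv_Cons le_Suc_ex add.commute)
  have "del k (tsum n j) = (\<Sum>i\<leftarrow>[1..<n + 1]. del k (gg i j))"
    unfolding tsum_def using assms by (subst del_sum_list[of _ n]) (auto intro!: gg_pures simp: comp_def)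
  also have "\<dots> = (if k = j then 0 else tsum (n - 1) (shift_index k j))"
  proof (cases "k = j")
    case True
    have "(\<Sum>i\<leftarrow>[1..<n + 1]. del k (gg i j)) = (\<Sum>i\<leftarrow>[1..<n + 1]. 0)"
      by (intro arg_cong[where f = sum_list] map_cong) (use assms True in \<open>auto simp: del_gg\<close>)
    with True show ?thesis by (simp add: sum_list_0)
  next
    case False
    have 1: "(\<Sum>i\<leftarrow>[1..<k]. del k (gg i j)) = (\<Sum>i\<leftarrow>[1..<k]. gg i (shift_index k j))"
      by (intro arg_cong[where f = sum_list] map_cong) (use assms False in \<open>auto simp: del_gg shift_index_def\<close>)
    have 2: "(\<Sum>i\<leftarrow>[Suc k..<Suc n]. del k (gg i j)) = (\<Sum>i\<leftarrow>[Suc k..<Suc n]. gg (i - 1) (shift_index k j))"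
      by (intro arg_cong[where f = sum_list] map_cong) (use assms False in \<open>auto simp: del_gg shift_index_def\<close>)
    have 3: "map (\<lambda>i. gg (i - 1) (shift_index k j)) [Suc k..<Suc n] = map (\<lambda>i. gg i (shift_index k j)) [k..<n]"
      by (simp add: comp_def flip: map_Suc_upt del: upt_Suc)
    have 4: "[1..<(n - 1) + 1] = [1..<k] @ [k..<n]"
      using assms upt_add_eq_append[of 1 k "n - k"] by simp
    have 5: "del k (gg k j) = 0" using assms by (simp add: del_gg)
    show ?thesis unfolding l tsum_def 4 using False
      by (simp only: map_append sum_list.append list.map sum_list.Cons 1 2 3 5) simp
  qed
  finally show ?thesis .
qed

lemma bd_shift: "a \<in> braids (n - 1) \<Longrightarrow> 1 \<le> n \<Longrightarrow> bd n (shift a) = a"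
  by (simp add: bd_def tht_shift del_1_shift)

lemma bd_pgen: "2 \<le> i \<Longrightarrow> i < j \<Longrightarrow> j \<le> n \<Longrightarrow> bd n (pgen i j) = pgen (i - 1) (j - 1)"
  by (simp add: bd_def tht_pgen del_pgen shift_index_def)

lemma bd_pgen_1: "2 \<le> j \<Longrightarrow> j \<le> n \<Longrightarrow> bd n (pgen 1 j) = - tsum (n - 1) (j - 1)"
proof -
  assume *: "2 \<le> j" "j \<le> n"
  have 1: "pgen 1 j \<in> pures n" "tsum n j \<in> pures n" using * by (auto intro!: pgen_pures tsum_pures)
  then have "bd n (pgen 1 j) = - del 1 (pgen 1 j) + - del 1 (tsum n j) + del 1 (pgen 1 j)"
    using * by (simp add: bd_def tht_pgen_1 del_pure_add[of _ n] del_pure_uminus[of _ n] pures_add pures_uminus add.assoc del: add_uminus_conv_diff)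
  then show ?thesis using * by (simp add: del_pgen del_tsum shift_index_def)
qed

lemma additive_bd: "1 \<le> n \<Longrightarrow> additive_on (pures n) (bd n)"
  unfolding bd_def[abs_def] by (intro additive_on_comp[OF additive_tht additive_del]) (auto intro: tht_pures)

lemma bd_pures: "a \<in> pures n \<Longrightarrow> 1 \<le> n \<Longrightarrow> bd n a \<in> pures (n - 1)"
  unfolding bd_def by (intro del_pures tht_pures) auto

text \<open>The exchange of strand 1 with infinity does not touch strand \<open>k\<close>. Hence
  \<theta> preserves the kernel of every deletion with \<open>k \<ge> 2\<close>, while by definition
  of \<open>bd\<close> it carries the kernel of \<open>bd n\<close> to that of
  \<open>del 1\<close>.\<close>

lemma del_tht:
  assumes "a \<in> pures n" "2 \<le> k" "k \<le> n"
  shows "del k (tht n a) = tht (n - 1) (del k a)"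
proof (rule additive_on_eqI[OF _ _ _ assms(1)])
  have n: "1 \<le> n" "1 \<le> n - 1" using assms by auto
  show "additive_on (pures n) (\<lambda>a. del k (tht n a))"
    using assms by (intro additive_on_comp[OF additive_tht[of n] additive_del[of k n]] tht_pures) auto
  show "additive_on (pures n) (\<lambda>a. tht (n - 1) (del k a))"
    using assms by (intro additive_on_comp[OF additive_del[of k n] additive_tht[of "n - 1"]] del_pures) auto
  fix i j assume ij: "1 \<le> i" "i < j" "j \<le> n"
  show "del k (tht n (pgen i j)) = tht (n - 1) (del k (pgen i j))"
  proof (cases "i = 1")
    case True
    have 1: "pgen 1 j \<in> pures n" "tsum n j \<in> pures n" using ij True by (auto intro!: pgen_pures tsum_pures)
    then have "del k (tht n (pgen 1 j)) = - del k (pgen 1 j) + - del k (tsum n j) + del k (pgen 1 j)"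
      using ij assms True by (simp add: tht_pgen_1 del_pure_add[of _ n] del_pure_uminus[of _ n] pures_add pures_uminus add.assoc del: add_uminus_conv_diff)
    also have "\<dots> = tht (n - 1) (del k (pgen 1 j))"
      using ij assms True shift_index_range[of j n k] additive_on_pures_uminus(1)[OF additive_tht[OF n(2)]]
      by (auto simp: del_pgen del_tsum tht_pgen_1 shift_index_def)
    finally show ?thesis using True by simp
  next
    case False
    then show ?thesis using ij assms shift_index_range[of j n k] additive_on_pures_uminus(1)[OF additive_tht[OF n(2)]]
      by (auto simp: tht_pgen del_pgen shift_index_def)
  qed
qed

section \<open>Free groups: reduced words, exponent sums and finitely generated normal
  subgroups\<close>

section \<open>Free groups\<close>

fun push :: "nat \<times> bool \<Rightarrow> (nat \<times> bool) list \<Rightarrow> (nat \<times> bool) list" where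
  "push l [] = [l]"
| "push l (m # w) = (if fst l = fst m \<and> snd l = (\<not> snd m) then w else l # m # w)"

primrec reduce :: "(nat \<times> bool) list \<Rightarrow> (nat \<times> bool) list" where
  "reduce [] = []"
| "reduce (l # w) = push l (reduce w)"

fun reduced :: "(nat \<times> bool) list \<Rightarrow> bool" where
  "reduced (l # m # w) = (\<not> (fst l = fst m \<and> snd l = (\<not> snd m)) \<and> reduced (m # w))"
| "reduced w = True"

lemma reduced_tl: "reduced (l # w) \<Longrightarrow> reduced w"
  by (cases w) auto

lemma reduced_push: "reduced w \<Longrightarrow> reduced (push l w)"
  by (cases w) (auto dest: reduced_tl)

lemma reduced_reduce [simp]: "reduced (reduce w)"
  by (induction w) (auto intro: reduced_push)

lemma reduce_reduced: "reduced w \<Longrightarrow> reduce w = w"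
proof (induction w)
  case (Cons l w) then show ?case by (cases w) (auto dest: reduced_tl)
qed simp

lemma push_push: "reduced w \<Longrightarrow> push (i, b) (push (i, \<not> b) w) = w"
  by (cases w rule: reduced.cases) (auto split: if_splits)

lemma reduce_append: "reduce (u @ v) = foldr push u (reduce v)"
  by (induction u) auto

lemma foldr_push_reduce: "reduced w \<Longrightarrow> foldr push (reduce u) w = foldr push u w"
proof (induction u)
  case (Cons l u)
  have *: "foldr push (push l v) w = push l (foldr push v w)" if "reduced w" for v
  proof (cases v)
    case (Cons m v')
    have "reduced (foldr push v' w)" using that by (induction v') (auto intro: reduced_push)
    then show ?thesis using Cons push_push[of _ "fst m" "\<not> snd m"]
      by (cases l; cases m) auto
  qed simp
  show ?case using Cons by (simp add: *)
qed simp

lemma reduce_append_cong: "reduce u = reduce u' \<Longrightarrow> reduce v = reduce v' \<Longrightarrow> reduce (u @ v) = reduce (u' @ v')"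
  unfolding reduce_append by (metis foldr_push_reduce reduced_reduce)

lemma reduce_inv_word: "reduce (inv_word w @ w) = []"
proof (induction w)
  case (Cons l w)
  obtain i b where l: "l = (i, b)" by force
  have "reduce (inv_word w @ (i, \<not> b) # (i, b) # w) = foldr push (inv_word w) (push (i, \<not> b) (push (i, \<not> \<not> b) (reduce w)))"
    by (simp add: reduce_append)
  also have "\<dots> = reduce (inv_word w @ w)"
    by (subst push_push) (simp_all add: reduce_append)
  finally show ?case using Cons l by simp
qed simp

quotient_type fg = "(nat \<times> bool) list" / "\<lambda>u v. reduce u = reduce v"
  by (auto intro!: equivpI reflpI sympI transpI)

instantiation fg :: group_add
begin

lift_definition zero_fg :: fg is "[]" .

lift_definition plus_fg :: "fg \<Rightarrow> fg \<Rightarrow> fg" is "(@)"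
  by (rule reduce_append_cong)

lemma reduce_inv_word_cong: "reduce u = reduce v \<Longrightarrow> reduce (inv_word u) = reduce (inv_word v)"
proof -
  assume *: "reduce u = reduce v"
  have 1: "reduce (v @ inv_word v) = []" using reduce_inv_word[of "inv_word v"] by simp
  have "reduce (inv_word u @ (v @ inv_word v)) = reduce (inv_word u @ [])"
    by (rule reduce_append_cong) (simp_all add: 1)
  moreover have "reduce ((inv_word u @ v) @ inv_word v) = reduce ((inv_word u @ u) @ inv_word v)"
    by (intro reduce_append_cong) (simp_all add: *)
  moreover have "reduce ((inv_word u @ u) @ inv_word v) = reduce ([] @ inv_word v)"
    by (rule reduce_append_cong) (simp_all add: reduce_inv_word)
  ultimately show ?thesis by simp
qed

lift_definition uminus_fg :: "fg \<Rightarrow> fg" is inv_word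
  by (rule reduce_inv_word_cong)

definition minus_fg :: "fg \<Rightarrow> fg \<Rightarrow> fg" where
  "minus_fg a b = a + - b"

instance
proof
  fix a b c :: fg
  show "a + b + c = a + (b + c)" by transfer simp
  show "0 + a = a" by transfer simp
  show "a + 0 = a" by transfer simp
  show "- a + a = 0" by transfer (simp add: reduce_inv_word)
  show "a + - b = a - b" by (simp add: minus_fg_def)
qed

end

lift_definition nf :: "fg \<Rightarrow> (nat \<times> bool) list" is reduce .

lift_definition fgen :: "nat \<Rightarrow> fg" is "\<lambda>i. [(i, True)]" .

definition lval :: "(nat \<Rightarrow> 'g::group_add) \<Rightarrow> nat \<times> bool \<Rightarrow> 'g" where
  "lval g l = (if snd l then g (fst l) else - g (fst l))"

definition wval :: "(nat \<Rightarrow> 'g::group_add) \<Rightarrow> (nat \<times> bool) list \<Rightarrow> 'g" where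
  "wval g w = sum_list (map (lval g) w)"

lemma wval_simps [simp]: "wval g [] = 0" "wval g (l # w) = lval g l + wval g w" "wval g (u @ v) = wval g u + wval g v"
  by (simp_all add: wval_def)

lemma wval_push: "wval g (push l w) = lval g l + wval g w"
  by (cases w) (auto simp: lval_def add.assoc)

lemma wval_reduce: "wval g (reduce w) = wval g w"
  by (induction w) (auto simp: wval_push)

lift_definition fhom :: "(nat \<Rightarrow> 'g::group_add) \<Rightarrow> fg \<Rightarrow> 'g" is wval
  by (metis wval_reduce)

lemma fhom_add: "fhom g (a + b) = fhom g a + fhom g b"
  by transfer simp

lemma fhom_zero [simp]: "fhom g 0 = 0"
  by transfer simp

lemma fhom_uminus: "fhom g (- a) = - fhom g a"
  using fhom_add[of g "- a" a] by (simp add: eq_neg_iff_add_eq_0)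

lemma fhom_diff: "fhom g (a - b) = fhom g a - fhom g b"
  using fhom_add[of g a "- b"] by (simp add: fhom_uminus)

lemma fhom_fgen [simp]: "fhom g (fgen i) = g i"
  by transfer (simp add: lval_def)

lemma fg_induct [case_names zero pos neg]:
  assumes "P 0" "\<And>i a. P a \<Longrightarrow> P (fgen i + a)" "\<And>i a. P a \<Longrightarrow> P (- fgen i + a)"
  shows "P (a :: fg)"
proof -
  have "P (abs_fg w)" for w
  proof (induction w)
    case Nil then show ?case using assms(1) by (simp add: zero_fg_def)
  next
    case (Cons l w)
    obtain i b where l: "l = (i, b)" by force
    have "abs_fg (l # w) = (if b then fgen i else - fgen i) + abs_fg w"
      by (auto simp: l fgen.abs_eq uminus_fg.abs_eq plus_fg.abs_eq)
    then show ?case using Cons assms by simp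
  qed
  then show ?thesis by (metis Quotient3_abs_rep Quotient3_fg)
qed

lemma additive_zero:
  assumes "\<And>a b. f (a + b) = f a + f (b :: 'a::group_add)" shows "f 0 = (0 :: 'b::group_add)"
proof -
  have "f 0 + f 0 = f 0 + 0" using assms[of 0 0] by simp
  then show ?thesis by (simp only: add_left_cancel)
qed

lemma fhom_unique:
  assumes "\<And>a b. f (a + b) = f a + (f b :: 'g::group_add)" "\<And>i. f (fgen i) = g i"
  shows "f a = fhom g a"
proof -
  have 0: "f 0 = 0" by (rule additive_zero) (rule assms(1))
  have "f (- a) + f a = 0" for a using assms(1)[of "- a" a] 0 by simp
  then have "f (- a) = - f a" for a by (simp add: eq_neg_iff_add_eq_0)
  then show ?thesis using 0 assms by (induction a rule: fg_induct) (auto simp: fhom_add fhom_uminus)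
qed

lemma fhom_id: "fhom fgen a = a"
  by (rule fhom_unique[symmetric]) auto

lemma fhom_wval: "fhom g (wval fgen w) = wval g w"
  by (induction w) (auto simp: fhom_add lval_def fhom_uminus)

lemma wval_nf: "wval fgen (nf a) = a"
proof -
  have "wval fgen (nf a) = fhom fgen a" by transfer (simp add: wval_reduce)
  then show ?thesis by (simp add: fhom_id)
qed

lemma fhom_nf: "fhom g a = wval g (nf a)"
  by (metis fhom_wval wval_nf)

lemma nf_zero [simp]: "nf 0 = []"
  by transfer simp

lemma nf_add: "nf (a + b) = reduce (nf a @ nf b)"
  by transfer (rule reduce_append_cong, simp_all add: reduce_reduced)

lemma nf_lval: "nf (lval fgen l) = [l]"
  by (cases l) (auto simp: lval_def, (transfer, simp)+)

lemma nf_wval: "reduced w \<Longrightarrow> nf (wval fgen w) = w"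
proof -
  have "nf (wval fgen w) = reduce w"
    by (induction w) (auto simp: nf_add nf_lval reduce_append reduce_reduced)
  then show "reduced w \<Longrightarrow> nf (wval fgen w) = w" by (simp add: reduce_reduced)
qed

lemma reduced_nf [simp]: "reduced (nf a)"
  by transfer simp

lemma nf_inj: "nf a = nf b \<Longrightarrow> a = b"
  by (metis wval_nf)

subsection \<open>The pairing cocycle\<close>

text \<open>\<open>cocyc i j w\<close> is the upper right entry of the image of \<open>w\<close> in the integral Heisenberg group.\<close>

definition esum :: "nat \<Rightarrow> fg \<Rightarrow> int" where
  "esum i = fhom (\<lambda>j. if j = i then 1 else 0)"

lemma esum_simps [simp]:
  "esum i 0 = 0" "esum i (a + b) = esum i a + esum i b" "esum i (- a) = - esum i a" "esum i (a - b) = esum i a - esum i b"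
  "esum i (fgen j) = (if j = i then 1 else 0)"
  by (simp_all add: esum_def fhom_add fhom_uminus fhom_diff)

definition wsum :: "nat \<Rightarrow> (nat \<times> bool) list \<Rightarrow> int" where
  "wsum i = wval (\<lambda>j. if j = i then 1 else 0)"

primrec cocyc_word :: "nat \<Rightarrow> nat \<Rightarrow> (nat \<times> bool) list \<Rightarrow> int" where
  "cocyc_word i j [] = 0"
| "cocyc_word i j (l # w) = wsum i [l] * wsum j w + cocyc_word i j w"

lemma cocyc_word_append: "cocyc_word i j (u @ v) = cocyc_word i j u + cocyc_word i j v + wsum i u * wsum j v"
  by (induction u) (auto simp: wsum_def algebra_simps)

lemma cocyc_word_push: "i \<noteq> j \<Longrightarrow> cocyc_word i j (push l w) = cocyc_word i j (l # w)"
  by (cases w) (auto simp: wsum_def lval_def)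

lemma cocyc_word_reduce: "i \<noteq> j \<Longrightarrow> cocyc_word i j (reduce w) = cocyc_word i j w"
  by (induction w) (auto simp: cocyc_word_push wsum_def wval_reduce)

text \<open>The Heisenberg entry of \<open>a + b\<close> is the sum of the entries of
  \<open>a\<close> and \<open>b\<close> plus \<open>esum i a * esum j b\<close>. Comparing the two
  orders leaves the determinant of the exponent sums.\<close>

lemma commute_esum:
  assumes "commute a b" "i \<noteq> j" shows "esum i a * esum j b = esum i b * esum j a"
proof -
  have *: "cocyc_word i j (nf (x + y)) = cocyc_word i j (nf x) + cocyc_word i j (nf y) + esum i x * esum j y" for x y
    using assms(2) by (simp add: nf_add cocyc_word_reduce cocyc_word_append esum_def fhom_nf wsum_def)
  from *[of a b] *[of b a] assms(1) show ?thesis by (simp add: commute_def)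
qed

subsection \<open>Finitely generated normal subgroups\<close>

lemma nf_snoc: "nf (a + lval fgen l) = (if nf a \<noteq> [] \<and> fst (last (nf a)) = fst l \<and> snd (last (nf a)) = (\<not> snd l) then butlast (nf a) else nf a @ [l])"
proof -
  have aux: "foldr push w [l] = (if w \<noteq> [] \<and> fst (last w) = fst l \<and> snd (last w) = (\<not> snd l) then butlast w else w @ [l])"
    if "reduced w" for w using that
  proof (induction w rule: reduced.induct)
    case (1 x y w)
    then show ?case by (cases w) auto
  qed auto
  have "nf (a + lval fgen l) = foldr push (nf a) [l]"
    by (simp add: nf_add nf_lval reduce_append)
  then show ?thesis using aux[of "nf a"] by simp
qed

text \<open>The Cayley graph of a free group is a tree, so a path from the identity visits all prefixes of its
  reduced endpoint.\<close>

lemma prefix_on_path: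
  assumes "nf (wval fgen w) = p @ q"
  obtains u v where "w = u @ v" "wval fgen u = wval fgen p"
  using assms
proof (induction w arbitrary: p q thesis rule: rev_induct)
  case Nil
  then show ?case by auto
next
  case (snoc l w)
  show ?case
  proof (cases "\<exists>q'. nf (wval fgen w) = p @ q'")
    case True
    then obtain q' where "nf (wval fgen w) = p @ q'" by blast
    then obtain u v where "w = u @ v" "wval fgen u = wval fgen p" using snoc.IH by blast
    then show ?thesis using snoc.prems(1)[of u "v @ [l]"] by simp
  next
    case False
    have eq: "nf (wval fgen w + lval fgen l) = p @ q" using snoc.prems(2) by simp
    \<comment> \<open>The prefix \<open>p\<close> shows up only with the last letter, which
      therefore does not cancel; so \<open>p\<close> is the whole endpoint and \<open>q\<close> is
      empty.\<close>
    have "nf (wval fgen w) @ [l] = p @ q"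
    proof (rule ccontr)
      assume "nf (wval fgen w) @ [l] \<noteq> p @ q"
      then have "nf (wval fgen w) \<noteq> []" "butlast (nf (wval fgen w)) = p @ q"
        using eq nf_snoc[of "wval fgen w" l] by (auto split: if_splits)
      then have "nf (wval fgen w) = p @ (q @ [last (nf (wval fgen w))])"
        by (metis append_butlast_last_id append_assoc)
      with False show False by blast
    qed
    with False have "q = []" by (cases q rule: rev_cases) auto
    then have "p = nf (wval fgen (w @ [l]))" using eq by simp
    then have "wval fgen p = wval fgen (w @ [l])" by (simp only: wval_nf)
    then show ?thesis using snoc.prems(1)[of "w @ [l]" "[]"] by simp
  qed
qed

text \<open>Concatenating the reduced words of generators and their inverses gives a path that
  strays from the subgroup by at most a prefix of one generator. \<open>D\<close> collects these
  prefixes and is finite when \<open>S\<close> is.\<close>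

lemma gen_word:
  fixes S :: "fg set"
  defines "D \<equiv> insert 0 {wval fgen p | p q s. s \<in> S \<and> nf s = p @ q}"
  assumes "m \<in> gen S"
  shows "\<exists>w. wval fgen w = m \<and> (\<forall>u v. w = u @ v \<longrightarrow> (\<exists>m' d. m' \<in> gen S \<and> d \<in> D \<and> wval fgen u = m' + d))"
  using assms(2)
proof induction
  case zero
  show ?case by (rule exI[of _ "[]"]) (auto simp: D_def intro: gen.zero exI[of _ 0])
next
  case (incl s)
  have "\<exists>m' d. m' \<in> gen S \<and> d \<in> D \<and> wval fgen u = m' + d" if "nf s = u @ v" for u v
    using that incl by (intro exI[of _ 0] exI[of _ "wval fgen u"]) (auto simp: D_def gen.zero)
  then show ?case by (intro exI[of _ "nf s"]) (auto simp: wval_nf)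
next
  case (add a b)
  then obtain w z where w: "wval fgen w = a" "\<forall>u v. w = u @ v \<longrightarrow> (\<exists>m' d. m' \<in> gen S \<and> d \<in> D \<and> wval fgen u = m' + d)"
    and z: "wval fgen z = b" "\<forall>u v. z = u @ v \<longrightarrow> (\<exists>m' d. m' \<in> gen S \<and> d \<in> D \<and> wval fgen u = m' + d)"
    by blast
  have "\<exists>m' d. m' \<in> gen S \<and> d \<in> D \<and> wval fgen u = m' + d" if uv: "w @ z = u @ v" for u v
  proof -
    from uv consider v' where "w = u @ v'" | u' where "u = w @ u'" "z = u' @ v"
      by (auto simp: append_eq_append_conv2)
    then show ?thesis
    proof cases
      case 2
      then obtain m' d where "m' \<in> gen S" "d \<in> D" "wval fgen u' = m' + d" using z by blast
      then show ?thesis using 2 w(1) add.hyps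
        by (intro exI[of _ "a + m'"] exI[of _ d]) (auto simp: add.assoc intro: gen.add)
    qed (use w in blast)
  qed
  then show ?case using w z by (intro exI[of _ "w @ z"]) auto
next
  case (uminus a)
  then obtain w where w: "wval fgen w = a" "\<forall>u v. w = u @ v \<longrightarrow> (\<exists>m' d. m' \<in> gen S \<and> d \<in> D \<and> wval fgen u = m' + d)"
    by blast
  have inv: "wval fgen (inv_word x) = - wval fgen x" for x
    by (induction x) (auto simp: minus_add lval_def simp del: add_uminus_conv_diff)
  have "\<exists>m' d. m' \<in> gen S \<and> d \<in> D \<and> wval fgen u = m' + d" if uv: "inv_word w = u @ v" for u v
  proof -
    have "w = inv_word v @ inv_word u" using uv by (metis inv_word_inv_word inv_word_simps(3))
    moreover from this obtain m' d where "m' \<in> gen S" "d \<in> D" "wval fgen (inv_word v) = m' + d"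
      using w(2) by blast
    moreover from \<open>w = _\<close> have "a = wval fgen (inv_word v) - wval fgen u" using w(1) by (simp add: inv)
    then have "wval fgen u = - a + wval fgen (inv_word v)" by (simp add: grp del: add_uminus_conv_diff)
    ultimately show ?thesis using uminus.hyps
      by (intro exI[of _ "- a + m'"] exI[of _ d]) (auto simp: add.assoc intro: gen.add gen.uminus)
  qed
  then show ?case using w inv by (intro exI[of _ "inv_word w"]) auto
qed

text \<open>The first letter of \<open>a\<close> has an index different from \<open>j\<close>, so
  the power in front does not cancel against it, and the inverse power appended behind is stopped at
  that letter at the latest.\<close>

lemma nf_conj_prefix:
  assumes "nf a = l # w" "fst l \<noteq> j"
  shows "\<exists>q. nf (wval fgen (replicate r (j, True)) + a - wval fgen (replicate r (j, True))) = replicate r (j, True) @ q"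
proof -
  let ?x = "replicate r (j, True)"
  have "reduced (replicate r (j, True) @ l # w)" for r
  proof (induction r)
    case (Suc r) then show ?case using assms by (cases r) auto
  qed (use assms reduced_nf[of a] in auto)
  from nf_wval[OF this[of r]] have *: "nf (wval fgen ?x + a) = ?x @ l # w"
    using assms(1) wval_nf[of a] by simp
  have "\<exists>q. nf (wval fgen ?x + a + wval fgen (replicate t (j, False))) = ?x @ l # q" for t
  proof (induction t)
    case 0 show ?case using * by (intro exI[of _ w]) simp
  next
    case (Suc t)
    then obtain q where q: "nf (wval fgen ?x + a + wval fgen (replicate t (j, False))) = ?x @ l # q" by blast
    have "replicate (Suc t) (j, False) = replicate t (j, False) @ [(j, False)]"
      by (simp add: replicate_append_same)
    then have "wval fgen ?x + a + wval fgen (replicate (Suc t) (j, False)) =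
        (wval fgen ?x + a + wval fgen (replicate t (j, False))) + lval fgen (j, False)"
      by (simp add: add.assoc del: replicate_Suc)
    then show ?case using nf_snoc[of "wval fgen ?x + a + wval fgen (replicate t (j, False))" "(j, False)"] q assms(2)
      by (auto simp: butlast_append)
  qed
  moreover have "wval fgen (replicate r (j, False)) = - wval fgen ?x"
  proof -
    have "wval fgen (replicate r (j, True)) + lval fgen (j, True) = lval fgen (j, True) + wval fgen (replicate r (j, True))" for r
      by (induction r) (auto simp: add.assoc)
    then show ?thesis by (induction r) (auto simp: lval_def minus_add simp del: add_uminus_conv_diff, metis minus_add)
  qed
  ultimately show ?thesis by (metis append_Cons diff_conv_add_uminus)
qed

text \<open>Schreier: a nontrivial normal subgroup of infinite index in a free group is not finitely
  generated. If it were, all powers of a generator would lie within bounded distance of it.\<close>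

lemma fg_normal_trivial:
  assumes "finite S"
    and conj: "\<And>a j. a \<in> gen S \<Longrightarrow> j \<in> J \<Longrightarrow> fgen j + a - fgen j \<in> gen S"
    and esum: "\<And>a j. a \<in> gen S \<Longrightarrow> j \<in> J \<Longrightarrow> esum j a = 0"
    and J: "j1 \<in> J" "j2 \<in> J" "j1 \<noteq> j2"
    and "a \<in> gen S"
  shows "a = 0"
proof (rule ccontr)
  assume "a \<noteq> 0"
  then have "nf a \<noteq> []" by (metis nf_zero nf_inj)
  then obtain l w where a: "nf a = l # w" by (cases "nf a") auto
  \<comment> \<open>Two distinct indices in \<open>J\<close> guarantee one that differs from the
    first letter of \<open>a\<close>.\<close>
  obtain j where j: "j \<in> J" "fst l \<noteq> j" using J by metis
  define x where "x r = wval fgen (replicate r (j, True))" for r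
  define D where "D = insert 0 {wval fgen p | p q s. s \<in> S \<and> nf s = p @ q}"
  have "x r + a - x r \<in> gen S" for r
  proof (induction r)
    case (Suc r)
    then show ?case using conj[OF Suc j(1)] by (simp add: x_def conj_conj lval_def)
  qed (simp add: x_def assms)
  \<comment> \<open>The path to \<open>x r + a - x r\<close> visits \<open>x r\<close>, which thus
    lies within \<open>D\<close> of the subgroup. As \<open>D\<close> is finite, two different
    powers differ by an element of the subgroup, and its exponent sum is not 0.\<close>
  have "\<exists>m d. m \<in> gen S \<and> d \<in> D \<and> x r = m + d" for r
  proof -
    obtain w where w: "wval fgen w = x r + a - x r"
      "\<And>u v. w = u @ v \<Longrightarrow> \<exists>m' d. m' \<in> gen S \<and> d \<in> D \<and> wval fgen u = m' + d"
      using gen_word[OF \<open>x r + a - x r \<in> gen S\<close>] unfolding D_def by blast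
    obtain q where "nf (wval fgen w) = replicate r (j, True) @ q"
      using nf_conj_prefix[OF a j(2), of r] w(1) by (auto simp: x_def)
    then obtain u v where "w = u @ v" "wval fgen u = x r" by (rule prefix_on_path) (simp add: x_def)
    with w(2) show ?thesis by metis
  qed
  then obtain m d where md: "\<And>r. m r \<in> gen S" "\<And>r. d r \<in> D" "\<And>r. x r = m r + d r" by metis
  have "finite D"
  proof -
    have "{wval fgen p | p q s. s \<in> S \<and> nf s = p @ q} \<subseteq> (\<Union>s\<in>S. (\<lambda>k. wval fgen (take k (nf s))) ` {..length (nf s)})"
    proof clarify
      fix p q s assume "s \<in> S" "nf s = p @ q"
      then show "wval fgen p \<in> (\<Union>s\<in>S. (\<lambda>k. wval fgen (take k (nf s))) ` {..length (nf s)})"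
        by (intro UN_I[of s] image_eqI[of _ _ "length p"]) auto
    qed
    then show ?thesis unfolding D_def finite_insert by (rule finite_subset) (use assms(1) in auto)
  qed
  then have "\<not> inj d" using md(2) by (metis finite_subset image_subsetI infinite_UNIV_nat finite_imageD)
  then obtain r t where rt: "r \<noteq> t" "d r = d t" by (auto simp: inj_on_def)
  have "x r - x t = m r - m t" using md(3)[of r] md(3)[of t] rt by (simp add: grp del: add_uminus_conv_diff)
  then have "x r - x t \<in> gen S" using md(1) gen_diff by metis
  then have "esum j (x r - x t) = 0" using esum j by blast
  moreover have "esum j (x r) = int r" for r
    unfolding x_def by (induction r) (auto simp: lval_def)
  ultimately show False using rt by simp
qed

section \<open>Intersections of kernels of retractions as symmetric commutator products\<close>

section \<open>Symmetric commutator subgroups\<close>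

text \<open>For normal \<open>R i\<close> this is the symmetric commutator product: the product,
  over all orderings of the finite set \<open>S\<close>, of the iterated commutator subgroups in
  which every index occurs exactly once.\<close>

inductive fc :: "('i \<Rightarrow> 'a::group_add set) \<Rightarrow> 'i set \<Rightarrow> 'a \<Rightarrow> bool" for R where
  base: "r \<in> R i \<Longrightarrow> fc R {i} r"
| comm: "fc R S c \<Longrightarrow> i \<notin> S \<Longrightarrow> r \<in> R i \<Longrightarrow> fc R (insert i S) (c + r - c - r)"
| zero: "fc R S 0"
| add: "fc R S a \<Longrightarrow> fc R S b \<Longrightarrow> fc R S (a + b)"
| uminus: "fc R S a \<Longrightarrow> fc R S (- a)"

lemma conj_comm: "g + (c + r - c - r) - g = (g + c - g) + (g + r - g) - (g + c - g) - (g + r - (g::'a::group_add))"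
  by (simp add: grp del: add_uminus_conv_diff)

lemma fc_conj:
  assumes "fc R S a" "\<And>i r. r \<in> R i \<Longrightarrow> g + r - g \<in> R i"
  shows "fc R S (g + a - g)"
  using assms(1)
proof induction
  case (comm S c i r) then show ?case unfolding conj_comm by (intro fc.comm assms(2))
next
  case (add S a b) then show ?case unfolding conj_add by (intro fc.add)
next
  case (uminus S a) then show ?case unfolding conj_uminus by (intro fc.uminus)
qed (auto intro: fc.base assms(2) fc.zero)

locale normal_family =
  fixes R :: "'i \<Rightarrow> 'a::group_add set"
  assumes R_zero: "0 \<in> R i" and R_add: "a \<in> R i \<Longrightarrow> b \<in> R i \<Longrightarrow> a + b \<in> R i"
    and R_uminus: "a \<in> R i \<Longrightarrow> - a \<in> R i" and R_conj: "a \<in> R i \<Longrightarrow> g + a - g \<in> R i"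
begin

lemma R_comm: "u \<in> R i \<or> v \<in> R i \<Longrightarrow> u + v - u - v \<in> R i"
proof (elim disjE)
  assume "u \<in> R i"
  then have "u + (v + (- u) - v) \<in> R i" by (intro R_add R_conj R_uminus)
  then show ?thesis by (simp add: grp del: add_uminus_conv_diff)
next
  assume "v \<in> R i"
  then have "(u + v - u) + - v \<in> R i" by (intro R_add R_conj R_uminus)
  then show ?thesis by (simp add: grp del: add_uminus_conv_diff)
qed

lemma fc_R: "fc R S a \<Longrightarrow> i \<in> S \<Longrightarrow> a \<in> R i"
proof (induction rule: fc.induct)
  case (comm S c j r) then show ?case using R_comm by blast
qed (auto intro: R_zero R_add R_uminus)

lemma fc_conj': "fc R S a \<Longrightarrow> fc R S (g + a - g)"
  using fc_conj R_conj by blast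

lemma comm_flip: "fc R S (a + b - a - b) \<Longrightarrow> fc R S (b + a - b - a)"
  using fc.uminus[of R S "a + b - a - b"] by (simp add: grp del: add_uminus_conv_diff)

lemma fc_pair_cases:
  assumes "fc R U e" "U = {i, k}" "i \<noteq> k" "P 0" "\<And>a b. P a \<Longrightarrow> P b \<Longrightarrow> P (a + b)" "\<And>a. P a \<Longrightarrow> P (- a)"
    "\<And>u v. u \<in> R i \<Longrightarrow> v \<in> R k \<Longrightarrow> P (u + v - u - v)" "\<And>u v. u \<in> R k \<Longrightarrow> v \<in> R i \<Longrightarrow> P (u + v - u - v)"
  shows "P e"
  using assms(1,2)
proof (induction rule: fc.induct)
  case (comm S c j r)
  then have "j \<in> {i, k}" "S = {i, k} - {j}" by auto
  then have "(j = i \<and> S = {k}) \<or> (j = k \<and> S = {i})" using assms(3) by auto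
  then show ?case using comm fc_R assms(7,8) by auto
qed (use assms in auto)

text \<open>The three subgroups argument: a commutator of \<open>c\<close> with that of
  \<open>u\<close> and \<open>v\<close> is made of commutators into which \<open>u\<close> and
  \<open>v\<close> are inserted one after the other. An explicit identity in \<open>p\<close> and
  \<open>q\<close>, the commutators of \<open>c\<close> with \<open>u\<close> and with
  \<open>v\<close>, plays the part of the Hall-Witt identity.\<close>

lemma fc_comm_comm:
  assumes c: "fc R S c" and ik: "i \<notin> S" "k \<notin> S" "i \<noteq> k" and u: "u \<in> R k" and v: "v \<in> R i"
  shows "fc R (insert i (insert k S)) (c + (u + v - u - v) - c - (u + v - u - v))"
proof -
  let ?N = "fc R (insert i (insert k S))"
  define p where "p = c + u - c - u"
  define q where "q = c + v - c - v"
  define w where "w = u + v - u - v"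
  have p: "fc R (insert k S) p" unfolding p_def using c ik u by (intro fc.comm)
  have q: "fc R (insert i S) q" unfolding q_def using c ik v by (intro fc.comm)
  have w: "w \<in> R i" "w \<in> R k" unfolding w_def using R_comm u v by auto
  have qR: "q \<in> R i" using fc_R[OF q] by simp
  have pN: "?N (p + r - p - r)" if "r \<in> R i" for r
    using p ik that by (intro fc.comm) auto
  have qN: "?N (q + r - q - r)" if "r \<in> R k" for r
    using q ik that by (subst insert_commute, intro fc.comm) auto
  have "c + w - c - w =
      (p + (u + q - u - q) - p) + (p + (q + w - q - w) - p) + (p + w - p - w) +
      (w + (p + (q + v) - p - (q + v)) - w)"
  proof -
    have "c + w - c = (c + u - c) + (c + v - c) - (c + u - c) - (c + v - c)"
      unfolding w_def by (rule conj_comm)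
    also have "c + u - c = p + u" by (simp add: p_def)
    also have "c + v - c = q + v" by (simp add: q_def)
    finally show ?thesis unfolding w_def by (simp add: grp del: add_uminus_conv_diff)
  qed
  moreover have "?N \<dots>"
    using u v w qR by (intro fc.add fc_conj' pN qN comm_flip[OF qN] R_add)
  ultimately show ?thesis unfolding w_def by simp
qed

lemma fc_comm_pair:
  assumes "fc R S c" "i \<notin> S" "k \<notin> S" "i \<noteq> k" "fc R {i, k} e"
  shows "fc R (insert i (insert k S)) (c + e - c - e)"
proof (rule fc_pair_cases[OF assms(5) HOL.refl assms(4), where P = "\<lambda>e. fc R (insert i (insert k S)) (c + e - c - e)"])
  fix a b assume ab: "fc R (insert i (insert k S)) (c + a - c - a)" "fc R (insert i (insert k S)) (c + b - c - b)"
  have "c + (a + b) - c - (a + b) = (c + a - c - a) + (a + (c + b - c - b) - a)"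
    by (simp add: grp del: add_uminus_conv_diff)
  then show "fc R (insert i (insert k S)) (c + (a + b) - c - (a + b))" using ab by (simp only: fc.add fc_conj')
next
  fix a assume a: "fc R (insert i (insert k S)) (c + a - c - a)"
  have "c + (- a) - c - (- a) = - a + - (c + a - c - a) - (- a)"
    by (simp add: grp del: add_uminus_conv_diff)
  then show "fc R (insert i (insert k S)) (c + (- a) - c - (- a))" using a by (simp only: fc.uminus fc_conj')
next
  fix u v assume "u \<in> R i" "v \<in> R k"
  then show "fc R (insert i (insert k S)) (c + (u + v - u - v) - c - (u + v - u - v))"
    using fc_comm_comm[of S c k i u v] assms by (simp add: insert_commute)
next
  fix u v assume "u \<in> R k" "v \<in> R i"
  then show "fc R (insert i (insert k S)) (c + (u + v - u - v) - c - (u + v - u - v))"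
    using fc_comm_comm[of S c i k u v] assms by simp
qed (simp add: fc.zero)

text \<open>If \<open>\<rho>\<close> retracts modulo \<open>R k\<close>, it moves symmetric commutators over \<open>S\<close> only by symmetric commutators over
  \<open>insert k S\<close>.\<close>

lemma fc_retract:
  assumes \<rho>_add: "\<And>a b. \<rho> (a + b) = \<rho> a + \<rho> b"
    and \<rho>_R: "\<And>i r. i \<noteq> k \<Longrightarrow> r \<in> R i \<Longrightarrow> fc R {i, k} (- r + \<rho> r)"
    and "fc R S w" "k \<notin> S"
  shows "fc R (insert k S) (- w + \<rho> w)"
  using assms(3,4)
proof (induction rule: fc.induct)
  case (base r i) then show ?case using \<rho>_R[of i r] by (simp add: insert_commute)
next
  case (comm S c i r)
  have \<rho>_0: "\<rho> 0 = 0" by (rule additive_zero) (rule \<rho>_add)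
  have \<rho>_uminus: "\<rho> (- a) = - \<rho> a" for a using \<rho>_add[of "- a" a] \<rho>_0 by (simp add: eq_neg_iff_add_eq_0)
  define d where "d = - c + \<rho> c"
  define e where "e = - r + \<rho> r"
  define w where "w = c + r - c - r"
  have d: "fc R (insert k S) d" unfolding d_def using comm by simp
  have e: "fc R {i, k} e" unfolding e_def using \<rho>_R comm by auto
  then have q: "r + e \<in> R i" using fc_R comm by (intro R_add) auto
  have 1: "fc R (insert k (insert i S)) (d + (r + e) - d - (r + e))"
    using d q comm by (subst insert_commute, intro fc.comm) auto
  have 2: "fc R (insert k (insert i S)) (c + e - c - e)"
    using fc_comm_pair[of S c i k e] comm.hyps comm.prems e by (simp add: insert_commute eq_commute[of k i])
  have "\<rho> c = c + d" "\<rho> r = r + e" by (simp_all add: d_def e_def)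
  then have "\<rho> w = (c + d) + (r + e) - (c + d) - (r + e)"
    unfolding w_def by (simp add: \<rho>_add \<rho>_uminus diff_conv_add_uminus del: add_uminus_conv_diff)
  \<comment> \<open>The commutator of \<open>c + d\<close> and \<open>r + e\<close> is expanded
    around that of \<open>c\<close> and \<open>r\<close>. One error term involves \<open>d\<close>,
    which already carries the index \<open>k\<close>; the other involves \<open>e\<close>, which
    carries both \<open>i\<close> and \<open>k\<close>.\<close>
  then have "- w + \<rho> w = (- w + (c + (d + (r + e) - d - (r + e)) - c) - (- w)) + (r + (c + e - c - e) - r)"
    unfolding w_def by (simp add: grp del: add_uminus_conv_diff)
  then have "fc R (insert k (insert i S)) (- w + \<rho> w)" using 1 2 by (simp only: fc.add fc_conj')
  then show ?case unfolding w_def .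
next
  case (zero S)
  have "\<rho> 0 = 0" by (rule additive_zero) (rule \<rho>_add)
  then show ?case by (simp add: fc.zero)
next
  case (add S a b)
  have "- (a + b) + \<rho> (a + b) = (- b + (- a + \<rho> a) - (- b)) + (- b + \<rho> b)"
    by (simp add: \<rho>_add grp del: add_uminus_conv_diff)
  then show ?case using add.IH[OF add.prems] by (simp only: fc.add fc_conj')
next
  case (uminus S a)
  have \<rho>_0: "\<rho> 0 = 0" by (rule additive_zero) (rule \<rho>_add)
  have "\<rho> (- a) = - \<rho> a" using \<rho>_add[of "- a" a] \<rho>_0 by (simp add: eq_neg_iff_add_eq_0)
  then have "- (- a) + \<rho> (- a) = - (a + (- a + \<rho> a) - a)"
    by (simp add: grp del: add_uminus_conv_diff)
  then show ?case using uminus.IH[OF uminus.prems] by (simp only: fc.uminus fc_conj')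
qed

end

definition fdel :: "nat \<Rightarrow> fg \<Rightarrow> fg" where
  "fdel k = fhom (\<lambda>j. if j = k then 0 else fgen j)"

lemma fdel_simps [simp]:
  "fdel k 0 = 0" "fdel k (a + b) = fdel k a + fdel k b" "fdel k (- a) = - fdel k a" "fdel k (a - b) = fdel k a - fdel k b"
  "fdel k (fgen j) = (if j = k then 0 else fgen j)"
  by (simp_all add: fdel_def fhom_add fhom_uminus fhom_diff)

lemma fdel_fdel [simp]: "fdel k (fdel k a) = fdel k a"
  by (induction a rule: fg_induct) auto

abbreviation fker :: "nat \<Rightarrow> fg set" where
  "fker k \<equiv> {a. fdel k a = 0}"

interpretation fker: normal_family fker
  by unfold_locales auto

lemma fdel_nclosure: "a - fdel i a \<in> gen {g + fgen i - g | g. True}"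
proof -
  let ?G = "gen {g + fgen i - g | g. True}"
  have conj: "h + b - h \<in> ?G" if "b \<in> ?G" for b h
  proof (rule gen_conj_closed[OF _ that])
    fix x assume "x \<in> {g + fgen i - g | g. True}"
    then obtain g where "x = g + fgen i - g" by blast
    then show "h + x - h \<in> ?G" by (intro gen.incl) (auto simp: conj_conj)
  qed
  have x: "fgen i \<in> ?G" by (intro gen.incl) (auto intro: exI[of _ 0])
  show ?thesis
  proof (induction a rule: fg_induct)
    case (pos j a)
    show ?case
    proof (cases "j = i")
      case True
      with gen.add[OF x pos] show ?thesis by (simp add: add_diff_eq)
    next
      case False
      with conj[OF pos, of "fgen j"] show ?thesis by (simp add: grp del: add_uminus_conv_diff)
    qed
  next
    case (neg j a)
    show ?case
    proof (cases "j = i")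
      case True
      with gen.add[OF gen.uminus[OF x] neg] show ?thesis by (simp add: add_diff_eq)
    next
      case False
      with conj[OF neg, of "- fgen j"] show ?thesis by (simp add: grp del: add_uminus_conv_diff)
    qed
  qed (simp add: gen.zero)
qed

text \<open>\<open>r\<close> is a product of conjugates of \<open>fgen i\<close> and its inverse.
  Applying \<open>fdel k\<close> changes a conjugator by an element of \<open>fker k\<close>, which
  costs a commutator of that element with \<open>fgen i\<close>.\<close>

lemma fdel_retract:
  assumes "i \<noteq> k" "r \<in> fker i" shows "fc fker {i, k} (- r + fdel k r)"
proof -
  have "r \<in> gen {g + fgen i - g | g. True}" using fdel_nclosure[of r i] assms by simp
  then show ?thesis
  proof induction
    case zero then show ?case by (simp add: fc.zero)
  next
    case (incl x)
    then obtain g where x: "x = g + fgen i - g" by blast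
    define h where "h = - g + fdel k g"
    have h: "h \<in> fker k" by (simp add: h_def)
    have "fc fker {i} (- fgen i)" by (intro fc.base) simp
    then have "fc fker (insert k {i}) (- fgen i + h - (- fgen i) - h)" using assms h by (intro fc.comm) auto
    then have "fc fker {i, k} (g + (- fgen i + h - (- fgen i) - h) - g)"
      by (simp only: insert_commute fker.fc_conj')
    moreover have "fdel k x = g + h + fgen i - (g + h)"
      using assms by (simp add: x h_def)
    ultimately show ?case by (simp add: x grp del: add_uminus_conv_diff)
  next
    case (add a b)
    have "- (a + b) + fdel k (a + b) = (- b + (- a + fdel k a) - (- b)) + (- b + fdel k b)"
      by (simp add: grp del: add_uminus_conv_diff)
    then show ?case using add by (simp only: fc.add fker.fc_conj')
  next
    case (uminus a)
    have "- (- a) + fdel k (- a) = - (a + (- a + fdel k a) - a)"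
      by (simp add: grp del: add_uminus_conv_diff)
    then show ?case using uminus by (simp only: fc.uminus fker.fc_conj')
  qed
qed

text \<open>Indices are added one at a time: by \<open>fc_retract\<close> the element
  \<open>- w + fdel k w\<close> is a symmetric commutator over the larger set, and its second
  summand is 0.\<close>

theorem fdel_kernel_fc:
  assumes "finite S" "S \<noteq> {}" "\<And>i. i \<in> S \<Longrightarrow> fdel i w = 0"
  shows "fc fker S w"
  using assms
proof (induction rule: finite_ne_induct)
  case (singleton i) then show ?case by (intro fc.base) auto
next
  case (insert k S)
  have "fc fker S w" using insert by simp
  then have "fc fker (insert k S) (- w + fdel k w)"
    by (rule fker.fc_retract[where \<rho> = "fdel k", rotated 2])
      (use insert.hyps in \<open>simp_all only: fdel_simps fdel_retract not_False_eq_True\<close>)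
  moreover have "fdel k w = 0" using insert.prems by simp
  ultimately have "fc fker (insert k S) (- w)" by simp
  then have "fc fker (insert k S) (- (- w))" by (rule fc.uminus)
  then show ?case by simp
qed

section \<open>Freeness of the loops of the first strand, centers, and intersections of deletion
  kernels\<close>

section \<open>The kernel of deleting the first strand is free\<close>

text \<open>The permutations of a free group contain its left translations and its automorphisms.
  They thus provide a single type of class \<open>group_add\<close> in which the semidirect product
  with Artin's action can be evaluated.\<close>

typedef fsym = "{f :: fg \<Rightarrow> fg. bij f}"
  by (rule exI[of _ id]) simp

setup_lifting type_definition_fsym

instantiation fsym :: group_add
begin

lift_definition zero_fsym :: fsym is id by simp
lift_definition plus_fsym :: "fsym \<Rightarrow> fsym \<Rightarrow> fsym" is "(\<circ>)" by (rule bij_comp)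
lift_definition uminus_fsym :: "fsym \<Rightarrow> fsym" is "inv_into UNIV" by (rule bij_imp_bij_inv)

definition minus_fsym :: "fsym \<Rightarrow> fsym \<Rightarrow> fsym" where
  "minus_fsym a b = a + - b"

instance
proof
  fix a b c :: fsym
  show "a + b + c = a + (b + c)" by transfer (simp add: comp_assoc)
  show "0 + a = a" by transfer simp
  show "a + 0 = a" by transfer simp
  show "- a + a = 0" by transfer (simp add: bij_is_inj)
  show "a + - b = a - b" by (simp add: minus_fsym_def)
qed

end

text \<open>Artin's automorphism attached to one crossing, matching the formulas in
  \<open>y_conj\<close>.\<close>

definition artin :: "nat \<Rightarrow> fg \<Rightarrow> fg" where
  "artin m = fhom (\<lambda>j. if j = m then fgen (Suc m) else if j = Suc m then - fgen (Suc m) + fgen m + fgen (Suc m) else fgen j)"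

definition artin' :: "nat \<Rightarrow> fg \<Rightarrow> fg" where
  "artin' m = fhom (\<lambda>j. if j = Suc m then fgen m else if j = m then fgen m + fgen (Suc m) - fgen m else fgen j)"

lemma artin_simps [simp]:
  "artin m 0 = 0" "artin m (a + b) = artin m a + artin m b" "artin m (- a) = - artin m a" "artin m (a - b) = artin m a - artin m b"
  "artin m (fgen j) = (if j = m then fgen (Suc m) else if j = Suc m then - fgen (Suc m) + fgen m + fgen (Suc m) else fgen j)"
  by (simp_all add: artin_def fhom_add fhom_uminus fhom_diff)

lemma artin'_simps [simp]:
  "artin' m 0 = 0" "artin' m (a + b) = artin' m a + artin' m b" "artin' m (- a) = - artin' m a" "artin' m (a - b) = artin' m a - artin' m b"
  "artin' m (fgen j) = (if j = Suc m then fgen m else if j = m then fgen m + fgen (Suc m) - fgen m else fgen j)"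
  by (simp_all add: artin'_def fhom_add fhom_uminus fhom_diff)

lemma fg_hom_eqI:
  assumes "\<And>a b. f (a + b) = f a + (f b :: 'a::group_add)" "\<And>a b. g (a + b) = g a + g b" "\<And>i. f (fgen i) = g (fgen i)"
  shows "f a = g a"
  using fhom_unique[of f "\<lambda>i. f (fgen i)" a] fhom_unique[of g "\<lambda>i. f (fgen i)" a] assms by simp

lemma artin_artin' [simp]: "artin m (artin' m a) = a" "artin' m (artin m a) = a"
proof -
  show "artin m (artin' m a) = a"
    by (rule fg_hom_eqI[where f = "\<lambda>a. artin m (artin' m a)"]) (auto simp: grp simp del: add_uminus_conv_diff)
  show "artin' m (artin m a) = a"
    by (rule fg_hom_eqI[where f = "\<lambda>a. artin' m (artin m a)"]) (auto simp: grp simp del: add_uminus_conv_diff)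
qed

definition As :: "nat \<Rightarrow> fsym" where
  "As m = Abs_fsym (artin m)"

definition Lm :: "fg \<Rightarrow> fsym" where
  "Lm a = Abs_fsym (\<lambda>x. a + x)"

lemma Rep_As: "Rep_fsym (As m) = artin m"
  unfolding As_def by (rule Abs_fsym_inverse, rule CollectI, rule o_bij[of "artin' m"]) (auto simp: fun_eq_iff)

lemma Rep_Lm: "Rep_fsym (Lm a) = (\<lambda>x. a + x)"
  unfolding Lm_def by (rule Abs_fsym_inverse, rule CollectI, rule o_bij[of "\<lambda>x. - a + x"]) (auto simp: fun_eq_iff)

lemma fsym_eqI: "(\<And>x. Rep_fsym f x = Rep_fsym g x) \<Longrightarrow> f = g"
  by (metis Rep_fsym_inject ext)

lemma Lm_add: "Lm (a + b) = Lm a + Lm b"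
  by (rule fsym_eqI) (simp add: plus_fsym.rep_eq Rep_Lm add.assoc)

lemma Lm_inj: "Lm a = Lm b \<longleftrightarrow> a = b"
  by (metis Rep_Lm add.right_neutral)

lemma Lm_zero: "Lm 0 = 0"
  by (rule fsym_eqI) (simp add: zero_fsym.rep_eq Rep_Lm)

lemma As_Lm: "As m + Lm a = Lm (artin m a) + As m"
  by (rule fsym_eqI) (simp add: plus_fsym.rep_eq Rep_Lm Rep_As)

lemma commute_As_Lm: "artin m a = a \<Longrightarrow> commute (As m) (Lm a)"
  by (simp add: commute_def As_Lm)

interpretation fr: braid_data n As "\<lambda>m. Lm (fgen m)" for n
proof
  show "commute (As i) (As j)" if "1 \<le> i" "i + 2 \<le> j" for i j
    unfolding commute_def
  proof (rule fsym_eqI)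
    have "artin i (artin j x) = artin j (artin i x)" for x
      by (rule fg_hom_eqI[where f = "\<lambda>x. artin i (artin j x)" and g = "\<lambda>x. artin j (artin i x)"]) (use that in auto)
    then show "Rep_fsym (As i + As j) x = Rep_fsym (As j + As i) x" for x
      by (simp add: plus_fsym.rep_eq Rep_As)
  qed
  show "As i + As (i + 1) + As i = As (i + 1) + As i + As (i + 1)" for i
  proof (rule fsym_eqI)
    have "artin i (artin (Suc i) (artin i x)) = artin (Suc i) (artin i (artin (Suc i) x))" for x
      by (rule fg_hom_eqI[where f = "\<lambda>x. artin i (artin (Suc i) (artin i x))" and g = "\<lambda>x. artin (Suc i) (artin i (artin (Suc i) x))"])
        (auto simp: grp simp del: add_uminus_conv_diff)
    then show "Rep_fsym (As i + As (i + 1) + As i) x = Rep_fsym (As (i + 1) + As i + As (i + 1)) x" for x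
      by (simp add: plus_fsym.rep_eq Rep_As)
  qed
  show "Lm (fgen (m + 1)) = As m + Lm (fgen m) - As m" for m
    by (simp add: As_Lm eq_diff_eq)
  show "commute (As i) (Lm (fgen 1))" if "2 \<le> i" for i
    using that by (intro commute_As_Lm) auto
  show "commute (As 1) (Lm (fgen 1) + Lm (fgen 2))"
    unfolding Lm_add[symmetric] by (intro commute_As_Lm) (auto simp: grp simp del: add_uminus_conv_diff)
qed

text \<open>\<open>fg\<close> has infinitely many generators; those outside the range from 1 to
  \<open>n - 1\<close> go to 0. \<open>trunc n\<close> is the matching retraction, and
  \<open>kap n\<close> is injective on its image.\<close>

definition kap :: "nat \<Rightarrow> fg \<Rightarrow> braid" where
  "kap n = fhom (\<lambda>m. if 1 \<le> m \<and> m < n then pgen 1 (Suc m) else 0)"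

definition trunc :: "nat \<Rightarrow> fg \<Rightarrow> fg" where
  "trunc n = fhom (\<lambda>m. if 1 \<le> m \<and> m < n then fgen m else 0)"

lemma kap_simps [simp]:
  "kap n 0 = 0" "kap n (a + b) = kap n a + kap n b" "kap n (- a) = - kap n a" "kap n (a - b) = kap n a - kap n b"
  "kap n (fgen m) = (if 1 \<le> m \<and> m < n then pgen 1 (Suc m) else 0)"
  by (simp_all add: kap_def fhom_add fhom_uminus fhom_diff)

lemma trunc_simps [simp]:
  "trunc n 0 = 0" "trunc n (a + b) = trunc n a + trunc n b" "trunc n (- a) = - trunc n a" "trunc n (a - b) = trunc n a - trunc n b"
  "trunc n (fgen m) = (if 1 \<le> m \<and> m < n then fgen m else 0)"
  by (simp_all add: trunc_def fhom_add fhom_uminus fhom_diff)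

lemma kap_trunc: "kap n (trunc n a) = kap n a"
  by (rule fg_hom_eqI[where f = "\<lambda>a. kap n (trunc n a)"]) auto

lemma trunc_trunc: "trunc n (trunc n a) = trunc n a"
  by (rule fg_hom_eqI[where f = "\<lambda>a. trunc n (trunc n a)"]) auto

lemma fdel_trunc: "fdel k (trunc n a) = trunc n (fdel k a)"
  by (rule fg_hom_eqI[where f = "\<lambda>a. fdel k (trunc n a)"]) auto

lemma kap_pures: "kap n a \<in> pures n"
  by (induction a rule: fg_induct) (auto intro!: pures_add pures_uminus pgen_pures)

text \<open>The crossed evaluation in \<open>fr\<close> sends the loop \<open>pgen 1 (Suc m)\<close>
  to translation by \<open>fgen m\<close>. Distinct reduced words in the loops are thereby told
  apart, which is the freeness of the kernel.\<close>

lemma Phi_kap: "1 \<le> n \<Longrightarrow> fr.Phi n 1 (kap n a) = Lm (trunc n a)"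
proof (rule fg_hom_eqI[where f = "\<lambda>a. fr.Phi n 1 (kap n a)"])
  assume n: "1 \<le> n"
  show "fr.Phi n 1 (kap n (a + b)) = fr.Phi n 1 (kap n a) + fr.Phi n 1 (kap n b)" for a b
    using n by (simp add: fr.Phi_1_pure_add kap_pures pures_braids)
  show "fr.Phi n 1 (kap n (fgen i)) = Lm (trunc n (fgen i))" for i
    using n by (auto simp: fr.Phi_1_pgen fr.Phi_zero Lm_zero)
qed (simp add: Lm_add)

lemma kap_eq_iff: "1 \<le> n \<Longrightarrow> kap n a = kap n b \<longleftrightarrow> trunc n a = trunc n b"
  by (metis Phi_kap Lm_inj kap_trunc)

lemma range_kap: "range (kap n) = gen (pgen 1 ` {2..n})"
proof
  show "range (kap n) \<subseteq> gen (pgen 1 ` {2..n})"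
  proof
    fix x assume "x \<in> range (kap n)"
    then obtain a where "x = kap n a" by blast
    moreover have "kap n a \<in> gen (pgen 1 ` {2..n})"
    proof (induction a rule: fg_induct)
      case (pos i a)
      have "1 \<le> i \<Longrightarrow> i < n \<Longrightarrow> pgen 1 (Suc i) \<in> gen (pgen 1 ` {2..n})" by (intro gen.incl) auto
      with pos show ?case by (auto intro: gen.add)
    next
      case (neg i a)
      have "1 \<le> i \<Longrightarrow> i < n \<Longrightarrow> pgen 1 (Suc i) \<in> gen (pgen 1 ` {2..n})" by (intro gen.incl) auto
      with neg show ?case by (auto intro: gen.add gen.uminus)
    qed (simp add: gen.zero)
    ultimately show "x \<in> gen (pgen 1 ` {2..n})" by simp
  qed
  show "gen (pgen 1 ` {2..n}) \<subseteq> range (kap n)"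
  proof
    fix x assume "x \<in> gen (pgen 1 ` {2..n})"
    then show "x \<in> range (kap n)"
    proof induction
      case zero then show ?case by (intro image_eqI[of _ _ 0]) auto
    next
      case (incl x)
      then obtain j where "x = pgen 1 j" "2 \<le> j" "j \<le> n" by auto
      then show ?case by (intro image_eqI[of _ _ "fgen (j - 1)"]) auto
    next
      case (add x y)
      then obtain a b where "x = kap n a" "y = kap n b" by blast
      then show ?case by (intro image_eqI[of _ _ "a + b"]) auto
    next
      case (uminus x)
      then obtain a where "x = kap n a" by blast
      then show ?case by (intro image_eqI[of _ _ "- a"]) auto
    qed
  qed
qed

text \<open>\<open>K n k\<close> is the kernel of deleting strand \<open>k\<close>, where strand \<open>0\<close> is the one at infinity.\<close>

definition dd :: "nat \<Rightarrow> nat \<Rightarrow> braid \<Rightarrow> braid" where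
  "dd n k = (if k = 0 then bd n else del k)"

definition K :: "nat \<Rightarrow> nat \<Rightarrow> braid set" where
  "K n k = {a \<in> pures n. dd n k a = 0}"

lemma K_1: "1 \<le> n \<Longrightarrow> K n 1 = range (kap n)"
proof
  assume n: "1 \<le> n"
  show "range (kap n) \<subseteq> K n 1"
  proof
    fix x assume "x \<in> range (kap n)"
    then obtain a where "x = kap n a" by blast
    moreover have "del 1 (kap n a) = 0"
      by (induction a rule: fg_induct) 
        (auto simp: del_pgen del_pure_add[OF pgen_pures[of 1 _ n]] del_pure_add[OF pures_uminus[OF pgen_pures[of 1 _ n]]] del_pure_uminus[OF pgen_pures[of 1 _ n]])
    ultimately show "x \<in> K n 1" by (simp add: K_def dd_def kap_pures)
  qed
  show "K n 1 \<subseteq> range (kap n)"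
  proof
    fix x assume "x \<in> K n 1"
    then have "x \<in> pures n" "del 1 x = 0" by (auto simp: K_def dd_def)
    with pure_decomp(1)[OF this(1) n] show "x \<in> range (kap n)" by (simp add: range_kap)
  qed
qed

lemma del_kap:
  assumes "2 \<le> k" "k \<le> n"
  shows "del k (kap n a) = 0 \<longleftrightarrow> fdel (k - 1) (trunc n a) = 0"
proof -
  \<comment> \<open>\<open>h\<close> drops the generator \<open>k - 1\<close> and closes the gap,
    \<open>h'\<close> reopens it; so \<open>h\<close> and \<open>fdel (k - 1)\<close> have the same
    kernel.\<close>
  define h where "h = fhom (\<lambda>j. if j = k - 1 then 0 else fgen (if j < k - 1 then j else j - 1))"
  define h' where "h' = fhom (\<lambda>j. fgen (if j < k - 1 then j else j + 1))"
  have h_simps: "h (a + b) = h a + h b" "h 0 = 0" "h (fgen j) = (if j = k - 1 then 0 else fgen (if j < k - 1 then j else j - 1))" for a b j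
    by (simp_all add: h_def fhom_add)
  have h'_simps: "h' (a + b) = h' a + h' b" "h' 0 = 0" "h' (fgen j) = fgen (if j < k - 1 then j else j + 1)" for a b j
    by (simp_all add: h'_def fhom_add)
  have eq: "del k (kap n a) = kap (n - 1) (h (trunc n a))"
  proof (rule fg_hom_eqI[where f = "\<lambda>a. del k (kap n a)"])
    show "del k (kap n (a + b)) = del k (kap n a) + del k (kap n b)" for a b
      using del_pure_add[OF kap_pures] assms by simp
    show "kap (n - 1) (h (trunc n (a + b))) = kap (n - 1) (h (trunc n a)) + kap (n - 1) (h (trunc n b))" for a b
      by (simp add: h_simps)
    show "del k (kap n (fgen i)) = kap (n - 1) (h (trunc n (fgen i)))" for i
      using assms by (auto simp: h_simps del_pgen shift_index_def)
  qed
  have "del k (kap n a) = 0 \<longleftrightarrow> trunc (n - 1) (h (trunc n a)) = 0"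
    using kap_eq_iff[of "n - 1" "h (trunc n a)" 0] assms by (simp add: eq)
  also have "trunc (n - 1) (h (trunc n a)) = h (trunc n a)"
    by (rule fg_hom_eqI[where f = "\<lambda>a. trunc (n - 1) (h (trunc n a))"]) (use assms in \<open>auto simp: h_simps\<close>)
  also have "h (trunc n a) = 0 \<longleftrightarrow> fdel (k - 1) (trunc n a) = 0"
  proof -
    have 1: "h' (h x) = fdel (k - 1) x" for x
      by (rule fg_hom_eqI[where f = "\<lambda>x. h' (h x)"]) (use assms in \<open>auto simp: h_simps h'_simps\<close>)
    have 2: "h (fdel (k - 1) x) = h x" for x
      by (rule fg_hom_eqI[where f = "\<lambda>x. h (fdel (k - 1) x)"]) (use assms in \<open>auto simp: h_simps\<close>)
    show ?thesis using 1[of "trunc n a"] 2[of "trunc n a"] h_simps(2) h'_simps(2) by metis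
  qed
  finally show ?thesis .
qed

lemma lnk_kap: "1 \<le> m \<Longrightarrow> m < n \<Longrightarrow> lnk 1 (Suc m) (kap n a) = esum m a"
proof (rule fg_hom_eqI[where f = "\<lambda>a. lnk 1 (Suc m) (kap n a)"])
  show "lnk 1 (Suc m) (kap n (a + b)) = lnk 1 (Suc m) (kap n a) + lnk 1 (Suc m) (kap n b)" for a b
    using lnk_pure_add[OF kap_pures] by simp
  show "1 \<le> m \<Longrightarrow> m < n \<Longrightarrow> lnk 1 (Suc m) (kap n (fgen i)) = esum m (fgen i)" for i
    by (auto simp: lnk_pgen)
qed simp

subsection \<open>Integer multiples\<close>

primrec nmul :: "nat \<Rightarrow> 'a::group_add \<Rightarrow> 'a" where
  "nmul 0 x = 0"
| "nmul (Suc n) x = nmul n x + x"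

definition imul :: "int \<Rightarrow> 'a::group_add \<Rightarrow> 'a" where
  "imul r x = (if 0 \<le> r then nmul (nat r) x else - nmul (nat (- r)) x)"

lemma commute_nmul: "commute a x \<Longrightarrow> commute a (nmul n x)"
  by (induction n) (auto intro: commute_add)

lemma commute_imul: "commute a x \<Longrightarrow> commute a (imul r x)"
  by (simp add: imul_def commute_nmul commute_uminus)

lemma nmul_Suc': "nmul (Suc n) x = x + nmul n x"
  using commute_nmul[of x x n] by (simp add: commute_def)

lemma imul_0 [simp]: "imul 0 x = 0" and imul_1 [simp]: "imul 1 x = x"
  by (auto simp: imul_def)

lemma imul_zero [simp]: "imul r 0 = (0 :: 'a::group_add)"
proof -
  have "nmul n (0 :: 'a) = 0" for n by (induction n) auto
  then show ?thesis by (simp add: imul_def)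
qed

lemma imul_succ: "imul (r + 1) x = imul r x + x"
proof -
  consider "0 \<le> r" | "r = -1" | "r < -1" by linarith
  then show ?thesis
  proof cases
    case 3
    then have "nat (- r) = Suc (nat (- (r + 1)))" by simp
    with 3 show ?thesis by (simp add: imul_def nmul_Suc' minus_add add.assoc del: nmul.simps add_uminus_conv_diff)
  qed (auto simp: imul_def nat_add_distrib)
qed

lemma imul_pred: "imul (r - 1) x = imul r x - x"
  using imul_succ[of "r - 1" x] by (simp add: eq_diff_eq)

lemma imul_add: "imul (r + s) x = imul r x + imul s x"
proof (induction s rule: int_induct[where k = 0])
  case (step1 i)
  then show ?case using imul_succ[of "r + i" x] imul_succ[of i x] by (simp add: add.assoc)
next
  case (step2 i)
  then show ?case using imul_pred[of "r + i" x] imul_pred[of i x] by (simp add: add_diff_eq)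
qed simp

lemma imul_uminus: "imul (- r) x = - imul r x"
  using imul_add[of "- r" r x] by (simp add: eq_neg_iff_add_eq_0)

lemma imul_diff: "imul (r - s) x = imul r x - imul s x"
  using imul_add[of r "- s" x] by (simp add: imul_uminus)

lemma imul_int: "imul r (x::int) = r * x"
  by (induction r rule: int_induct[where k = 0]) (auto simp: imul_succ imul_pred algebra_simps)

lemma imul_pures: "x \<in> pures n \<Longrightarrow> imul r x \<in> pures n"
  by (induction r rule: int_induct[where k = 0]) (auto simp: imul_succ imul_pred pures_add pures_diff)

lemma imul_imul: "imul r (imul s x) = imul (r * s) x"
  by (induction r rule: int_induct[where k = 0])
    (auto simp: imul_succ imul_pred imul_add imul_diff imul_uminus distrib_right left_diff_distrib)

lemma additive_diff:
  assumes "additive_on (pures n) f" "a \<in> pures n" "b \<in> pures n" shows "f (a - b) = f a - f b"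
proof -
  have "f (a + - b) = f a + f (- b)" using assms pures_uminus unfolding additive_on_def by blast
  then show ?thesis using additive_on_pures_uminus(2)[OF assms(1,3)] by simp
qed

lemma additive_imul:
  assumes "additive_on (pures n) f" "x \<in> pures n" shows "f (imul r x) = imul r (f x)"
proof (induction r rule: int_induct[where k = 0])
  case base
  then show ?case using additive_on_pures_uminus(1)[OF assms(1)] by simp
next
  case (step1 i)
  then show ?case using assms imul_pures[OF assms(2)] by (simp add: imul_succ additive_on_def)
next
  case (step2 i)
  then show ?case using assms imul_pures[OF assms(2)] by (simp add: imul_pred additive_diff)
qed

lemma gen_singleton: "gen {x} = range (\<lambda>r. imul r x)"
proof
  show "gen {x} \<subseteq> range (\<lambda>r. imul r x)"
  proof
    fix a assume "a \<in> gen {x}"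
    then show "a \<in> range (\<lambda>r. imul r x)"
    proof induction
      case zero show ?case by (rule image_eqI[of _ _ 0]) auto
    next
      case (incl y) then show ?case by (intro image_eqI[of _ _ 1]) auto
    next
      case (add a b)
      then obtain r s where "a = imul r x" "b = imul s x" by auto
      then show ?case by (intro image_eqI[of _ _ "r + s"]) (auto simp: imul_add)
    next
      case (uminus a)
      then obtain r where "a = imul r x" by auto
      then show ?case by (intro image_eqI[of _ _ "- r"]) (auto simp: imul_uminus)
    qed
  qed
  have "imul r x \<in> gen {x}" for r
    by (induction r rule: int_induct[where k = 0])
      (auto simp: imul_succ imul_pred intro: gen.zero gen.add gen_diff gen.incl)
  then show "range (\<lambda>r. imul r x) \<subseteq> gen {x}" by auto
qed

subsection \<open>The full twist\<close>

lemma lsum_tsum: "1 \<le> j \<Longrightarrow> lsum j = tsum j j"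
  by (simp add: tsum_eq)

lemma lnk_sum_list: "set xs \<subseteq> pures n \<Longrightarrow> lnk p q (sum_list xs) = sum_list (map (lnk p q) xs)"
  by (induction xs) (auto simp: lnk_pure_add)

lemma lnk_lsum: "1 \<le> p \<Longrightarrow> p < q \<Longrightarrow> lnk p q (lsum j) = (if q = j then 1 else 0)"
proof (cases "1 \<le> j")
  case True
  assume pq: "1 \<le> p" "p < q"
  have "lnk p q (sum_list (map (\<lambda>i. pgen i j) [1..<j])) = sum_list (map (\<lambda>i. lnk p q (pgen i j)) [1..<j])"
    by (subst lnk_sum_list[of _ j]) (auto simp: comp_def intro!: pgen_pures)
  also have "\<dots> = (\<Sum>i\<in>{1..<j}. lnk p q (pgen i j))"
    by (simp add: sum_list_distinct_conv_sum_set)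
  also have "\<dots> = (\<Sum>i\<in>{1..<j}. if i = p \<and> q = j then 1 else 0)"
    using pq by (intro sum.cong) (auto simp: lnk_pgen)
  also have "\<dots> = (if q = j then 1 else 0)" using pq by (auto simp: if_distrib sum.delta)
  finally show ?thesis using pgen_lsum[OF True] by simp
qed (cases j; simp)

lemma lnk_zn: "1 \<le> p \<Longrightarrow> p < q \<Longrightarrow> q \<le> n \<Longrightarrow> lnk p q (zn n) = 1"
proof -
  have *: "1 \<le> p \<Longrightarrow> p < q \<Longrightarrow> lnk p q (zn n) = (if q \<le> n then 1 else 0)" for n
    by (induction n) (auto simp: lnk_pure_add[OF zn_pures[OF order_refl]] lnk_lsum simp del: lsum.simps)
  then show "1 \<le> p \<Longrightarrow> p < q \<Longrightarrow> q \<le> n \<Longrightarrow> lnk p q (zn n) = 1" by simp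
qed

lemma del_lsum:
  assumes "1 \<le> k" "1 \<le> j"
  shows "del k (lsum j) = (if k = j then 0 else lsum (shift_index k j))"
proof (cases "k \<le> j")
  case True
  then show ?thesis using assms del_tsum[of j j k]
    by (auto simp: lsum_tsum shift_index_def)
next
  case False
  then show ?thesis using assms del_last[OF pures_braids[OF lsum_pures[of j j]], of k]
    by (simp add: shift_index_def)
qed

lemma del_zn: "1 \<le> k \<Longrightarrow> k \<le> n \<Longrightarrow> del k (zn n) = zn (n - 1)"
proof (induction n)
  case (Suc n)
  have e: "del k (zn (Suc n)) = del k (zn n) + del k (lsum (Suc n))"
    using Suc.prems by (simp add: del_pure_add[OF zn_pures[OF order_refl]] del: lsum.simps)
  show ?case
  proof (cases "k \<le> n")
    case True
    then have "zn (n - 1) + lsum n = zn n" using Suc.prems zn.simps(2)[of "n - 1"] by (simp del: zn.simps)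
    with True show ?thesis using Suc e by (simp add: del_lsum shift_index_def del: lsum.simps zn.simps)
  next
    case False
    then have "k = Suc n" using Suc.prems by simp
    then show ?thesis using e del_last[OF pures_braids[OF zn_pures[of n n]], of k]
      by (simp add: del_lsum del: lsum.simps zn.simps)
  qed
qed simp

lemma zn_central: "a \<in> pures n \<Longrightarrow> commute a (zn n)"
  by (simp add: zn_commute pures_braids)

lemma zn_2: "zn 2 = pgen 1 2"
  using zn.simps(2)[of 1] lsum.simps(2)[of 1] zn_1 lsum_1 by (simp del: zn.simps lsum.simps)

lemma pures_1: "pures 1 = {0}"
proof -
  have "gen {} = {0 :: braid}"
  proof -
    have "x = 0" if "x \<in> gen {}" for x :: braid using that by induction auto
    then show ?thesis using gen.zero by auto
  qed
  moreover have "pgens 1 = {}" by (auto simp: pgens_def)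
  ultimately show ?thesis by (simp add: pures_eq_gen)
qed

lemma pures_2: "a \<in> pures 2 \<Longrightarrow> a = imul (lnk 1 2 a) (zn 2)"
proof -
  assume a: "a \<in> pures 2"
  have "pgens 2 = {pgen 1 2}"
  proof
    show "pgens 2 \<subseteq> {pgen 1 2}"
    proof
      fix x assume "x \<in> pgens 2"
      then obtain i j :: nat where "x = pgen i j" "1 \<le> i" "i < j" "j \<le> 2" unfolding pgens_def by blast
      moreover from this have "i = 1" "j = 2" by auto
      ultimately show "x \<in> {pgen 1 2}" by simp
    qed
    show "{pgen 1 2} \<subseteq> pgens 2" unfolding pgens_def by force
  qed
  then have "a \<in> gen {pgen 1 2}" using a pures_eq_gen by metis
  then obtain r where r: "a = imul r (zn 2)" by (auto simp: gen_singleton zn_2)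
  then have "lnk 1 2 a = r"
    using additive_imul[OF additive_lnk zn_pures[OF order_refl], of 1 2 r 2] by (simp add: lnk_zn imul_int)
  with r show ?thesis by simp
qed

subsection \<open>Finitely generated normal subgroups of the pure braid group\<close>

lemma dd_additive: "1 \<le> n \<Longrightarrow> additive_on (pures n) (dd n k)"
  using additive_bd additive_del by (cases "k = 0") (auto simp: dd_def)

lemma dd_pures: "a \<in> pures n \<Longrightarrow> 1 \<le> n \<Longrightarrow> k \<le> n \<Longrightarrow> dd n k a \<in> pures (n - 1)"
  by (auto simp: dd_def bd_pures del_pures)

lemma additive_gen_image:
  assumes "additive_on (pures n) f" "S \<subseteq> pures n"
  shows "f ` gen S = gen (f ` S)"
proof
  show "f ` gen S \<subseteq> gen (f ` S)"
  proof clarify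
    fix x assume "x \<in> gen S"
    then have "x \<in> pures n \<and> f x \<in> gen (f ` S)"
    proof induction
      case zero then show ?case using additive_on_pures_uminus(1)[OF assms(1)] by (simp add: gen.zero)
    next
      case (incl x) then show ?case using assms by (auto intro: gen.incl)
    next
      case (add x y) then show ?case using assms(1) by (auto simp: pures_add additive_on_def intro: gen.add)
    next
      case (uminus x) then show ?case
        by (auto simp: pures_uminus additive_on_pures_uminus(2)[OF assms(1)] intro: gen.uminus)
    qed
    then show "f x \<in> gen (f ` S)" ..
  qed
  show "gen (f ` S) \<subseteq> f ` gen S"
  proof
    fix y assume "y \<in> gen (f ` S)"
    then show "y \<in> f ` gen S"
    proof induction
      case zero then show ?case using additive_on_pures_uminus(1)[OF assms(1)] gen.zero by (intro image_eqI[of _ _ 0]) auto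
    next
      case (incl y) then show ?case by (auto intro: gen.incl)
    next
      case (add u v)
      then obtain x y where xy: "u = f x" "v = f y" "x \<in> gen S" "y \<in> gen S" by blast
      then have "f (x + y) = f x + f y" using assms gen_pures unfolding additive_on_def by blast
      with xy show ?case by (intro image_eqI[of _ _ "x + y"]) (auto intro: gen.add)
    next
      case (uminus u)
      then obtain x where x: "u = f x" "x \<in> gen S" by blast
      then have "f (- x) = - f x" using assms gen_pures additive_on_pures_uminus(2) by blast
      with x show ?case by (intro image_eqI[of _ _ "- x"]) (auto intro: gen.uminus)
    qed
  qed
qed

text \<open>Induction by deleting the first strand: the image satisfies the same hypotheses, so the
  subgroup lies in the free kernel of \<open>del 1\<close>. There linking numbers with the first
  strand are exponent sums, and \<open>fg_normal_trivial\<close> applies once the rank is at least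
  two.\<close>

theorem fg_normal_pures_trivial:
  assumes "finite S" "S \<subseteq> pures n"
    "\<And>a g. a \<in> gen S \<Longrightarrow> g \<in> pures n \<Longrightarrow> g + a - g \<in> gen S"
    "\<And>a p q. a \<in> gen S \<Longrightarrow> 1 \<le> p \<Longrightarrow> p < q \<Longrightarrow> q \<le> n \<Longrightarrow> lnk p q a = 0"
    "a \<in> gen S"
  shows "a = 0"
  using assms
proof (induction n arbitrary: S a)
  case 0
  have "pures 0 = {0}" by (auto simp: pures_def braids_def braid_words_def)
  then show ?case using 0 gen_pures by blast
next
  case (Suc n)
  have im: "del 1 ` gen S = gen (del 1 ` S)"
    using Suc.prems by (intro additive_gen_image[of "Suc n"] additive_del) auto
  have del0: "del 1 a = 0" if "a \<in> gen S" for a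
  proof (rule Suc.IH)
    show "finite (del 1 ` S)" using Suc.prems by simp
    show "del 1 ` S \<subseteq> pures n" using Suc.prems del_pures[of _ "Suc n" 1] by auto
    show "del 1 a \<in> gen (del 1 ` S)" using that im by blast
  next
    fix b g assume b: "b \<in> gen (del 1 ` S)" and g: "g \<in> pures n"
    then obtain a where a: "a \<in> gen S" "b = del 1 a" using im by blast
    then have "a \<in> pures (Suc n)" using gen_pures Suc.prems by blast
    then have "g + b - g = del 1 (shift g + a - shift g)"
      using shift_pures[OF g] a
      using del_conj[OF \<open>a \<in> pures (Suc n)\<close>, of 1 "shift g"] pos_pure[OF shift_pures[OF g]]
      by (simp add: del_1_shift)
    moreover have "shift g + a - shift g \<in> gen S" using a shift_pures[OF g] Suc.prems by blast
    ultimately show "g + b - g \<in> gen (del 1 ` S)" using im by blast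
  next
    fix b p q assume b: "b \<in> gen (del 1 ` S)" and pq: "1 \<le> p" "p < q" "q \<le> n"
    then obtain a where a: "a \<in> gen S" "b = del 1 a" using im by blast
    then have "a \<in> pures (Suc n)" using gen_pures Suc.prems by blast
    from lnk_del[OF this, of 1 "Suc p" "Suc q"] pq a
    show "lnk p q b = 0" using Suc.prems(4)[OF a(1), of "Suc p" "Suc q"] by (simp add: shift_index_def)
  qed
  consider "n = 0" | "n = 1" | "2 \<le> n" by linarith
  then show ?case
  proof cases
    case 1
    then show ?thesis using pures_1 gen_pures Suc.prems by (metis One_nat_def singletonD)
  next
    case 2
    then have "a \<in> pures 2" using Suc.prems gen_pures by (metis Suc_1)
    from pures_2[OF this] show ?thesis using Suc.prems(4)[OF Suc.prems(5), of 1 2] 2 by simp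
  next
    case 3
    let ?n = "Suc n"
    have "\<exists>w. trunc ?n w = w \<and> kap ?n w = a" if "a \<in> gen S" for a
    proof -
      have "a \<in> K ?n 1" using that del0 gen_pures Suc.prems by (auto simp: K_def dd_def)
      then obtain w where "a = kap ?n w" using K_1[of ?n] by auto
      then show ?thesis using kap_trunc trunc_trunc by metis
    qed
    \<comment> \<open>\<open>w\<close> assigns free coordinates, made unique by
      \<open>trunc\<close>; \<open>up\<close> and \<open>down\<close> identify \<open>gen S\<close>
      with the subgroup generated by the coordinates of \<open>S\<close>.\<close>
    then obtain w where w: "\<And>a. a \<in> gen S \<Longrightarrow> trunc ?n (w a) = w a \<and> kap ?n (w a) = a" by metis
    have tr: "trunc ?n x = x" if "x \<in> gen (w ` S)" for x
      using that by induction (auto simp: w gen.incl)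
    have up: "x \<in> gen (w ` S) \<Longrightarrow> kap ?n x \<in> gen S" for x
      by (induction x rule: gen.induct) (auto simp: w gen.incl intro: gen.zero gen.add gen.uminus)
    have down: "w a \<in> gen (w ` S)" if "a \<in> gen S" for a
      using that
    proof induction
      case zero
      have "w 0 = 0" using w[OF gen.zero] kap_eq_iff[of ?n "w 0" 0] by simp
      then show ?case by (simp add: gen.zero)
    next
      case (add x y)
      have "w (x + y) = w x + w y"
        using w[OF gen.add[OF add.hyps]] w[OF add.hyps(1)] w[OF add.hyps(2)]
          kap_eq_iff[of ?n "w (x + y)" "w x + w y"] by simp
      with add show ?case by (simp add: gen.add)
    next
      case (uminus x)
      have "w (- x) = - w x"
        using w[OF gen.uminus[OF uminus.hyps]] w[OF uminus.hyps] kap_eq_iff[of ?n "w (- x)" "- w x"] by simp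
      with uminus show ?case by (simp add: gen.uminus)
    qed (auto intro: gen.incl)
    have "w a = 0"
    proof (rule fg_normal_trivial[where S = "w ` S" and J = "{1..n}"])
      show "finite (w ` S)" using Suc.prems by simp
      show "w a \<in> gen (w ` S)" using down Suc.prems by blast
      show "esum j x = 0" if "x \<in> gen (w ` S)" "j \<in> {1..n}" for x j
        using lnk_kap[of j ?n x] Suc.prems(4)[OF up[OF that(1)], of 1 "Suc j"] that by simp
      show "fgen j + x - fgen j \<in> gen (w ` S)" if x: "x \<in> gen (w ` S)" and j: "j \<in> {1..n}" for x j
      proof -
        let ?y = "fgen j + x - fgen j"
        have "kap ?n ?y \<in> gen S"
          using j up[OF x] Suc.prems(3)[of "kap ?n x" "pgen 1 (Suc j)"] by (simp add: pgen_pures)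
        from down[OF this] w[OF this] show ?thesis
          using kap_eq_iff[of ?n "w (kap ?n ?y)" ?y] tr[OF x] j by simp
      qed
      show "1 \<in> {1..n}" "2 \<in> {1..n}" "(1::nat) \<noteq> 2" using 3 by auto
    qed
    then show ?thesis using w[OF Suc.prems(5)] by simp
  qed
qed

text \<open>By induction a central braid becomes a multiple of the full twist after deleting the
  first strand. The difference \<open>b\<close> lies in the free kernel and its coordinates
  \<open>w\<close> commute with all generators there, so the cyclic subgroup of \<open>w\<close> is
  normal and \<open>fg_normal_trivial\<close> removes it.\<close>

theorem central_zn:
  assumes "2 \<le> n" "a \<in> pures n" "\<And>g. g \<in> pures n \<Longrightarrow> commute a g"
  obtains r where "a = imul r (zn n)"
proof -
  have "\<exists>r. a = imul r (zn n)"
    using assms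
  proof (induction n arbitrary: a rule: nat_induct_at_least)
    case base then show ?case using pures_2 by blast
  next
    case (Suc n)
    let ?n = "Suc n"
    have da: "del 1 a \<in> pures n" using del_pures[OF Suc.prems(1), of 1] by simp
    have "commute (del 1 a) g" if "g \<in> pures n" for g
    proof -
      have "commute a (shift g)" using Suc.prems shift_pures that by blast
      then show ?thesis using Suc.prems(1) shift_pures[OF that]
        by (metis commute_def del_1_shift del_pure_add order_refl)
    qed
    from Suc.IH[OF da this] obtain r where r: "del 1 a = imul r (zn n)" by blast
    define b where "b = a - imul r (zn ?n)"
    have z: "zn ?n \<in> pures ?n" by (rule zn_pures) simp
    have b: "b \<in> pures ?n" unfolding b_def using Suc.prems z by (intro pures_diff imul_pures)
    have "del 1 b = 0" unfolding b_def
      using Suc.prems z r additive_diff[OF additive_del[of 1 ?n] Suc.prems(1) imul_pures[OF z]]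
        additive_imul[OF additive_del z, of 1 r] del_zn[of 1 ?n] by (simp add: imul_pures del: zn.simps)
    then have "b \<in> K ?n 1" using b by (simp add: K_def dd_def)
    then obtain w' where "b = kap ?n w'" using K_1[of ?n] by auto
    then obtain w where w: "b = kap ?n w" "trunc ?n w = w" using kap_trunc trunc_trunc by metis
    have comm: "commute (fgen j) w" if "j \<in> {1..n}" for j
    proof -
      have p: "pgen 1 (Suc j) \<in> pures ?n" using that by (intro pgen_pures) auto
      then have "commute (pgen 1 (Suc j)) a" using Suc.prems commute_sym by blast
      then have "commute (pgen 1 (Suc j)) b"
        unfolding b_def using zn_central[OF p] by (intro commute_diff commute_imul)
      then have "kap ?n (fgen j + w) = kap ?n (w + fgen j)" using that w by (simp add: commute_def)
      then show ?thesis using that w kap_eq_iff[of ?n "fgen j + w" "w + fgen j"] by (simp add: commute_def)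
    qed
    \<comment> \<open>\<open>commute_esum\<close> for \<open>fgen j\<close> and \<open>w\<close>,
      with an index \<open>j\<close> other than \<open>i\<close>, isolates
      \<open>esum i w\<close>.\<close>
    have e0: "esum i w = 0" if "i \<in> {1..n}" for i
    proof -
      define j :: nat where "j = (if i = 1 then 2 else 1)"
      have "j \<in> {1..n}" "j \<noteq> i" using Suc.hyps that by (auto simp: j_def)
      then show ?thesis using commute_esum[OF comm, of j j i] by auto
    qed
    have "w = 0"
    proof (rule fg_normal_trivial[where S = "{w}" and J = "{1..n}"])
      show "fgen j + x - fgen j \<in> gen {w}" if x: "x \<in> gen {w}" and j: "j \<in> {1..n}" for x j
      proof -
        obtain r where "x = imul r w" using x by (auto simp: gen_singleton)
        then have "commute (fgen j) x" using comm[OF j] by (simp add: commute_imul)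
        with x show ?thesis by (simp add: commute_conj_iff)
      qed
      show "esum j x = 0" if "x \<in> gen {w}" "j \<in> {1..n}" for x j
        using that by (induction x rule: gen.induct) (auto simp: e0)
      show "1 \<in> {1..n}" "2 \<in> {1..n}" "(1::nat) \<noteq> 2" using Suc.hyps by auto
    qed (auto intro: gen.incl)
    then show ?case using w b_def by (intro exI[of _ r]) simp
  qed
  then show ?thesis using that by blast
qed

text \<open>The center is preserved, so the twist goes to a multiple of itself; the square of
  \<theta> is inner and fixes it, which makes the multiple a sign.\<close>

lemma tht_zn:
  assumes "1 \<le> n" obtains r where "tht n (zn n) = imul r (zn n)" "r * r = 1"
proof (cases "n = 1")
  case True
  then show ?thesis using that[of 1] tht_pures[of "zn 1" 1] pures_1 zn_1 by simp
next
  case False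
  then have n: "2 \<le> n" using assms by simp
  have z: "zn n \<in> pures n" by (rule zn_pures) simp
  have "commute (tht n (zn n)) g" if g: "g \<in> pures n" for g
  proof -
    obtain b where b: "b \<in> pures n" "tht n b = g" using tht_surj[OF g assms] by blast
    have "commute b (zn n)" using zn_central b by blast
    then show ?thesis using additive_tht[OF assms] z b unfolding commute_def additive_on_def by metis
  qed
  then obtain r where r: "tht n (zn n) = imul r (zn n)"
    using central_zn[OF n tht_pures[OF z assms]] by blast
  have "tht n (tht n (zn n)) = imul (r * r) (zn n)"
    unfolding r using additive_imul[OF additive_tht[OF assms] z] by (simp add: r imul_imul)
  moreover have "tht n (tht n (zn n)) = zn n"
    using tht_tht[OF z assms] zn_central[OF shift_zn_pures[OF assms]] by (simp add: commute_conj_iff)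
  ultimately have "lnk 1 2 (zn n) = lnk 1 2 (imul (r * r) (zn n))" by simp
  then have "r * r = 1"
    using additive_imul[OF additive_lnk z, of 1 2 "r * r"] lnk_zn[of 1 2 n] n by (simp add: imul_int)
  with r that show ?thesis by blast
qed

subsection \<open>Transport of symmetric commutators\<close>

definition subgrp :: "'a::group_add set \<Rightarrow> bool" where
  "subgrp P \<longleftrightarrow> 0 \<in> P \<and> (\<forall>a\<in>P. \<forall>b\<in>P. a + b \<in> P) \<and> (\<forall>a\<in>P. - a \<in> P)"

lemma subgrpD:
  assumes "subgrp P"
  shows "0 \<in> P" "a \<in> P \<Longrightarrow> b \<in> P \<Longrightarrow> a + b \<in> P" "a \<in> P \<Longrightarrow> - a \<in> P" "a \<in> P \<Longrightarrow> b \<in> P \<Longrightarrow> a - b \<in> P"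
proof -
  show 1: "0 \<in> P" "a \<in> P \<Longrightarrow> b \<in> P \<Longrightarrow> a + b \<in> P" "a \<in> P \<Longrightarrow> - a \<in> P" for a b
    using assms by (auto simp: subgrp_def)
  show "a \<in> P \<Longrightarrow> b \<in> P \<Longrightarrow> a - b \<in> P"
    using 1(2)[of a "- b"] 1(3) by simp
qed

lemma subgrp_pures: "subgrp (pures n)"
  by (auto simp: subgrp_def pures_add pures_uminus)

lemma subgrp_UNIV: "subgrp UNIV"
  by (auto simp: subgrp_def)

lemma gen_least:
  assumes "S \<subseteq> H" "subgrp H" shows "gen S \<subseteq> H"
proof
  fix a assume "a \<in> gen S"
  then show "a \<in> H" by induction (use assms subgrpD[OF assms(2)] in auto)
qed

lemma additive_sub:
  assumes "additive_on P f" "subgrp P"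
  shows "f 0 = 0" "a \<in> P \<Longrightarrow> f (- a) = - f a" "a \<in> P \<Longrightarrow> b \<in> P \<Longrightarrow> f (a - b) = f a - f b"
    "a \<in> P \<Longrightarrow> b \<in> P \<Longrightarrow> f (a + b) = f a + f b"
proof -
  show add: "a \<in> P \<Longrightarrow> b \<in> P \<Longrightarrow> f (a + b) = f a + f b" for a b using assms by (auto simp: additive_on_def)
  have "f 0 + f 0 = f 0 + 0" using add[of 0 0] subgrpD(1)[OF assms(2)] by simp
  then show 0: "f 0 = 0" by (simp only: add_left_cancel)
  show neg: "f (- a) = - f a" if "a \<in> P" for a
    using add[of "- a" a] that subgrpD(3)[OF assms(2)] 0 by (simp add: eq_neg_iff_add_eq_0)
  show "a \<in> P \<Longrightarrow> b \<in> P \<Longrightarrow> f (a - b) = f a - f b"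
    using add[of a "- b"] neg subgrpD(3)[OF assms(2)] by simp
qed

lemma fc_image:
  assumes "fc R S a" "subgrp P" "additive_on P f" "\<And>i. i \<in> S \<Longrightarrow> R i \<subseteq> P"
    "\<And>i. i \<in> S \<Longrightarrow> f ` R i \<subseteq> R' (\<pi> i)" "inj_on \<pi> S"
  shows "a \<in> P \<and> fc R' (\<pi> ` S) (f a)"
  using assms(1,4,5,6)
proof (induction rule: fc.induct)
  case (base r i) then show ?case using fc.base[of "f r" R' "\<pi> i"] by auto
next
  case (comm S c i r)
  have "f r \<in> R' (\<pi> i)" using comm.prems(2)[of i] comm.hyps by blast
  then have cr: "c \<in> P" "r \<in> P" "fc R' (\<pi> ` S) (f c)" "f r \<in> R' (\<pi> i)" "\<pi> i \<notin> \<pi> ` S"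
    using comm by (auto simp: inj_on_def)
  then have "fc R' (insert (\<pi> i) (\<pi> ` S)) (f c + f r - f c - f r)" by (intro fc.comm)
  moreover have "f (c + r - c - r) = f c + f r - f c - f r"
    using cr subgrpD[OF assms(2)] by (simp add: additive_sub[OF assms(3,2)])
  ultimately show ?case using cr subgrpD[OF assms(2)] by auto
next
  case (add S a b)
  then show ?case using subgrpD[OF assms(2)] by (auto simp: additive_sub[OF assms(3,2)] intro: fc.add)
next
  case (uminus S a)
  then show ?case using subgrpD[OF assms(2)] by (auto simp: additive_sub[OF assms(3,2)] intro: fc.uminus)
qed (use subgrpD[OF assms(2)] additive_sub[OF assms(3,2)] in \<open>auto intro: fc.zero\<close>)

text \<open>Each entry of a commutator is lifted separately; \<open>P\<close> is closed, so the lift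
  of the whole commutator stays where \<open>f\<close> is additive.\<close>

lemma fc_preimage:
  assumes "fc R' U b" "subgrp P" "additive_on P f" "\<And>i. i \<in> U \<Longrightarrow> R (\<rho> i) \<subseteq> P"
    "\<And>i. i \<in> U \<Longrightarrow> R' i \<subseteq> f ` R (\<rho> i)" "inj_on \<rho> U"
  shows "\<exists>a\<in>P. fc R (\<rho> ` U) a \<and> f a = b"
  using assms(1,4,5,6)
proof (induction rule: fc.induct)
  case (base r i)
  then obtain x where "x \<in> R (\<rho> i)" "r = f x" by blast
  then show ?case using base fc.base[of x R "\<rho> i"] by auto
next
  case (comm S c i r)
  then obtain a where a: "a \<in> P" "fc R (\<rho> ` S) a" "f a = c" by (metis inj_on_insert insertCI)
  obtain x where x: "x \<in> R (\<rho> i)" "r = f x" using comm by blast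
  have xP: "x \<in> P" and "\<rho> i \<notin> \<rho> ` S" using comm x by (auto simp: inj_on_def)
  then have "fc R (insert (\<rho> i) (\<rho> ` S)) (a + x - a - x)" using a x by (intro fc.comm)
  moreover have "f (a + x - a - x) = c + r - c - r"
    using a x xP subgrpD[OF assms(2)] by (simp add: additive_sub[OF assms(3,2)])
  ultimately show ?case using a xP subgrpD[OF assms(2)] by (intro bexI[of _ "a + x - a - x"]) auto
next
  case (zero S)
  show ?case using subgrpD[OF assms(2)] additive_sub[OF assms(3,2)] by (intro bexI[of _ 0]) (auto intro: fc.zero)
next
  case (add S c d)
  then obtain a b where "a \<in> P" "fc R (\<rho> ` S) a" "f a = c" "b \<in> P" "fc R (\<rho> ` S) b" "f b = d" by metis
  then show ?case using subgrpD[OF assms(2)]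
    by (intro bexI[of _ "a + b"]) (auto simp: additive_sub[OF assms(3,2)] intro: fc.add)
next
  case (uminus S c)
  then obtain a where "a \<in> P" "fc R (\<rho> ` S) a" "f a = c" by metis
  then show ?case using subgrpD[OF assms(2)]
    by (intro bexI[of _ "- a"]) (auto simp: additive_sub[OF assms(3,2)] intro: fc.uminus)
qed

lemma fc_subset:
  assumes "fc R S a" "subgrp P" "\<And>i. i \<in> S \<Longrightarrow> R i \<subseteq> P" "\<And>i. i \<in> S \<Longrightarrow> subgrp (R i)"
    "\<And>i g r. i \<in> S \<Longrightarrow> g \<in> P \<Longrightarrow> r \<in> R i \<Longrightarrow> g + r - g \<in> R i"
  shows "a \<in> P \<and> (\<forall>i\<in>S. a \<in> R i)"
  using assms(1,3-)
proof (induction rule: fc.induct)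
  case (comm S c j r)
  have c: "c \<in> P" "\<And>i. i \<in> S \<Longrightarrow> c \<in> R i" and r: "r \<in> P" "r \<in> R j" using comm by auto
  have "c + r - c - r \<in> R i" if "i \<in> insert j S" for i
  proof -
    note sub = subgrpD[OF comm.prems(2)[OF that]]
    show ?thesis
    proof (cases "i = j")
      case True
      then show ?thesis using comm.prems(3)[of j c r] c r sub by auto
    next
      case False
      then have "c \<in> R i" using that c by auto
      then have "r + (- c) - r \<in> R i" using comm.prems(3)[OF that r(1) sub(3)] by blast
      then have "c + (r + (- c) - r) \<in> R i" using \<open>c \<in> R i\<close> by (intro sub(2))
      then show ?thesis by (simp add: grp del: add_uminus_conv_diff)
    qed
  qed
  then show ?case using c r subgrpD[OF assms(2)] by auto
next
  case (add S a b)
  then have "a \<in> P" "b \<in> P" "\<And>i. i \<in> S \<Longrightarrow> a \<in> R i" "\<And>i. i \<in> S \<Longrightarrow> b \<in> R i" by auto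
  then show ?case using subgrpD(2)[OF assms(2)] subgrpD(2)[OF add.prems(2)] by auto
next
  case (uminus S a)
  then have "a \<in> P" "\<And>i. i \<in> S \<Longrightarrow> a \<in> R i" by auto
  then show ?case using subgrpD(3)[OF assms(2)] subgrpD(3)[OF uminus.prems(2)] by auto
next
  case (zero S) then show ?case using subgrpD(1)[OF assms(2)] subgrpD(1)[OF zero(2)] by auto
qed auto

subsection \<open>The kernels of the strand deletions\<close>

lemma K_pures: "K n k \<subseteq> pures n"
  by (auto simp: K_def)

lemma K_subgrp: "1 \<le> n \<Longrightarrow> subgrp (K n k)"
  using additive_sub[OF dd_additive subgrp_pures] subgrpD[OF subgrp_pures]
  unfolding subgrp_def K_def by auto

lemma K_conj:
  assumes "1 \<le> n" "a \<in> K n k" "g \<in> pures n" shows "g + a - g \<in> K n k"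
proof -
  note dd = additive_sub[OF dd_additive[OF assms(1)] subgrp_pures]
  show ?thesis using assms subgrpD[OF subgrp_pures] by (auto simp: K_def dd)
qed

lemma K_braid_conj:
  assumes "a \<in> K n k" "g \<in> braids n" "pos g j = k" "1 \<le> j"
  shows "g + a - g \<in> K n j"
  using assms pos_ge_1[of j g] by (auto simp: K_def dd_def pures_conj del_conj)

definition ncl :: "nat \<Rightarrow> braid \<Rightarrow> braid set" where
  "ncl n x = gen {g + x - g | g. g \<in> pures n}"

lemma ncl_least: "1 \<le> n \<Longrightarrow> x \<in> K n k \<Longrightarrow> ncl n x \<subseteq> K n k"
proof
  fix a assume n: "1 \<le> n" and x: "x \<in> K n k" and a: "a \<in> ncl n x"
  have "{g + x - g | g. g \<in> pures n} \<subseteq> K n k" using K_conj[OF n x] by blast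
  from gen_least[OF this K_subgrp[OF n]] a show "a \<in> K n k" unfolding ncl_def by blast
qed

lemma ncl_conj:
  assumes "a \<in> ncl n x" "g \<in> braids n" shows "g + a - g \<in> ncl n (g + x - g)"
  unfolding ncl_def
proof (rule gen_conj_closed[OF _ assms(1)[unfolded ncl_def]])
  fix y assume "y \<in> {h + x - h | h. h \<in> pures n}"
  then obtain h where h: "y = h + x - h" "h \<in> pures n" by blast
  have "g + y - g = (g + h - g) + (g + x - g) - (g + h - g)"
    unfolding h by (simp add: grp del: add_uminus_conv_diff)
  then show "g + y - g \<in> gen {h + (g + x - g) - h | h. h \<in> pures n}"
    using pures_conj[OF h(2) assms(2)] by (intro gen.incl) blast
qed

lemma ncl_image:
  assumes "additive_on (pures n) f" "f ` pures n = pures m" "x \<in> pures n"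
  shows "f ` ncl n x = ncl m (f x)"
proof -
  have "f ` gen {g + x - g | g. g \<in> pures n} = gen (f ` {g + x - g | g. g \<in> pures n})"
    using assms pures_conj pures_braids by (intro additive_gen_image[of n]) auto
  also have "f ` {g + x - g | g. g \<in> pures n} = (\<lambda>g. f (g + x - g)) ` pures n" by auto
  also have "\<dots> = (\<lambda>g. f g + f x - f g) ` pures n"
    using assms(3) subgrpD[OF subgrp_pures]
    by (intro image_cong HOL.refl) (simp add: additive_sub[OF assms(1) subgrp_pures])
  also have "\<dots> = {g + f x - g | g. g \<in> pures m}" unfolding assms(2)[symmetric] by auto
  finally show ?thesis by (simp add: ncl_def)
qed

text \<open>In free coordinates deleting strand \<open>j\<close> kills the generator
  \<open>j - 1\<close>, and the kernel of that retraction is the normal closure of the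
  generator.\<close>

lemma K_1_inter:
  assumes "2 \<le> j" "j \<le> n" shows "K n 1 \<inter> K n j = ncl n (pgen 1 j)"
proof
  have n: "1 \<le> n" using assms by simp
  have p: "pgen 1 j \<in> pures n" using assms by (intro pgen_pures) auto
  then have "pgen 1 j \<in> K n 1" "pgen 1 j \<in> K n j" using assms by (auto simp: K_def dd_def del_pgen)
  then show "ncl n (pgen 1 j) \<subseteq> K n 1 \<inter> K n j" using ncl_least n by blast
  show "K n 1 \<inter> K n j \<subseteq> ncl n (pgen 1 j)"
  proof
    fix a assume a: "a \<in> K n 1 \<inter> K n j"
    then obtain w' where "a = kap n w'" using K_1[OF n] by auto
    then obtain w where w: "a = kap n w" "trunc n w = w" using kap_trunc trunc_trunc by metis
    then have "fdel (j - 1) w = 0" using a del_kap[of j n w] assms by (auto simp: K_def dd_def)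
    then have "w \<in> gen {g + fgen (j - 1) - g | g. True}" using fdel_nclosure[of w "j - 1"] by simp
    then have "kap n w \<in> ncl n (pgen 1 j)" unfolding ncl_def
    proof induction
      case (incl x)
      then obtain g where "x = g + fgen (j - 1) - g" by blast
      moreover have "1 \<le> j - 1" "j - 1 < n" "Suc (j - 1) = j" using assms by auto
      ultimately have "kap n x = kap n g + pgen 1 j - kap n g" by simp
      then show ?case using kap_pures by (intro gen.incl) blast
    qed (auto intro: gen.intros)
    then show "a \<in> ncl n (pgen 1 j)" using w by simp
  qed
qed

lemma up_braids: "1 \<le> n \<Longrightarrow> j \<le> n \<Longrightarrow> up i j \<in> braids n"
  by (induction j) (auto intro!: braids_add braids_sigma)

lemma pos_up: "1 \<le> j \<Longrightarrow> pos (up 0 j) k = (if k = j then 1 else if 1 \<le> k \<and> k < j then Suc k else k)"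
proof (induction j arbitrary: k rule: nat_induct_at_least)
  case base show ?case by (auto simp: One_nat_def)
next
  case (Suc j)
  then show ?case by (auto simp: pos_add pos_sigma Transposition.transpose_def)
qed

lemma K_conj_up:
  assumes "1 \<le> j" "j \<le> n" shows "a \<in> K n j \<longleftrightarrow> - up 0 j + a - (- up 0 j) \<in> K n 1"
proof -
  have u: "up 0 j \<in> braids n" using assms up_braids by auto
  have p: "pos (up 0 j) j = 1" using assms by (simp add: pos_up)
  then have q: "pos (- up 0 j) 1 = j" using pos_uminus(1)[of "up 0 j" j] by simp
  show ?thesis
  proof
    show "a \<in> K n j \<Longrightarrow> - up 0 j + a - (- up 0 j) \<in> K n 1"
      by (rule K_braid_conj[where k = j]) (use u q in \<open>auto intro: braids_uminus\<close>)
    assume "- up 0 j + a - (- up 0 j) \<in> K n 1"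
    then have "up 0 j + (- up 0 j + a - (- up 0 j)) - up 0 j \<in> K n j"
      by (rule K_braid_conj[where k = 1]) (use u p assms in \<open>auto\<close>)
    then show "a \<in> K n j" by (simp add: grp del: add_uminus_conv_diff)
  qed
qed

lemma pgen_up: "1 \<le> i \<Longrightarrow> i < j \<Longrightarrow> pgen i j = up 0 i + pgen 1 j - up 0 i"
proof (induction i rule: nat_induct_at_least)
  case base show ?case by simp
next
  case (Suc i)
  then show ?case using pgen_conj_left[of i j] by (simp add: grp del: add_uminus_conv_diff)
qed

text \<open>Conjugation with \<open>up 0 i\<close> reduces to strand 1. Because \<open>i < j\<close>
  it leaves position \<open>j\<close> alone, and by \<open>pgen_up\<close> it relates
  \<open>pgen 1 j\<close> to \<open>pgen i j\<close>.\<close>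

lemma K_inter:
  assumes "1 \<le> i" "i < j" "j \<le> n" shows "K n i \<inter> K n j = ncl n (pgen i j)"
proof
  let ?u = "up 0 i"
  have n: "1 \<le> n" using assms by simp
  have p: "pgen i j \<in> pures n" using assms by (intro pgen_pures) auto
  then have "pgen i j \<in> K n i" "pgen i j \<in> K n j" using assms by (auto simp: K_def dd_def del_pgen)
  then show "ncl n (pgen i j) \<subseteq> K n i \<inter> K n j" using ncl_least n by blast
  show "K n i \<inter> K n j \<subseteq> ncl n (pgen i j)"
  proof
    fix a assume a: "a \<in> K n i \<inter> K n j"
    have u: "?u \<in> braids n" using assms up_braids by auto
    have "pos ?u j = j" using assms by (simp add: pos_up)
    then have q: "pos (- ?u) j = j" using pos_uminus(1)[of ?u j] by simp
    have "- ?u + a - (- ?u) \<in> K n 1" using a K_conj_up[of i n a] assms by auto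
    moreover have "- ?u + a - (- ?u) \<in> K n j"
      by (rule K_braid_conj[where k = j]) (use a u q assms in \<open>auto intro: braids_uminus\<close>)
    ultimately have "- ?u + a - (- ?u) \<in> ncl n (pgen 1 j)" using K_1_inter[of j n] assms by auto
    from ncl_conj[OF this u] show "a \<in> ncl n (pgen i j)"
      using pgen_up[of i j] assms by (simp add: grp del: add_uminus_conv_diff)
  qed
qed

lemma tht_K:
  assumes "2 \<le> j" "j \<le> n" "a \<in> pures n" shows "tht n a \<in> K n j \<longleftrightarrow> a \<in> K n j"
proof -
  have n: "1 \<le> n" "1 \<le> n - 1" using assms by auto
  have "tht (n - 1) (del j a) = tht (n - 1) 0 \<longleftrightarrow> del j a = 0"
    using tht_inj[of "del j a" "n - 1" 0] del_pures[of a n j] assms n by auto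
  then show ?thesis using assms n del_tht[of a n j] additive_on_pures_uminus(1)[OF additive_tht[OF n(2)]]
    by (auto simp: K_def dd_def tht_pures)
qed

lemma tht_K_0: "1 \<le> n \<Longrightarrow> a \<in> pures n \<Longrightarrow> tht n a \<in> K n 1 \<longleftrightarrow> a \<in> K n 0"
  by (auto simp: K_def dd_def bd_def tht_pures)

lemma ncl_uminus: "ncl n (- x) = ncl n x"
proof -
  have *: "ncl n (- x) \<subseteq> ncl n x" for x
  proof
    fix a assume "a \<in> ncl n (- x)"
    then show "a \<in> ncl n x" unfolding ncl_def
    proof induction
      case (incl y)
      then obtain g where g: "y = g + - x - g" "g \<in> pures n" by blast
      have "g + x - g \<in> gen {g + x - g | g. g \<in> pures n}" using g by (intro gen.incl) blast
      then show ?case unfolding g conj_uminus by (rule gen.uminus)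
    qed (auto intro: gen.intros)
  qed
  from *[of x] *[of "- x"] show ?thesis by auto
qed

lemma ncl_conj_eq: "g \<in> pures n \<Longrightarrow> ncl n (g + x - g) = ncl n x"
proof -
  have *: "ncl n (g + x - g) \<subseteq> ncl n x" if "g \<in> pures n" for g x
  proof
    fix a assume "a \<in> ncl n (g + x - g)"
    then show "a \<in> ncl n x" unfolding ncl_def
    proof induction
      case (incl y)
      then obtain h where "y = h + (g + x - g) - h" "h \<in> pures n" by blast
      then have "y = (h + g) + x - (h + g)" "h + g \<in> pures n" using that by (auto simp: conj_conj pures_add)
      then show ?case by (intro gen.incl) blast
    qed (auto intro: gen.intros)
  qed
  assume g: "g \<in> pures n"
  from *[OF pures_uminus[OF g], of "g + x - g"] *[OF g, of x] show ?thesis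
    by (auto simp: grp simp del: add_uminus_conv_diff)
qed

text \<open>\<theta> maps this intersection to the one for strand 1, the normal closure of
  \<open>pgen 1 j\<close>. A second application yields a conjugate of \<open>- tsum n j\<close>,
  whereas the square of \<theta>, being inner, does not move the intersection.\<close>

lemma K_0_inter:
  assumes "2 \<le> j" "j \<le> n" shows "K n 0 \<inter> K n j = ncl n (tsum n j)"
proof -
  let ?c = "shift (zn (n - 1))"
  have n: "1 \<le> n" using assms by simp
  have c: "?c \<in> pures n" using shift_zn_pures n by simp
  have p: "pgen 1 j \<in> pures n" using assms by (intro pgen_pures) auto
  have t: "tsum n j \<in> pures n" using assms by (intro tsum_pures) auto
  have "tht n ` (K n 0 \<inter> K n j) = K n 1 \<inter> K n j"
  proof
    show "tht n ` (K n 0 \<inter> K n j) \<subseteq> K n 1 \<inter> K n j"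
    proof (rule image_subsetI)
      fix a assume a: "a \<in> K n 0 \<inter> K n j"
      then have "a \<in> pures n" using K_pures by blast
      then show "tht n a \<in> K n 1 \<inter> K n j" using a tht_K[OF assms] tht_K_0[OF n] by simp
    qed
    show "K n 1 \<inter> K n j \<subseteq> tht n ` (K n 0 \<inter> K n j)"
    proof
      fix b assume b: "b \<in> K n 1 \<inter> K n j"
      then have "b \<in> pures n" using K_pures by blast
      from tht_surj[OF this n] obtain a where a: "a \<in> pures n" "tht n a = b" by blast
      then have "a \<in> K n 0 \<inter> K n j" using b tht_K[OF assms a(1)] tht_K_0[OF n a(1)] by simp
      then show "b \<in> tht n ` (K n 0 \<inter> K n j)" using a(2) by blast
    qed
  qed
  then have "tht n ` (tht n ` (K n 0 \<inter> K n j)) = tht n ` ncl n (pgen 1 j)"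
    using K_1_inter assms by simp
  also have "\<dots> = ncl n (tht n (pgen 1 j))"
    using bij_tht[OF n] additive_tht[OF n] p by (intro ncl_image) (auto simp: bij_betw_def)
  also have "tht n (pgen 1 j) = - pgen 1 j + (- tsum n j) - (- pgen 1 j)"
    using assms tht_pgen_1 by simp
  also have "ncl n \<dots> = ncl n (- tsum n j)" by (rule ncl_conj_eq) (use p pures_uminus in auto)
  also have "\<dots> = ncl n (tsum n j)" by (rule ncl_uminus)
  finally have 1: "tht n ` (tht n ` (K n 0 \<inter> K n j)) = ncl n (tsum n j)" .
  have "tht n ` (tht n ` (K n 0 \<inter> K n j)) = (\<lambda>a. ?c + a - ?c) ` (K n 0 \<inter> K n j)"
    unfolding image_image using K_pures n by (intro image_cong) (auto intro!: tht_tht)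
  also have "\<dots> = K n 0 \<inter> K n j"
  proof
    show "(\<lambda>a. ?c + a - ?c) ` (K n 0 \<inter> K n j) \<subseteq> K n 0 \<inter> K n j" using K_conj n c by auto
    show "K n 0 \<inter> K n j \<subseteq> (\<lambda>a. ?c + a - ?c) ` (K n 0 \<inter> K n j)"
    proof
      fix a assume a: "a \<in> K n 0 \<inter> K n j"
      then have "- ?c + a - (- ?c) \<in> K n 0 \<inter> K n j" using K_conj[OF n _ pures_uminus[OF c]] by blast
      then show "a \<in> (\<lambda>a. ?c + a - ?c) ` (K n 0 \<inter> K n j)"
        by (rule image_eqI[rotated]) (simp add: grp del: add_uminus_conv_diff)
    qed
  qed
  finally show ?thesis using 1 by simp
qed

lemma bd_surj: "1 \<le> n \<Longrightarrow> bd n ` pures n = pures (n - 1)"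
proof
  assume n: "1 \<le> n"
  show "bd n ` pures n \<subseteq> pures (n - 1)" using bd_pures n by auto
  show "pures (n - 1) \<subseteq> bd n ` pures n"
  proof
    fix a assume a: "a \<in> pures (n - 1)"
    then have "bd n (shift a) = a" "shift a \<in> pures n" using bd_shift[of a n] shift_pures[OF a] n by (auto simp: pures_braids)
    then show "a \<in> bd n ` pures n" by force
  qed
qed

text \<open>Both sides are normal closures of one edge element, and \<open>bd\<close> carries one to
  the other up to sign with all indices lowered by one: the first strand becomes the one at
  infinity. The bound on \<open>b\<close> keeps \<open>b - 1\<close> clear of 0 and 1.\<close>

lemma bd_K_inter:
  assumes "3 \<le> b" "b \<le> Suc n" "1 \<le> i" "i \<le> Suc n" "i \<noteq> b"
  shows "bd (Suc n) ` (K (Suc n) b \<inter> K (Suc n) i) = K n (b - 1) \<inter> K n (i - 1)"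
proof -
  let ?f = "bd (Suc n)"
  have im: "?f ` ncl (Suc n) x = ncl n (?f x)" if "x \<in> pures (Suc n)" for x
    using additive_bd[of "Suc n"] bd_surj[of "Suc n"] that by (intro ncl_image) auto
  consider "i = 1" | "2 \<le> i" "i < b" | "b < i" using assms by linarith
  then show ?thesis
  proof cases
    case 1
    then have "K (Suc n) b \<inter> K (Suc n) i = ncl (Suc n) (pgen 1 b)"
      using K_1_inter[of b "Suc n"] assms by auto
    then show ?thesis using assms 1 K_0_inter[of "b - 1" n] im[OF pgen_pures[of 1 b]]
      by (simp add: bd_pgen_1 ncl_uminus Int_commute)
  next
    case 2
    then have "K (Suc n) b \<inter> K (Suc n) i = ncl (Suc n) (pgen i b)"
      using K_inter[of i b "Suc n"] assms by auto
    then show ?thesis using assms 2 K_inter[of "i - 1" "b - 1" n] im[OF pgen_pures[of i b]]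
      by (simp add: bd_pgen Int_commute)
  next
    case 3
    then have "K (Suc n) b \<inter> K (Suc n) i = ncl (Suc n) (pgen b i)"
      using K_inter[of b i "Suc n"] assms by auto
    then show ?thesis using assms 3 K_inter[of "b - 1" "i - 1" n] im[OF pgen_pures[of b i]]
      by (simp add: bd_pgen)
  qed
qed

definition brun :: "nat \<Rightarrow> braid set" where
  "brun n = {a \<in> pures n. \<forall>k\<in>{1..n}. a \<in> K n k}"

text \<open>In the free coordinates of \<open>K n 1\<close> a Brunnian braid is a word that dies
  when any one generator is deleted, so \<open>fdel_kernel_fc\<close> applies.\<close>

lemma brun_fc_1:
  assumes "2 \<le> n" "a \<in> brun n"
  shows "fc (\<lambda>i. K n 1 \<inter> K n i) {2..n} a"
proof -
  have n: "1 \<le> n" using assms by simp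
  have "a \<in> K n 1" using assms n by (auto simp: brun_def)
  then obtain w' where "a = kap n w'" using K_1[OF n] by auto
  then obtain w where w: "a = kap n w" "trunc n w = w" using kap_trunc trunc_trunc by metis
  have "fc fker {1..n - 1} w"
  proof (rule fdel_kernel_fc)
    fix i assume i: "i \<in> {1..n - 1}"
    then have "a \<in> K n (Suc i)" using assms by (auto simp: brun_def)
    then show "fdel i w = 0" using del_kap[of "Suc i" n w] w i assms by (auto simp: K_def dd_def)
  qed (use assms in auto)
  then have "fc (\<lambda>i. K n 1 \<inter> K n i) (Suc ` {1..n - 1}) (kap n w)"
  proof (rule fc_image[where P = UNIV, THEN conjunct2])
    fix i assume i: "i \<in> {1..n - 1}"
    show "kap n ` fker i \<subseteq> K n 1 \<inter> K n (Suc i)"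
    proof clarify
      fix x assume "fdel i x = 0"
      then have "del (Suc i) (kap n x) = 0" using del_kap[of "Suc i" n x] fdel_trunc[of i n x] i assms by auto
      then show "kap n x \<in> K n 1 \<inter> K n (Suc i)"
        using K_1[OF n] kap_pures[of n x] by (auto simp: K_def dd_def)
    qed
  qed (auto simp: subgrp_UNIV additive_on_def)
  moreover have "Suc ` {1..n - 1} = {2..n}" using assms by (simp add: image_Suc_atLeastAtMost)
  ultimately show ?thesis by (simp only: w(1))
qed

lemma brun_conj:
  assumes "a \<in> brun n" "g \<in> braids n" shows "g + a - g \<in> brun n"
  unfolding brun_def
proof (intro CollectI conjI ballI)
  show "g + a - g \<in> pures n" using assms by (auto simp: brun_def pures_conj)
  fix k assume k: "k \<in> {1..n}"
  then have "a \<in> K n (pos g k)" using assms pos_range by (auto simp: brun_def)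
  then show "g + a - g \<in> K n k" by (rule K_braid_conj[where k = "pos g k"]) (use k assms in \<open>auto\<close>)
qed

text \<open>Any strand can serve as base: conjugation with \<open>up 0 b\<close> brings it to the
  front, and Brunnian braids are invariant under conjugation.\<close>

lemma brun_fc:
  assumes "2 \<le> n" "a \<in> brun n" "b \<in> {1..n}"
  shows "fc (\<lambda>i. K n b \<inter> K n i) ({1..n} - {b}) a"
proof -
  let ?u = "up 0 b"
  have u: "?u \<in> braids n" using assms up_braids[of n b] by auto
  have b: "pos ?u b = 1" using assms by (simp add: pos_up)
  have "- ?u + a - (- ?u) \<in> brun n" using assms u by (intro brun_conj braids_uminus)
  from brun_fc_1[OF assms(1) this]
  have "fc (\<lambda>i. K n b \<inter> K n i) (pos (- ?u) ` {2..n}) (?u + (- ?u + a - (- ?u)) - ?u)"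
  proof (rule fc_image[where P = "pures n" and f = "\<lambda>x. ?u + x - ?u", THEN conjunct2])
    fix i assume i: "i \<in> {2..n}"
    have "1 \<le> pos (- ?u) i" using i by (intro pos_ge_1) auto
    then show "(\<lambda>x. ?u + x - ?u) ` (K n 1 \<inter> K n i) \<subseteq> K n b \<inter> K n (pos (- ?u) i)"
    proof clarify
      fix x assume x: "x \<in> K n 1" "x \<in> K n i"
      have "?u + x - ?u \<in> K n b" using x u b assms by (intro K_braid_conj[where k = 1]) auto
      moreover have "?u + x - ?u \<in> K n (pos (- ?u) i)"
        using x(2) u \<open>1 \<le> pos (- ?u) i\<close> by (intro K_braid_conj[where k = i]) auto
      ultimately show "?u + x - ?u \<in> K n b \<inter> K n (pos (- ?u) i)" by blast
    qed
  qed (auto simp: subgrp_pures additive_on_def conj_add inj_on_def pos_inj K_pures[THEN subsetD])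
  moreover have "pos (- ?u) ` {2..n} = {1..n} - {b}"
  proof
    have "pos (- ?u) i \<noteq> b" if "i \<in> {2..n}" for i
    proof
      assume "pos (- ?u) i = b"
      then have "i = 1" using pos_uminus(2)[of ?u i] b by simp
      with that show False by simp
    qed
    then show "pos (- ?u) ` {2..n} \<subseteq> {1..n} - {b}"
      using pos_range[OF braids_uminus[OF u]] by fastforce
    show "{1..n} - {b} \<subseteq> pos (- ?u) ` {2..n}"
    proof
      fix i assume i: "i \<in> {1..n} - {b}"
      then have "pos ?u i \<in> {1..n}" "pos ?u i \<noteq> 1" using pos_range[OF u] b pos_inj by (auto, metis)
      then show "i \<in> pos (- ?u) ` {2..n}" by (intro image_eqI[of _ _ "pos ?u i"]) auto
    qed
  qed
  ultimately show ?thesis by (simp add: grp del: add_uminus_conv_diff)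
qed

lemma fc_brun:
  assumes "2 \<le> n" "b \<in> {1..n}" "fc (\<lambda>i. K n b \<inter> K n i) ({1..n} - {b}) a"
  shows "a \<in> brun n"
proof -
  have n: "1 \<le> n" using assms by simp
  have "a \<in> pures n \<and> (\<forall>i\<in>{1..n} - {b}. a \<in> K n b \<inter> K n i)"
  proof (rule fc_subset[OF assms(3) subgrp_pures])
    fix i show "subgrp (K n b \<inter> K n i)" using K_subgrp[OF n] by (auto simp: subgrp_def)
  qed (use K_pures K_conj[OF n] in auto)
  moreover have "(if b = 1 then 2 else 1) \<in> {1..n} - {b}" using assms by auto
  ultimately show ?thesis unfolding brun_def by blast
qed

definition bdt :: "nat \<Rightarrow> braid set" where
  "bdt n = bd (n + 1) ` brun (n + 1)"

text \<open>Brunnian braids on \<open>n + 1\<close> strands are symmetric commutators with base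
  \<open>b + 1\<close>, and \<open>bd\<close> lowers all indices by one. That the same set arises
  for every base at least 2 is what later allows the base to move along with an
  automorphism.\<close>

theorem bdt_eq_fc:
  assumes "2 \<le> b" "b \<le> n"
  shows "bdt n = {a. fc (\<lambda>i. K n b \<inter> K n i) ({0..n} - {b}) a}"
proof
  let ?f = "bd (Suc n)" and ?S = "{1..Suc n} - {Suc b}"
  have S: "(\<lambda>i. i - 1) ` ?S = {0..n} - {b}"
  proof
    show "(\<lambda>i. i - 1) ` ?S \<subseteq> {0..n} - {b}" by auto
    show "{0..n} - {b} \<subseteq> (\<lambda>i. i - 1) ` ?S"
    proof
      fix i assume "i \<in> {0..n} - {b}"
      then show "i \<in> (\<lambda>i. i - 1) ` ?S" by (intro image_eqI[of _ _ "Suc i"]) auto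
    qed
  qed
  have im: "?f ` (K (Suc n) (Suc b) \<inter> K (Suc n) i) = K n b \<inter> K n (i - 1)" if "i \<in> ?S" for i
    using bd_K_inter[of "Suc b" n i] that assms by auto
  show "bdt n \<subseteq> {a. fc (\<lambda>i. K n b \<inter> K n i) ({0..n} - {b}) a}"
  proof
    fix x assume "x \<in> bdt n"
    then obtain a where a: "a \<in> brun (Suc n)" "x = ?f a" by (auto simp: bdt_def)
    have "fc (\<lambda>i. K (Suc n) (Suc b) \<inter> K (Suc n) i) ?S a"
      using assms a by (intro brun_fc) auto
    then have "fc (\<lambda>i. K n b \<inter> K n i) ((\<lambda>i. i - 1) ` ?S) (?f a)"
      by (rule fc_image[where P = "pures (Suc n)", THEN conjunct2])
        (use im in \<open>auto simp: subgrp_pures additive_bd K_pures[THEN subsetD] inj_on_def\<close>)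
    then show "x \<in> {a. fc (\<lambda>i. K n b \<inter> K n i) ({0..n} - {b}) a}" using a S by simp
  qed
  show "{a. fc (\<lambda>i. K n b \<inter> K n i) ({0..n} - {b}) a} \<subseteq> bdt n"
  proof clarify
    fix x assume x: "fc (\<lambda>i. K n b \<inter> K n i) ({0..n} - {b}) x"
    have "Suc ` ({0..n} - {b}) = ?S"
    proof
      show "?S \<subseteq> Suc ` ({0..n} - {b})"
      proof
        fix i assume "i \<in> ?S"
        then show "i \<in> Suc ` ({0..n} - {b})" by (intro image_eqI[of _ _ "i - 1"]) auto
      qed
    qed auto
    moreover have "\<exists>a\<in>pures (Suc n). fc (\<lambda>i. K (Suc n) (Suc b) \<inter> K (Suc n) i) (Suc ` ({0..n} - {b})) a \<and> ?f a = x"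
    proof (rule fc_preimage[OF x subgrp_pures])
      fix i assume "i \<in> {0..n} - {b}"
      then show "K n b \<inter> K n i \<subseteq> ?f ` (K (Suc n) (Suc b) \<inter> K (Suc n) (Suc i))"
        using im[of "Suc i"] by simp
    qed (auto simp: additive_bd K_pures[THEN subsetD])
    ultimately obtain a where "fc (\<lambda>i. K (Suc n) (Suc b) \<inter> K (Suc n) i) ?S a" "?f a = x" by auto
    moreover from this have "a \<in> brun (Suc n)" using assms by (intro fc_brun[of "Suc n" "Suc b"]) auto
    ultimately show "x \<in> bdt n" by (auto simp: bdt_def)
  qed
qed

section \<open>Plane-valued edge weights with parallel values on disjoint edges\<close>

section \<open>Combinatorics of isotropic pairs\<close>

text \<open>Two weights \<open>a\<close>, \<open>b\<close> on the edges of a complete graph with vanishing vertex sums are regarded as one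
  weight with values in the plane. If disjoint edges have parallel values, but not all values are parallel,
  then the weight lives on four vertices.\<close>

locale isotropic_pair =
  fixes V :: "'v set" and a b :: "'v \<Rightarrow> 'v \<Rightarrow> int"
  assumes fin: "finite V"
    and sym_a: "a i j = a j i" and sym_b: "b i j = b j i"
    and sum_a: "i \<in> V \<Longrightarrow> (\<Sum>j\<in>V - {i}. a i j) = 0"
    and sum_b: "i \<in> V \<Longrightarrow> (\<Sum>j\<in>V - {i}. b i j) = 0"
    and disj: "i \<in> V \<Longrightarrow> j \<in> V \<Longrightarrow> k \<in> V \<Longrightarrow> l \<in> V \<Longrightarrow> distinct [i, j, k, l] \<Longrightarrow> a i j * b k l = a k l * b i j"
begin

definition par :: "'v \<Rightarrow> 'v \<Rightarrow> 'v \<Rightarrow> 'v \<Rightarrow> bool" where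
  "par i j k l \<longleftrightarrow> a i j * b k l = a k l * b i j"

definition nul :: "'v \<Rightarrow> 'v \<Rightarrow> bool" where
  "nul i j \<longleftrightarrow> a i j = 0 \<and> b i j = 0"

lemma par_flip: "par i j k l = par j i k l" "par i j k l = par i j l k"
  using sym_a[of i j] sym_b[of i j] sym_a[of k l] sym_b[of k l] by (simp_all add: par_def)

lemma nul_flip: "nul i j = nul j i"
  using sym_a[of i j] sym_b[of i j] by (simp add: nul_def)

lemma par_sym: "par i j k l \<Longrightarrow> par k l i j"
  by (simp add: par_def)

lemma cross_trans:
  fixes x y u v z w :: int
  assumes "x * v = u * y" "u * w = z * v" "u \<noteq> 0 \<or> v \<noteq> 0"
  shows "x * w = z * y"
proof -
  have "u * (x * w) = u * (z * y)" "v * (x * w) = v * (z * y)"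
    using assms(1,2) by algebra+
  then show ?thesis using assms(3) by auto
qed

lemma par_trans: "par i j k l \<Longrightarrow> par k l p q \<Longrightarrow> \<not> nul k l \<Longrightarrow> par i j p q"
  using cross_trans[of "a i j" "b k l" "a k l" "b i j" "b p q" "a p q"] by (auto simp: par_def nul_def)

lemma nulI: "par i j k l \<Longrightarrow> par i j p q \<Longrightarrow> \<not> par k l p q \<Longrightarrow> nul i j"
  using par_trans[of k l i j p q] par_sym by blast

lemma nul_par: "nul i j \<Longrightarrow> par i j k l"
  by (simp add: nul_def par_def)

lemma disj_par: "i \<in> V \<Longrightarrow> j \<in> V \<Longrightarrow> k \<in> V \<Longrightarrow> l \<in> V \<Longrightarrow> distinct [i, j, k, l] \<Longrightarrow> par i j k l"
  unfolding par_def by (rule disj)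

text \<open>At a vertex, the last edge is parallel to a direction that all other edges have.\<close>

lemma par_vertex:
  assumes "i \<in> V" "j \<in> V" "i \<noteq> j" "\<And>l. l \<in> V - {i, j} \<Longrightarrow> par i l p q"
  shows "par i j p q"
proof -
  have V: "V - {i} = insert j (V - {i, j})" using assms by auto
  have "a i j = - (\<Sum>l\<in>V - {i, j}. a i l)" "b i j = - (\<Sum>l\<in>V - {i, j}. b i l)"
    using sum_a[OF assms(1)] sum_b[OF assms(1)] fin unfolding V by simp_all
  moreover have "(\<Sum>l\<in>V - {i, j}. a i l * b p q) = (\<Sum>l\<in>V - {i, j}. a p q * b i l)"
    using assms(4) by (intro sum.cong) (auto simp: par_def)
  ultimately show ?thesis by (simp add: par_def sum_distrib_left sum_distrib_right)
qed

lemma nul_vertex: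
  assumes "i \<in> V" "j \<in> V" "i \<noteq> j" "\<And>l. l \<in> V - {i, j} \<Longrightarrow> nul i l"
  shows "nul i j"
proof -
  have V: "V - {i} = insert j (V - {i, j})" using assms by auto
  have "(\<Sum>l\<in>V - {i, j}. a i l) = 0" "(\<Sum>l\<in>V - {i, j}. b i l) = 0"
    using assms(4) by (auto intro!: sum.neutral simp: nul_def)
  then show ?thesis using sum_a[OF assms(1)] sum_b[OF assms(1)] fin unfolding V nul_def by simp
qed

text \<open>If \<open>r\<close> is joined only to \<open>p\<close> and \<open>q\<close>, its vertex
  sum makes the edges \<open>p r\<close> and \<open>q r\<close> parallel. The edges from
  \<open>p\<close> to further vertices are disjoint from \<open>q r\<close>, so the vertex sum at
  \<open>p\<close> makes \<open>p q\<close> parallel to \<open>q r\<close> as well.\<close>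

lemma no_flat:
  assumes V: "p \<in> V" "q \<in> V" "r \<in> V" "distinct [p, q, r]" and np: "\<not> par p q q r"
    and "\<And>w. w \<in> V - {p, q, r} \<Longrightarrow> nul r w"
  shows False
proof -
  have rp: "par p r q r"
  proof -
    have "par r p q r"
    proof (rule par_vertex)
      fix l assume l: "l \<in> V - {r, p}"
      show "par r l q r"
      proof (cases "l = q")
        case True then show ?thesis by (simp add: par_def sym_a[of r] sym_b[of r])
      next
        case False then show ?thesis using assms(6) l by (intro nul_par) auto
      qed
    qed (use V in auto)
    then show ?thesis by (simp add: par_flip(1))
  qed
  have "par p q q r"
  proof (rule par_vertex)
    fix l assume l: "l \<in> V - {p, q}"
    then show "par p l q r" using rp disj_par[of p l q r] V by (cases "l = r") auto
  qed (use V in auto)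
  with np show False by blast
qed

text \<open>The independent edges \<open>p q\<close> and \<open>q r\<close> fix two directions. An
  edge inside \<open>?W\<close> is disjoint from both and vanishes; an edge from \<open>r\<close>
  into \<open>?W\<close> is parallel to \<open>p q\<close>, and one from \<open>p\<close> into
  \<open>?W\<close> is parallel to \<open>q r\<close>.\<close>

lemma supported_on_four:
  assumes V: "p \<in> V" "q \<in> V" "r \<in> V" "distinct [p, q, r]" and np: "\<not> par p q q r"
  shows "\<exists>Q\<subseteq>V. card Q = 4 \<and> (\<forall>i\<in>V. \<forall>j\<in>V. i \<noteq> j \<longrightarrow> \<not> (i \<in> Q \<and> j \<in> Q) \<longrightarrow> nul i j)"
proof -
  let ?W = "V - {p, q, r}"
  have WW: "nul w w'" if "w \<in> ?W" "w' \<in> ?W" "w \<noteq> w'" for w w'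
    using that V by (intro nulI[OF _ _ np] disj_par) auto
  have rw: "par r w p q" and pw: "par p w q r" if "w \<in> ?W" for w
    using that V by (auto intro!: disj_par)
  have qw: "nul q w" if "w \<in> ?W" "nul p w" "nul r w" for w
  proof -
    have "nul w q"
    proof (rule nul_vertex)
      fix l assume "l \<in> V - {w, q}"
      then show "nul w l" using that WW[of w l] nul_flip[of w] by (cases "l = p"; cases "l = r") auto
    qed (use that V in auto)
    then show ?thesis by (simp add: nul_flip)
  qed
  show ?thesis
  \<comment> \<open>A vertex of \<open>?W\<close> joined to both \<open>p\<close> and
    \<open>r\<close> is the fourth vertex. Without one, \<open>p\<close> or \<open>r\<close> has no
    edge into \<open>?W\<close> at all, against \<open>no_flat\<close>.\<close>
  proof (cases "\<exists>w\<in>?W. \<not> nul p w \<and> \<not> nul r w")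
    case True
    then obtain w where w: "w \<in> ?W" "\<not> nul p w" "\<not> nul r w" by blast
    have n1: "\<not> par q w q r"
    proof
      assume *: "par q w q r"
      have "par w r q r"
      proof (rule par_vertex)
        fix l assume l: "l \<in> V - {w, r}"
        show "par w l q r"
        proof (cases "l = q \<or> l = p")
          case True then show ?thesis using * pw[OF w(1)] by (auto simp: par_flip(1)[of w])
        next
          case False then show ?thesis using l WW[of w l] w by (intro nul_par) auto
        qed
      qed (use w V in auto)
      then have "par q r r w" using par_sym par_flip by blast
      from par_trans[OF this rw[OF w(1)] w(3)] have "par q r p q" .
      with np par_sym show False by blast
    qed
    have n2: "\<not> par q w p q"
    proof
      assume *: "par q w p q"
      have "par w p p q"
      proof (rule par_vertex)
        fix l assume l: "l \<in> V - {w, p}"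
        show "par w l p q"
        proof (cases "l = q \<or> l = r")
          case True then show ?thesis using * rw[OF w(1)] by (auto simp: par_flip(1)[of w])
        next
          case False then show ?thesis using l WW[of w l] w by (intro nul_par) auto
        qed
      qed (use w V in auto)
      then have "par p q p w" using par_sym par_flip by blast
      from par_trans[OF this pw[OF w(1)] w(2)] show False using np by blast
    qed
    \<comment> \<open>The edge \<open>q w\<close> is independent of \<open>q r\<close> and of
      \<open>p q\<close>. An edge from \<open>p\<close> to a further vertex is parallel to
      \<open>q w\<close> and \<open>q r\<close>, one from \<open>r\<close> to \<open>q w\<close> and
      \<open>p q\<close>; so both vanish.\<close>
    have z: "nul p x \<and> nul q x \<and> nul r x \<and> nul w x" if x: "x \<in> ?W" "x \<noteq> w" for x
    proof -
      have "par p x q w" "par r x q w" using x w V by (auto intro!: disj_par)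
      then have "nul p x" "nul r x" using nulI[OF _ pw[OF x(1)] n1] nulI[OF _ rw[OF x(1)] n2] by auto
      with qw[OF x(1)] WW[of w x] w x show ?thesis by auto
    qed
    show ?thesis
    proof (intro exI[of _ "{p, q, r, w}"] conjI ballI impI)
      show "card {p, q, r, w} = 4" using V w by auto
      fix i j assume ij: "i \<in> V" "j \<in> V" "i \<noteq> j" "\<not> (i \<in> {p, q, r, w} \<and> j \<in> {p, q, r, w})"
      have *: "nul i j" if "i \<in> V" "j \<in> V" "i \<noteq> j" "j \<notin> {p, q, r, w}" for i j
      proof (cases "i \<in> {p, q, r, w}")
        case True then show ?thesis using z[of j] that by auto
      next
        case False then show ?thesis using WW that by auto
      qed
      show "nul i j"
      proof (cases "j \<in> {p, q, r, w}")
        case False then show ?thesis using * ij by blast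
      next
        case True then show ?thesis using *[of j i] ij by (simp add: nul_flip)
      qed
    qed (use V w in auto)
  next
    case False
    have "(\<forall>x\<in>?W. nul r x) \<or> (\<forall>x\<in>?W. nul p x)"
    proof (cases "\<exists>w\<in>?W. \<not> nul p w")
      case True
      then obtain w where w: "w \<in> ?W" "\<not> nul p w" by blast
      have "nul r x" if x: "x \<in> ?W" for x
      proof (cases "x = w")
        case True then show ?thesis using False w by blast
      next
        case ne: False
        then have "par r x p w" using x w V by (intro disj_par) auto
        from par_trans[OF this pw[OF w(1)] w(2)] rw[OF x]
        show ?thesis using np nulI by blast
      qed
      then show ?thesis by blast
    qed blast
    then show ?thesis
    proof
      assume *: "\<forall>x\<in>?W. nul r x"
      have False by (rule no_flat[OF V np]) (use * in blast)
      then show ?thesis ..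
    next
      assume *: "\<forall>x\<in>?W. nul p x"
      have "\<not> par r q q p" using np par_sym by (auto simp: par_flip)
      then have False
        by (rule no_flat[rotated 4]) (use * V in \<open>auto simp: insert_commute\<close>)
      then show ?thesis ..
    qed
  qed
qed

end

section \<open>Reconstructing a permutation of points from a map of four-element subsets\<close>

section \<open>Maps of four-element subsets\<close>

lemma card4E:
  assumes "card Q = 4" obtains i j k l where "Q = {i, j, k, l}" "distinct [i, j, k, l]"
  using assms by (auto simp: card_Suc_eq numeral_eq_Suc)

lemma obtain_two:
  assumes "2 \<le> card P" obtains x y where "x \<in> P" "y \<in> P" "x \<noteq> y"
proof -
  have "finite P" using assms card.infinite by fastforce
  moreover have "\<not> card P \<le> Suc 0" using assms by simp
  ultimately show ?thesis using card_le_Suc0_iff_eq[of P] that by blast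
qed

text \<open>\<open>F\<close> stands for the map of supports induced by an automorphism. The
  five-point axiom records a linear relation between weights supported on three four-subsets of a
  five-set.\<close>

locale four_map =
  fixes V :: "'v set" and F :: "'v set \<Rightarrow> 'v set"
  assumes finV: "finite V"
    and F_sub: "Q \<subseteq> V \<Longrightarrow> card Q = 4 \<Longrightarrow> F Q \<subseteq> V" and F_card: "Q \<subseteq> V \<Longrightarrow> card Q = 4 \<Longrightarrow> card (F Q) = 4"
    and F_inj: "Q \<subseteq> V \<Longrightarrow> card Q = 4 \<Longrightarrow> Q' \<subseteq> V \<Longrightarrow> card Q' = 4 \<Longrightarrow> F Q = F Q' \<Longrightarrow> Q = Q'"
    and F_five: "P \<subseteq> V \<Longrightarrow> card P = 5 \<Longrightarrow> x \<in> P \<Longrightarrow> y \<in> P \<Longrightarrow> z \<in> P \<Longrightarrow> distinct [x, y, z] \<Longrightarrow>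
       F (P - {z}) \<subseteq> F (P - {x}) \<union> F (P - {y}) \<and> card (F (P - {x}) \<inter> F (P - {y})) = 3"
begin

definition U :: "'v set \<Rightarrow> 'v set" where
  "U P = \<Union> (F ` {Q. Q \<subseteq> P \<and> card Q = 4})"

lemma U_mono: "P \<subseteq> P' \<Longrightarrow> U P \<subseteq> U P'"
  by (auto simp: U_def)

lemma U_sub: "P \<subseteq> V \<Longrightarrow> U P \<subseteq> V"
  unfolding U_def using F_sub by blast

text \<open>Counting: when \<open>U P\<close> has as many points as \<open>P\<close>, the injective
  map \<open>F\<close> takes the four-subsets of \<open>P\<close> onto all four-subsets of
  \<open>U P\<close>. So \<open>U P\<close> determines the four-subsets of \<open>P\<close>, and
  these determine \<open>P\<close>.\<close>

lemma U_inj: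
  assumes "P \<subseteq> V" "P' \<subseteq> V" "card P = card P'" "4 \<le> card P" "card (U P) = card P" "U P = U P'"
  shows "P = P'"
proof -
  have fin: "finite P" "finite P'"
    using finite_subset[OF assms(1) finV] finite_subset[OF assms(2) finV] by auto
  have finU: "finite (U P)" using finite_subset[OF U_sub[OF assms(1)] finV] .
  have *: "F ` {Q. Q \<subseteq> R \<and> card Q = 4} = {Q. Q \<subseteq> U P \<and> card Q = 4}" if "R \<in> {P, P'}" for R
  proof (rule card_subset_eq)
    show "finite {Q. Q \<subseteq> U P \<and> card Q = 4}" using finU by auto
    have R: "R \<subseteq> V" "finite R" "U R = U P" "card R = card P" using that assms fin by auto
    show "F ` {Q. Q \<subseteq> R \<and> card Q = 4} \<subseteq> {Q. Q \<subseteq> U P \<and> card Q = 4}"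
    proof (rule image_subsetI)
      fix Q assume Q: "Q \<in> {Q. Q \<subseteq> R \<and> card Q = 4}"
      then have "F Q \<subseteq> U R" by (auto simp: U_def)
      moreover have "card (F Q) = 4" using Q R(1) by (intro F_card) auto
      ultimately show "F Q \<in> {Q. Q \<subseteq> U P \<and> card Q = 4}" using R(3) by simp
    qed
    have "inj_on F {Q. Q \<subseteq> R \<and> card Q = 4}" 
    proof (rule inj_onI)
      fix Q Q' assume "Q \<in> {Q. Q \<subseteq> R \<and> card Q = 4}" "Q' \<in> {Q. Q \<subseteq> R \<and> card Q = 4}" "F Q = F Q'"
      then show "Q = Q'" using F_inj[of Q Q'] R(1) by auto
    qed
    then show "card (F ` {Q. Q \<subseteq> R \<and> card Q = 4}) = card {Q. Q \<subseteq> U P \<and> card Q = 4}"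
      using R finU assms(5) by (simp add: card_image n_subsets)
  qed
  then have eq: "F ` {Q. Q \<subseteq> P \<and> card Q = 4} = F ` {Q. Q \<subseteq> P' \<and> card Q = 4}" by simp
  have sub: "R \<subseteq> R'" if R: "R \<subseteq> V" "R' \<subseteq> V" "finite R" "4 \<le> card R"
    and e: "F ` {Q. Q \<subseteq> R \<and> card Q = 4} = F ` {Q. Q \<subseteq> R' \<and> card Q = 4}" for R R'
  proof
    fix x assume x: "x \<in> R"
    have "3 \<le> card (R - {x})" using R x by simp
    then obtain T where T: "T \<subseteq> R - {x}" "card T = 3" by (meson obtain_subset_with_card_n)
    then have "finite T" using R finite_subset by blast
    with T have Q: "insert x T \<subseteq> R" "card (insert x T) = 4" using x by (auto simp: card_insert_if)
    then have "F (insert x T) \<in> F ` {Q. Q \<subseteq> R' \<and> card Q = 4}" unfolding e[symmetric] by blast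
    then obtain Q' where "Q' \<subseteq> R'" "card Q' = 4" "F (insert x T) = F Q'" by auto
    moreover have "insert x T \<subseteq> V" "Q' \<subseteq> V" using \<open>Q' \<subseteq> R'\<close> Q R by auto
    ultimately have "Q' \<subseteq> R'" "insert x T = Q'" using F_inj[of "insert x T" Q'] Q by auto
    then show "x \<in> R'" using \<open>Q' \<subseteq> R'\<close> by blast
  qed
  have "P \<subseteq> P'" by (rule sub[OF assms(1,2) fin(1) assms(4) eq])
  moreover have "P' \<subseteq> P" by (rule sub[OF assms(2,1) fin(2) _ eq[symmetric]]) (use assms in simp)
  ultimately show ?thesis by blast
qed

text \<open>Size five is the axiom. For larger \<open>P\<close> the images of \<open>P - {x}\<close>
  and \<open>P - {y}\<close> are different sets of equal size meeting in the image of
  \<open>P - {x, y}\<close>, which has one point less; hence their union gains exactly one point,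
  and it is shown to be all of \<open>U P\<close>.\<close>

theorem card_U: "P \<subseteq> V \<Longrightarrow> 4 \<le> card P \<Longrightarrow> card (U P) = card P"
proof (induction "card P" arbitrary: P rule: less_induct)
  case less
  have finP: "finite P" using less finV finite_subset by blast
  consider "card P = 4" | "card P = 5" | "6 \<le> card P" using less by linarith
  then show ?case
  proof cases
    case 1
    have "Q = P" if "Q \<subseteq> P" "card Q = 4" for Q using that 1 finP card_subset_eq by metis
    then have "{Q. Q \<subseteq> P \<and> card Q = 4} = {P}" using 1 by auto
    then show ?thesis using F_card less 1 by (simp add: U_def)
  next
    case 2
    then obtain x y where xy: "x \<in> P" "y \<in> P" "x \<noteq> y"
      using obtain_two[of P] by auto
    have U: "U P = F (P - {x}) \<union> F (P - {y})"
    proof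
      show "U P \<subseteq> F (P - {x}) \<union> F (P - {y})"
      proof
        fix v assume "v \<in> U P"
        then obtain Q where Q: "Q \<subseteq> P" "card Q = 4" "v \<in> F Q" by (auto simp: U_def)
        have "card (P - Q) = 1" using Q 2 finP finite_subset[OF Q(1) finP] by (simp add: card_Diff_subset)
        then obtain z where "P - Q = {z}" by (rule card_1_singletonE)
        then have z: "Q = P - {z}" "z \<in> P" using Q by auto
        then show "v \<in> F (P - {x}) \<union> F (P - {y})"
          using F_five[of P x y z] less 2 xy Q by (cases "z = x"; cases "z = y") auto
      qed
      have "P - {x} \<in> {Q. Q \<subseteq> P \<and> card Q = 4}" "P - {y} \<in> {Q. Q \<subseteq> P \<and> card Q = 4}"
        using xy 2 finP by auto
      then show "F (P - {x}) \<union> F (P - {y}) \<subseteq> U P" unfolding U_def by blast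
    qed
    have c: "card (F (P - {x})) = 4" "card (F (P - {y})) = 4"
      using F_card[of "P - {x}"] F_card[of "P - {y}"] less xy 2 finP by auto
    obtain z where "z \<in> P" "distinct [x, y, z]"
    proof -
      have "card (P - {x, y}) = 3" using xy 2 finP by (simp add: card_Diff_subset)
      then have "P - {x, y} \<noteq> {}" by (metis card.empty zero_neq_numeral)
      then show ?thesis using that xy by auto
    qed
    then have "card (F (P - {x}) \<inter> F (P - {y})) = 3" using F_five[of P x y z] less 2 xy by blast
    moreover have "finite (F (P - {x}))" "finite (F (P - {y}))" using c card.infinite by fastforce+
    ultimately show ?thesis using card_Un_Int[of "F (P - {x})" "F (P - {y})"] c U 2 by simp
  next
    case 3
    define m where "m = card P - 1"
    have m: "card P = Suc m" "5 \<le> m" using 3 by (auto simp: m_def)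
    have Ux: "card (U (P - {x})) = m" "card (P - {x}) = m" if "x \<in> P" for x
      using less(1)[of "P - {x}"] that finP m less(2) by auto
    have Uxy: "card (U (P - {x, y})) = m - 1" "card (P - {x, y}) = m - 1" if "x \<in> P" "y \<in> P" "x \<noteq> y" for x y
    proof -
      show c: "card (P - {x, y}) = m - 1" using that finP m by (simp add: card_Diff_subset)
      have "P - {x, y} \<subseteq> V" "m - 1 < Suc m" "4 \<le> m - 1" using less(2) m by auto
      then show "card (U (P - {x, y})) = m - 1" using less(1)[of "P - {x, y}"] m(1) c by simp
    qed
    have finU: "finite (U R)" if "R \<subseteq> P" for R
      by (rule finite_subset[OF U_sub finV]) (use that less(2) in blast)
    obtain x y where xy: "x \<in> P" "y \<in> P" "x \<noteq> y"
      using obtain_two[of P] m by auto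
    have int: "U (P - {u}) \<inter> U (P - {v}) = U (P - {u, v})" if uv: "u \<in> P" "v \<in> P" "u \<noteq> v" for u v
    proof (rule HOL.sym, rule card_seteq)
      show "finite (U (P - {u}) \<inter> U (P - {v}))" using finU by blast
      show "U (P - {u, v}) \<subseteq> U (P - {u}) \<inter> U (P - {v})" by (intro Int_greatest U_mono) auto
      have "P - {u} \<noteq> P - {v}" using uv by blast
      then have "U (P - {u}) \<noteq> U (P - {v})"
        using U_inj[of "P - {u}" "P - {v}"] Ux uv less(2) m by auto
      then have "U (P - {u}) \<inter> U (P - {v}) \<subset> U (P - {u})"
        using Ux[OF uv(1)] Ux[OF uv(2)] finU[of "P - {v}"] card_subset_eq[of "U (P - {v})" "U (P - {u})"] by auto
      then have "card (U (P - {u}) \<inter> U (P - {v})) < m"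
        using psubset_card_mono[OF finU[of "P - {u}"]] Ux uv by auto
      then show "card (U (P - {u}) \<inter> U (P - {v})) \<le> card (U (P - {u, v}))" using Uxy uv by auto
    qed
    have "U P = U (P - {x}) \<union> U (P - {y})"
    proof
      show "U (P - {x}) \<union> U (P - {y}) \<subseteq> U P" by (intro Un_least U_mono) auto
      \<comment> \<open>\<open>U (P - {w})\<close> has \<open>m\<close> points and contains the
        different sets \<open>?A\<close> and \<open>?B\<close> of \<open>m - 1\<close> points each,
        so it is their union; each of them lies in one of the two images.\<close>
      have w: "U (P - {w}) \<subseteq> U (P - {x}) \<union> U (P - {y})" if w: "w \<in> P" for w
      proof (cases "w = x \<or> w = y")
        case False
        let ?A = "U (P - {x, w})" and ?B = "U (P - {y, w})"
        have ne: "x \<noteq> w" "y \<noteq> w" using False by auto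
        note U1 = Uxy[OF xy(1) w ne(1)] and U2 = Uxy[OF xy(2) w ne(2)]
        have AB: "?A \<noteq> ?B"
        proof
          assume eq: "?A = ?B"
          have "P - {x, w} = P - {y, w}"
          proof (rule U_inj)
            show "P - {x, w} \<subseteq> V" "P - {y, w} \<subseteq> V" using less(2) by auto
            show "card (P - {x, w}) = card (P - {y, w})" using U1(2) U2(2) by linarith
            show "4 \<le> card (P - {x, w})" using U1(2) m by linarith
            show "card (U (P - {x, w})) = card (P - {x, w})" using U1 by linarith
          qed (rule eq)
          then show False using xy False by blast
        qed
        have c: "card ?A = m - 1" "card ?B = m - 1" by (rule U1, rule U2)
        have fins: "finite ?A" "finite ?B" "finite (U (P - {w}))" by (auto intro!: finU)
        have "?A \<union> ?B = U (P - {w})"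
        proof (rule card_seteq)
          show "?A \<union> ?B \<subseteq> U (P - {w})" by (intro Un_least U_mono) auto
          have "\<not> ?B \<subseteq> ?A" using AB c card_subset_eq[OF fins(1), of ?B] by auto
          then have "?A \<subset> ?A \<union> ?B" by blast
          then have "card ?A < card (?A \<union> ?B)" using fins by (intro psubset_card_mono) auto
          then show "card (U (P - {w})) \<le> card (?A \<union> ?B)" using Ux(1)[OF w] c by linarith
        qed (use fins in auto)
        moreover have "?A \<subseteq> U (P - {x})" by (rule U_mono) auto
        moreover have "?B \<subseteq> U (P - {y})" by (rule U_mono) auto
        ultimately show ?thesis by blast
      qed auto
      show "U P \<subseteq> U (P - {x}) \<union> U (P - {y})"
      proof
        fix v assume "v \<in> U P"
        then obtain Q where Q: "Q \<subseteq> P" "card Q = 4" "v \<in> F Q" by (auto simp: U_def)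
        then have "Q \<noteq> P" using m by auto
        then obtain w where "w \<in> P" "Q \<subseteq> P - {w}" using Q by auto
        then have "v \<in> U (P - {w})" using Q by (auto simp: U_def)
        then show "v \<in> U (P - {x}) \<union> U (P - {y})" using w \<open>w \<in> P\<close> by blast
      qed
    qed
    moreover have "card (U (P - {x}) \<union> U (P - {y})) + card (U (P - {x, y})) = m + m"
      using card_Un_Int[of "U (P - {x})" "U (P - {y})"] finU Ux xy int[OF xy] by simp
    ultimately show ?thesis using Uxy[OF xy] m by simp
  qed
qed

text \<open>\<open>\<kappa> k\<close> is the single point missing from \<open>U (V - {k})\<close>,
  which contains \<open>F Q\<close> for every four-subset \<open>Q\<close> avoiding
  \<open>k\<close>.\<close>

theorem point_map:
  assumes "5 \<le> card V"
  obtains \<kappa> where "inj_on \<kappa> V" "\<kappa> ` V \<subseteq> V"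
    "\<And>k Q. k \<in> V \<Longrightarrow> Q \<subseteq> V \<Longrightarrow> card Q = 4 \<Longrightarrow> k \<notin> Q \<Longrightarrow> \<kappa> k \<notin> F Q"
proof -
  have "\<exists>k'. k' \<in> V \<and> U (V - {k}) = V - {k'}" if k: "k \<in> V" for k
  proof -
    have c: "card (U (V - {k})) = card V - 1" using card_U[of "V - {k}"] k assms finV by simp
    have s: "U (V - {k}) \<subseteq> V" by (rule U_sub) auto
    then have "card (V - U (V - {k})) = 1"
      using c assms finV by (subst card_Diff_subset) (auto intro: finite_subset)
    then obtain k' where "V - U (V - {k}) = {k'}" by (rule card_1_singletonE)
    then show ?thesis using s by (intro exI[of _ k']) auto
  qed
  then obtain \<kappa> where \<kappa>: "\<And>k. k \<in> V \<Longrightarrow> \<kappa> k \<in> V \<and> U (V - {k}) = V - {\<kappa> k}" by metis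
  have "inj_on \<kappa> V"
  proof (rule inj_onI)
    fix x y assume xy: "x \<in> V" "y \<in> V" "\<kappa> x = \<kappa> y"
    then have "U (V - {x}) = U (V - {y})" using \<kappa> by auto
    then have "V - {x} = V - {y}"
      using U_inj[of "V - {x}" "V - {y}"] card_U[of "V - {x}"] xy assms finV by auto
    then show "x = y" using xy by auto
  qed
  moreover have "\<kappa> k \<notin> F Q" if "k \<in> V" "Q \<subseteq> V" "card Q = 4" "k \<notin> Q" for k Q
  proof -
    have "F Q \<subseteq> U (V - {k})" using that by (auto simp: U_def)
    then show ?thesis using \<kappa> that by auto
  qed
  ultimately show ?thesis using that \<kappa> by blast
qed

end

section \<open>Integral cohomology as edge weights on the strands together with infinity\<close>

section \<open>The first cohomology of the pure braid group\<close>

text \<open>\<open>- tsum n j\<close> is the element A_{0,j}, so that 0 becomes a vertex like the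
  others.\<close>

definition ed :: "nat \<Rightarrow> nat \<Rightarrow> nat \<Rightarrow> braid" where
  "ed n i j = (if i = j then 0 else if i = 0 then - tsum n j else if j = 0 then - tsum n i else gg i j)"

lemma gg_sym: "gg i j = gg j i"
  by (simp add: gg_def min.commute max.commute)

lemma ed_sym: "ed n i j = ed n j i"
  by (simp add: ed_def gg_sym)

lemma ed_pures: "i \<le> n \<Longrightarrow> j \<le> n \<Longrightarrow> ed n i j \<in> pures n"
  by (auto simp: ed_def intro!: pures_uminus tsum_pures gg_pures)

lemma ed_pgen: "1 \<le> i \<Longrightarrow> i < j \<Longrightarrow> ed n i j = pgen i j"
  by (simp add: ed_def gg_def)

lemma lnk_gg: "1 \<le> i \<Longrightarrow> 1 \<le> j \<Longrightarrow> i \<noteq> j \<Longrightarrow> p \<noteq> q \<Longrightarrow>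
    lnk p q (gg i j) = (if p = i \<and> q = j \<or> p = j \<and> q = i then 1 else 0)"
  by (auto simp: gg_def lnk_pgen min_def max_def)

lemma additive_sum_list:
  assumes "additive_on (pures n) h" "set xs \<subseteq> pures n"
  shows "h (sum_list xs) = sum_list (map h xs)"
  using assms(2)
proof (induction xs)
  case Nil then show ?case using additive_sub(1)[OF assms(1) subgrp_pures] by simp
next
  case (Cons x xs)
  then have "sum_list xs \<in> pures n" by (intro sum_list_pures) auto
  then show ?case using Cons additive_sub(4)[OF assms(1) subgrp_pures] by simp
qed

lemma additive_tsum:
  assumes "additive_on (pures n) h" "1 \<le> i" "i \<le> n"
  shows "h (tsum n i) = (\<Sum>j\<in>{1..n}. h (gg j i) :: int)"
proof -
  have "h (tsum n i) = sum_list (map (\<lambda>j. h (gg j i)) [1..<n + 1])"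
    unfolding tsum_def using assms
    by (subst additive_sum_list[OF assms(1)]) (auto simp: comp_def intro!: gg_pures)
  also have "\<dots> = (\<Sum>j\<in>set [1..<n + 1]. h (gg j i))" by (rule sum_list_distinct_conv_sum_set) simp
  also have "set [1..<n + 1] = {1..n}" by auto
  finally show ?thesis .
qed

lemma lnk_tsum:
  assumes "1 \<le> j" "j \<le> n" "1 \<le> p" "p \<le> n" "1 \<le> q" "q \<le> n" "p \<noteq> q"
  shows "lnk p q (tsum n j) = (if j = p \<or> j = q then 1 else 0)"
proof -
  have "lnk p q (tsum n j) = (\<Sum>i\<in>{1..n}. lnk p q (gg i j))"
    by (rule additive_tsum[OF additive_lnk]) (use assms in auto)
  also have "\<dots> = (\<Sum>i\<in>{1..n}. if i = p \<and> j = q \<or> i = q \<and> j = p then 1 else 0)"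
  proof (rule sum.cong)
    fix i assume i: "i \<in> {1..n}"
    show "lnk p q (gg i j) = (if i = p \<and> j = q \<or> i = q \<and> j = p then 1 else 0)"
      using assms i by (cases "i = j") (auto simp: lnk_gg)
  qed simp
  also have "\<dots> = (\<Sum>i\<in>{1..n}. (if i = p then if j = q then 1 else 0 else 0) + (if i = q then if j = p then 1 else 0 else 0))"
    using assms by (intro sum.cong) auto
  also have "\<dots> = (if j = p \<or> j = q then 1 else 0)"
    using assms by (simp add: sum.distrib sum.delta')
  finally show ?thesis .
qed

text \<open>The linking numbers are the basis dual to the pure generators.\<close>

lemma additive_formula:
  fixes h :: "braid \<Rightarrow> int"
  assumes "additive_on (pures n) h" "x \<in> pures n"
  shows "h x = (\<Sum>p\<in>{1..n}. \<Sum>q\<in>{1..n}. if p < q then h (pgen p q) * lnk p q x else 0)"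
proof (rule additive_on_eqI[OF assms(1) _ _ assms(2)])
  show "additive_on (pures n) (\<lambda>x. \<Sum>p\<in>{1..n}. \<Sum>q\<in>{1..n}. if p < q then h (pgen p q) * lnk p q x else 0)"
    unfolding additive_on_def
    by (auto simp: lnk_pure_add distrib_left sum.distrib[symmetric] intro!: sum.cong)
  fix i j assume ij: "1 \<le> i" "i < j" "j \<le> n"
  have "(\<Sum>p\<in>{1..n}. \<Sum>q\<in>{1..n}. if p < q then h (pgen p q) * lnk p q (pgen i j) else 0)
      = (\<Sum>p\<in>{1..n}. \<Sum>q\<in>{1..n}. if q = j then if p = i then h (pgen p q) else 0 else 0)"
    using ij by (intro sum.cong) (auto simp: lnk_pgen)
  also have "\<dots> = h (pgen i j)" using ij by (simp add: sum.delta')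
  finally show "h (pgen i j) = (\<Sum>p\<in>{1..n}. \<Sum>q\<in>{1..n}. if p < q then h (pgen p q) * lnk p q (pgen i j) else 0)" ..
qed

lemma additive_eq_of_lnk:
  fixes h :: "braid \<Rightarrow> int"
  assumes "additive_on (pures n) h" "x \<in> pures n" "y \<in> pures n"
    "\<And>p q. 1 \<le> p \<Longrightarrow> p < q \<Longrightarrow> q \<le> n \<Longrightarrow> lnk p q x = lnk p q y"
  shows "h x = h y"
  unfolding additive_formula[OF assms(1,2)] additive_formula[OF assms(1,3)]
  using assms(4) by (intro sum.cong) auto

text \<open>At a vertex other than 0 the sum vanishes by the choice of the element at infinity. At 0
  each pair of strands is counted from both its ends, so the sum is the value of \<open>h\<close> at
  minus twice the full twist.\<close>

lemma vertex_sum: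
  fixes h :: "braid \<Rightarrow> int"
  assumes "additive_on (pures n) h" "h (zn n) = 0" "i \<le> n"
  shows "(\<Sum>j\<in>{0..n} - {i}. h (ed n i j)) = 0"
proof (cases "i = 0")
  case False
  have V: "{0..n} - {i} = insert 0 ({1..n} - {i})" using False by auto
  have t: "tsum n i \<in> pures n" using False assms by (intro tsum_pures) auto
  have "h (tsum n i) = h (gg i i) + (\<Sum>j\<in>{1..n} - {i}. h (gg j i))"
    using False assms by (simp add: additive_tsum sum.remove[of "{1..n}" i])
  moreover have "(\<Sum>j\<in>{1..n} - {i}. h (ed n i j)) = (\<Sum>j\<in>{1..n} - {i}. h (gg j i))"
    using False by (intro sum.cong) (auto simp: ed_def gg_sym)
  ultimately show ?thesis
    using False t unfolding V by (simp add: ed_def additive_sub[OF assms(1) subgrp_pures])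
next
  case True
  let ?x = "sum_list (map (tsum n) [1..<n + 1])"
  have x: "set (map (tsum n) [1..<n + 1]) \<subseteq> pures n" by (auto intro!: tsum_pures)
  have z: "zn n \<in> pures n" by (rule zn_pures) simp
  have s: "h ?x = (\<Sum>j\<in>{1..n}. h (tsum n j))" if "additive_on (pures n) h" for h :: "braid \<Rightarrow> int"
  proof -
    have "h ?x = sum_list (map (\<lambda>j. h (tsum n j)) [1..<n + 1])"
      using additive_sum_list[OF that x] by (simp add: comp_def del: upt_Suc)
    also have "\<dots> = (\<Sum>j\<in>set [1..<n + 1]. h (tsum n j))" by (rule sum_list_distinct_conv_sum_set) simp
    also have "set [1..<n + 1] = {1..n}" by auto
    finally show ?thesis .
  qed
  have "h ?x = h (zn n + zn n)"
  proof (rule additive_eq_of_lnk[OF assms(1)])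
    fix p q assume pq: "1 \<le> p" "p < q" "q \<le> n"
    have "lnk p q ?x = (\<Sum>j\<in>{1..n}. if j = p \<or> j = q then 1 else 0)"
      unfolding s[OF additive_lnk] using pq by (intro sum.cong) (auto simp: lnk_tsum)
    also have "\<dots> = (\<Sum>j\<in>{1..n}. (if j = p then 1 else 0) + (if j = q then 1 else 0))"
      using pq by (intro sum.cong) auto
    also have "\<dots> = 2" using pq by (simp add: sum.distrib)
    finally show "lnk p q ?x = lnk p q (zn n + zn n)" using pq by (simp add: lnk_pure_add[OF z] lnk_zn)
  qed (use sum_list_pures[OF x] z in \<open>auto intro: pures_add\<close>)
  then have "(\<Sum>j\<in>{1..n}. h (tsum n j)) = 0"
    using s[OF assms(1)] additive_sub(4)[OF assms(1) subgrp_pures z z] assms(2) by simp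
  moreover have "(\<Sum>j\<in>{0..n} - {0}. h (ed n 0 j)) = (\<Sum>j\<in>{1..n}. - h (tsum n j))"
    by (rule sum.cong) (auto simp: ed_def additive_sub[OF assms(1) subgrp_pures] tsum_pures)
  ultimately show ?thesis using True by (simp add: sum_negf)
qed

text \<open>The classes that vanish on the full twist and are supported on the edges inside
  \<open>Q\<close>. For a four-element \<open>Q\<close> this is the plane pulled back along
  forgetting all other vertices.\<close>

definition SQ :: "nat \<Rightarrow> nat set \<Rightarrow> (braid \<Rightarrow> int) set" where
  "SQ n Q = {h. additive_on (pures n) h \<and> h (zn n) = 0 \<and>
     (\<forall>i\<le>n. \<forall>j\<le>n. i \<noteq> j \<longrightarrow> \<not> (i \<in> Q \<and> j \<in> Q) \<longrightarrow> h (ed n i j) = 0)}"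

lemma additive_eq_of_ed:
  fixes h h' :: "braid \<Rightarrow> int"
  assumes "additive_on (pures n) h" "additive_on (pures n) h'"
    "\<And>i j. i \<le> n \<Longrightarrow> j \<le> n \<Longrightarrow> i \<noteq> j \<Longrightarrow> h (ed n i j) = h' (ed n i j)" "x \<in> pures n"
  shows "h x = h' x"
proof (rule additive_on_eqI[OF assms(1,2) _ assms(4)])
  fix i j assume "1 \<le> i" "i < j" "j \<le> n"
  then show "h (pgen i j) = h' (pgen i j)" using assms(3)[of i j] ed_pgen[of i j n] by simp
qed

definition ind :: "nat \<Rightarrow> nat \<Rightarrow> nat \<Rightarrow> nat \<Rightarrow> int" where
  "ind i j p q = (if i = p \<and> j = q \<or> i = q \<and> j = p then 1 else 0)"

text \<open>Edges at infinity get no linking number of their own: their weights are dictated by the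
  vertex sums, and the corrections in \<open>lk0_ed\<close> cancel in the alternating sums
  \<open>cyc\<close>.\<close>

definition lk0 :: "nat \<Rightarrow> nat \<Rightarrow> braid \<Rightarrow> int" where
  "lk0 i j x = (if i = 0 \<or> j = 0 then 0 else lnk i j x)"

text \<open>Alternating signs around a four-cycle make every vertex sum vanish; by
  \<open>SQ_decomp\<close> two such cycles on the same points form a basis of the plane.\<close>

definition cyc :: "nat \<Rightarrow> nat \<Rightarrow> nat \<Rightarrow> nat \<Rightarrow> braid \<Rightarrow> int" where
  "cyc i j k l x = lk0 i j x - lk0 j k x + lk0 k l x - lk0 l i x"

lemma additive_lk0: "additive_on (pures n) (lk0 i j)"
  using additive_lnk by (auto simp: additive_on_def lk0_def)

lemma additive_cyc: "additive_on (pures n) (cyc i j k l)"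
  using additive_lk0 unfolding additive_on_def cyc_def by fastforce

lemma lk0_ed:
  assumes "i \<le> n" "j \<le> n" "i \<noteq> j" "q \<le> n" "1 \<le> q"
  shows "1 \<le> p \<Longrightarrow> p \<le> n \<Longrightarrow> p \<noteq> q \<Longrightarrow> lk0 i j (ed n p q) = ind i j p q"
    and "lk0 i j (ed n 0 q) = ind i j 0 q - of_bool (q = i) - of_bool (q = j)"
proof -
  show "1 \<le> p \<Longrightarrow> p \<le> n \<Longrightarrow> p \<noteq> q \<Longrightarrow> lk0 i j (ed n p q) = ind i j p q"
    using assms by (auto simp: lk0_def ed_def ind_def lnk_gg)
  have "tsum n q \<in> pures n" using assms by (intro tsum_pures)
  then have *: "lnk i j (- tsum n q) = - lnk i j (tsum n q)" by (rule lnk_pure_uminus)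
  show "lk0 i j (ed n 0 q) = ind i j 0 q - of_bool (q = i) - of_bool (q = j)"
  proof (cases "i = 0 \<or> j = 0")
    case True then show ?thesis using assms by (auto simp: lk0_def ind_def)
  next
    case False then show ?thesis using assms by (auto simp: lk0_def ed_def ind_def * lnk_tsum)
  qed
qed

lemma cyc_ed:
  assumes "i \<le> n" "j \<le> n" "k \<le> n" "l \<le> n" "distinct [i, j, k, l]" "p \<le> n" "q \<le> n" "p \<noteq> q"
  shows "cyc i j k l (ed n p q) = ind i j p q - ind j k p q + ind k l p q - ind l i p q"
proof -
  have 0: "cyc i j k l (ed n 0 q) = ind i j 0 q - ind j k 0 q + ind k l 0 q - ind l i 0 q" if "q \<le> n" "1 \<le> q" for q
    using assms that by (simp add: cyc_def lk0_ed)
  have ind: "ind a b p q = ind a b q p" for a b p q by (auto simp: ind_def)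
  consider "p = 0" | "q = 0" | "1 \<le> p" "1 \<le> q" by linarith
  then show ?thesis
  proof cases
    case 2
    then show ?thesis using 0[of p] assms by (simp add: ed_sym[of n p 0] ind[of _ _ p 0])
  qed (use 0[of q] assms lk0_ed(1)[of _ n _ q p] in \<open>auto simp: cyc_def\<close>)
qed

lemma cyc_zn:
  assumes "i \<le> n" "j \<le> n" "k \<le> n" "l \<le> n" "distinct [i, j, k, l]"
  shows "cyc i j k l (zn n) = 0"
proof -
  have "lnk a b (zn n) = 1" if "1 \<le> a" "a \<le> n" "1 \<le> b" "b \<le> n" "a \<noteq> b" for a b
    using lnk_zn[of a b n] lnk_zn[of b a n] lnk_sym[OF zn_pures[of n n], of a b] that by (cases "a < b") auto
  then have "lk0 a b (zn n) = 1 - of_bool (a = 0) - of_bool (b = 0)" if "a \<le> n" "b \<le> n" "a \<noteq> b" for a b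
    using that by (auto simp: lk0_def)
  then show ?thesis using assms by (simp add: cyc_def)
qed

lemma cyc_SQ:
  assumes "i \<le> n" "j \<le> n" "k \<le> n" "l \<le> n" "distinct [i, j, k, l]"
  shows "cyc i j k l \<in> SQ n {i, j, k, l}"
  unfolding SQ_def
proof (intro CollectI conjI allI impI)
  fix p q assume pq: "p \<le> n" "q \<le> n" "p \<noteq> q" "\<not> (p \<in> {i, j, k, l} \<and> q \<in> {i, j, k, l})"
  then have "ind a b p q = 0" if "a \<in> {i, j, k, l}" "b \<in> {i, j, k, l}" for a b
    using that by (auto simp: ind_def)
  then show "cyc i j k l (ed n p q) = 0" using cyc_ed[OF assms pq(1-3)] by simp
qed (use assms in \<open>auto simp: additive_cyc cyc_zn\<close>)

text \<open>The four vertex equations force opposite edges to have equal weights and the three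
  opposite pairs to add up to 0. So the weights of \<open>i j\<close> and \<open>i k\<close>
  determine all others.\<close>

lemma SQ_decomp:
  assumes "h \<in> SQ n {i, j, k, l}" "i \<le> n" "j \<le> n" "k \<le> n" "l \<le> n" "distinct [i, j, k, l]" "x \<in> pures n"
  shows "h x = h (ed n i j) * cyc i j k l x + h (ed n i k) * cyc i k j l x"
proof -
  let ?w = "\<lambda>p q. h (ed n p q)"
  have h: "additive_on (pures n) h" "h (zn n) = 0" using assms by (auto simp: SQ_def)
  have row: "?w a b + ?w a c + ?w a d = 0" if "{a, b, c, d} = {i, j, k, l}" "distinct [a, b, c, d]" for a b c d
  proof -
    have a: "a \<le> n" "{b, c, d} \<subseteq> {0..n} - {a}" using that assms by auto
    have "(\<Sum>q\<in>{0..n} - {a}. ?w a q) = (\<Sum>q\<in>{b, c, d}. ?w a q)"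
    proof (rule sum.mono_neutral_right)
      show "\<forall>q\<in>{0..n} - {a} - {b, c, d}. ?w a q = 0"
      proof
        fix q assume q: "q \<in> {0..n} - {a} - {b, c, d}"
        then have "q \<notin> {i, j, k, l}" using that by auto
        then show "?w a q = 0" using assms(1) q a(1) by (auto simp: SQ_def)
      qed
    qed (use a in auto)
    then show ?thesis using vertex_sum[OF h a(1)] that by (simp add: add.assoc)
  qed
  have s: "?w a b = ?w b a" for a b by (simp add: ed_sym)
  have 1: "?w i j + ?w i k + ?w i l = 0" and 2: "?w i j + ?w j k + ?w j l = 0"
    and 3: "?w i k + ?w j k + ?w k l = 0" and 4: "?w i l + ?w j l + ?w k l = 0"
    using row[of i j k l] row[of j i k l] row[of k i j l] row[of l i j k] assms(6) s[of j i] s[of k i] s[of k j] s[of l i] s[of l j] s[of l k]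
    by (auto simp: insert_commute)
  show ?thesis
  proof (rule additive_eq_of_ed[OF h(1) _ _ assms(7)])
    show "additive_on (pures n) (\<lambda>x. ?w i j * cyc i j k l x + ?w i k * cyc i k j l x)"
      using additive_cyc[of n i j k l] additive_cyc[of n i k j l] by (auto simp: additive_on_def algebra_simps)
    fix p q assume pq: "p \<le> n" "q \<le> n" "p \<noteq> q"
    have c: "cyc i j k l (ed n p q) = ind i j p q - ind j k p q + ind k l p q - ind l i p q"
      "cyc i k j l (ed n p q) = ind i k p q - ind k j p q + ind j l p q - ind l i p q"
      using assms pq by (auto intro!: cyc_ed)
    show "?w p q = ?w i j * cyc i j k l (ed n p q) + ?w i k * cyc i k j l (ed n p q)"
    proof (cases "p \<in> {i, j, k, l} \<and> q \<in> {i, j, k, l}")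
      case False
      then have "?w p q = 0" using assms(1) pq by (auto simp: SQ_def)
      moreover have "ind a b p q = 0" if "a \<in> {i, j, k, l}" "b \<in> {i, j, k, l}" for a b
        using False that by (auto simp: ind_def)
      ultimately show ?thesis unfolding c by simp
    next
      case True
      then show ?thesis unfolding c
        using assms(6) pq 1 2 3 4 s[of j i] s[of k i] s[of k j] s[of l i] s[of l j] s[of l k]
        by (elim conjE insertE emptyE) (simp_all add: ind_def)
    qed
  qed
qed

subsection \<open>Isotropy\<close>

text \<open>Deleting all other strands leads to three strands, which modulo the full twist form a
  free group of rank two; there commuting elements have proportional exponent sums. The differences
  of linking numbers are the combinations that vanish on the full twist.\<close>

lemma triple_isotropic:
  assumes "x \<in> pures n" "y \<in> pures n" "commute x y" "{i, j, l} \<subseteq> {1..n}" "distinct [i, j, l]"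
  shows "(lnk i j x - lnk i l x) * (lnk j l y - lnk i l y) = (lnk i j y - lnk i l y) * (lnk j l x - lnk i l x)"
  using assms
proof (induction n arbitrary: x y i j l)
  case 0 then show ?case by simp
next
  case (Suc n)
  show ?case
  proof (cases "\<exists>k\<in>{1..Suc n}. k \<notin> {i, j, l}")
    case True
    then obtain k where k: "k \<in> {1..Suc n}" "k \<noteq> i" "k \<noteq> j" "k \<noteq> l" by auto
    have d: "lnk (shift_index k p) (shift_index k q) (del k a) = lnk p q a"
      if "p \<in> {i, j, l}" "q \<in> {i, j, l}" "a \<in> {x, y}" for p q a
      using lnk_del[of a "Suc n" k p q] that k Suc.prems by auto
    have "(lnk (shift_index k i) (shift_index k j) (del k x) - lnk (shift_index k i) (shift_index k l) (del k x)) *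
        (lnk (shift_index k j) (shift_index k l) (del k y) - lnk (shift_index k i) (shift_index k l) (del k y)) =
        (lnk (shift_index k i) (shift_index k j) (del k y) - lnk (shift_index k i) (shift_index k l) (del k y)) *
        (lnk (shift_index k j) (shift_index k l) (del k x) - lnk (shift_index k i) (shift_index k l) (del k x))"
    proof (rule Suc.IH)
      show "del k x \<in> pures n" "del k y \<in> pures n" using del_pures[of _ "Suc n" k] Suc.prems k by auto
      show "commute (del k x) (del k y)"
        using Suc.prems k by (simp add: commute_def flip: del_pure_add[of _ "Suc n"])
      show "{shift_index k i, shift_index k j, shift_index k l} \<subseteq> {1..n}"
        using Suc.prems k by (auto simp: shift_index_def)
      show "distinct [shift_index k i, shift_index k j, shift_index k l]"
        using Suc.prems k by (auto simp: shift_index_def)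
    qed
    then show ?thesis by (simp add: d)
  next
    case False
    then have eq: "{1..Suc n} = {i, j, l}" using Suc.prems by auto
    then have "card {1..Suc n} = 3" using Suc.prems by simp
    then have n: "Suc n = 3" by simp
    have x: "x \<in> pures 3" "y \<in> pures 3" using Suc.prems n by auto
    have z: "zn 3 \<in> pures 3" by (rule zn_pures) simp
    \<comment> \<open>The multiple of the full twist is chosen to unlink strands 2 and 3, so that
      \<open>del 1\<close> becomes trivial and free coordinates exist.\<close>
    define r where "r a = a - imul (lnk 2 3 a) (zn 3)" for a
    have rK: "\<exists>w. r a = kap 3 w \<and> trunc 3 w = w" if a: "a \<in> pures 3" for a
    proof -
      have ra: "r a \<in> pures 3" unfolding r_def using a z by (intro pures_diff imul_pures)
      have "lnk 2 3 (r a) = 0"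
        unfolding r_def using additive_diff[OF additive_lnk a imul_pures[OF z]] additive_imul[OF additive_lnk z]
        by (simp add: imul_int lnk_zn)
      moreover have "shift_index 1 2 = 1" "shift_index 1 3 = 2" by (simp_all add: shift_index_def One_nat_def)
      ultimately have "lnk 1 2 (del 1 (r a)) = 0" using lnk_del[OF ra, of 1 2 3] by simp
      then have "del 1 (r a) = 0" using pures_2[of "del 1 (r a)"] del_pures[OF ra, of 1] by simp
      then have "r a \<in> K 3 1" using ra by (simp add: K_def dd_def)
      then show ?thesis using K_1[of 3] kap_trunc trunc_trunc by (metis imageE one_le_numeral)
    qed
    obtain u where u: "r x = kap 3 u" "trunc 3 u = u" using rK x by blast
    obtain v where v: "r y = kap 3 v" "trunc 3 v = v" using rK x by blast
    have c: "commute (r x) (r y)" unfolding r_def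
      using Suc.prems(3) zn_central[OF x(1)] zn_central[OF x(2)]
      by (intro commute_diff commute_diff_left commute_imul commute_sym[OF commute_imul[OF _]]) (auto intro: commute_sym commute_imul)
    have "kap 3 (u + v) = kap 3 (v + u)" using c u v by (simp add: commute_def)
    then have "commute u v" using kap_eq_iff[of 3 "u + v" "v + u"] u v by (simp add: commute_def)
    then have e: "esum 1 u * esum 2 v = esum 1 v * esum 2 u" by (rule commute_esum) simp
    have lr: "lnk p q (r a) = lnk p q a - lnk 2 3 a" if "a \<in> pures 3" "1 \<le> p" "p < q" "q \<le> 3" for a p q
      unfolding r_def using that additive_diff[OF additive_lnk that(1) imul_pures[OF z]] additive_imul[OF additive_lnk z]
      by (simp add: imul_int lnk_zn)
    have "esum 1 u = lnk 1 2 (r x)" "esum 2 u = lnk 1 3 (r x)" "esum 1 v = lnk 1 2 (r y)" "esum 2 v = lnk 1 3 (r y)"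
      using lnk_kap[of 1 3] lnk_kap[of 2 3] u v by simp_all
    then have "esum 1 u = lnk 1 2 x - lnk 2 3 x" "esum 2 u = lnk 1 3 x - lnk 2 3 x"
      "esum 1 v = lnk 1 2 y - lnk 2 3 y" "esum 2 v = lnk 1 3 y - lnk 2 3 y"
      using lr x by simp_all
    with e have e': "(lnk 1 2 x - lnk 2 3 x) * (lnk 1 3 y - lnk 2 3 y) = (lnk 1 2 y - lnk 2 3 y) * (lnk 1 3 x - lnk 2 3 x)"
      by simp
    have s: "lnk 2 1 a = lnk 1 2 a" "lnk 3 1 a = lnk 1 3 a" "lnk 3 2 a = lnk 2 3 a" if "a \<in> {x, y}" for a
      using lnk_sym x that by auto
    have "{1..3::nat} = {1, 2, 3}" by auto
    then have "i \<in> {1, 2, 3}" "j \<in> {1, 2, 3}" "l \<in> {1, 2, 3}" using eq n by auto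
    then show ?thesis using Suc.prems(5) s[of x] s[of y] e'
      by (elim insertE emptyE) (simp_all add: algebra_simps)
  qed
qed

lemma lnk_tht:
  assumes "x \<in> pures n" "2 \<le> p" "p < q" "q \<le> n"
  shows "lnk p q (tht n x) = lnk p q x - lnk 1 p x - lnk 1 q x"
proof (rule additive_on_eqI[OF _ _ _ assms(1)])
  have n: "1 \<le> n" using assms by simp
  show "additive_on (pures n) (\<lambda>x. lnk p q (tht n x))"
    using n by (intro additive_on_comp[OF additive_tht additive_lnk[of n]] tht_pures) auto
  show "additive_on (pures n) (\<lambda>x. lnk p q x - lnk 1 p x - lnk 1 q x)"
    by (auto simp: additive_on_def lnk_pure_add)
  fix i j assume ij: "1 \<le> i" "i < j" "j \<le> n"
  show "lnk p q (tht n (pgen i j)) = lnk p q (pgen i j) - lnk 1 p (pgen i j) - lnk 1 q (pgen i j)"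
  proof (cases "i = 1")
    case False
    then show ?thesis using ij assms by (auto simp: tht_pgen lnk_pgen)
  next
    case True
    have t: "tsum n j \<in> pures n" using ij by (intro tsum_pures) auto
    have p: "pgen 1 j \<in> pures n" using ij True by (intro pgen_pures) auto
    have "tht n (pgen 1 j) = (- pgen 1 j) + (- tsum n j) - (- pgen 1 j)"
      using ij True by (simp add: tht_pgen_1)
    then have "lnk p q (tht n (pgen 1 j)) = - lnk p q (tsum n j)"
      using lnk_conj[OF pures_uminus[OF t], of p q "- pgen 1 j"] pos_neg_pure[OF p] lnk_pure_uminus[OF t] by simp
    then show ?thesis using ij assms True by (auto simp: lnk_tsum lnk_pgen)
  qed
qed

lemma pos_up_top: "a < q \<Longrightarrow> pos (up a q) q = Suc a"
  by (induction q) (auto simp: pos_add pos_sigma less_Suc_eq Transposition.transpose_def)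

lemma pos_up_low: "m \<le> a \<Longrightarrow> pos (up a q) m = m"
  by (induction q) (auto simp: pos_add pos_sigma Transposition.transpose_def)

lemma exists_position3:
  assumes "{i, j, k} \<subseteq> {1..n}" "distinct [i, j, k]"
  obtains g where "g \<in> braids n" "pos g i = 1" "pos g j = 2" "pos g k = 3"
proof -
  have n: "1 \<le> n" using assms by auto
  note ub = up_braids[OF n]
  have g1: "up 0 i \<in> braids n" "pos (up 0 i) i = 1" using assms ub pos_up_top[of 0 i] by auto
  define g2 where "g2 = up 0 i + up 1 (pos (up 0 i) j)"
  have j: "pos (up 0 i) j \<in> {1..n}" "pos (up 0 i) j \<noteq> 1"
    using pos_range[OF g1(1), of j] g1(2) pos_inj[of "up 0 i" j i] assms by auto
  have g2: "g2 \<in> braids n" "pos g2 i = 1" "pos g2 j = 2"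
    using j g1 ub pos_up_low[of 1 1] pos_up_top[of 1 "pos (up 0 i) j"] by (auto simp: g2_def pos_add intro!: braids_add)
  define g3 where "g3 = g2 + up 2 (pos g2 k)"
  have k: "pos g2 k \<in> {1..n}" "pos g2 k \<noteq> 1" "pos g2 k \<noteq> 2"
    using pos_range[OF g2(1), of k] g2 pos_inj[of g2 k i] pos_inj[of g2 k j] assms by auto
  have "g3 \<in> braids n" "pos g3 i = 1" "pos g3 j = 2" "pos g3 k = 3"
    using k g2 ub pos_up_low[of 1 2] pos_up_low[of 2 2] pos_up_top[of 2 "pos g2 k"]
    by (auto simp: g3_def pos_add intro!: braids_add)
  then show ?thesis by (rule that)
qed

lemma exists_position:
  assumes "{i, j, k, l} \<subseteq> {1..n}" "distinct [i, j, k, l]"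
  obtains g where "g \<in> braids n" "pos g i = 1" "pos g j = 2" "pos g k = 3" "pos g l = 4"
proof -
  have "{i, j, k} \<subseteq> {1..n}" "distinct [i, j, k]" using assms by auto
  then obtain g where g: "g \<in> braids n" "pos g i = 1" "pos g j = 2" "pos g k = 3" by (rule exists_position3)
  have n: "1 \<le> n" using assms by auto
  have l: "pos g l \<in> {1..n}" "pos g l \<noteq> 1" "pos g l \<noteq> 2" "pos g l \<noteq> 3"
    using pos_range[OF g(1), of l] g pos_inj[of g l i] pos_inj[of g l j] pos_inj[of g l k] assms by auto
  have "g + up 3 (pos g l) \<in> braids n" "pos (g + up 3 (pos g l)) i = 1" "pos (g + up 3 (pos g l)) j = 2"
    "pos (g + up 3 (pos g l)) k = 3" "pos (g + up 3 (pos g l)) l = 4"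
    using l g up_braids[OF n] pos_up_low[of 1 3] pos_up_low[of 2 3] pos_up_low[of 3 3] pos_up_top[of 3 "pos g l"]
    by (auto simp: pos_add intro!: braids_add)
  then show ?thesis by (rule that)
qed

text \<open>After moving the four strands to positions 1 to 4, \<theta> trades the first one for
  infinity; by \<open>lnk_tht\<close> the two cycles become, up to a change of basis, the linking
  differences of the triple 2, 3, 4.\<close>

lemma quad_isotropic:
  assumes "x \<in> pures n" "y \<in> pures n" "commute x y" "{i, j, k, l} \<subseteq> {1..n}" "distinct [i, j, k, l]"
  shows "cyc i j k l x * cyc i k j l y = cyc i j k l y * cyc i k j l x"
proof -
  obtain g where g: "g \<in> braids n" "pos g i = 1" "pos g j = 2" "pos g k = 3" "pos g l = 4"
    using exists_position assms by blast
  have n: "4 \<le> n" "1 \<le> n" using pos_range[OF g(1), of l] g assms by auto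
  have b: "- g \<in> braids n" using g braids_uminus by blast
  have q: "pos (- g) 1 = i" "pos (- g) 2 = j" "pos (- g) 3 = k" "pos (- g) 4 = l"
    using pos_uminus(1)[of g] g by metis+
  define u where "u a = - g + a - (- g)" for a
  have u: "u a \<in> pures n" if "a \<in> pures n" for a using that b unfolding u_def by (rule pures_conj)
  have lu: "lnk p q (u a) = lnk (pos (- g) p) (pos (- g) q) a" if "a \<in> pures n" for a p q
    unfolding u_def using lnk_conj[OF that, of p q "- g"] .
  have c: "commute (tht n (u x)) (tht n (u y))"
  proof -
    have "commute (u x) (u y)" unfolding u_def using assms(3) by (rule commute_conj)
    then have "tht n (u x + u y) = tht n (u y + u x)" by (simp add: commute_def)
    then show ?thesis using additive_sub(4)[OF additive_tht[OF n(2)] subgrp_pures] u assms(1,2)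
      by (simp add: commute_def)
  qed
  have t: "(lnk 2 3 (tht n (u x)) - lnk 2 4 (tht n (u x))) * (lnk 3 4 (tht n (u y)) - lnk 2 4 (tht n (u y)))
      = (lnk 2 3 (tht n (u y)) - lnk 2 4 (tht n (u y))) * (lnk 3 4 (tht n (u x)) - lnk 2 4 (tht n (u x)))"
    using u assms n c by (intro triple_isotropic[of _ n] tht_pures) auto
  have e: "lnk 2 3 (tht n (u a)) - lnk 2 4 (tht n (u a)) = - cyc i k j l a"
    "lnk 3 4 (tht n (u a)) - lnk 2 4 (tht n (u a)) = cyc i j k l a - cyc i k j l a" if a: "a \<in> pures n" for a
  proof -
    have nz: "i \<noteq> 0" "j \<noteq> 0" "k \<noteq> 0" "l \<noteq> 0" using assms by auto
    show "lnk 2 3 (tht n (u a)) - lnk 2 4 (tht n (u a)) = - cyc i k j l a"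
      using n u[OF a] nz lnk_sym[OF a, of j k] lnk_sym[OF a, of i l] by (simp add: lnk_tht lu[OF a] q cyc_def lk0_def)
    show "lnk 3 4 (tht n (u a)) - lnk 2 4 (tht n (u a)) = cyc i j k l a - cyc i k j l a"
      using n u[OF a] nz lnk_sym[OF a, of j k] lnk_sym[OF a, of i l] by (simp add: lnk_tht lu[OF a] q cyc_def lk0_def)
  qed
  show ?thesis using t e[OF assms(1)] e[OF assms(2)] by (simp add: algebra_simps)
qed

lemma cyc_isotropic:
  assumes "x \<in> pures n" "y \<in> pures n" "commute x y" "{i, j, k} \<subseteq> {1..n}" "l \<le> n" "distinct [i, j, k, l]"
  shows "cyc i j k l x * cyc i k j l y = cyc i j k l y * cyc i k j l x"
proof (cases "l = 0")
  case False
  then show ?thesis using quad_isotropic[OF assms(1,2,3), of i j k l] assms by auto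
next
  case True
  have nz: "i \<noteq> 0" "j \<noteq> 0" "k \<noteq> 0" using assms by auto
  have "(lnk i j x - lnk i k x) * (lnk j k y - lnk i k y) = (lnk i j y - lnk i k y) * (lnk j k x - lnk i k x)"
    using assms by (intro triple_isotropic[of _ n]) auto
  then show ?thesis using True nz lnk_sym[OF assms(1), of k j] lnk_sym[OF assms(2), of k j]
    by (simp add: cyc_def lk0_def algebra_simps)
qed

subsection \<open>Automorphisms permute the resonant planes\<close>

text \<open>A commuting pair amounts to a map of a torus, and the condition says that the cup
  product of the two classes vanishes on all these tori.\<close>

definition isotropic :: "nat \<Rightarrow> (braid \<Rightarrow> int) \<Rightarrow> (braid \<Rightarrow> int) \<Rightarrow> bool" where
  "isotropic n \<alpha> \<beta> \<longleftrightarrow> (\<forall>x\<in>pures n. \<forall>y\<in>pures n. commute x y \<longrightarrow> \<alpha> x * \<beta> y = \<alpha> y * \<beta> x)"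

lemma lnk_sigma_square: "1 \<le> i \<Longrightarrow> lnk p q (\<sigma> i + \<sigma> i) = (if p = i \<and> q = Suc i \<or> p = Suc i \<and> q = i then 1 else 0)"
  using lnk_pgen[of i "Suc i" p q] by (simp add: pgen_Suc)

lemma sigma_square_pures: "1 \<le> i \<Longrightarrow> i < n \<Longrightarrow> \<sigma> i + \<sigma> i \<in> pures n"
  using pgen_pures[of i "Suc i" n] by (simp add: pgen_Suc)

lemma lnk_shift:
  assumes "a \<in> pures m"
  shows "1 \<le> p \<Longrightarrow> 1 \<le> q \<Longrightarrow> lnk (Suc p) (Suc q) (shift a) = lnk p q a" "lnk 1 q (shift a) = 0"
proof -
  have s: "shift a \<in> pures (Suc m)" using assms by (rule shift_pures)
  show "lnk (Suc p) (Suc q) (shift a) = lnk p q a" if "1 \<le> p" "1 \<le> q"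
    using lnk_del[OF s, of 1 "Suc p" "Suc q"] that del_1_shift[of a] by (simp add: shift_index_def)
  show "lnk 1 q (shift a) = 0"
  proof (rule additive_on_eqI[OF _ _ _ assms, where g = "\<lambda>_. 0"])
    show "additive_on (pures m) (\<lambda>a. lnk 1 q (shift a))"
      using lnk_pure_add[OF shift_pures] by (auto simp: additive_on_def shift_add)
    fix i j assume "1 \<le> i" "i < j" "j \<le> m"
    then show "lnk 1 q (shift (pgen i j)) = 0" by (simp add: shift_pgen lnk_pgen)
  qed (simp add: additive_on_def)
qed

text \<open>Disjoint edges have commuting representatives: Dehn twists about disjoint curves.\<close>

lemma isotropic_disjoint:
  assumes \<alpha>: "additive_on (pures n) \<alpha>" "\<alpha> (zn n) = 0" and \<beta>: "additive_on (pures n) \<beta>" "\<beta> (zn n) = 0"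
    and iso: "isotropic n \<alpha> \<beta>" and ij: "i \<le> n" "j \<le> n" "k \<le> n" "l \<le> n" "distinct [i, j, k, l]"
  shows "\<alpha> (ed n i j) * \<beta> (ed n k l) = \<alpha> (ed n k l) * \<beta> (ed n i j)"
proof -
  have rep: "h (g + x - g) = h (ed n i j)"
    if "additive_on (pures n) h" "h (zn n) = 0" "g \<in> braids n" "x \<in> pures n" "1 \<le> i" "1 \<le> j" "i \<le> n" "j \<le> n" "i \<noteq> j"
      "\<And>p q. lnk p q x = (if p = pos g i \<and> q = pos g j \<or> p = pos g j \<and> q = pos g i then 1 else 0)"
    for h :: "braid \<Rightarrow> int" and g x i j
  proof (rule additive_eq_of_lnk[OF that(1)])
    show "lnk p q (g + x - g) = lnk p q (ed n i j)" if "1 \<le> p" "p < q" "q \<le> n" for p q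
      using that \<open>1 \<le> i\<close> \<open>1 \<le> j\<close> \<open>i \<noteq> j\<close> by (auto simp: lnk_conj[OF \<open>x \<in> pures n\<close>] \<open>\<And>p q. lnk p q x = _\<close> pos_inj ed_def lnk_gg)
  qed (use that in \<open>auto intro: pures_conj ed_pures\<close>)
  have main0: "\<alpha> (ed n 0 j) * \<beta> (ed n k l) = \<alpha> (ed n k l) * \<beta> (ed n 0 j)"
    if jkl: "{j, k, l} \<subseteq> {1..n}" "distinct [j, k, l]" for j k l
  proof -
    obtain g where g: "g \<in> braids n" "pos g j = 1" "pos g k = 2" "pos g l = 3"
      using exists_position3[OF jkl] by blast
    have n: "3 \<le> n" using pos_range[OF g(1), of l] g jkl by auto
    \<comment> \<open>The curve belonging to the edge from infinity to \<open>j\<close> surrounds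
      all strands but \<open>j\<close>. Its twist has the class of \<open>zn n - tsum n j\<close>,
      which is that of \<open>ed n 0 j\<close> modulo the full twist.\<close>
    let ?z = "shift (zn (n - 1))" and ?s = "\<sigma> 2 + \<sigma> 2"
    have zp: "?z \<in> pures n" using shift_zn_pures n by simp
    have sp: "?s \<in> pures n" using n by (intro sigma_square_pures) auto
    have zz: "zn n \<in> pures n" by (rule zn_pures) simp
    have tp: "tsum n j \<in> pures n" using jkl by (intro tsum_pures) auto
    have "commute (shift (zn (n - 1))) (shift (\<sigma> 1 + \<sigma> 1))"
    proof -
      have "commute (\<sigma> 1 + \<sigma> 1) (zn (n - 1))" using n by (intro zn_commute braids_add braids_sigma) auto
      then show ?thesis by (simp add: commute_def flip: shift_add)
    qed
    moreover have "shift (\<sigma> 1 + \<sigma> 1) = ?s" by (simp add: shift_add shift_sigma)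
    ultimately have "commute (g + ?z - g) (g + ?s - g)" by (intro commute_conj) simp
    then have eq: "\<alpha> (g + ?z - g) * \<beta> (g + ?s - g) = \<alpha> (g + ?s - g) * \<beta> (g + ?z - g)"
      using iso pures_conj[OF zp g(1)] pures_conj[OF sp g(1)] unfolding isotropic_def by blast
    have hs: "h (g + ?s - g) = h (ed n k l)" if "additive_on (pures n) h" "h (zn n) = 0" for h :: "braid \<Rightarrow> int"
      by (rule rep[OF that g(1) sp]) (use g jkl in \<open>auto simp: lnk_sigma_square\<close>)
    have hz: "h (g + ?z - g) = h (ed n 0 j)" if h: "additive_on (pures n) h" "h (zn n) = 0" for h :: "braid \<Rightarrow> int"
    proof -
      have "h (g + ?z - g) = h (zn n - tsum n j)"
      proof (rule additive_eq_of_lnk[OF h(1)])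
        fix p q assume pq: "1 \<le> p" "p < q" "q \<le> n"
        have t: "lnk p q (zn n - tsum n j) = (if j = p \<or> j = q then 0 else 1)"
          using additive_diff[OF additive_lnk zz tp] lnk_tsum[of j n p q] lnk_zn[of p q n] pq jkl by auto
        have r: "pos g p \<in> {1..n}" "pos g q \<in> {1..n}" "pos g p \<noteq> pos g q"
          using pos_range[OF g(1)] pq pos_inj by auto
        have "lnk (pos g p) (pos g q) ?z = (if pos g p = 1 \<or> pos g q = 1 then 0 else 1)"
        proof -
          have zm: "zn (n - 1) \<in> pures (n - 1)" by (rule zn_pures) simp
          show ?thesis
          proof (cases "pos g p = 1 \<or> pos g q = 1")
            case True
            then show ?thesis using lnk_shift(2)[OF zm] lnk_sym[OF zp, of _ 1] by auto
          next
            case False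
            then obtain u v where uv: "pos g p = Suc u" "pos g q = Suc v" "1 \<le> u" "u \<le> n - 1" "1 \<le> v" "v \<le> n - 1" "u \<noteq> v"
              using r by (cases "pos g p"; cases "pos g q") (auto simp: One_nat_def Suc_le_eq)
            have "lnk u v (zn (n - 1)) = 1"
              using lnk_zn[of u v "n - 1"] lnk_zn[of v u "n - 1"] lnk_sym[OF zm, of u v] uv by (cases "u < v") auto
            then show ?thesis using lnk_shift(1)[OF zm, of u v] uv False by simp
          qed
        qed
        also have "\<dots> = (if j = p \<or> j = q then 0 else 1)" using g(2) pos_inj by metis
        finally show "lnk p q (g + ?z - g) = lnk p q (zn n - tsum n j)"
          using t lnk_conj[OF zp] by simp
      qed (use zp zz tp g in \<open>auto intro: pures_conj pures_diff\<close>)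
      also have "\<dots> = h (ed n 0 j)"
        using additive_sub[OF h(1) subgrp_pures] zz tp h(2) jkl by (auto simp: ed_def)
      finally show ?thesis .
    qed
    show ?thesis using eq by (simp only: hs[OF \<alpha>] hs[OF \<beta>] hz[OF \<alpha>] hz[OF \<beta>])
  qed
  consider "i = 0" | "j = 0" | "k = 0" | "l = 0" | "{i, j, k, l} \<subseteq> {1..n}"
    using ij by (cases "i = 0"; cases "j = 0"; cases "k = 0"; cases "l = 0") auto
  then show ?thesis
  proof cases
    case 1
    have "{j, k, l} \<subseteq> {1..n}" "distinct [j, k, l]" using ij 1 by auto
    from main0[OF this] show ?thesis using 1 by simp
  next
    case 2
    have "{i, k, l} \<subseteq> {1..n}" "distinct [i, k, l]" using ij 2 by auto
    from main0[OF this] show ?thesis using 2 ed_sym[of n i 0] by simp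
  next
    case 3
    have "{l, i, j} \<subseteq> {1..n}" "distinct [l, i, j]" using ij 3 by auto
    from main0[OF this] show ?thesis using 3 by simp
  next
    case 4
    have "{k, i, j} \<subseteq> {1..n}" "distinct [k, i, j]" using ij 4 by auto
    from main0[OF this] show ?thesis using 4 ed_sym[of n k 0] by simp
  next
    case 5
    obtain g where g: "g \<in> braids n" "pos g i = 1" "pos g j = 2" "pos g k = 3" "pos g l = 4"
      using exists_position[OF 5 ij(5)] by blast
    have n: "4 \<le> n" using pos_range[OF g(1), of l] g 5 by auto
    \<comment> \<open>With the four strands at positions 1 to 4, the squares of these two distant
      crossings represent the two edges.\<close>
    let ?s = "\<sigma> 1 + \<sigma> 1" and ?t = "\<sigma> 3 + \<sigma> 3"
    have sp: "?s \<in> pures n" "?t \<in> pures n" using n by (auto intro!: sigma_square_pures)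
    have "commute (\<sigma> 1) (\<sigma> 3)" by (rule sigma_commute) auto
    then have "commute (g + ?s - g) (g + ?t - g)"
      by (intro commute_conj commute_add commute_add_left)
    then have eq: "\<alpha> (g + ?s - g) * \<beta> (g + ?t - g) = \<alpha> (g + ?t - g) * \<beta> (g + ?s - g)"
      using iso pures_conj[OF sp(1) g(1)] pures_conj[OF sp(2) g(1)] unfolding isotropic_def by blast
    have hs: "h (g + ?s - g) = h (ed n i j)" "h (g + ?t - g) = h (ed n k l)"
      if "additive_on (pures n) h" "h (zn n) = 0" for h :: "braid \<Rightarrow> int"
      by (rule rep[OF that g(1) sp(1)], use g 5 ij in \<open>auto simp: lnk_sigma_square\<close>)
        (rule rep[OF that g(1) sp(2)], use g 5 ij in \<open>auto simp: lnk_sigma_square\<close>)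
    show ?thesis using eq by (simp only: hs[OF \<alpha>] hs[OF \<beta>])
  qed
qed

text \<open>Additive maps are determined by their values on edges, so independence at
  \<open>x\<close>, \<open>y\<close> yields two independent edges. By
  \<open>isotropic_disjoint\<close> these cannot be disjoint; sharing one endpoint, they form the
  path that \<open>supported_on_four\<close> starts from.\<close>

lemma isotropic_support:
  assumes \<alpha>: "additive_on (pures n) \<alpha>" "\<alpha> (zn n) = 0" and \<beta>: "additive_on (pures n) \<beta>" "\<beta> (zn n) = 0"
    and iso: "isotropic n \<alpha> \<beta>" and xy: "x \<in> pures n" "y \<in> pures n" "\<alpha> x * \<beta> y \<noteq> \<alpha> y * \<beta> x"
  shows "\<exists>Q\<subseteq>{0..n}. card Q = 4 \<and> \<alpha> \<in> SQ n Q \<and> \<beta> \<in> SQ n Q"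
proof -
  interpret isotropic_pair "{0..n}" "\<lambda>i j. \<alpha> (ed n i j)" "\<lambda>i j. \<beta> (ed n i j)"
  proof
    show "\<alpha> (ed n i j) * \<beta> (ed n k l) = \<alpha> (ed n k l) * \<beta> (ed n i j)"
      if "i \<in> {0..n}" "j \<in> {0..n}" "k \<in> {0..n}" "l \<in> {0..n}" "distinct [i, j, k, l]" for i j k l
      using that by (intro isotropic_disjoint[OF \<alpha> \<beta> iso]) auto
  qed (auto simp: ed_sym[of n] vertex_sum[OF \<alpha>] vertex_sum[OF \<beta>])
  have "\<exists>i j k l. i \<le> n \<and> j \<le> n \<and> k \<le> n \<and> l \<le> n \<and> i \<noteq> j \<and> k \<noteq> l \<and> \<not> par i j k l"
  proof (rule ccontr)
    assume H: "\<not> ?thesis"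
    have 1: "\<alpha> x * \<beta> (ed n k l) = \<alpha> (ed n k l) * \<beta> x" if "x \<in> pures n" "k \<le> n" "l \<le> n" "k \<noteq> l" for x k l
    proof (rule additive_eq_of_ed[OF _ _ _ that(1)])
      show "additive_on (pures n) (\<lambda>x. \<alpha> x * \<beta> (ed n k l))" "additive_on (pures n) (\<lambda>x. \<alpha> (ed n k l) * \<beta> x)"
        using \<alpha> \<beta> by (auto simp: additive_on_def algebra_simps)
      show "\<alpha> (ed n i j) * \<beta> (ed n k l) = \<alpha> (ed n k l) * \<beta> (ed n i j)" if "i \<le> n" "j \<le> n" "i \<noteq> j" for i j
        using H that \<open>k \<le> n\<close> \<open>l \<le> n\<close> \<open>k \<noteq> l\<close> unfolding par_def by blast
    qed
    have "\<alpha> x * \<beta> y = \<alpha> y * \<beta> x"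
    proof (rule additive_eq_of_ed[OF _ _ _ xy(2)])
      show "additive_on (pures n) (\<lambda>y. \<alpha> x * \<beta> y)" "additive_on (pures n) (\<lambda>y. \<alpha> y * \<beta> x)"
        using \<alpha> \<beta> by (auto simp: additive_on_def algebra_simps)
    qed (use 1[OF xy(1)] in auto)
    with xy show False by blast
  qed
  then obtain i j k l where ijkl: "i \<le> n" "j \<le> n" "k \<le> n" "l \<le> n" "i \<noteq> j" "k \<noteq> l" "\<not> par i j k l" by blast
  then have "\<not> distinct [i, j, k, l]" using disj_par[of i j k l] by auto
  moreover have "\<not> par i j i j" "\<not> par i j j i" if "{i, j} = {k, l}"
    using that ijkl(7) par_flip by (auto simp: doubleton_eq_iff)
  moreover have "par i j i j" "par i j j i" using par_flip(2)[of i j j i] by (auto simp: par_def)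
  ultimately obtain p q r where "p \<le> n" "q \<le> n" "r \<le> n" "distinct [p, q, r]" "\<not> par p q q r"
  proof -
    consider "i = k" "j \<noteq> l" | "i = l" "j \<noteq> k" | "j = k" "i \<noteq> l" | "j = l" "i \<noteq> k"
      using \<open>\<not> distinct [i, j, k, l]\<close> \<open>{i, j} = {k, l} \<Longrightarrow> \<not> par i j i j\<close> \<open>par i j i j\<close> ijkl by auto
    then show ?thesis
    proof cases
      case 1 then show ?thesis using that[of j i l] ijkl par_flip(1)[of i j] by auto
    next
      case 2 then show ?thesis using that[of j i k] ijkl par_flip(1)[of i j] par_flip(2)[of _ _ k l] by auto
    next
      case 3 then show ?thesis using that[of i j l] ijkl by auto
    next
      case 4 then show ?thesis using that[of i j k] ijkl par_flip(2)[of _ _ k l] by auto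
    qed
  qed
  then obtain Q where "Q \<subseteq> {0..n}" "card Q = 4" "\<forall>i\<in>{0..n}. \<forall>j\<in>{0..n}. i \<noteq> j \<longrightarrow> \<not> (i \<in> Q \<and> j \<in> Q) \<longrightarrow> nul i j"
    using supported_on_four[of p q r] by auto
  then show ?thesis using \<alpha> \<beta> by (intro exI[of _ Q]) (auto simp: SQ_def nul_def)
qed

definition pauto :: "nat \<Rightarrow> (braid \<Rightarrow> braid) \<Rightarrow> bool" where
  "pauto n f \<longleftrightarrow> additive_on (pures n) f \<and> bij_betw f (pures n) (pures n)"

lemma pautoD:
  assumes "pauto n f"
  shows "additive_on (pures n) f" "x \<in> pures n \<Longrightarrow> f x \<in> pures n" "f ` pures n = pures n" "inj_on f (pures n)"
  using assms by (auto simp: pauto_def bij_betw_def)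

lemma pauto_inv:
  assumes "pauto n f"
  obtains f' where "pauto n f'" "\<And>x. x \<in> pures n \<Longrightarrow> f' (f x) = x" "\<And>x. x \<in> pures n \<Longrightarrow> f (f' x) = x"
proof
  let ?g = "inv_into (pures n) f"
  show l: "?g (f x) = x" if "x \<in> pures n" for x using that pautoD(4)[OF assms] by simp
  show r: "f (?g x) = x" if "x \<in> pures n" for x using that pautoD(3)[OF assms] by (metis f_inv_into_f)
  have b: "bij_betw ?g (pures n) (pures n)" using assms by (simp add: pauto_def bij_betw_inv_into)
  have "additive_on (pures n) ?g" unfolding additive_on_def
  proof (intro ballI)
    fix a b assume ab: "a \<in> pures n" "b \<in> pures n"
    then have g: "?g a \<in> pures n" "?g b \<in> pures n" using b by (auto simp: bij_betw_def)
    then have "f (?g a + ?g b) = a + b" using pautoD(1)[OF assms] ab r by (simp add: additive_on_def)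
    then show "?g (a + b) = ?g a + ?g b" using l[OF pures_add[OF g]] by simp
  qed
  with b show "pauto n ?g" by (simp add: pauto_def)
qed

lemma pauto_commute:
  assumes "pauto n f" "x \<in> pures n" "y \<in> pures n" "commute x y" shows "commute (f x) (f y)"
proof -
  have "f (x + y) = f (y + x)" using assms(4) by (simp add: commute_def)
  then show ?thesis
    using additive_sub(4)[OF pautoD(1)[OF assms(1)] subgrp_pures] assms(2,3) by (simp add: commute_def)
qed

lemma pauto_zn:
  assumes "pauto n f" "2 \<le> n" obtains r where "f (zn n) = imul r (zn n)"
proof (rule central_zn[OF assms(2)])
  have z: "zn n \<in> pures n" by (rule zn_pures) simp
  then show "f (zn n) \<in> pures n" using pautoD(2)[OF assms(1)] by blast
  fix g assume "g \<in> pures n"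
  then obtain x where "x \<in> pures n" "g = f x" using pautoD(3)[OF assms(1)] by blast
  then show "commute (f (zn n)) g" using pauto_commute[OF assms(1)] z zn_central commute_sym by blast
qed

text \<open>The vertex 0, if present, is listed last, the one place where
  \<open>cyc_isotropic\<close> admits it.\<close>

lemma four_points:
  fixes n :: nat
  assumes "Q \<subseteq> {0..n}" "card Q = 4"
  obtains i j k l where "Q = {i, j, k, l}" "distinct [i, j, k, l]" "{i, j, k} \<subseteq> {1..n}" "l \<le> n"
proof -
  obtain a b c d where q: "Q = {a, b, c, d}" "distinct [a, b, c, d]" using card4E[OF assms(2)] by blast
  have ge: "1 \<le> v" if "v \<noteq> 0" for v :: nat using that by simp
  consider "a = 0" | "b = 0" | "c = 0" | "a \<noteq> 0" "b \<noteq> 0" "c \<noteq> 0" by blast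
  then show ?thesis
  proof cases
    case 1 show ?thesis by (rule that[of b c d a]) (use 1 q assms in \<open>auto intro!: ge\<close>)
  next
    case 2 show ?thesis by (rule that[of a c d b]) (use 2 q assms in \<open>auto intro!: ge\<close>)
  next
    case 3 show ?thesis by (rule that[of a b d c]) (use 3 q assms in \<open>auto intro!: ge\<close>)
  next
    case 4 show ?thesis by (rule that[of a b c d]) (use 4 q assms in \<open>auto intro!: ge\<close>)
  qed
qed

text \<open>Automorphisms preserve commuting pairs and the center. So the two basis cycles pull back
  to an independent isotropic pair, \<open>isotropic_support\<close> gives their common support, and
  linearity extends it to the whole plane.\<close>

lemma SQ_comp:
  assumes f: "pauto n f" and n: "2 \<le> n" and Q: "Q \<subseteq> {0..n}" "card Q = 4"
  shows "\<exists>Q'\<subseteq>{0..n}. card Q' = 4 \<and> (\<forall>h\<in>SQ n Q. (\<lambda>x. h (f x)) \<in> SQ n Q')"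
proof -
  obtain i j k l where q: "Q = {i, j, k, l}" "distinct [i, j, k, l]" "{i, j, k} \<subseteq> {1..n}" "l \<le> n"
    using four_points[OF Q] by blast
  then have ijkl: "i \<le> n" "j \<le> n" "k \<le> n" "l \<le> n" by auto
  define \<alpha> where "\<alpha> x = cyc i j k l (f x)" for x
  define \<beta> where "\<beta> x = cyc i k j l (f x)" for x
  have d2: "distinct [i, k, j, l]" using q by auto
  obtain r where r: "f (zn n) = imul r (zn n)" using pauto_zn[OF f n] by blast
  have z: "zn n \<in> pures n" by (rule zn_pures) simp
  have kill: "h (f (zn n)) = 0" if "additive_on (pures n) h" "h (zn n) = 0" for h :: "braid \<Rightarrow> int"
    using additive_imul[OF that(1) z, of r] that(2) by (simp add: r)
  have add: "additive_on (pures n) (\<lambda>x. h (f x))" if "additive_on (pures n) h" for h :: "braid \<Rightarrow> int"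
    using pautoD[OF f] that by (intro additive_on_comp[of _ f _ h]) auto
  have ab: "additive_on (pures n) \<alpha>" "\<alpha> (zn n) = 0" "additive_on (pures n) \<beta>" "\<beta> (zn n) = 0"
    unfolding \<alpha>_def \<beta>_def using add additive_cyc kill cyc_zn ijkl q(2) d2 by auto
  have iso: "isotropic n \<alpha> \<beta>" unfolding isotropic_def \<alpha>_def \<beta>_def
    using pautoD(2)[OF f] pauto_commute[OF f] q by (auto intro!: cyc_isotropic[of _ n])
  \<comment> \<open>On preimages of the edges \<open>i j\<close> and \<open>i k\<close> the two
    pulled-back cycles take the values of the unit matrix, which shows independence.\<close>
  obtain x where x: "x \<in> pures n" "f x = ed n i j" using pautoD(3)[OF f] ed_pures[OF ijkl(1,2)] by (metis imageE)
  obtain y where y: "y \<in> pures n" "f y = ed n i k" using pautoD(3)[OF f] ed_pures[OF ijkl(1,3)] by (metis imageE)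
  have "\<alpha> x * \<beta> y \<noteq> \<alpha> y * \<beta> x"
    unfolding \<alpha>_def \<beta>_def x(2) y(2) using ijkl q(2) d2 by (simp add: cyc_ed ind_def)
  from isotropic_support[OF ab iso x(1) y(1) this]
  obtain Q' where Q': "Q' \<subseteq> {0..n}" "card Q' = 4" "\<alpha> \<in> SQ n Q'" "\<beta> \<in> SQ n Q'" by blast
  have "(\<lambda>x. h (f x)) \<in> SQ n Q'" if h: "h \<in> SQ n Q" for h
  proof -
    have e: "h (f x) = h (ed n i j) * \<alpha> x + h (ed n i k) * \<beta> x" if "x \<in> pures n" for x
      unfolding \<alpha>_def \<beta>_def using h q ijkl pautoD(2)[OF f that] by (intro SQ_decomp) auto
    show ?thesis unfolding SQ_def
    proof (intro CollectI conjI allI impI)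
      show "additive_on (pures n) (\<lambda>x. h (f x))" "h (f (zn n)) = 0" using h add kill by (auto simp: SQ_def)
      fix p q assume "p \<le> n" "q \<le> n" "p \<noteq> q" "\<not> (p \<in> Q' \<and> q \<in> Q')"
      then show "h (f (ed n p q)) = 0" using Q' e ed_pures by (simp add: SQ_def)
    qed
  qed
  with Q' show ?thesis by blast
qed

lemma SQ_ext: "h \<in> SQ n Q \<Longrightarrow> (\<And>x. x \<in> pures n \<Longrightarrow> h' x = h x) \<Longrightarrow> h' \<in> SQ n Q"
  using ed_pures zn_pures[of n n] unfolding SQ_def additive_on_def by (auto simp: pures_add)

lemma SQ_mem_subset:
  assumes "Q \<subseteq> {0..n}" "card Q = 4" "\<And>h. h \<in> SQ n Q \<Longrightarrow> h \<in> SQ n Q'" shows "Q \<subseteq> Q'"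
proof -
  obtain i j k l where q: "Q = {i, j, k, l}" "distinct [i, j, k, l]" "{i, j, k} \<subseteq> {1..n}" "l \<le> n"
    using four_points[OF assms(1,2)] by blast
  then have ijkl: "i \<le> n" "j \<le> n" "k \<le> n" "l \<le> n" by auto
  have "cyc i j k l \<in> SQ n Q'" using cyc_SQ[OF ijkl q(2)] assms(3) q by blast
  moreover have "cyc i j k l (ed n i j) \<noteq> 0" "cyc i j k l (ed n k l) \<noteq> 0"
    using ijkl q(2) by (auto simp: cyc_ed ind_def)
  ultimately show ?thesis using ijkl q by (auto simp: SQ_def)
qed

text \<open>A single nonzero edge at a vertex would contradict the vertex sum.\<close>

lemma SQ_vertex:
  assumes "h \<in> SQ n Q" "p \<le> n" "q \<le> n" "p \<noteq> q" "h (ed n p q) \<noteq> 0"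
  shows "\<exists>q'\<le>n. q' \<noteq> p \<and> q' \<noteq> q \<and> h (ed n p q') \<noteq> 0"
proof (rule ccontr)
  assume H: "\<not> ?thesis"
  have "(\<Sum>j\<in>{0..n} - {p}. h (ed n p j)) = (\<Sum>j\<in>{q}. h (ed n p j))"
    using assms H by (intro sum.mono_neutral_right) auto
  then show False using vertex_sum[of n h p] assms by (simp add: SQ_def)
qed

text \<open>The sum of two elements whose supports share at most one edge covers all vertices of both supports.\<close>

lemma SQ_sum:
  assumes \<alpha>: "\<alpha> \<in> SQ n Q1" and \<beta>: "\<beta> \<in> SQ n Q2" and \<gamma>: "\<gamma> \<in> SQ n Q3"
    and sum: "\<And>x. x \<in> pures n \<Longrightarrow> \<alpha> x + \<beta> x = \<gamma> x"
    and Q: "card Q1 = 4" "card Q2 = 4" "card Q3 = 4" "Q1 \<subseteq> {0..n}" "Q2 \<subseteq> {0..n}" "Q3 \<subseteq> {0..n}" "Q1 \<noteq> Q2"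
    and nz: "\<And>p. p \<in> Q1 \<Longrightarrow> \<exists>q\<le>n. q \<noteq> p \<and> \<alpha> (ed n p q) \<noteq> 0" "\<And>p. p \<in> Q2 \<Longrightarrow> \<exists>q\<le>n. q \<noteq> p \<and> \<beta> (ed n p q) \<noteq> 0"
      "\<And>p. p \<in> Q3 \<Longrightarrow> \<exists>q\<le>n. q \<noteq> p \<and> \<gamma> (ed n p q) \<noteq> 0"
  shows "Q3 \<subseteq> Q1 \<union> Q2" "card (Q1 \<inter> Q2) = 3"
proof -
  have se: "\<alpha> (ed n p q) + \<beta> (ed n p q) = \<gamma> (ed n p q)" if "p \<le> n" "q \<le> n" for p q
    using sum ed_pures that by blast
  have sup: "p \<in> Q \<and> q \<in> Q" if "h \<in> SQ n Q" "p \<le> n" "q \<le> n" "p \<noteq> q" "h (ed n p q) \<noteq> 0" for h p q Q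
    using that by (auto simp: SQ_def)
  show s3: "Q3 \<subseteq> Q1 \<union> Q2"
  proof
    fix p assume p: "p \<in> Q3"
    then obtain q where q: "q \<le> n" "q \<noteq> p" "\<gamma> (ed n p q) \<noteq> 0" using nz(3) by blast
    have "p \<le> n" using p Q by auto
    then have "\<alpha> (ed n p q) \<noteq> 0 \<or> \<beta> (ed n p q) \<noteq> 0" using se[of p q] q by auto
    then show "p \<in> Q1 \<union> Q2" using sup[OF \<alpha> \<open>p \<le> n\<close> q(1)] sup[OF \<beta> \<open>p \<le> n\<close> q(1)] q by auto
  qed
  have fin: "finite Q1" "finite Q2" using Q finite_subset by blast+
  \<comment> \<open>A vertex with one nonzero edge has a second one. If the supports share at most
    two vertices, one of these two edges is not inside the other support, survives in the sum, and
    puts the vertex into \<open>Q3\<close>.\<close>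
  have cov: "P \<subseteq> Q3"
    if le: "card (Q1 \<inter> Q2) \<le> 2" and P: "h \<in> SQ n P" "h' \<in> SQ n P'" "P \<inter> P' = Q1 \<inter> Q2" "P \<subseteq> {0..n}"
      "\<And>p. p \<in> P \<Longrightarrow> \<exists>q\<le>n. q \<noteq> p \<and> h (ed n p q) \<noteq> 0"
      "\<And>p q. p \<le> n \<Longrightarrow> q \<le> n \<Longrightarrow> h (ed n p q) + h' (ed n p q) = \<gamma> (ed n p q)" for h h' P P'
  proof
    fix p assume p: "p \<in> P"
    then have pn: "p \<le> n" using P by auto
    obtain q where q: "q \<le> n" "q \<noteq> p" "h (ed n p q) \<noteq> 0" using P(5) p by blast
    obtain q' where q': "q' \<le> n" "q' \<noteq> p" "q' \<noteq> q" "h (ed n p q') \<noteq> 0"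
      using SQ_vertex[OF P(1) pn q(1) _ q(3)] q by auto
    have "q \<in> P" "q' \<in> P" using sup[OF P(1) pn] q q' by auto
    have "\<not> {p, q, q'} \<subseteq> Q1 \<inter> Q2"
    proof
      assume "{p, q, q'} \<subseteq> Q1 \<inter> Q2"
      then have "card {p, q, q'} \<le> 2" using le fin card_mono[of "Q1 \<inter> Q2" "{p, q, q'}"] by auto
      then show False using q q' by auto
    qed
    then consider "\<not> (p \<in> P' \<and> q \<in> P')" | "\<not> (p \<in> P' \<and> q' \<in> P')"
      using P(3) p \<open>q \<in> P\<close> \<open>q' \<in> P\<close> by auto
    then show "p \<in> Q3"
    proof cases
      case 1
      then have "h' (ed n p q) = 0" using sup[OF P(2) pn q(1)] q by auto
      then have "\<gamma> (ed n p q) \<noteq> 0" using P(6)[OF pn q(1)] q by auto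
      then show ?thesis using sup[OF \<gamma> pn q(1)] q by auto
    next
      case 2
      then have "h' (ed n p q') = 0" using sup[OF P(2) pn q'(1)] q' by auto
      then have "\<gamma> (ed n p q') \<noteq> 0" using P(6)[OF pn q'(1)] q' by auto
      then show ?thesis using sup[OF \<gamma> pn q'(1)] q' by auto
    qed
  qed
  have "\<not> card (Q1 \<inter> Q2) \<le> 2"
  proof
    assume le: "card (Q1 \<inter> Q2) \<le> 2"
    have "Q1 \<subseteq> Q3" by (rule cov[OF le \<alpha> \<beta>]) (use Q nz se in auto)
    moreover have "Q2 \<subseteq> Q3" by (rule cov[OF le \<beta> \<alpha>]) (use Q nz se in \<open>auto simp: add.commute\<close>)
    moreover have "finite Q3" using Q finite_subset by blast
    ultimately have "Q1 = Q3" "Q2 = Q3" using card_subset_eq Q by metis+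
    with Q show False by simp
  qed
  moreover have "card (Q1 \<inter> Q2) \<le> 3"
  proof (rule ccontr)
    assume "\<not> card (Q1 \<inter> Q2) \<le> 3"
    moreover have "card (Q1 \<inter> Q2) \<le> card Q1" using fin by (intro card_mono) auto
    ultimately have "card (Q1 \<inter> Q2) = card Q1" "card (Q1 \<inter> Q2) = card Q2" using Q by auto
    then have "Q1 \<inter> Q2 = Q1" "Q1 \<inter> Q2 = Q2" using card_subset_eq[of Q1 "Q1 \<inter> Q2"] card_subset_eq[of Q2 "Q1 \<inter> Q2"] fin by auto
    with Q show False by blast
  qed
  ultimately show "card (Q1 \<inter> Q2) = 3" by simp
qed

text \<open>The two four-cycles share the two edges at \<open>d\<close>, on which their signs are
  opposite.\<close>

lemma cyc_relation:
  assumes "x \<in> pures n" "a \<le> n" "b \<le> n" "c \<le> n" "d \<le> n" "e \<le> n"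
  shows "cyc a b c d x + cyc a d c e x = cyc a b c e x"
proof -
  have "lk0 p q x = lk0 q p x" for p q using lnk_sym[OF assms(1), of p q] by (auto simp: lk0_def)
  from this[of d c] this[of d a] this[of c d] show ?thesis by (simp add: cyc_def)
qed

text \<open>The support map of the inverse automorphism undoes \<open>F\<close>, which gives
  injectivity. In a five-set \<open>cyc_relation\<close> writes a cycle on \<open>P - {z}\<close> as
  a sum of cycles on \<open>P - {x}\<close> and \<open>P - {y}\<close>; applied to the pullbacks,
  \<open>SQ_sum\<close> yields the five-point axiom.\<close>

theorem automorphism_point_map:
  assumes f: "pauto n f" and n: "4 \<le> n"
  obtains \<kappa> where "inj_on \<kappa> {0..n}" "\<kappa> ` {0..n} \<subseteq> {0..n}"
    "\<And>k Q h. k \<le> n \<Longrightarrow> Q \<subseteq> {0..n} \<Longrightarrow> card Q = 4 \<Longrightarrow> k \<notin> Q \<Longrightarrow> h \<in> SQ n Q \<Longrightarrow>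
       \<exists>Q'. \<kappa> k \<notin> Q' \<and> (\<lambda>x. h (f x)) \<in> SQ n Q'"
proof -
  have n2: "2 \<le> n" using n by simp
  obtain F where F: "\<And>Q. Q \<subseteq> {0..n} \<Longrightarrow> card Q = 4 \<Longrightarrow>
      F Q \<subseteq> {0..n} \<and> card (F Q) = 4 \<and> (\<forall>h\<in>SQ n Q. (\<lambda>x. h (f x)) \<in> SQ n (F Q))"
    using SQ_comp[OF f n2] by metis
  obtain g where g: "pauto n g" "\<And>x. x \<in> pures n \<Longrightarrow> g (f x) = x" "\<And>x. x \<in> pures n \<Longrightarrow> f (g x) = x"
    using pauto_inv[OF f] by blast
  obtain G where G: "\<And>Q. Q \<subseteq> {0..n} \<Longrightarrow> card Q = 4 \<Longrightarrow>
      G Q \<subseteq> {0..n} \<and> card (G Q) = 4 \<and> (\<forall>h\<in>SQ n Q. (\<lambda>x. h (g x)) \<in> SQ n (G Q))"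
    using SQ_comp[OF g(1) n2] by metis
  have GF: "G (F Q) = Q" if Q: "Q \<subseteq> {0..n}" "card Q = 4" for Q
  proof -
    have "Q \<subseteq> G (F Q)"
    proof (rule SQ_mem_subset[OF Q])
      fix h assume "h \<in> SQ n Q"
      then have "(\<lambda>x. h (f x)) \<in> SQ n (F Q)" using F[OF Q] by blast
      moreover have "\<forall>h\<in>SQ n (F Q). (\<lambda>x. h (g x)) \<in> SQ n (G (F Q))" using F[OF Q] G[of "F Q"] by blast
      ultimately have "(\<lambda>x. h (f (g x))) \<in> SQ n (G (F Q))" by (rule bspec[rotated])
      then show "h \<in> SQ n (G (F Q))" by (rule SQ_ext) (simp add: g(3))
    qed
    moreover have "finite (G (F Q))" using F[OF Q] G[of "F Q"] finite_subset by blast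
    ultimately show ?thesis using F[OF Q] G[of "F Q"] Q card_subset_eq by metis
  qed
  interpret four_map "{0..n}" F
  proof
    fix Q Q' assume Q: "Q \<subseteq> {0..n}" "card Q = 4" "Q' \<subseteq> {0..n}" "card Q' = 4" "F Q = F Q'"
    then show "Q = Q'" using GF[OF Q(1,2)] GF[OF Q(3,4)] by metis
  next
    fix P x y z assume P: "P \<subseteq> {0..n}" "card P = 5" and xyz: "x \<in> P" "y \<in> P" "z \<in> P" "distinct [x, y, z]"
    have finP: "finite P" using P finite_subset by blast
    have "card (P - {x, y, z}) = 2" using P xyz finP by (simp add: card_Diff_subset)
    then obtain a c where ac: "P - {x, y, z} = {a, c}" "a \<noteq> c" by (auto simp: card_2_iff)
    then have Pe: "P = {x, y, z, a, c}" "distinct [x, y, z, a, c]" using xyz by auto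
    have le: "x \<le> n" "y \<le> n" "z \<le> n" "a \<le> n" "c \<le> n" using Pe P by auto
    let ?\<alpha> = "cyc a y c z" and ?\<beta> = "cyc a z c x" and ?\<gamma> = "cyc a y c x"
    have Q: "P - {x} = {a, y, c, z}" "P - {y} = {a, z, c, x}" "P - {z} = {a, y, c, x}" using Pe by auto
    have S: "?\<alpha> \<in> SQ n (P - {x})" "?\<beta> \<in> SQ n (P - {y})" "?\<gamma> \<in> SQ n (P - {z})"
      unfolding Q using le Pe by (auto intro!: cyc_SQ)
    have sub: "P - {w} \<subseteq> {0..n}" "card (P - {w}) = 4" if "w \<in> P" for w using P that finP by auto
    have C: "(\<lambda>u. ?\<alpha> (f u)) \<in> SQ n (F (P - {x}))" "(\<lambda>u. ?\<beta> (f u)) \<in> SQ n (F (P - {y}))" "(\<lambda>u. ?\<gamma> (f u)) \<in> SQ n (F (P - {z}))"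
      using F[OF sub] S xyz by blast+
    \<comment> \<open>Opposite edges of a four-set carry equal weights, so a weight that vanishes on
      all edges at one vertex vanishes altogether.\<close>
    have nonzero: "\<exists>q\<le>n. q \<noteq> p \<and> h (f (ed n p q)) \<noteq> 0"
      if h: "h \<in> SQ n R" "R \<subseteq> {0..n}" "card R = 4" "\<not> (\<forall>u\<in>pures n. h u = 0)" and p: "p \<in> F R" for h R p
    proof (rule ccontr)
      assume H: "\<not> ?thesis"
      let ?h = "\<lambda>u. h (f u)"
      have FR: "F R \<subseteq> {0..n}" "card (F R) = 4" "?h \<in> SQ n (F R)" using F[OF h(2,3)] h(1) by auto
      obtain i j k l where q: "F R = {i, j, k, l}" "distinct [i, j, k, l]" "{i, j, k} \<subseteq> {1..n}" "l \<le> n"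
        using four_points[OF FR(1,2)] by blast
      have ijkl: "i \<le> n" "j \<le> n" "k \<le> n" "l \<le> n" using q by auto
      have van: "?h (ed n p q) = 0" "?h (ed n q p) = 0" if "q \<le> n" "q \<noteq> p" for q
        using H that ed_sym[of n q p] by auto
      have dec: "?h u = ?h (ed n i j) * cyc i j k l u + ?h (ed n i k) * cyc i k j l u" if "u \<in> pures n" for u
        using FR(3) q ijkl that by (intro SQ_decomp) auto
      have d2: "distinct [i, k, j, l]" using q by auto
      have "?h (ed n i j) = 0 \<and> ?h (ed n i k) = 0"
      proof -
        have e: "?h (ed n k l) = ?h (ed n i j)" "?h (ed n j l) = ?h (ed n i k)"
          "?h (ed n j k) = - ?h (ed n i j) - ?h (ed n i k)" "?h (ed n i l) = - ?h (ed n i j) - ?h (ed n i k)"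
          using dec[OF ed_pures[OF ijkl(3,4)]] dec[OF ed_pures[OF ijkl(2,4)]] dec[OF ed_pures[OF ijkl(2,3)]] dec[OF ed_pures[OF ijkl(1,4)]]
            ijkl q(2) d2 by (simp_all add: cyc_ed ind_def)
        have "p = i \<or> p = j \<or> p = k \<or> p = l" using p q by auto
        then show ?thesis using e q(2) ijkl van[of i] van[of j] van[of k] van[of l] by auto
      qed
      then have "\<forall>u\<in>pures n. ?h u = 0" using dec by simp
      then have "\<forall>u\<in>pures n. h u = 0" using pautoD(3)[OF f] by (metis imageE)
      with h(4) show False by blast
    qed
    have nz: "\<not> (\<forall>u\<in>pures n. ?\<alpha> u = 0)" "\<not> (\<forall>u\<in>pures n. ?\<beta> u = 0)" "\<not> (\<forall>u\<in>pures n. ?\<gamma> u = 0)"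
    proof -
      have "?\<alpha> (ed n a y) = 1" "?\<beta> (ed n a z) = 1" "?\<gamma> (ed n a y) = 1"
        using le Pe by (auto simp: cyc_ed ind_def)
      then show "\<not> (\<forall>u\<in>pures n. ?\<alpha> u = 0)" "\<not> (\<forall>u\<in>pures n. ?\<beta> u = 0)" "\<not> (\<forall>u\<in>pures n. ?\<gamma> u = 0)"
        using ed_pures le by (metis zero_neq_one)+
    qed
    have rel: "?\<alpha> (f u) + ?\<beta> (f u) = ?\<gamma> (f u)" if "u \<in> pures n" for u
      using cyc_relation[of "f u" n a y c z x] pautoD(2)[OF f that] le by simp
    have ne: "F (P - {x}) \<noteq> F (P - {y})"
    proof
      assume "F (P - {x}) = F (P - {y})"
      then have "P - {x} = P - {y}" using GF[OF sub[OF xyz(1)]] GF[OF sub[OF xyz(2)]] by metis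
      then show False using xyz by auto
    qed
    note FP = F[OF sub[OF xyz(1)]] F[OF sub[OF xyz(2)]] F[OF sub[OF xyz(3)]]
    show "F (P - {z}) \<subseteq> F (P - {x}) \<union> F (P - {y}) \<and> card (F (P - {x}) \<inter> F (P - {y})) = 3"
      using SQ_sum[OF C rel, of] FP ne nonzero[OF S(1) sub[OF xyz(1)] nz(1)] nonzero[OF S(2) sub[OF xyz(2)] nz(2)] nonzero[OF S(3) sub[OF xyz(3)] nz(3)]
      by auto
  qed (use F in auto)
  have "5 \<le> card {0..n}" using n by simp
  then obtain \<kappa> where \<kappa>: "inj_on \<kappa> {0..n}" "\<kappa> ` {0..n} \<subseteq> {0..n}"
    "\<And>k Q. k \<in> {0..n} \<Longrightarrow> Q \<subseteq> {0..n} \<Longrightarrow> card Q = 4 \<Longrightarrow> k \<notin> Q \<Longrightarrow> \<kappa> k \<notin> F Q"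
    using point_map by blast
  show ?thesis
  proof (rule that[OF \<kappa>(1,2)])
    fix k Q h assume "k \<le> n" "Q \<subseteq> {0..n}" "card Q = 4" "k \<notin> Q" "h \<in> SQ n Q"
    then show "\<exists>Q'. \<kappa> k \<notin> Q' \<and> (\<lambda>x. h (f x)) \<in> SQ n Q'" using \<kappa>(3)[of k Q] F[of Q] by auto
  qed
qed

section \<open>From permuted supports to permuted kernels, and invariance of both subgroups\<close>

section \<open>Invariance under automorphisms\<close>

definition KZ :: "nat \<Rightarrow> nat \<Rightarrow> braid set" where
  "KZ n k = {x \<in> pures n. \<exists>r. dd n k x = imul r (zn (n - 1))}"

lemma pauto_tht: "1 \<le> n \<Longrightarrow> pauto n (tht n)"
  by (simp add: pauto_def additive_tht bij_tht)

text \<open>The finitely many loops generating \<open>K n 1\<close> are carried over by conjugation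
  with \<open>up 0 k\<close>, and for \<open>k = 0\<close> by the inverse of \<theta>.\<close>

lemma K_fg:
  assumes "1 \<le> n" "k \<le> n"
  obtains S where "finite S" "S \<subseteq> pures n" "K n k = gen S"
proof -
  let ?S = "pgen 1 ` {2..n}"
  have S1: "K n 1 = gen ?S" using K_1 range_kap assms by simp
  show ?thesis
  proof (cases "k = 0")
    case False
    let ?u = "up 0 k"
    have u: "?u \<in> braids n" using assms up_braids by auto
    have "K n k = (\<lambda>x. ?u + x - ?u) ` K n 1"
    proof
      show "K n k \<subseteq> (\<lambda>x. ?u + x - ?u) ` K n 1"
      proof
        fix a assume "a \<in> K n k"
        then have "- ?u + a - (- ?u) \<in> K n 1" using K_conj_up[of k n a] False assms by auto
        then show "a \<in> (\<lambda>x. ?u + x - ?u) ` K n 1"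
          by (rule image_eqI[rotated]) (simp add: grp del: add_uminus_conv_diff)
      qed
      show "(\<lambda>x. ?u + x - ?u) ` K n 1 \<subseteq> K n k"
      proof
        fix a assume "a \<in> (\<lambda>x. ?u + x - ?u) ` K n 1"
        then obtain x where "x \<in> K n 1" "a = ?u + x - ?u" by blast
        then have "- ?u + a - (- ?u) \<in> K n 1" by (simp add: grp del: add_uminus_conv_diff)
        then show "a \<in> K n k" using K_conj_up[of k n a] False assms by auto
      qed
    qed
    also have "\<dots> = gen ((\<lambda>x. ?u + x - ?u) ` ?S)"
      unfolding S1 by (rule additive_gen_image[of n]) (auto simp: additive_on_def conj_add pgen_1_pures[THEN subsetD] intro!: pgen_pures)
    finally show ?thesis using u pgen_1_pures[of n] pures_conj by (intro that[of "(\<lambda>x. ?u + x - ?u) ` ?S"]) auto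
  next
    case True
    obtain g where g: "pauto n g" "\<And>x. x \<in> pures n \<Longrightarrow> g (tht n x) = x" "\<And>x. x \<in> pures n \<Longrightarrow> tht n (g x) = x"
      using pauto_inv[OF pauto_tht[OF assms(1)]] by blast
    have "K n 0 = g ` K n 1"
    proof
      show "K n 0 \<subseteq> g ` K n 1"
      proof
        fix x assume x: "x \<in> K n 0"
        then have "x \<in> pures n" using K_pures by blast
        then have "tht n x \<in> K n 1" "x = g (tht n x)" using x tht_K_0[OF assms(1)] g(2) by auto
        then show "x \<in> g ` K n 1" by blast
      qed
      show "g ` K n 1 \<subseteq> K n 0"
      proof (rule image_subsetI)
        fix y assume y: "y \<in> K n 1"
        then have "y \<in> pures n" using K_pures by blast
        then show "g y \<in> K n 0" using y g(3) tht_K_0[OF assms(1) pautoD(2)[OF g(1)]] by simp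
      qed
    qed
    also have "\<dots> = gen (g ` ?S)"
      unfolding S1 by (rule additive_gen_image[OF pautoD(1)[OF g(1)] pgen_1_pures])
    finally have 1: "K n k = gen (g ` ?S)" using True by simp
    have 2: "g ` ?S \<subseteq> pures n" by (intro image_subsetI pautoD(2)[OF g(1)]) (use pgen_1_pures in blast)
    show ?thesis by (rule that[OF _ 2 1]) simp
  qed
qed

text \<open>On edge classes \<theta> acts as the transposition of the vertices 0 and 1. For edges
  with an end other than these two this is read off the generators; the edge between 0 and 1 follows
  from the vertex sums.\<close>

lemma SQ_tht:
  assumes h: "h \<in> SQ n Q" and n: "2 \<le> n"
  shows "(\<lambda>x. h (tht n x)) \<in> SQ n (Transposition.transpose 0 1 ` Q)"
proof -
  let ?H = "\<lambda>x. h (tht n x)" and ?s = "Transposition.transpose 0 (1::nat)"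
  have n1: "1 \<le> n" using n by simp
  have ha: "additive_on (pures n) h" "h (zn n) = 0" using h by (auto simp: SQ_def)
  note hs = additive_sub[OF ha(1) subgrp_pures] and ts = additive_sub[OF additive_tht[OF n1] subgrp_pures]
  have hc: "h (g + x - g) = h x" if "g \<in> pures n" "x \<in> pures n" for g x
    using that by (simp add: hs pures_add)
  have z: "zn n \<in> pures n" by (rule zn_pures) simp
  have Ha: "additive_on (pures n) ?H" using ha tht_pures n1 by (intro additive_on_comp[OF additive_tht]) auto
  obtain r where "tht n (zn n) = imul r (zn n)" using tht_zn[OF n1] by blast
  then have Hz: "?H (zn n) = 0" using additive_imul[OF ha(1) z] ha(2) by simp
  have H1: "?H (ed n 1 q) = h (ed n 0 q)" and H0: "?H (ed n 0 q) = h (ed n 1 q)" if q: "2 \<le> q" "q \<le> n" for q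
  proof -
    let ?A = "pgen 1 q" and ?t = "tsum n q"
    have p: "?A \<in> pures n" "?t \<in> pures n" using q by (auto intro!: pgen_pures tsum_pures)
    have e: "ed n 1 q = ?A" "ed n 0 q = - ?t" using q by (auto simp: ed_def gg_def)
    have tA: "tht n ?A = (- ?A) + (- ?t) - (- ?A)" using q by (simp add: tht_pgen_1)
    show "?H (ed n 1 q) = h (ed n 0 q)" unfolding e tA using p by (intro hc pures_uminus)
    have "- ?t = ?A + tht n ?A - ?A" unfolding tA by (simp add: grp del: add_uminus_conv_diff)
    then have "tht n (- ?t) = tht n ?A + tht n (tht n ?A) - tht n ?A"
      using p tht_pures[OF p(1) n1] by (simp add: ts pures_add)
    then have "h (tht n (- ?t)) = h (tht n (tht n ?A))"
      using hc tht_pures[OF p(1) n1] tht_pures[OF tht_pures[OF p(1) n1] n1] by simp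
    also have "\<dots> = h ?A" unfolding tht_tht[OF p(1) n1] using p shift_zn_pures[OF n1] by (intro hc)
    finally show "?H (ed n 0 q) = h (ed n 1 q)" unfolding e .
  qed
  have H2: "?H (ed n p q) = h (ed n p q)" if "2 \<le> p" "2 \<le> q" "p \<le> n" "q \<le> n" for p q
  proof -
    have 0: "tht n 0 = 0" by (rule ts)
    show ?thesis using that 0 by (auto simp: ed_def gg_def tht_pgen min_def max_def)
  qed
  have V: "{0..n} - {i} = insert (1 - i) {2..n}" if "i \<le> 1" for i
  proof -
    have "i = 0 \<or> i = 1" using that by linarith
    then show ?thesis using n by (elim disjE) auto
  qed
  have "(\<Sum>q\<in>{0..n} - {0}. ?H (ed n 0 q)) = 0" by (rule vertex_sum[OF Ha Hz]) simp
  then have "?H (ed n 0 1) = - (\<Sum>q\<in>{2..n}. ?H (ed n 0 q))" by (simp add: V)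
  also have "\<dots> = - (\<Sum>q\<in>{2..n}. h (ed n 1 q))" using H0 by simp
  also have "\<dots> = h (ed n 1 0)" using vertex_sum[OF ha n1] by (simp add: V[of 1])
  finally have H01: "?H (ed n 0 1) = h (ed n 1 0)" .
  have H: "?H (ed n p q) = h (ed n (?s p) (?s q))" if "p \<le> n" "q \<le> n" "p \<noteq> q" "p < q" for p q
  proof -
    have "(p = 0 \<and> q = 1) \<or> (p = 0 \<and> 2 \<le> q) \<or> (p = 1 \<and> 2 \<le> q) \<or> (2 \<le> p \<and> 2 \<le> q)"
      using \<open>p < q\<close> by presburger
    then consider "p = 0" "q = 1" | "p = 0" "2 \<le> q" | "p = 1" "2 \<le> q" | "2 \<le> p" "2 \<le> q"
      by blast
    then show ?thesis using that H0 H1 H2 H01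
      by cases (auto simp: Transposition.transpose_def)
  qed
  have H': "?H (ed n p q) = h (ed n (?s p) (?s q))" if "p \<le> n" "q \<le> n" "p \<noteq> q" for p q
    using H[of p q] H[of q p] that ed_sym[of n p q] ed_sym[of n "?s p" "?s q"] by (cases "p < q") auto
  show ?thesis unfolding SQ_def
  proof (intro CollectI conjI allI impI Ha Hz)
    fix p q assume pq: "p \<le> n" "q \<le> n" "p \<noteq> q" "\<not> (p \<in> ?s ` Q \<and> q \<in> ?s ` Q)"
    have "?s p \<le> n" "?s q \<le> n" "?s p \<noteq> ?s q" using pq n by (auto simp: Transposition.transpose_def)
    moreover have "\<not> (?s p \<in> Q \<and> ?s q \<in> Q)"
      using pq(4) image_eqI[of p ?s "?s p" Q] image_eqI[of q ?s "?s q" Q] by auto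
    ultimately have "h (ed n (?s p) (?s q)) = 0" using h by (auto simp: SQ_def)
    then show "?H (ed n p q) = 0" using H' pq by simp
  qed
qed

text \<open>A weight without edges at \<open>k\<close> involves only linking numbers of the other
  strands, which survive the deletion of \<open>k\<close>. The case \<open>k = 0\<close> is
  transferred to strand 1 by \<theta>; the double application is a conjugation, which
  \<open>h\<close> ignores.\<close>

lemma SQ_kills_K:
  assumes "h \<in> SQ n Q" "k \<le> n" "k \<notin> Q" "x \<in> K n k" "2 \<le> n"
  shows "h x = 0"
proof -
  have *: "h x = 0" if h: "h \<in> SQ n Q" and k: "1 \<le> k" "k \<le> n" "k \<notin> Q" and x: "x \<in> K n k" for h x k Q
  proof -
    have ha: "additive_on (pures n) h" using h by (simp add: SQ_def)
    have xp: "x \<in> pures n" "del k x = 0" using x k by (auto simp: K_def dd_def)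
    have "h (pgen p q) * lnk p q x = 0" if "1 \<le> p" "p < q" "q \<le> n" for p q
    proof (cases "p = k \<or> q = k")
      case True
      then have "h (ed n p q) = 0" using h k that by (auto simp: SQ_def)
      then show ?thesis using that by (simp add: ed_pgen)
    next
      case False
      then have "lnk p q x = 0" using lnk_del[OF xp(1) k(1,2), of p q] xp(2) by simp
      then show ?thesis by simp
    qed
    then show ?thesis unfolding additive_formula[OF ha xp(1)]
      by (intro sum.neutral ballI) auto
  qed
  show ?thesis
  proof (cases "k = 0")
    case False then show ?thesis using *[of h Q k x] assms by simp
  next
    case True
    have n: "1 \<le> n" using assms by simp
    have x: "x \<in> pures n" using assms K_pures by blast
    have t: "tht n x \<in> K n 1" using tht_K_0[OF n x] assms True by simp
    let ?Q = "Transposition.transpose 0 (1::nat) ` Q"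
    have "1 \<notin> ?Q" using assms True by (auto simp: Transposition.transpose_def)
    with *[OF SQ_tht[OF assms(1,5)] _ n _ t] have "h (tht n (tht n x)) = 0" by simp
    moreover have "h (tht n (tht n x)) = h x"
    proof -
      have hadd: "additive_on (pures n) h" using assms(1) by (simp add: SQ_def)
      note hs = additive_sub[OF hadd subgrp_pures] shift_zn_pures[OF n]
      show ?thesis unfolding tht_tht[OF x n] using hs x by (simp add: pures_add)
    qed
    ultimately show ?thesis by simp
  qed
qed

lemma del_surj:
  assumes "1 \<le> k" "k \<le> n" "a \<in> pures (n - 1)"
  obtains b where "b \<in> pures n" "del k b = a"
proof
  let ?u = "up 0 k"
  have n: "1 \<le> n" using assms by simp
  have u: "?u \<in> braids n" using assms up_braids by auto
  let ?d = "del k ?u"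
  have d: "?d \<in> braids (n - 1)" using u assms by (intro del_braids) auto
  let ?x = "- ?d + a - (- ?d)"
  have x: "?x \<in> pures (n - 1)" using assms d by (intro pures_conj braids_uminus)
  then have s: "shift ?x \<in> pures n" using shift_pures[OF x] n by simp
  show "?u + shift ?x - ?u \<in> pures n" using s u by (rule pures_conj)
  have "del k (?u + shift ?x - ?u) = ?d + ?x - ?d"
    using del_conj[OF s assms(1), of ?u] pos_up[OF assms(1), of k] del_1_shift[of ?x] by simp
  then show "del k (?u + shift ?x - ?u) = a" by (simp add: grp del: add_uminus_conv_diff)
qed

text \<open>\<open>\<psi>\<close> is the deleted image with a multiple of the full twist removed.
  Among the classes assumed to vanish are the four-cycles through 0 that avoid \<open>k\<close>;
  they make all linking numbers of the deleted image equal, so those of \<open>\<psi>\<close> are 0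
  and \<open>fg_normal_pures_trivial\<close> applies.\<close>

lemma image_K_subset_KZ:
  assumes f: "pauto n f" and n: "4 \<le> n" and k: "1 \<le> k" "k \<le> n" and j: "j \<le> n"
    and kill: "\<And>Q h x. Q \<subseteq> {0..n} \<Longrightarrow> card Q = 4 \<Longrightarrow> k \<notin> Q \<Longrightarrow> h \<in> SQ n Q \<Longrightarrow> x \<in> K n j \<Longrightarrow> h (f x) = 0"
  shows "f ` K n j \<subseteq> KZ n k"
proof -
  define m where "m = n - 1"
  have m: "3 \<le> m" "Suc m = n" using n by (auto simp: m_def)
  have z: "zn m \<in> pures m" by (rule zn_pures) simp
  define \<phi> where "\<phi> x = del k (f x)" for x
  have \<phi>: "additive_on (pures n) \<phi>" unfolding \<phi>_def[abs_def]
    using pautoD[OF f] k by (intro additive_on_comp[OF _ additive_del[of k n]]) auto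
  have \<phi>p: "\<phi> x \<in> pures m" if "x \<in> pures n" for x
    unfolding \<phi>_def m_def using that pautoD(2)[OF f] k by (intro del_pures) auto
  define c where "c a = imul (lnk 1 2 a) (zn m)" for a
  have cc: "commute g (c a)" if "g \<in> pures m" for g a
    unfolding c_def using zn_central[OF that] by (rule commute_imul)
  have cp: "c a \<in> pures m" for a unfolding c_def using z by (rule imul_pures)
  define \<rho> where "\<rho> a = a - c a" for a
  \<comment> \<open>The subtracted element is central and depends additively on the
    argument.\<close>
  have \<rho>: "additive_on (pures m) \<rho>" unfolding additive_on_def
  proof (intro ballI)
    fix a b assume ab: "a \<in> pures m" "b \<in> pures m"
    have "c (a + b) = c a + c b" using ab by (simp add: c_def lnk_pure_add imul_add)
    then have "\<rho> (a + b) = a + (b + - c b) + - c a" by (simp add: \<rho>_def grp del: add_uminus_conv_diff)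
    also have "\<dots> = a + (- c a + (b + - c b))"
    proof -
      have "commute (b + - c b) (- c a)"
        using cc[OF ab(2)] cc[OF pures_uminus[OF cp]] by (intro commute_uminus commute_add_left) auto
      then show ?thesis by (simp only: commute_def add.assoc)
    qed
    finally show "\<rho> (a + b) = \<rho> a + \<rho> b" by (simp add: \<rho>_def grp del: add_uminus_conv_diff)
  qed
  define \<psi> where "\<psi> x = \<rho> (\<phi> x)" for x
  have \<psi>: "additive_on (pures n) \<psi>" unfolding \<psi>_def[abs_def] using \<phi> \<rho> \<phi>p by (rule additive_on_comp)
  obtain S where S: "finite S" "S \<subseteq> pures n" "K n j = gen S" using K_fg j n by (metis One_nat_def le_trans one_le_numeral)
  have im: "\<psi> ` K n j = gen (\<psi> ` S)" unfolding S(3) by (rule additive_gen_image[OF \<psi> S(2)])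
  have const: "lnk a b (\<phi> x) = lnk b e (\<phi> x)" if x: "x \<in> K n j" and abe: "{a, b, e} \<subseteq> {1..m}" "distinct [a, b, e]" for x a b e
  proof -
    have xp: "f x \<in> pures n" using x K_pures pautoD(2)[OF f] by blast
    \<comment> \<open>\<open>u\<close> reopens the gap at \<open>k\<close>, undoing
      \<open>shift_index k\<close>.\<close>
    define u where "u v = (if v < k then v else Suc v)" for v
    have u: "shift_index k (u v) = v" "u v \<noteq> k" "1 \<le> v \<Longrightarrow> v \<le> m \<Longrightarrow> 1 \<le> u v \<and> u v \<le> n" for v
      using m by (auto simp: u_def shift_index_def)
    have ui: "u v = u w \<longleftrightarrow> v = w" for v w by (metis u(1))
    have r: "1 \<le> u a" "u a \<le> n" "1 \<le> u b" "u b \<le> n" "1 \<le> u e" "u e \<le> n" using u(3) abe by auto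
    have d: "distinct [0, u a, u b, u e]" using abe r by (auto simp: ui)
    have "cyc 0 (u a) (u b) (u e) (f x) = 0"
    proof (rule kill[OF _ _ _ _ x])
      show "cyc 0 (u a) (u b) (u e) \<in> SQ n {0, u a, u b, u e}" using r d by (intro cyc_SQ) auto
    qed (use r d k u(2) in auto)
    then have "lnk (u a) (u b) (f x) = lnk (u b) (u e) (f x)" using r by (auto simp: cyc_def lk0_def)
    then show ?thesis using lnk_del[OF xp k, of "u a" "u b"] lnk_del[OF xp k, of "u b" "u e"] u(1) not_sym[OF u(2)]
      by (simp add: \<phi>_def)
  qed
  have zero: "lnk p q (\<psi> x) = 0" if x: "x \<in> K n j" and pq: "1 \<le> p" "p < q" "q \<le> m" for x p q
  proof -
    have xp: "\<phi> x \<in> pures m" using x K_pures \<phi>p by blast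
    note sy = lnk_sym[OF xp]
    have "lnk p q (\<phi> x) = lnk 1 2 (\<phi> x)"
    proof -
      consider "p = 1" "q = 2" | "p = 1" "3 \<le> q" | "p = 2" "3 \<le> q" | "3 \<le> p" using pq by linarith
      then show ?thesis
      proof cases
        case 2 then show ?thesis using const[OF x, of q 1 2] sy[of 1 q] pq by auto
      next
        case 3 then show ?thesis using const[OF x, of q 2 1] sy[of 2 q] sy[of 1 2] pq by auto
      next
        case 4 then show ?thesis using const[OF x, of p q 1] const[OF x, of q 1 2] pq by auto
      qed simp
    qed
    moreover have "lnk p q (c (\<phi> x)) = lnk 1 2 (\<phi> x)"
      unfolding c_def using additive_imul[OF additive_lnk z, of p q] lnk_zn[OF pq] by (simp add: imul_int)
    ultimately show ?thesis unfolding \<psi>_def \<rho>_def using additive_diff[OF additive_lnk xp cp, of p q] by simp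
  qed
  have \<psi>0: "\<psi> x = 0" if x: "x \<in> K n j" for x
  proof (rule fg_normal_pures_trivial[where S = "\<psi> ` S" and n = m])
    show "finite (\<psi> ` S)" using S by simp
    show "\<psi> ` S \<subseteq> pures m" using S(2) \<phi>p cp by (auto simp: \<psi>_def \<rho>_def intro!: pures_diff)
    show "\<psi> x \<in> gen (\<psi> ` S)" using im x by blast
    show "lnk p q a = 0" if "a \<in> gen (\<psi> ` S)" "1 \<le> p" "p < q" "q \<le> m" for a p q
      using that zero im by (metis imageE)
    fix a g assume a: "a \<in> gen (\<psi> ` S)" and g: "g \<in> pures m"
    then obtain y where y: "y \<in> K n j" "a = \<psi> y" using im by blast
    then have yp: "y \<in> pures n" using K_pures by blast
    obtain b where b: "b \<in> pures n" "del k b = g" using del_surj[OF k, of g] g unfolding m_def by blast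
    obtain v where v: "v \<in> pures n" "f v = b" using pautoD(3)[OF f] b by (metis imageE)
    have "v + y - v \<in> K n j" using n v y by (intro K_conj) auto
    moreover have "\<psi> (v + y - v) = g + a - g"
    proof -
      have "\<psi> (v + y - v) = \<psi> v + a - \<psi> v" using v yp y(2) by (simp add: additive_sub[OF \<psi> subgrp_pures] pures_add)
      also have "\<psi> v = g + - c g" using b v by (simp add: \<psi>_def \<phi>_def \<rho>_def)
      also have "(g + - c g) + a - (g + - c g) = g + (- c g + a - (- c g)) - g"
        by (simp add: grp del: add_uminus_conv_diff)
      also have "- c g + a - (- c g) = a"
      proof -
        have "a \<in> pures m" using y yp \<phi>p cp by (auto simp: \<psi>_def \<rho>_def intro!: pures_diff)
        then have "commute (- c g) a" using cc commute_sym commute_uminus_left by blast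
        then show ?thesis by (simp only: commute_conj_iff)
      qed
      finally show ?thesis .
    qed
    ultimately show "g + a - g \<in> gen (\<psi> ` S)" using im by (metis imageI)
  qed
  show ?thesis
  proof (rule image_subsetI)
    fix x assume x: "x \<in> K n j"
    then have "\<phi> x = c (\<phi> x)" using \<psi>0 by (simp add: \<psi>_def \<rho>_def)
    then have "dd n k (f x) = imul (lnk 1 2 (\<phi> x)) (zn (n - 1))" using k by (simp add: dd_def \<phi>_def c_def m_def)
    then show "f x \<in> KZ n k" using x K_pures pautoD(2)[OF f] by (auto simp: KZ_def)
  qed
qed

text \<open>For \<open>k = 0\<close> the preceding lemma is applied at strand 1 to \<open>f\<close>
  followed by \<theta>; by \<open>SQ_tht\<close> the classes avoiding 1 pull back along \<theta> to
  classes avoiding 0.\<close>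

theorem automorphism_permutes_K:
  assumes f: "pauto n f" and n: "4 \<le> n"
  obtains \<kappa> where "inj_on \<kappa> {0..n}" "\<kappa> ` {0..n} \<subseteq> {0..n}" "\<And>k. k \<le> n \<Longrightarrow> f ` K n (\<kappa> k) \<subseteq> KZ n k"
proof -
  obtain \<kappa> where \<kappa>: "inj_on \<kappa> {0..n}" "\<kappa> ` {0..n} \<subseteq> {0..n}"
    and h: "\<And>k Q h. k \<le> n \<Longrightarrow> Q \<subseteq> {0..n} \<Longrightarrow> card Q = 4 \<Longrightarrow> k \<notin> Q \<Longrightarrow> h \<in> SQ n Q \<Longrightarrow>
       \<exists>Q'. \<kappa> k \<notin> Q' \<and> (\<lambda>x. h (f x)) \<in> SQ n Q'"
    using automorphism_point_map[OF f n] by metis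
  have n12: "1 \<le> n" "2 \<le> n" using n by auto
  have le: "\<kappa> k \<le> n" if "k \<le> n" for k
  proof -
    have "\<kappa> k \<in> \<kappa> ` {0..n}" using that by simp
    then show ?thesis using \<kappa>(2) by (metis atLeastAtMost_iff subsetD)
  qed
  have kill: "h (f x) = 0" if "k \<le> n" "Q \<subseteq> {0..n}" "card Q = 4" "k \<notin> Q" "h \<in> SQ n Q" "x \<in> K n (\<kappa> k)" for k Q h x
    using h[OF that(1-5)] SQ_kills_K[OF _ le[OF that(1)] _ that(6) n12(2)] by blast
  have "f ` K n (\<kappa> k) \<subseteq> KZ n k" if k: "k \<le> n" for k
  proof (cases "k = 0")
    case False
    then show ?thesis using kill k le by (intro image_K_subset_KZ[OF f n]) auto
  next
    case True
    let ?g = "\<lambda>x. tht n (f x)"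
    have g: "pauto n ?g"
    proof -
      have "bij_betw (tht n \<circ> f) (pures n) (pures n)"
        using f bij_tht[OF n12(1)] by (auto simp: pauto_def intro: bij_betw_trans)
      then show ?thesis using pautoD[OF f] additive_tht[OF n12(1)]
        by (auto simp: pauto_def comp_def intro!: additive_on_comp[of _ f _ "tht n"])
    qed
    have "?g ` K n (\<kappa> 0) \<subseteq> KZ n 1"
    proof (rule image_K_subset_KZ[OF g n _ n12(1) le])
      fix Q h x assume Q: "Q \<subseteq> {0..n}" "card Q = 4" "1 \<notin> Q" "h \<in> SQ n Q" "x \<in> K n (\<kappa> 0)"
      let ?s = "Transposition.transpose 0 (1::nat)"
      have "?s ` Q \<subseteq> {0..n}" using Q n12 by (auto simp: Transposition.transpose_def)
      moreover have "card (?s ` Q) = 4" using Q by (simp add: card_image)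
      moreover have "0 \<notin> ?s ` Q" using Q by (auto simp: Transposition.transpose_def)
      ultimately show "h (tht n (f x)) = 0" using kill[of 0 "?s ` Q" "\<lambda>x. h (tht n x)" x] SQ_tht[OF Q(4) n12(2)] Q by simp
    qed auto
    then show ?thesis using True K_pures[of n] pautoD(2)[OF f] by (auto simp: KZ_def dd_def bd_def)
  qed
  with \<kappa> show ?thesis using that by blast
qed

definition zt :: "nat \<Rightarrow> braid set" where
  "zt n = {x \<in> pures n. \<forall>k\<le>n. x \<in> K n k}"

lemma zt_2: "zt 2 = pures 2"
proof -
  have "dd 2 k x = 0" if "x \<in> pures 2" "k \<le> 2" for x k
  proof -
    have "2 - 1 = (1 :: nat)" by simp
    then have "dd 2 k x \<in> pures 1" using dd_pures[OF that(1) _ that(2)] by (metis one_le_numeral)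
    then show ?thesis unfolding pures_1 by simp
  qed
  then show ?thesis by (auto simp: zt_def K_def)
qed

text \<open>For \<open>n \<ge> 3\<close> each pair of strands survives some deletion, so all linking
  numbers vanish on \<open>zt n\<close>, and with them every integral class. The multiple of the
  full twist that could keep \<open>f x\<close> out of \<open>K n k\<close> is itself the value of
  such a class at \<open>x\<close>.\<close>

theorem zt_invariant:
  assumes f: "pauto n f" and n: "2 \<le> n" shows "f ` zt n \<subseteq> zt n"
proof (cases "n = 2")
  case True then show ?thesis using pautoD(2)[OF f] zt_2 by auto
next
  case False
  then have n3: "3 \<le> n" "1 \<le> n" using n by auto
  show ?thesis
  proof (rule image_subsetI)
    fix x assume x: "x \<in> zt n"
    then have xp: "x \<in> pures n" by (simp add: zt_def)
    have l0: "lnk p q x = 0" if pq: "1 \<le> p" "p < q" "q \<le> n" for p q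
    proof -
      obtain k where k: "k \<in> {1..n}" "k \<noteq> p" "k \<noteq> q"
      proof -
        have "card ({1..n} - {p, q}) = n - 2" using pq by (simp add: card_Diff_subset)
        then have "card ({1..n} - {p, q}) \<noteq> 0" using n3 by linarith
        then obtain k where "k \<in> {1..n} - {p, q}" by (metis card.empty ex_in_conv)
        then show ?thesis using that by blast
      qed
      then have "del k x = 0" using x by (auto simp: zt_def K_def dd_def)
      then show ?thesis using lnk_del[OF xp, of k p q] k by simp
    qed
    have h0: "h x = 0" if "additive_on (pures n) h" for h :: "braid \<Rightarrow> int"
      using additive_eq_of_lnk[OF that xp pures_zero] l0 additive_sub(1)[OF that subgrp_pures] by simp
    have "f x \<in> KZ n k" if k: "k \<le> n" for k
    proof (cases "n = 3")
      case True
      \<comment> \<open>On three strands membership in \<open>KZ\<close> is automatic: the group on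
        two strands is generated by the full twist.\<close>
      then have "dd n k (f x) \<in> pures 2" using dd_pures[OF pautoD(2)[OF f xp] n3(2) k] by simp
      then show ?thesis using pures_2 pautoD(2)[OF f xp] True by (auto simp: KZ_def)
    next
      case False
      then have n4: "4 \<le> n" using n3 by simp
      obtain \<kappa> where \<kappa>: "\<kappa> ` {0..n} \<subseteq> {0..n}" "\<And>k. k \<le> n \<Longrightarrow> f ` K n (\<kappa> k) \<subseteq> KZ n k"
        using automorphism_permutes_K[OF f n4] by metis
      have "\<kappa> k \<in> \<kappa> ` {0..n}" using k by simp
      then have "\<kappa> k \<le> n" using \<kappa>(1) by (metis atLeastAtMost_iff subsetD)
      then have "x \<in> K n (\<kappa> k)" using x by (simp add: zt_def)
      then show ?thesis using \<kappa>(2)[OF k] by blast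
    qed
    then have "f x \<in> K n k" if k: "k \<le> n" for k
    proof -
      obtain r where r: "dd n k (f x) = imul r (zn (n - 1))" using \<open>k \<le> n \<Longrightarrow> f x \<in> KZ n k\<close> k by (auto simp: KZ_def)
      have z: "zn (n - 1) \<in> pures (n - 1)" by (rule zn_pures) simp
      have "additive_on (pures n) (\<lambda>x. lnk 1 2 (dd n k (f x)))"
      proof (rule additive_on_comp[where f = "\<lambda>x. dd n k (f x)" and U = "pures (n - 1)" and g = "lnk 1 2"])
        show "additive_on (pures n) (\<lambda>x. dd n k (f x))"
          by (rule additive_on_comp[OF pautoD(1)[OF f] dd_additive[OF n3(2)]]) (rule pautoD(2)[OF f])
        show "dd n k (f x) \<in> pures (n - 1)" if "x \<in> pures n" for x
          by (rule dd_pures[OF pautoD(2)[OF f that] n3(2) k])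
      qed (rule additive_lnk)
      then have "lnk 1 2 (dd n k (f x)) = 0" by (rule h0)
      then have "r = 0" using additive_imul[OF additive_lnk z, of 1 2 r] lnk_zn[of 1 2 "n - 1"] n3 by (simp add: r imul_int)
      then show ?thesis using r pautoD(2)[OF f xp] by (simp add: K_def)
    qed
    then show "f x \<in> zt n" using pautoD(2)[OF f xp] by (simp add: zt_def)
  qed
qed

text \<open>At least four strands leave a pair \<open>p\<close>, \<open>q\<close> disjoint from
  \<open>j\<close> and \<open>k\<close>. Its linking number equals both multiples, so a single
  multiple of the full twist corrects both deletions.\<close>

lemma KZ_inter_pos:
  assumes n: "4 \<le> n" and jk: "1 \<le> k" "k \<le> n" "1 \<le> j" "j \<le> n" and x: "x \<in> KZ n k" "x \<in> KZ n j"
  shows "\<exists>r. x - imul r (zn n) \<in> K n k \<inter> K n j"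
proof -
  have z: "zn n \<in> pures n" "zn (n - 1) \<in> pures (n - 1)" by (auto intro!: zn_pures)
  have xp: "x \<in> pures n" using x by (simp add: KZ_def)
  obtain r where r: "del k x = imul r (zn (n - 1))" using x jk by (auto simp: KZ_def dd_def)
  obtain s where s: "del j x = imul s (zn (n - 1))" using x jk by (auto simp: KZ_def dd_def)
  obtain p q where pq: "1 \<le> p" "p < q" "q \<le> n" "{p, q} \<inter> {j, k} = {}"
  proof -
    have "2 \<le> card ({1..n} - {j, k})"
    proof -
      have "card {1..n} - card {j, k} \<le> card ({1..n} - {j, k})" by (rule diff_card_le_card_Diff) simp
      moreover have "card {j, k} \<le> 2" by (simp add: card_insert_if)
      ultimately show ?thesis using n by simp
    qed
    then obtain a b where ab: "a \<in> {1..n} - {j, k}" "b \<in> {1..n} - {j, k}" "a \<noteq> b" by (rule obtain_two)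
    then show ?thesis using that[of a b] that[of b a] by (cases "a < b") auto
  qed
  have lz: "lnk u v (imul t (zn (n - 1))) = t" if "1 \<le> u" "u < v" "v \<le> n - 1" for u v t
    using additive_imul[OF additive_lnk z(2), of u v t] lnk_zn[OF that] by (simp add: imul_int)
  have e: "lnk p q x = t" if i: "i \<in> {j, k}" "del i x = imul t (zn (n - 1))" for i t
  proof -
    have i': "1 \<le> i" "i \<le> n" "i \<noteq> p" "i \<noteq> q" using i jk pq by auto
    have "1 \<le> shift_index i p" "shift_index i p < shift_index i q" "shift_index i q \<le> n - 1"
      using shift_index_range[of p n i] shift_index_range[of q n i] shift_index_less[of p q i] pq i' by auto
    then show ?thesis using lnk_del[OF xp i'(1,2), of p q] i' i(2) lz by simp
  qed
  have "r = s" using e[of k r] e[of j s] r s by simp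
  have "x - imul r (zn n) \<in> pures n" using xp z by (intro pures_diff imul_pures)
  moreover have "del i (x - imul r (zn n)) = 0" if i: "i \<in> {j, k}" for i
  proof -
    have i': "1 \<le> i" "i \<le> n" using i jk by auto
    have "del i (x - imul r (zn n)) = del i x - imul r (del i (zn n))"
      using additive_diff[OF additive_del[OF i'(1)] xp imul_pures[OF z(1)]] additive_imul[OF additive_del[OF i'(1)] z(1)] by simp
    then show ?thesis using i i' r s \<open>r = s\<close> by (auto simp: del_zn)
  qed
  ultimately show ?thesis using jk by (intro exI[of _ r]) (auto simp: K_def dd_def)
qed

lemma KZ_inter:
  assumes n: "4 \<le> n" and jk: "2 \<le> k" "k \<le> n" "j \<le> n" and x: "x \<in> KZ n k" "x \<in> KZ n j"
  shows "\<exists>r. x - imul r (zn n) \<in> K n k \<inter> K n j"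
proof (cases "j = 0")
  case False then show ?thesis using assms by (intro KZ_inter_pos) auto
next
  case True
  have n1: "1 \<le> n" "1 \<le> n - 1" using n by auto
  have z: "zn n \<in> pures n" "zn (n - 1) \<in> pures (n - 1)" by (auto intro!: zn_pures)
  have xp: "x \<in> pures n" using x by (simp add: KZ_def)
  have t: "tht n x \<in> pures n" using xp n1 by (intro tht_pures)
  obtain s where s: "bd n x = imul s (zn (n - 1))" using x True by (auto simp: KZ_def dd_def)
  obtain r where r: "del k x = imul r (zn (n - 1))" using x jk by (auto simp: KZ_def dd_def)
  obtain e where e: "tht (n - 1) (zn (n - 1)) = imul e (zn (n - 1))" using tht_zn[OF n1(2)] by blast
  obtain e' where e': "tht n (zn n) = imul e' (zn n)" "e' * e' = 1" using tht_zn[OF n1(1)] by blast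
  have "tht n x \<in> KZ n 1" using s t by (auto simp: KZ_def dd_def bd_def)
  moreover have "del k (tht n x) = imul (r * e) (zn (n - 1))"
    using del_tht[OF xp jk(1,2)] r additive_imul[OF additive_tht[OF n1(2)] z(2), of r] e by (simp add: imul_imul)
  then have "tht n x \<in> KZ n k" using t jk by (auto simp: KZ_def dd_def)
  ultimately obtain u where u: "tht n x - imul u (zn n) \<in> K n k \<inter> K n 1"
    using KZ_inter_pos[of n k 1 "tht n x"] n jk n1 by auto
  \<comment> \<open>\<theta> multiplies the full twist by \<open>e'\<close>; since
    \<open>e' * e' = 1\<close>, the extra factor \<open>e'\<close> cancels when \<theta> is
    applied.\<close>
  let ?y = "x - imul (u * e') (zn n)"
  have y: "?y \<in> pures n" using xp z by (intro pures_diff imul_pures)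
  have "tht n ?y = tht n x - imul u (zn n)"
    using additive_diff[OF additive_tht[OF n1(1)] xp imul_pures[OF z(1)]] additive_imul[OF additive_tht[OF n1(1)] z(1)] e'
    by (simp add: imul_imul mult.assoc)
  then have "?y \<in> K n k \<inter> K n 0" using u tht_K[OF jk(1,2) y] tht_K_0[OF n1(1) y] by simp
  then show ?thesis using True by blast
qed

subsection \<open>The boundary subgroup\<close>

lemma comm_mod_center:
  assumes "commute z c" "commute z r" "commute z d" "commute z s" "c = d + imul i z" "r = s + imul j z"
  shows "c + r - c - r = d + s - d - (s :: 'a::group_add)"
proof -
  let ?u = "imul i z" and ?v = "imul j z"
  have u: "commute x ?u" "commute x ?v" if "commute z x" for x using that commute_sym commute_imul by blast+
  have su: "?u + s = s + ?u" "?v + d = d + ?v" "?v + s = s + ?v" "?u + d = d + ?u"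
    using u[OF assms(3)] u[OF assms(4)] by (auto simp: commute_def)
  have uv: "?u + ?v = ?v + ?u" using commute_imul[of ?u z j] commute_sym[OF commute_imul[of z z i]] by (simp add: commute_def)
  have "c + r = (d + s) + (?u + ?v)"
    unfolding assms(5,6) using su(1) by (metis add.assoc)
  moreover have "r + c = (s + d) + (?u + ?v)"
    unfolding assms(5,6) using su(2) uv by (metis add.assoc)
  moreover have "c + r - c - r = (c + r) - (r + c)" by (simp add: grp del: add_uminus_conv_diff)
  ultimately show ?thesis by (simp add: grp del: add_uminus_conv_diff)
qed

text \<open>A central error of an entry disappears as soon as the entry enters a commutator. It can
  persist only over a singleton, which the clause on \<open>card S\<close> records.\<close>

lemma fc_image_mod_center:
  assumes "fc R S a" "subgrp P" "additive_on P f" "\<And>i. i \<in> S \<Longrightarrow> R i \<subseteq> P" "inj_on \<pi> S"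
    "\<And>i r. i \<in> S \<Longrightarrow> r \<in> R i \<Longrightarrow> \<exists>t s. s \<in> R' (\<pi> i) \<and> f r = s + imul t z"
    "subgrp P'" "\<And>x. x \<in> P' \<Longrightarrow> commute z x" "f ` P \<subseteq> P'" "\<And>i. i \<in> S \<Longrightarrow> R' (\<pi> i) \<subseteq> P'"
  shows "a \<in> P \<and> (\<exists>t u. u \<in> P' \<and> fc R' (\<pi> ` S) u \<and> f a = u + imul t z \<and> (card S \<noteq> 1 \<longrightarrow> t = 0))"
  using assms(1,4,5,6,10)
proof (induction rule: fc.induct)
  case (base r i)
  obtain t s where s: "s \<in> R' (\<pi> i)" "f r = s + imul t z" using base(4)[OF singletonI base(1)] by auto
  have "s \<in> P'" "r \<in> P" using base(1) base(2)[OF singletonI] base(5)[OF singletonI] s(1) by auto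
  moreover have "fc R' (\<pi> ` {i}) s" using fc.base[of s R' "\<pi> i", OF s(1)] by simp
  moreover have "card {i} \<noteq> 1 \<longrightarrow> t = 0" by simp
  ultimately show ?case using s(2) by blast
next
  case (comm S c i r)
  have "c \<in> P \<and> (\<exists>t u. u \<in> P' \<and> fc R' (\<pi> ` S) u \<and> f c = u + imul t z \<and> (card S \<noteq> 1 \<longrightarrow> t = 0))"
    using comm.prems by (intro comm.IH) (auto simp: inj_on_def)
  then obtain t u where c: "c \<in> P" "u \<in> P'" "fc R' (\<pi> ` S) u" "f c = u + imul t z" by blast
  obtain t' s where s: "s \<in> R' (\<pi> i)" "f r = s + imul t' z" using comm.prems(3)[of i r] comm.hyps by auto
  have r: "r \<in> P" "s \<in> P'" using comm.prems(1)[of i] comm.prems(4)[of i] comm.hyps s by auto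
  have \<pi>i: "\<pi> i \<notin> \<pi> ` S" using comm.prems(2) comm.hyps by (auto simp: inj_on_def)
  have z: "commute z (f c)" "commute z (f r)" "commute z u" "commute z s" using assms(8,9) c r by auto
  have "f (c + r - c - r) = f c + f r - f c - f r"
    using c r subgrpD[OF assms(2)] by (simp add: additive_sub[OF assms(3,2)])
  also have "\<dots> = u + s - u - s" by (rule comm_mod_center[OF z c(4) s(2)])
  finally have "f (c + r - c - r) = (u + s - u - s) + imul 0 z" by simp
  moreover have "fc R' (insert (\<pi> i) (\<pi> ` S)) (u + s - u - s)" by (rule fc.comm[OF c(3) \<pi>i s(1)])
  ultimately show ?case using c r subgrpD[OF assms(2)] subgrpD[OF assms(7)]
    by (intro conjI exI[of _ 0] exI[of _ "u + s - u - s"]) auto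
next
  case (zero S)
  show ?case using subgrpD[OF assms(2)] subgrpD[OF assms(7)] additive_sub[OF assms(3,2)]
    by (intro conjI exI[of _ 0] exI[of _ "0"]) (auto intro: fc.zero)
next
  case (add S a b)
  obtain t u where a: "a \<in> P" "u \<in> P'" "fc R' (\<pi> ` S) u" "f a = u + imul t z" "card S \<noteq> 1 \<longrightarrow> t = 0"
    using add.IH(1)[OF add.prems] by blast
  obtain t' u' where b: "b \<in> P" "u' \<in> P'" "fc R' (\<pi> ` S) u'" "f b = u' + imul t' z" "card S \<noteq> 1 \<longrightarrow> t' = 0"
    using add.IH(2)[OF add.prems] by blast
  have "commute u' (imul t z)" by (rule commute_imul[OF commute_sym[OF assms(8)[OF b(2)]]])
  then have 1: "imul t z + u' = u' + imul t z" by (simp add: commute_def)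
  have "f (a + b) = u + (imul t z + u') + imul t' z"
    using a(1) b(1) by (simp add: additive_sub[OF assms(3,2)] a(4) b(4) add.assoc)
  also have "\<dots> = (u + u') + imul (t + t') z" unfolding 1 by (simp add: imul_add add.assoc)
  finally have "f (a + b) = (u + u') + imul (t + t') z" .
  moreover have "fc R' (\<pi> ` S) (u + u')" by (rule fc.add[OF a(3) b(3)])
  moreover have "a + b \<in> P" "u + u' \<in> P'" using a b subgrpD[OF assms(2)] subgrpD[OF assms(7)] by auto
  moreover have "card S \<noteq> 1 \<longrightarrow> t + t' = 0" using a(5) b(5) by simp
  ultimately show ?case by blast
next
  case (uminus S a)
  obtain t u where a: "a \<in> P" "u \<in> P'" "fc R' (\<pi> ` S) u" "f a = u + imul t z" "card S \<noteq> 1 \<longrightarrow> t = 0"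
    using uminus.IH[OF uminus.prems] by blast
  have "commute u (imul t z)" by (rule commute_imul[OF commute_sym[OF assms(8)[OF a(2)]]])
  then have 1: "u + imul t z = imul t z + u" by (simp add: commute_def)
  have "f (- a) = - (u + imul t z)" using a(1) by (simp only: additive_sub[OF assms(3,2)] a(4))
  also have "\<dots> = - u + imul (- t) z" unfolding 1 by (simp add: imul_uminus minus_add del: add_uminus_conv_diff)
  finally have "f (- a) = - u + imul (- t) z" .
  moreover have "fc R' (\<pi> ` S) (- u)" by (rule fc.uminus[OF a(3)])
  moreover have "- a \<in> P" "- u \<in> P'" using a subgrpD[OF assms(2)] subgrpD[OF assms(7)] by auto
  moreover have "card S \<noteq> 1 \<longrightarrow> - t = 0" using a(5) by simp
  ultimately show ?case by blast
qed

lemma bdt_invariant_4: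
  assumes f: "pauto n f" and n: "4 \<le> n" shows "f ` bdt n \<subseteq> bdt n"
proof (rule image_subsetI)
  fix x assume x: "x \<in> bdt n"
  have n1: "1 \<le> n" using n by simp
  obtain \<kappa> where \<kappa>: "inj_on \<kappa> {0..n}" "\<kappa> ` {0..n} \<subseteq> {0..n}" "\<And>k. k \<le> n \<Longrightarrow> f ` K n (\<kappa> k) \<subseteq> KZ n k"
    using automorphism_permutes_K[OF f n] by metis
  have \<kappa>im: "\<kappa> ` {0..n} = {0..n}" by (rule endo_inj_surj) (use \<kappa> in auto)
  define \<pi> where "\<pi> = inv_into {0..n} \<kappa>"
  have \<pi>: "\<pi> i \<le> n" "\<kappa> (\<pi> i) = i" if "i \<le> n" for i
    using that \<kappa>im inv_into_into[of i \<kappa> "{0..n}"] f_inv_into_f[of i \<kappa> "{0..n}"] by (auto simp: \<pi>_def)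
  have \<pi>\<kappa>: "\<pi> (\<kappa> k) = k" if "k \<le> n" for k using that \<kappa>(1) by (simp add: \<pi>_def)
  \<comment> \<open>\<open>bdt_eq_fc\<close> asks for a base at least 2 on both sides. Of the three
    or more elements of \<open>{2..n}\<close> at most two can be sent to 0 and 1.\<close>
  obtain k where k: "2 \<le> k" "k \<le> n" "2 \<le> \<kappa> k"
  proof (rule ccontr)
    assume "\<not> thesis"
    then have "\<kappa> ` {2..n} \<subseteq> {0, 1}" using that by fastforce
    then have "card (\<kappa> ` {2..n}) \<le> card {0, 1 :: nat}" by (intro card_mono) auto
    moreover have "card (\<kappa> ` {2..n}) = card {2..n}" by (rule card_image, rule inj_on_subset[OF \<kappa>(1)]) auto
    ultimately show False using n by simp
  qed
  let ?b = "\<kappa> k"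
  have b: "2 \<le> ?b" "?b \<le> n"
  proof -
    have "?b \<in> \<kappa> ` {0..n}" using k by simp
    then show "?b \<le> n" using \<kappa>(2) by (metis atLeastAtMost_iff subsetD)
  qed (use k in simp)
  have "fc (\<lambda>i. K n ?b \<inter> K n i) ({0..n} - {?b}) x" using x bdt_eq_fc[OF b] by simp
  then have "x \<in> pures n \<and> (\<exists>t u. u \<in> pures n \<and> fc (\<lambda>i. K n k \<inter> K n i) (\<pi> ` ({0..n} - {?b})) u \<and> f x = u + imul t (zn n) \<and>
      (card ({0..n} - {?b}) \<noteq> 1 \<longrightarrow> t = 0))"
  proof (rule fc_image_mod_center[OF _ subgrp_pures pautoD(1)[OF f] _ _ _ subgrp_pures])
    show "inj_on \<pi> ({0..n} - {?b})" using \<pi>(2) by (intro inj_onI) (metis DiffD1 atLeastAtMost_iff)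
    show "\<exists>t s. s \<in> K n k \<inter> K n (\<pi> i) \<and> f r = s + imul t (zn n)"
      if i: "i \<in> {0..n} - {?b}" and r: "r \<in> K n ?b \<inter> K n i" for i r
    proof -
      have "f r \<in> KZ n k" "f r \<in> KZ n (\<pi> i)" using \<kappa>(3)[of k] \<kappa>(3)[of "\<pi> i"] \<pi>[of i] i r k by auto
      then obtain t where "f r - imul t (zn n) \<in> K n k \<inter> K n (\<pi> i)" using KZ_inter[OF n k(1,2) \<pi>(1)] i by auto
      then show ?thesis by (intro exI[of _ t] exI[of _ "f r - imul t (zn n)"]) simp
    qed
    show "commute (zn n) y" if "y \<in> pures n" for y using zn_central[OF that] by (rule commute_sym)
  qed (use K_pures pautoD(2)[OF f] in auto)
  \<comment> \<open>More than one index occurs, so the central error \<open>t\<close> is 0.\<close>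
  moreover have "card ({0..n} - {?b}) = n" using b by simp
  moreover have "\<pi> ` ({0..n} - {?b}) = {0..n} - {k}"
  proof
    have "\<pi> i \<noteq> k" if "i \<in> {0..n} - {?b}" for i using \<pi>(2)[of i] that by auto
    moreover have "\<pi> i \<in> {0..n}" if "i \<in> {0..n} - {?b}" for i using \<pi>(1)[of i] that by simp
    ultimately show "\<pi> ` ({0..n} - {?b}) \<subseteq> {0..n} - {k}" by blast
    show "{0..n} - {k} \<subseteq> \<pi> ` ({0..n} - {?b})"
    proof
      fix j assume j: "j \<in> {0..n} - {k}"
      have "\<kappa> j \<in> \<kappa> ` {0..n}" using j by simp
      then have "\<kappa> j \<in> {0..n}" using \<kappa>(2) by blast
      then have "\<kappa> j \<le> n" by simp
      moreover have "\<kappa> j \<noteq> ?b" using inj_onD[OF \<kappa>(1), of j k] j k by auto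
      ultimately have "\<kappa> j \<le> n" "\<kappa> j \<noteq> ?b" by blast+
      then show "j \<in> \<pi> ` ({0..n} - {?b})" using j \<pi>\<kappa> by (intro image_eqI[of _ _ "\<kappa> j"]) auto
    qed
  qed
  ultimately have "fc (\<lambda>i. K n k \<inter> K n i) ({0..n} - {k}) (f x)" using n by auto
  then show "f x \<in> bdt n" using bdt_eq_fc[OF k(1,2)] by simp
qed

definition gam2 :: "nat \<Rightarrow> braid set" where
  "gam2 n = gen {a + b - a - b | a b. a \<in> pures n \<and> b \<in> pures n}"

definition gam3 :: "nat \<Rightarrow> braid set" where
  "gam3 n = gen {a + b - a - b | a b. a \<in> gam2 n \<and> b \<in> pures n}"

lemma gam2_pures: "gam2 n \<subseteq> pures n"
  unfolding gam2_def by (rule gen_least[OF _ subgrp_pures]) (auto intro!: pures_diff pures_add)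

lemma gam3_invariant: assumes f: "pauto n f" shows "f ` gam3 n \<subseteq> gam3 n"
proof -
  note fs = additive_sub[OF pautoD(1)[OF f] subgrp_pures]
  have comm: "f (a + b - a - b) = f a + f b - f a - f b" if "a \<in> pures n" "b \<in> pures n" for a b
    using that by (simp add: fs pures_add pures_diff)
  have "f ` gam2 n = gen (f ` {a + b - a - b | a b. a \<in> pures n \<and> b \<in> pures n})"
    unfolding gam2_def using pautoD(1)[OF f] by (rule additive_gen_image) (auto intro!: pures_diff pures_add)
  also have "\<dots> \<subseteq> gam2 n"
  proof -
    have "f ` {a + b - a - b | a b. a \<in> pures n \<and> b \<in> pures n} \<subseteq> gam2 n"
    proof clarify
      fix a b assume ab: "a \<in> pures n" "b \<in> pures n"
      then have "f a + f b - f a - f b \<in> gam2 n" unfolding gam2_def using pautoD(2)[OF f] by (intro gen.incl) blast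
      then show "f (a + b - a - b) \<in> gam2 n" using comm ab by simp
    qed
    then show ?thesis unfolding gam2_def using gen_mono by blast
  qed
  finally have 2: "f ` gam2 n \<subseteq> gam2 n" .
  have sub: "{a + b - a - b | a b. a \<in> gam2 n \<and> b \<in> pures n} \<subseteq> pures n"
    using gam2_pures by (auto intro!: pures_diff pures_add)
  have "f ` gam3 n = gen (f ` {a + b - a - b | a b. a \<in> gam2 n \<and> b \<in> pures n})"
    unfolding gam3_def using pautoD(1)[OF f] sub by (rule additive_gen_image)
  also have "\<dots> \<subseteq> gam3 n"
  proof -
    have "f ` {a + b - a - b | a b. a \<in> gam2 n \<and> b \<in> pures n} \<subseteq> gam3 n"
    proof clarify
      fix a b assume ab: "a \<in> gam2 n" "b \<in> pures n"
      then have "f a + f b - f a - f b \<in> gam3 n" unfolding gam3_def using pautoD(2)[OF f] 2 by (intro gen.incl) blast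
      moreover have "f (a + b - a - b) = f a + f b - f a - f b" using ab gam2_pures by (intro comm) auto
      ultimately show "f (a + b - a - b) \<in> gam3 n" by simp
    qed
    then show ?thesis unfolding gam3_def using gen_mono by blast
  qed
  finally show ?thesis .
qed

lemma fc_gam:
  assumes "fc R S a" "\<And>i. i \<in> S \<Longrightarrow> R i \<subseteq> pures n"
  shows "a \<in> pures n \<and> (card S = 2 \<longrightarrow> a \<in> gam2 n) \<and> (card S = 3 \<longrightarrow> a \<in> gam3 n)"
  using assms
proof (induction rule: fc.induct)
  case (comm S c i r)
  have r: "r \<in> pures n" using comm by auto
  have c: "c \<in> pures n" "card S = 2 \<longrightarrow> c \<in> gam2 n" using comm by auto
  have "card S = 2" if "card (insert i S) = 3"
  proof -
    have "finite (insert i S)" using that by (intro card_ge_0_finite) simp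
    then have "finite S" by simp
    then show ?thesis using that comm.hyps by simp
  qed
  then show ?case using c r unfolding gam2_def gam3_def
    by (auto intro!: pures_diff pures_add gen.incl)
next
  case (zero S) show ?case by (auto simp: gam2_def gam3_def gen.zero)
next
  case (add S a b) then show ?case by (auto simp: gam2_def gam3_def intro: gen.add pures_add)
next
  case (uminus S a) then show ?case by (auto simp: gam2_def gam3_def intro: gen.uminus pures_uminus)
qed auto

text \<open>A commutator with a sum \<open>a + b\<close> is the commutator with \<open>a\<close>
  plus a conjugate of the one with \<open>b\<close>, so the generators suffice.\<close>

lemma commutators_in_normal:
  assumes D: "subgrp D" "\<And>g d. g \<in> gen X \<Longrightarrow> d \<in> D \<Longrightarrow> g + d - g \<in> D"
    and c: "\<And>x. x \<in> X \<Longrightarrow> c + x - c - x \<in> D" and a: "a \<in> gen X"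
  shows "c + a - c - (a :: 'a::group_add) \<in> D"
  using a
proof induction
  case (add a b)
  have "c + (a + b) - c - (a + b) = (c + a - c - a) + (a + (c + b - c - b) - a)"
    by (simp add: grp del: add_uminus_conv_diff)
  then show ?case using add D(2) subgrpD(2)[OF D(1)] by simp
next
  case (uminus a)
  have "c + (- a) - c - (- a) = - a + - (c + a - c - a) - (- a)"
    by (simp add: grp del: add_uminus_conv_diff)
  then show ?case using D(2)[OF gen.uminus[OF uminus.hyps] subgrpD(3)[OF D(1) uminus.IH]] by simp
qed (use c subgrpD[OF D(1)] in auto)

text \<open>With base 2 the entries with index 1, 3 and 0 contain \<open>?a\<close>,
  \<open>?b\<close> and \<open>?a + ?b\<close>; \<open>?a\<close>, \<open>?b\<close> and the central
  twist generate the group. So symmetric commutators over any two of the indices already contain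
  \<open>gam2 3\<close>, and a third entry then brings in the commutators with \<open>?a\<close> or
  \<open>?b\<close>.\<close>

lemma bdt_3: "bdt 3 = gam3 3"
proof -
  let ?R = "\<lambda>i. K 3 2 \<inter> K 3 i"
  have set: "{0..3} - {2} = {0, 1, 3 :: nat}" by auto
  have eq: "bdt 3 = {a. fc ?R {0, 1, 3} a}" using bdt_eq_fc[of 2 3] unfolding set by simp
  let ?a = "pgen 1 2" and ?b = "pgen 2 3" and ?z = "zn 3"
  have p: "?a \<in> pures 3" "?b \<in> pures 3" by (rule pgen_pures; simp)+
  have z: "?z \<in> pures 3" by (rule zn_pures) simp
  have ncl_self: "x \<in> ncl 3 x" for x
  proof -
    have "\<exists>g. x = g + x - g \<and> g \<in> pures 3" by (rule exI[of _ 0]) (simp add: pures_zero)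
    then show ?thesis unfolding ncl_def by (intro gen.incl) blast
  qed
  have "?a \<in> K 3 1 \<inter> K 3 2" using K_inter[of 1 2 3] ncl_self[of ?a] by (simp del: pgen_1_2)
  then have r1: "?a \<in> ?R 1" by (simp del: pgen_1_2)
  have r3: "?b \<in> ?R 3" using K_inter[of 2 3 3] ncl_self[of ?b] by simp
  have ls: "lsum 2 = ?a" using lsum.simps(2)[of 1] lsum_1 by (simp del: lsum.simps)
  have t: "tsum 3 2 = ?a + ?b"
  proof -
    have "rsum 3 2 = ?b" by (simp add: rsum_def)
    then show ?thesis using tsum_eq[of 2 3] ls by simp
  qed
  have "K 3 0 \<inter> K 3 2 = ncl 3 (tsum 3 2)" by (rule K_0_inter) simp_all
  then have r0: "?a + ?b \<in> ?R 0" using ncl_self[of "tsum 3 2"] unfolding t by blast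
  have gens: "pures 3 = gen {?a, ?b, ?z}"
  proof
    show "gen {?a, ?b, ?z} \<subseteq> pures 3" by (rule gen_least[OF _ subgrp_pures]) (use p z in auto)
    have in': "?a \<in> gen {?a, ?b, ?z}" "?b \<in> gen {?a, ?b, ?z}" "?z \<in> gen {?a, ?b, ?z}" by (auto intro: gen.incl)
    \<comment> \<open>The full twist is the product of the three pure generators, so it can replace
      \<open>pgen 1 3\<close> in a generating set.\<close>
    have "lsum 3 = pgen 1 3 + ?b"
      using pgen_lsum[of 3] by (simp add: upt_rec[of 1] upt_rec[of 2] upt_rec[of 3])
    moreover have "?z = zn 2 + lsum 3" using zn.simps(2)[of 2] by (simp del: zn.simps lsum.simps)
    ultimately have "pgen 1 3 = - ?a + ?z - ?b" by (simp add: zn_2 grp del: add_uminus_conv_diff pgen_1_2)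
    then have c: "pgen 1 3 \<in> gen {?a, ?b, ?z}" using in' by (simp only:) (intro gen_diff gen.add gen.uminus)
    have "pgens 3 \<subseteq> gen {?a, ?b, ?z}"
    proof
      fix x assume "x \<in> pgens 3"
      then obtain i j where x: "x = pgen i j" "1 \<le> i" "i < j" "j \<le> (3::nat)" unfolding pgens_def by blast
      then have "(i = 1 \<and> j = 2) \<or> (i = 1 \<and> j = 3) \<or> (i = 2 \<and> j = 3)" by auto
      then show "x \<in> gen {?a, ?b, ?z}" using c in' x(1) by (elim disjE conjE) (simp_all del: pgen_1_2)
    qed
    then show "pures 3 \<subseteq> gen {?a, ?b, ?z}" unfolding pures_eq_gen using gen_mono by blast
  qed
  have sub: "subgrp {a. fc ?R S a}" for S by (auto simp: subgrp_def intro: fc.intros)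
  have conj: "g + d - g \<in> {a. fc ?R S a}" if "d \<in> {a. fc ?R S a}" "g \<in> pures 3" for S g d
    using fc_conj[of ?R S d g] K_conj[of 3 _ _ g] that by auto
  have pair: "gam2 3 \<subseteq> {a. fc ?R S a}" if ab: "?a + ?b - ?a - ?b \<in> {a. fc ?R S a}" for S
  proof -
    let ?D = "{a. fc ?R S a}"
    have ba: "?b + ?a - ?b - ?a \<in> ?D"
    proof -
      have "- (?a + ?b - ?a - ?b) = ?b + ?a - ?b - ?a" by (simp add: grp del: add_uminus_conv_diff pgen_1_2)
      then show ?thesis using subgrpD(3)[OF sub ab] by (simp only:)
    qed
    have zz: "?z + y - ?z - y \<in> ?D" "y + ?z - y - ?z \<in> ?D" if "y \<in> pures 3" for y
    proof -
      have "y + ?z = ?z + y" using zn_central[OF that] by (simp add: commute_def)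
      then have "?z + y - ?z - y = 0" "y + ?z - y - ?z = 0" by (metis add_diff_cancel diff_self)+
      then show "?z + y - ?z - y \<in> ?D" "y + ?z - y - ?z \<in> ?D" using subgrpD(1)[OF sub[of S]] by simp_all
    qed
    have 1: "c + y - c - y \<in> ?D" if c: "c \<in> {?a, ?b, ?z}" and y: "y \<in> pures 3" for c y
    proof (rule commutators_in_normal[OF sub, where X = "{?a, ?b, ?z}"])
      show "y \<in> gen {?a, ?b, ?z}" using y gens by simp
      show "c + x - c - x \<in> ?D" if "x \<in> {?a, ?b, ?z}" for x
        using that c ab ba zz p z subgrpD(1)[OF sub[of S]] by (elim insertE emptyE) (simp_all del: pgen_1_2)
    qed (use conj gens in auto)
    have 2: "y + c - y - c \<in> ?D" if c: "c \<in> {?a, ?b, ?z}" and y: "y \<in> pures 3" for c y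
    proof -
      have "- (c + y - c - y) = y + c - y - c" by (simp add: grp del: add_uminus_conv_diff)
      then show ?thesis using subgrpD(3)[OF sub 1[OF that]] by (simp only:)
    qed
    have 3: "x + y - x - y \<in> ?D" if "x \<in> pures 3" "y \<in> pures 3" for x y
    proof (rule commutators_in_normal[OF sub, where X = "{?a, ?b, ?z}"])
      show "y \<in> gen {?a, ?b, ?z}" using that gens by simp
    qed (use 2 that conj gens in auto)
    show ?thesis unfolding gam2_def by (rule gen_least[OF _ sub]) (use 3 in blast)
  qed
  have d13: "gam2 3 \<subseteq> {a. fc ?R {3, 1} a}"
    using fc.comm[OF fc.base[of ?a ?R 1, OF r1], of 3 ?b] r3 by (intro pair) auto
  have d03: "gam2 3 \<subseteq> {a. fc ?R {3, 0} a}"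
  proof (rule pair)
    have "fc ?R {3, 0} (?a + ?b + ?b - (?a + ?b) - ?b)"
      using fc.comm[OF fc.base[of "?a + ?b" ?R 0, OF r0], of 3 ?b] r3 by auto
    moreover have "?a + ?b + ?b - (?a + ?b) - ?b = ?a + ?b - ?a - ?b"
      by (simp add: grp del: add_uminus_conv_diff pgen_1_2)
    ultimately show "?a + ?b - ?a - ?b \<in> {a. fc ?R {3, 0} a}" by simp
  qed
  have d01: "gam2 3 \<subseteq> {a. fc ?R {1, 0} a}"
  proof (rule pair)
    have "fc ?R {1, 0} (?a + ?b + ?a - (?a + ?b) - ?a)"
      using fc.comm[OF fc.base[of "?a + ?b" ?R 0, OF r0], of 1 ?a] r1 by auto
    then have "- ?a + - (?a + ?b + ?a - (?a + ?b) - ?a) - - ?a \<in> {a. fc ?R {1, 0} a}"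
      by (intro conj[OF _ pures_uminus[OF p(1)]] CollectI fc.uminus)
    moreover have "- ?a + - (?a + ?b + ?a - (?a + ?b) - ?a) - - ?a = ?a + ?b - ?a - ?b"
      by (simp add: grp del: add_uminus_conv_diff pgen_1_2)
    ultimately show "?a + ?b - ?a - ?b \<in> {a. fc ?R {1, 0} a}" by metis
  qed
  show ?thesis
  proof
    show "bdt 3 \<subseteq> gam3 3" unfolding eq using fc_gam[of ?R "{0, 1, 3}" _ 3] K_pures by auto
    have "c + r - c - r \<in> {a. fc ?R {0, 1, 3} a}" if c: "c \<in> gam2 3" and r: "r \<in> pures 3" for c r
    proof (rule commutators_in_normal[OF sub, where X = "{?a, ?b, ?z}"])
      show "r \<in> gen {?a, ?b, ?z}" using r gens by simp
      have "c + ?a - c - ?a \<in> {a. fc ?R {0, 1, 3} a}"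
      proof -
        have "fc ?R (insert 1 {3, 0}) (c + ?a - c - ?a)" using c d03 r1 by (intro fc.comm) auto
        then show ?thesis by (simp add: insert_commute)
      qed
      moreover have "c + ?b - c - ?b \<in> {a. fc ?R {0, 1, 3} a}"
      proof -
        have "fc ?R (insert 3 {1, 0}) (c + ?b - c - ?b)" using c d01 r3 by (intro fc.comm) auto
        then show ?thesis by (simp add: insert_commute)
      qed
      moreover have "c + ?z - c - ?z \<in> {a. fc ?R {0, 1, 3} a}"
      proof -
        have "c + ?z = ?z + c" using zn_central[of c 3] c gam2_pures by (auto simp: commute_def)
        then have "c + ?z - c - ?z = 0" by (metis add_diff_cancel diff_self)
        then show ?thesis by (simp add: fc.zero)
      qed
      ultimately show "c + x - c - x \<in> {a. fc ?R {0, 1, 3} a}" if "x \<in> {?a, ?b, ?z}" for x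
        using that by (elim insertE emptyE) (simp_all only:)
    qed (use conj gens in auto)
    then show "gam3 3 \<subseteq> bdt 3" unfolding eq gam3_def by (intro gen_least[OF _ sub]) blast
  qed
qed

lemma bdt_2: "bdt 2 = {0}"
proof -
  have "a = 0" if "a \<in> gam2 2" for a
    using that unfolding gam2_def
  proof induction
    case (incl x)
    then obtain a b where ab: "x = a + b - a - b" "a \<in> pures 2" "b \<in> pures 2" by blast
    have "commute a b" using pures_2[OF ab(3)] zn_central[OF ab(2)] commute_imul by metis
    then show ?case using ab by (simp add: commute_conj_iff)
  qed auto
  moreover have "bdt 2 \<subseteq> gam2 2"
  proof
    have set: "{0..2} - {2} = {0, 1 :: nat}" by auto
    fix a assume "a \<in> bdt 2"
    then have "fc (\<lambda>i. K 2 2 \<inter> K 2 i) {0, 1} a" using bdt_eq_fc[of 2 2] unfolding set by simp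
    then show "a \<in> gam2 2" using fc_gam[of _ "{0, 1}" a 2] K_pures by fastforce
  qed
  moreover have "0 \<in> bdt 2" using bdt_eq_fc[of 2 2] by (simp add: fc.zero)
  ultimately show ?thesis by blast
qed

theorem bdt_invariant:
  assumes f: "pauto n f" and n: "2 \<le> n" shows "f ` bdt n \<subseteq> bdt n"
proof -
  consider "n = 2" | "n = 3" | "4 \<le> n" using n by linarith
  then show ?thesis
  proof cases
    case 1
    then show ?thesis using bdt_2 additive_sub(1)[OF pautoD(1)[OF f] subgrp_pures] by simp
  next
    case 2
    then show ?thesis using bdt_3 gam3_invariant[OF f] by simp
  next
    case 3
    then show ?thesis by (rule bdt_invariant_4[OF f])
  qed
qed

section \<open>Translation between additive braids and the groups of braid classes\<close>

section \<open>The braid groups as quotients of words\<close>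

definition cls :: "nat \<Rightarrow> braid \<Rightarrow> braid_word set" where
  "cls n a = {w \<in> braid_words n. of_word w = a}"

lemma braid_class_eq: "w \<in> braid_words n \<Longrightarrow> braid_class n w = cls n (of_word w)"
proof -
  assume w: "w \<in> braid_words n"
  have "braid_eq n w v \<longleftrightarrow> v \<in> braid_words n \<and> of_word v = of_word w" for v
    using braid_eq_words[of n w v] of_word_eq_iff[OF w, of v] by metis
  then show ?thesis by (simp add: braid_class_def cls_def)
qed

lemma braidsE:
  assumes "a \<in> braids n" obtains w where "w \<in> braid_words n" "of_word w = a"
  using assms unfolding braids_def by blast

lemma cls_eq_iff: "a \<in> braids n \<Longrightarrow> cls n a = cls n b \<longleftrightarrow> a = b"
  unfolding cls_def braids_def by blast

lemma carrier_braid_group: "carrier (braid_group n) = cls n ` braids n"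
  unfolding braid_group_def braids_def by (simp add: image_image braid_class_eq cong: image_cong)

lemma mult_braid_group:
  assumes "a \<in> braids n" "b \<in> braids n"
  shows "cls n a \<otimes>\<^bsub>braid_group n\<^esub> cls n b = cls n (a + b)"
proof -
  have "braid_class n (x @ y) = cls n (a + b)" if "x \<in> cls n a" "y \<in> cls n b" for x y
  proof -
    have "x \<in> braid_words n" "y \<in> braid_words n" "of_word x = a" "of_word y = b" using that by (simp_all add: cls_def)
    then show ?thesis using braid_class_eq[of "x @ y" n] of_word_append[of x n y] by simp
  qed
  moreover have "cls n a \<noteq> {}" "cls n b \<noteq> {}" using assms by (auto simp: cls_def braids_def)
  ultimately show ?thesis unfolding braid_group_def by auto
qed

lemma one_braid_group: "\<one>\<^bsub>braid_group n\<^esub> = cls n 0"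
  unfolding braid_group_def using braid_class_eq[of "[]" n] by simp

lemma run_word_perm: "w \<in> braid_words n \<Longrightarrow> run tr (word_perm w k) w = k"
proof (induction w)
  case (Cons l w)
  have "word_perm (l # w) k = tr l (word_perm w k)"
    by (simp add: word_perm_def tr_def split: prod.splits)
  moreover have "w \<in> braid_words n" using Cons.prems by (cases l) simp
  moreover have "tr l (tr l x) = x" for x by (cases l) (simp only: tr_tr)
  ultimately show ?case using Cons.IH by simp
qed (simp add: word_perm_def)

text \<open>\<open>word_perm\<close> composes its transpositions with the first letter acting last,
  opposite to \<open>pos\<close>, whence the inverse. The condition of being the identity is the
  same for both.\<close>

lemma word_perm_eq: "w \<in> braid_words n \<Longrightarrow> word_perm w = pos (- of_word w)"
proof
  fix k assume w: "w \<in> braid_words n"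
  have "pos (of_word w) (word_perm w k) = pos (of_word w) (pos (- of_word w) k)"
    using run_word_perm[OF w] pos_del_of_word(1)[OF w] by simp
  then show "word_perm w k = pos (- of_word w) k" by (simp only: pos_inj)
qed

lemma braid_perm_cls: "a \<in> braids n \<Longrightarrow> braid_perm (cls n a) = pos (- a)"
proof -
  assume "a \<in> braids n"
  then obtain w where w: "w \<in> braid_words n" "of_word w = a" by (rule braidsE)
  have "word_perm ` cls n a = {pos (- a)}"
  proof
    show "word_perm ` cls n a \<subseteq> {pos (- a)}" by (auto simp: cls_def word_perm_eq)
    show "{pos (- a)} \<subseteq> word_perm ` cls n a"
      using w word_perm_eq[OF w(1)] by (auto simp: cls_def intro!: image_eqI[of _ _ w])
  qed
  then show ?thesis by (simp add: braid_perm_def)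
qed

lemma pos_eq_id_iff: "pos (- a) = id \<longleftrightarrow> (\<forall>k. pos a k = k)"
proof -
  have "pos (- a) k = k \<longleftrightarrow> pos a k = k" for k
    using pos_uminus[of a k] pos_inj by metis
  then show ?thesis by (simp add: fun_eq_iff)
qed

lemma carrier_pure: "carrier (pure_braid_group n) = cls n ` pures n"
proof -
  have "carrier (pure_braid_group n) = {X \<in> cls n ` braids n. braid_perm X = id}"
    by (simp add: pure_braid_group_def kernel_def carrier_braid_group sym_group_def)
  also have "\<dots> = cls n ` {a \<in> braids n. braid_perm (cls n a) = id}" by blast
  also have "{a \<in> braids n. braid_perm (cls n a) = id} = pures n"
    unfolding pures_def by (simp add: braid_perm_cls pos_eq_id_iff cong: conj_cong)
  finally show ?thesis .
qed

lemma mult_pure: "a \<in> pures n \<Longrightarrow> b \<in> pures n \<Longrightarrow> cls n a \<otimes>\<^bsub>pure_braid_group n\<^esub> cls n b = cls n (a + b)"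
  using mult_braid_group[OF pures_braids pures_braids] by (simp add: pure_braid_group_def)

lemma one_pure: "\<one>\<^bsub>pure_braid_group n\<^esub> = cls n 0"
  using one_braid_group by (simp add: pure_braid_group_def)

lemma cls_inj: "a \<in> pures n \<Longrightarrow> cls n a = cls n b \<longleftrightarrow> a = b"
  using cls_eq_iff pures_braids by blast

lemma inj_on_cls: "inj_on (cls n) (pures n)"
  by (auto simp: inj_on_def cls_inj)

lemma group_pure: "group (pure_braid_group n)"
proof (rule groupI)
  fix x y z
  show "x \<otimes>\<^bsub>pure_braid_group n\<^esub> y \<in> carrier (pure_braid_group n)"
    if "x \<in> carrier (pure_braid_group n)" "y \<in> carrier (pure_braid_group n)"
    using that by (auto simp: carrier_pure mult_pure intro: pures_add)
  show "x \<otimes>\<^bsub>pure_braid_group n\<^esub> y \<otimes>\<^bsub>pure_braid_group n\<^esub> z = x \<otimes>\<^bsub>pure_braid_group n\<^esub> (y \<otimes>\<^bsub>pure_braid_group n\<^esub> z)"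
    if "x \<in> carrier (pure_braid_group n)" "y \<in> carrier (pure_braid_group n)" "z \<in> carrier (pure_braid_group n)"
    using that by (auto simp: carrier_pure mult_pure pures_add add.assoc)
  show "\<exists>y\<in>carrier (pure_braid_group n). y \<otimes>\<^bsub>pure_braid_group n\<^esub> x = \<one>\<^bsub>pure_braid_group n\<^esub>"
    if x: "x \<in> carrier (pure_braid_group n)"
  proof -
    obtain a where a: "a \<in> pures n" "x = cls n a" using x carrier_pure by blast
    have "cls n (- a) \<otimes>\<^bsub>pure_braid_group n\<^esub> x = \<one>\<^bsub>pure_braid_group n\<^esub>"
      using a pures_uminus by (simp add: mult_pure one_pure)
    moreover have "cls n (- a) \<in> carrier (pure_braid_group n)" using pures_uminus[OF a(1)] carrier_pure by blast
    ultimately show ?thesis by blast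
  qed
qed (auto simp: carrier_pure one_pure mult_pure)

lemma cls_carrier: "a \<in> pures n \<Longrightarrow> cls n a \<in> carrier (pure_braid_group n)"
  by (simp add: carrier_pure)

lemma inv_pure: "a \<in> pures n \<Longrightarrow> inv\<^bsub>pure_braid_group n\<^esub> (cls n a) = cls n (- a)"
  by (rule group.inv_equality[OF group_pure])
     (simp_all add: cls_carrier pures_uminus mult_pure one_pure)

lemma of_word_pure_gen_word:
  assumes "1 \<le> i" "i < j" "j \<le> n"
  shows "pure_gen_word i j \<in> braid_words n \<and> of_word (pure_gen_word i j) = pgen i j"
  using assms(2,3)
proof (induction j)
  case (Suc j)
  show ?case
  proof (cases "i = j")
    case True
    have "[Suc j..<Suc j] = []" by simp
    then have "pure_gen_word i (Suc j) = [(j, True), (j, True)]" using True by (simp add: pure_gen_word_def)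
    moreover have "of_word [(j, True), (j, True)] = \<sigma> j + \<sigma> j"
      using True assms Suc.prems of_word_Cons[of j True "[(j, True)]" n] of_word_letter[of j True] by (simp add: sletter_def)
    ultimately show ?thesis using True assms Suc.prems by (simp add: pgen_Suc)
  next
    case False
    then have ij: "i < j" using Suc.prems by simp
    have "[i + 1..<Suc j] = [i + 1..<j] @ [j]" using ij by simp
    then have eq: "pure_gen_word i (Suc j) = (j, True) # (pure_gen_word i j @ [(j, False)])"
      by (simp add: pure_gen_word_def)
    have IH: "pure_gen_word i j \<in> braid_words n" "of_word (pure_gen_word i j) = pgen i j"
      using Suc.IH[OF ij] Suc.prems by auto
    have j: "1 \<le> j" "j < n" using assms ij Suc.prems by auto
    have w: "[(j, False)] \<in> braid_words n" "pure_gen_word i j @ [(j, False)] \<in> braid_words n" using IH j by auto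
    have "of_word (pure_gen_word i (Suc j)) = \<sigma> j + (pgen i j + - \<sigma> j)"
      unfolding eq using of_word_Cons[of j True "pure_gen_word i j @ [(j, False)]" n] of_word_append[OF IH(1) w(1)] 
        of_word_letter[OF j(1), of False] IH j w by (simp add: sletter_def)
    then show ?thesis using ij w j eq by (simp add: pgen_step add.assoc diff_conv_add_uminus del: add_uminus_conv_diff)
  qed
qed simp

lemma pure_gen_eq:
  assumes "1 \<le> i" "i \<le> n" "1 \<le> j" "j \<le> n" shows "pure_gen n i j = cls n (gg i j)"
proof (cases "i = j")
  case False
  then have "min i j < max i j" "1 \<le> min i j" "max i j \<le> n" using assms by auto
  then have "pure_gen_word (min i j) (max i j) \<in> braid_words n"
    "of_word (pure_gen_word (min i j) (max i j)) = pgen (min i j) (max i j)"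
    using of_word_pure_gen_word by blast+
  then show ?thesis using False by (simp add: pure_gen_def gg_def braid_class_eq)
qed (simp add: pure_gen_def one_pure)

lemma pure_gen_less:
  "1 \<le> i \<Longrightarrow> i < j \<Longrightarrow> j \<le> n \<Longrightarrow> pure_gen n i j = cls n (pgen i j)"
  using pure_gen_eq[of i n j] by (simp add: gg_def min_def max_def)

lemma pure_gen0_eq:
  assumes j: "1 \<le> j" "j \<le> n" shows "pure_gen0 n j = cls n (- tsum n j)"
proof -
  have *: "foldr (\<lambda>i x. pure_gen n i j \<otimes>\<^bsub>pure_braid_group n\<^esub> x) is \<one>\<^bsub>pure_braid_group n\<^esub>
      = cls n (sum_list (map (\<lambda>i. gg i j) is)) \<and> sum_list (map (\<lambda>i. gg i j) is) \<in> pures n"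
    if "set is \<subseteq> {1..n}" for "is"
    using that
  proof (induction "is")
    case (Cons i "is")
    then have i: "1 \<le> i" "i \<le> n" by auto
    have "gg i j \<in> pures n" using gg_pures i j by blast
    then show ?case using Cons pure_gen_eq[OF i j] by (auto simp: mult_pure intro: pures_add)
  qed (simp add: one_pure)
  have "set [1..<n + 1] \<subseteq> {1..n}" by auto
  note c = *[OF this]
  show ?thesis unfolding pure_gen0_def tsum_def conjunct1[OF c] by (rule inv_pure[OF conjunct2[OF c]])
qed

subsection \<open>Homomorphisms between pure braid groups\<close>

definition val :: "nat \<Rightarrow> braid_word set \<Rightarrow> braid" where
  "val n = inv_into (pures n) (cls n)"

lemma val_cls: "a \<in> pures n \<Longrightarrow> val n (cls n a) = a"
  unfolding val_def by (rule inv_into_f_f[OF inj_on_cls])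

lemma val_pures: "X \<in> carrier (pure_braid_group n) \<Longrightarrow> val n X \<in> pures n"
  and cls_val: "X \<in> carrier (pure_braid_group n) \<Longrightarrow> cls n (val n X) = X"
  unfolding carrier_pure using val_cls by auto

text \<open>Restriction to the carrier supplies the extensionality demanded by the definite
  descriptions of \<open>del_strand\<close> and \<open>theta\<close>.\<close>

definition lift :: "nat \<Rightarrow> nat \<Rightarrow> (braid \<Rightarrow> braid) \<Rightarrow> braid_word set \<Rightarrow> braid_word set" where
  "lift n m F = (\<lambda>X\<in>carrier (pure_braid_group n). cls m (F (val n X)))"

lemma lift_cls: "a \<in> pures n \<Longrightarrow> lift n m F (cls n a) = cls m (F a)"
  by (simp add: lift_def cls_carrier val_cls)

lemma lift_hom:
  assumes "additive_on (pures n) F" "\<And>a. a \<in> pures n \<Longrightarrow> F a \<in> pures m"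
  shows "lift n m F \<in> hom (pure_braid_group n) (pure_braid_group m)"
proof (rule homI)
  fix x y assume "x \<in> carrier (pure_braid_group n)" "y \<in> carrier (pure_braid_group n)"
  then obtain a b where "a \<in> pures n" "b \<in> pures n" "x = cls n a" "y = cls n b" unfolding carrier_pure by blast
  then show "lift n m F (x \<otimes>\<^bsub>pure_braid_group n\<^esub> y) = lift n m F x \<otimes>\<^bsub>pure_braid_group m\<^esub> lift n m F y"
    using assms by (simp add: mult_pure lift_cls pures_add additive_on_def)
next
  fix x assume "x \<in> carrier (pure_braid_group n)"
  then show "lift n m F x \<in> carrier (pure_braid_group m)"
    using assms(2) by (auto simp: carrier_pure lift_cls)
qed

lemma additive_on_val:
  assumes "h \<in> hom (pure_braid_group n) (pure_braid_group m)"
  shows "additive_on (pures n) (\<lambda>a. val m (h (cls n a)))"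
proof -
  have "val m (h (cls n (a + b))) = val m (h (cls n a)) + val m (h (cls n b))" if ab: "a \<in> pures n" "b \<in> pures n" for a b
  proof -
    have h: "h (cls n a) \<in> carrier (pure_braid_group m)" "h (cls n b) \<in> carrier (pure_braid_group m)"
      using ab by (auto intro!: hom_in_carrier[OF assms] cls_carrier)
    have "h (cls n (a + b)) = h (cls n a) \<otimes>\<^bsub>pure_braid_group m\<^esub> h (cls n b)"
      using hom_mult[OF assms cls_carrier cls_carrier, OF ab] mult_pure[OF ab] by simp
    also have "\<dots> = cls m (val m (h (cls n a)) + val m (h (cls n b)))"
      using mult_pure[OF val_pures val_pures, OF h] by (simp add: cls_val h)
    finally show ?thesis using val_pures[OF h(1)] val_pures[OF h(2)] by (simp add: val_cls pures_add)
  qed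
  then show ?thesis by (simp add: additive_on_def)
qed

text \<open>The uniqueness half of both definite descriptions: the generators fix the map on the
  carrier, extensionality fixes it elsewhere.\<close>

lemma hom_eq_lift:
  assumes "h \<in> hom (pure_braid_group n) (pure_braid_group m)" "h \<in> extensional (carrier (pure_braid_group n))"
    and F: "additive_on (pures n) F" "\<And>a. a \<in> pures n \<Longrightarrow> F a \<in> pures m"
    and eq: "\<And>i j. 1 \<le> i \<Longrightarrow> i < j \<Longrightarrow> j \<le> n \<Longrightarrow> h (pure_gen n i j) = cls m (F (pgen i j))"
  shows "h = lift n m F"
proof (rule extensionalityI[OF assms(2)])
  show "lift n m F \<in> extensional (carrier (pure_braid_group n))" by (simp add: lift_def)
  fix X assume X: "X \<in> carrier (pure_braid_group n)"
  let ?a = "val n X"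
  have "val m (h (cls n ?a)) = F ?a"
  proof (rule additive_on_eqI[OF additive_on_val[OF assms(1)] F(1) _ val_pures[OF X]])
    fix i j assume ij: "1 \<le> i" "i < j" "j \<le> n"
    then show "val m (h (cls n (pgen i j))) = F (pgen i j)"
      using eq[OF ij] F(2)[OF pgen_pures[OF ij]] by (simp add: pure_gen_less val_cls)
  qed
  moreover have "h X \<in> carrier (pure_braid_group m)" by (rule hom_in_carrier[OF assms(1) X])
  ultimately have "h X = cls m (F ?a)" using cls_val[of "h X" m] cls_val[OF X] by simp
  then show "h X = lift n m F X" using X by (simp add: lift_def)
qed

lemma del_strand_eq:
  assumes k: "1 \<le> k" "k \<le> n" shows "del_strand n k = lift n (n - 1) (del k)"
  unfolding del_strand_def
proof (rule the_equality)
  let ?v = "\<lambda>i j. if k \<in> {i, j} then \<one>\<^bsub>pure_braid_group (n - 1)\<^esub>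
                   else pure_gen (n - 1) (shift_index k i) (shift_index k j)"
  have v: "?v i j = cls (n - 1) (del k (pgen i j))" if ij: "1 \<le> i" "i < j" "j \<le> n" for i j
  proof (cases "k \<in> {i, j}")
    case False
    then have "shift_index k j \<le> n - 1" "1 \<le> shift_index k i" "shift_index k i < shift_index k j"
      using shift_index_range[of j n k] shift_index_range[of i n k] shift_index_less[of i j k] ij k by auto
    then show ?thesis using False ij k by (auto simp: del_pgen pure_gen_less)
  qed (use ij k in \<open>auto simp: del_pgen one_pure\<close>)
  have F: "additive_on (pures n) (del k)" "\<And>a. a \<in> pures n \<Longrightarrow> del k a \<in> pures (n - 1)"
    using additive_del del_pures k by auto
  show "lift n (n - 1) (del k) \<in> hom (pure_braid_group n) (pure_braid_group (n - 1)) \<and>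
      lift n (n - 1) (del k) \<in> extensional (carrier (pure_braid_group n)) \<and>
      (\<forall>i j. 1 \<le> i \<and> i < j \<and> j \<le> n \<longrightarrow> lift n (n - 1) (del k) (pure_gen n i j) = ?v i j)"
  proof (intro conjI allI impI lift_hom F)
    show "lift n (n - 1) (del k) \<in> extensional (carrier (pure_braid_group n))" by (simp add: lift_def)
    fix i j assume ij: "1 \<le> i \<and> i < j \<and> j \<le> n"
    then show "lift n (n - 1) (del k) (pure_gen n i j) = ?v i j"
      using v[of i j] pgen_pures[of i j n] by (simp add: pure_gen_less lift_cls)
  qed
  show "d = lift n (n - 1) (del k)"
    if d: "d \<in> hom (pure_braid_group n) (pure_braid_group (n - 1)) \<and>
      d \<in> extensional (carrier (pure_braid_group n)) \<and>
      (\<forall>i j. 1 \<le> i \<and> i < j \<and> j \<le> n \<longrightarrow> d (pure_gen n i j) = ?v i j)" for d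
    using d v by (intro hom_eq_lift F) auto
qed

lemma lift_auto:
  assumes "pauto n F" shows "lift n n F \<in> auto (pure_braid_group n)"
proof -
  have "bij_betw (lift n n F) (carrier (pure_braid_group n)) (carrier (pure_braid_group n))"
    unfolding carrier_pure
  proof (rule bij_betw_imageI)
    show "inj_on (lift n n F) (cls n ` pures n)"
      using pautoD[OF assms] by (auto intro!: inj_onI simp: lift_cls cls_inj inj_on_eq_iff)
    show "lift n n F ` cls n ` pures n = cls n ` pures n"
    proof -
      have "lift n n F ` cls n ` pures n = cls n ` F ` pures n" by (simp add: image_image lift_cls cong: image_cong)
      then show ?thesis using pautoD(3)[OF assms] by simp
    qed
  qed
  then show ?thesis using lift_hom[OF pautoD(1,2)[OF assms]] by (simp add: auto_def Bij_def lift_def)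
qed

lemma theta_eq:
  assumes n: "1 \<le> n" shows "theta n = lift n n (tht n)"
  unfolding theta_def
proof (rule the_equality)
  let ?v = "\<lambda>j. inv\<^bsub>pure_braid_group n\<^esub> (pure_gen n 1 j)
                    \<otimes>\<^bsub>pure_braid_group n\<^esub> pure_gen0 n j
                    \<otimes>\<^bsub>pure_braid_group n\<^esub> pure_gen n 1 j"
  have v: "?v j = cls n (tht n (pgen 1 j))" if j: "2 \<le> j" "j \<le> n" for j
  proof -
    have p: "pgen 1 j \<in> pures n" "tsum n j \<in> pures n" using j pgen_pures[of 1 j n] tsum_pures[of j n] by auto
    have g: "pure_gen n 1 j = cls n (pgen 1 j)" "pure_gen0 n j = cls n (- tsum n j)"
      using pure_gen_less[of 1 j n] pure_gen0_eq[of j n] j by auto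
    show ?thesis unfolding g tht_pgen_1[OF j]
      using p by (simp add: inv_pure mult_pure pures_uminus pures_add del: add_uminus_conv_diff uminus_add_conv_diff pgen_1_2)
  qed
  have F: "additive_on (pures n) (tht n)" "\<And>a. a \<in> pures n \<Longrightarrow> tht n a \<in> pures n"
    using additive_tht tht_pures n by auto
  show "lift n n (tht n) \<in> auto (pure_braid_group n) \<and>
      (\<forall>i j. 2 \<le> i \<and> i < j \<and> j \<le> n \<longrightarrow> lift n n (tht n) (pure_gen n i j) = pure_gen n i j) \<and>
      (\<forall>j. 2 \<le> j \<and> j \<le> n \<longrightarrow> lift n n (tht n) (pure_gen n 1 j) = ?v j)"
  proof (intro conjI allI impI lift_auto pauto_tht n)
    fix i j assume ij: "2 \<le> i \<and> i < j \<and> j \<le> n"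
    then show "lift n n (tht n) (pure_gen n i j) = pure_gen n i j"
      using pgen_pures[of i j n] by (simp add: pure_gen_less lift_cls tht_pgen)
  next
    fix j assume j: "2 \<le> j \<and> j \<le> n"
    then have "lift n n (tht n) (pure_gen n 1 j) = cls n (tht n (pgen 1 j))"
      using pgen_pures[of 1 j n] pure_gen_less[of 1 j n] lift_cls by simp
    then show "lift n n (tht n) (pure_gen n 1 j) = ?v j" using v[of j] j by simp
  qed
  show "t = lift n n (tht n)"
    if t: "t \<in> auto (pure_braid_group n) \<and>
      (\<forall>i j. 2 \<le> i \<and> i < j \<and> j \<le> n \<longrightarrow> t (pure_gen n i j) = pure_gen n i j) \<and>
      (\<forall>j. 2 \<le> j \<and> j \<le> n \<longrightarrow> t (pure_gen n 1 j) = ?v j)" for t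
  proof (rule hom_eq_lift[OF _ _ F])
    show "t \<in> hom (pure_braid_group n) (pure_braid_group n)" "t \<in> extensional (carrier (pure_braid_group n))"
      using t by (auto simp: auto_def Bij_def)
    fix i j assume ij: "1 \<le> i" "i < j" "j \<le> n"
    show "t (pure_gen n i j) = cls n (tht n (pgen i j))"
    proof (cases "i = 1")
      case True
      have "2 \<le> j \<and> j \<le> n" using True ij by linarith
      then show ?thesis using t v[of j] True by metis
    next
      case False
      have i: "2 \<le> i \<and> i < j \<and> j \<le> n" using False ij by linarith
      then have "t (pure_gen n i j) = pure_gen n i j" using t by blast
      then show ?thesis using i by (simp add: pure_gen_less tht_pgen)
    qed
  qed
qed

lemma bdry_hom_cls:
  assumes "1 \<le> n" "a \<in> pures n" shows "bdry_hom n (cls n a) = cls (n - 1) (bd n a)"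
  using assms by (simp add: bdry_hom_def theta_eq del_strand_eq lift_cls tht_pures bd_def)

lemma Brun_eq:
  assumes n: "1 \<le> n" shows "Brun n = cls n ` brun n"
proof -
  have "kernel (pure_braid_group n) (pure_braid_group (n - 1)) (del_strand n k) = cls n ` K n k" if k: "k \<in> {1..n}" for k
  proof -
    have "del_strand n k (cls n a) = \<one>\<^bsub>pure_braid_group (n - 1)\<^esub> \<longleftrightarrow> dd n k a = 0" if "a \<in> pures n" for a
      using that k del_pures[OF that, of k] by (simp add: del_strand_eq lift_cls one_pure cls_inj dd_def)
    then show ?thesis unfolding kernel_def carrier_pure K_def by auto
  qed
  then have "Brun n = (\<Inter>k\<in>{1..n}. cls n ` K n k)" unfolding Brun_def by (intro INF_cong) auto
  also have "\<dots> = cls n ` (\<Inter>k\<in>{1..n}. K n k)"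
    by (rule HOL.sym, rule image_INT[OF inj_on_cls, where j = 1]) (use n K_pures in auto)
  also have "(\<Inter>k\<in>{1..n}. K n k) = brun n" using n K_pures[of n 1] by (auto simp: brun_def)
  finally show ?thesis .
qed

lemma Z_eq:
  assumes n: "1 \<le> n" shows "Z n = cls n ` zt n"
proof -
  have "bdry_hom n (cls n a) = \<one>\<^bsub>pure_braid_group (n - 1)\<^esub> \<longleftrightarrow> dd n 0 a = 0" if "a \<in> pures n" for a
    using that n bd_pures[OF that n] by (simp add: bdry_hom_cls one_pure cls_inj dd_def)
  then have "kernel (pure_braid_group n) (pure_braid_group (n - 1)) (bdry_hom n) = cls n ` K n 0"
    unfolding kernel_def carrier_pure K_def by auto
  then have "Z n = cls n ` brun n \<inter> cls n ` K n 0" using Brun_eq[OF n] by (simp add: Z_def)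
  also have "\<dots> = cls n ` (brun n \<inter> K n 0)"
    by (rule inj_on_image_Int[OF inj_on_cls, symmetric]) (auto simp: brun_def K_def)
  also have "brun n \<inter> K n 0 = zt n"
  proof -
    have "(\<forall>k\<in>{1..n}. a \<in> K n k) \<and> a \<in> K n 0 \<longleftrightarrow> (\<forall>k\<le>n. a \<in> K n k)" for a
      by (metis One_nat_def atLeastAtMost_iff less_one not_le le0)
    then show ?thesis unfolding brun_def zt_def by blast
  qed
  finally show ?thesis .
qed

lemma Bd_eq: "Bd n = cls n ` bdt n"
proof -
  have "bdry_hom (n + 1) (cls (n + 1) a) = cls n (bd (n + 1) a)" if "a \<in> brun (n + 1)" for a
    using that bdry_hom_cls[of "n + 1" a] by (simp add: brun_def)
  then show ?thesis unfolding Bd_def bdt_def using Brun_eq[of "n + 1"] by (simp add: image_image cong: image_cong)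
qed

subsection \<open>Characteristic subgroups\<close>

lemma pauto_of_auto:
  assumes f: "f \<in> auto (pure_braid_group n)"
  shows "pauto n (\<lambda>a. val n (f (cls n a)))"
proof -
  have hom: "f \<in> hom (pure_braid_group n) (pure_braid_group n)" and b: "bij_betw f (carrier (pure_braid_group n)) (carrier (pure_braid_group n))"
    using f by (auto simp: auto_def Bij_def)
  have c: "bij_betw (cls n) (pures n) (carrier (pure_braid_group n))"
    unfolding carrier_pure by (rule inj_on_imp_bij_betw[OF inj_on_cls])
  have "bij_betw (val n) (carrier (pure_braid_group n)) (pures n)" unfolding val_def by (rule bij_betw_inv_into[OF c])
  from bij_betw_trans[OF bij_betw_trans[OF c b] this]
  have "bij_betw (\<lambda>a. val n (f (cls n a))) (pures n) (pures n)" by (simp add: comp_def)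
  then show ?thesis using additive_on_val[OF hom] by (simp add: pauto_def)
qed

lemma subgroup_cls:
  assumes "subgrp H" "H \<subseteq> pures n" shows "subgroup (cls n ` H) (pure_braid_group n)"
proof (rule group.subgroupI[OF group_pure])
  show "cls n ` H \<subseteq> carrier (pure_braid_group n)" using assms(2) by (auto simp: carrier_pure)
  show "cls n ` H \<noteq> {}" using subgrpD(1)[OF assms(1)] by blast
  fix x assume "x \<in> cls n ` H"
  then obtain a where a: "a \<in> H" "a \<in> pures n" "x = cls n a" using assms(2) by blast
  then show "inv\<^bsub>pure_braid_group n\<^esub> x \<in> cls n ` H" using subgrpD(3)[OF assms(1)] by (simp add: inv_pure)
  fix y assume "y \<in> cls n ` H"
  then obtain b where "b \<in> H" "b \<in> pures n" "y = cls n b" using assms(2) by blast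
  then show "x \<otimes>\<^bsub>pure_braid_group n\<^esub> y \<in> cls n ` H" using a subgrpD(2)[OF assms(1)] by (simp add: mult_pure)
qed

text \<open>One inclusion for every automorphism gives equality, by applying it to the inverse as
  well.\<close>

lemma characteristic_cls:
  assumes "subgrp H" "H \<subseteq> pures n" "\<And>F. pauto n F \<Longrightarrow> F ` H \<subseteq> H"
  shows "characteristic_subgroup (cls n ` H) (pure_braid_group n)"
  unfolding characteristic_subgroup_def
proof (intro conjI ballI)
  show "subgroup (cls n ` H) (pure_braid_group n)" by (rule subgroup_cls[OF assms(1,2)])
  fix f assume f: "f \<in> auto (pure_braid_group n)"
  define F where "F = (\<lambda>a. val n (f (cls n a)))"
  have F: "pauto n F" unfolding F_def by (rule pauto_of_auto[OF f])
  have H: "F ` H = H"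
  proof
    show "F ` H \<subseteq> H" by (rule assms(3)[OF F])
    obtain F' where F': "pauto n F'" "\<And>x. x \<in> pures n \<Longrightarrow> F (F' x) = x" using pauto_inv[OF F] by metis
    show "H \<subseteq> F ` H"
    proof
      fix a assume a: "a \<in> H"
      then have "F' a \<in> H" using assms(3)[OF F'(1)] by blast
      moreover have "F (F' a) = a" using F'(2) a assms(2) by blast
      ultimately show "a \<in> F ` H" by (metis image_eqI)
    qed
  qed
  have "cls n (F a) = f (cls n a)" if "a \<in> H" for a unfolding F_def
  proof (rule cls_val)
    have hom: "f \<in> hom (pure_braid_group n) (pure_braid_group n)" using f by (simp add: auto_def)
    have "a \<in> pures n" using that assms(2) by blast
    then show "f (cls n a) \<in> carrier (pure_braid_group n)" by (intro hom_in_carrier[OF hom] cls_carrier)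
  qed
  then have "f ` cls n ` H = cls n ` F ` H" by (simp add: image_image cong: image_cong)
  then show "f ` cls n ` H = cls n ` H" unfolding H .
qed

lemma characteristic_Z: "2 \<le> n \<Longrightarrow> characteristic_subgroup (Z n) (pure_braid_group n)"
proof -
  assume n: "2 \<le> n"
  have "subgrp (zt n)" unfolding subgrp_def zt_def
    using subgrpD[OF K_subgrp, of n] n by (auto intro: pures_add pures_uminus)
  moreover have "zt n \<subseteq> pures n" by (auto simp: zt_def)
  ultimately show ?thesis using Z_eq[of n] n zt_invariant by (simp add: characteristic_cls)
qed

lemma characteristic_Bd: "2 \<le> n \<Longrightarrow> characteristic_subgroup (Bd n) (pure_braid_group n)"
proof -
  assume n: "2 \<le> n"
  have add: "additive_on (pures (n + 1)) (bd (n + 1))" by (rule additive_bd) simp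
  have brun: "brun (n + 1) \<subseteq> pures (n + 1)" by (auto simp: brun_def)
  have sub: "subgrp (brun (n + 1))" unfolding subgrp_def brun_def
    using subgrpD[OF K_subgrp, of "n + 1"] by (auto intro: pures_add pures_uminus)
  have "subgrp (bdt n)" unfolding subgrp_def
  proof (intro conjI ballI)
    show "0 \<in> bdt n" unfolding bdt_def
      using additive_sub(1)[OF add subgrp_pures] subgrpD(1)[OF sub] by (metis image_eqI)
    fix x assume "x \<in> bdt n"
    then obtain a where a: "a \<in> brun (n + 1)" "x = bd (n + 1) a" unfolding bdt_def by blast
    then have "- x = bd (n + 1) (- a)" using additive_sub(2)[OF add subgrp_pures, of a] brun by auto
    then show "- x \<in> bdt n" unfolding bdt_def using subgrpD(3)[OF sub a(1)] by blast
    fix y assume "y \<in> bdt n"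
    then obtain b where b: "b \<in> brun (n + 1)" "y = bd (n + 1) b" unfolding bdt_def by blast
    have "a \<in> pures (n + 1)" "b \<in> pures (n + 1)" using a(1) b(1) brun by blast+
    then have "x + y = bd (n + 1) (a + b)" using a(2) b(2) additive_sub(4)[OF add subgrp_pures] by metis
    then show "x + y \<in> bdt n" unfolding bdt_def using subgrpD(2)[OF sub a(1) b(1)] by blast
  qed
  moreover have "bdt n \<subseteq> pures n"
  proof
    fix x assume "x \<in> bdt n"
    then obtain a where "a \<in> pures (n + 1)" "x = bd (n + 1) a" unfolding bdt_def using brun by blast
    then show "x \<in> pures n" using bd_pures[of a "n + 1"] by simp
  qed
  ultimately show ?thesis using Bd_eq[of n] n bdt_invariant by (simp add: characteristic_cls)
qed

lemma inner_auto:
  assumes "group G" "c \<in> carrier G"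
  shows "(\<lambda>x\<in>carrier G. c \<otimes>\<^bsub>G\<^esub> x \<otimes>\<^bsub>G\<^esub> inv\<^bsub>G\<^esub> c) \<in> auto G"
proof -
  interpret group G by fact
  let ?f = "\<lambda>x\<in>carrier G. c \<otimes>\<^bsub>G\<^esub> x \<otimes>\<^bsub>G\<^esub> inv\<^bsub>G\<^esub> c"
  have c: "c \<in> carrier G" "inv\<^bsub>G\<^esub> c \<in> carrier G" using assms(2) by auto
  have "?f \<in> hom G G"
  proof (rule homI)
    fix x y assume "x \<in> carrier G" "y \<in> carrier G"
    then show "?f (x \<otimes>\<^bsub>G\<^esub> y) = ?f x \<otimes>\<^bsub>G\<^esub> ?f y"
      using c by (simp add: m_assoc inv_solve_left' flip: m_assoc[of "inv\<^bsub>G\<^esub> c" c])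
  qed (use c in simp)
  moreover have "bij_betw ?f (carrier G) (carrier G)"
  proof (rule bij_betw_byWitness[where f' = "\<lambda>x. inv\<^bsub>G\<^esub> c \<otimes>\<^bsub>G\<^esub> x \<otimes>\<^bsub>G\<^esub> c"])
    show "\<forall>x\<in>carrier G. inv\<^bsub>G\<^esub> c \<otimes>\<^bsub>G\<^esub> ?f x \<otimes>\<^bsub>G\<^esub> c = x"
      using c by (simp add: m_assoc flip: m_assoc[of "inv\<^bsub>G\<^esub> c" c])
    show "\<forall>x\<in>carrier G. ?f (inv\<^bsub>G\<^esub> c \<otimes>\<^bsub>G\<^esub> x \<otimes>\<^bsub>G\<^esub> c) = x"
      using c by (simp add: m_assoc flip: m_assoc[of c "inv\<^bsub>G\<^esub> c"])
  qed (use c in auto)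
  ultimately show ?thesis by (simp add: auto_def Bij_def)
qed

lemma characteristic_normal:
  assumes "group G" "characteristic_subgroup N G" shows "N \<lhd> G"
proof -
  interpret group G by fact
  have N: "subgroup N G" and ch: "\<And>f. f \<in> auto G \<Longrightarrow> f ` N = N" using assms(2) by (auto simp: characteristic_subgroup_def)
  have "c \<otimes>\<^bsub>G\<^esub> h \<otimes>\<^bsub>G\<^esub> inv\<^bsub>G\<^esub> c \<in> N" if "c \<in> carrier G" "h \<in> N" for c h
    using ch[OF inner_auto[OF assms(1) that(1)]] that(2) subgroup.mem_carrier[OF N that(2)]
    by (metis (no_types, lifting) image_eqI restrict_apply')
  then show ?thesis using N normal_inv_iff by blast
qed

text \<open>Cosets are sets, so the induced map is the image under \<open>f\<close>. Closure of the
  quotient under multiplication is recorded because \<open>auto_conjugate\<close> asks for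
  it.\<close>

lemma auto_quotient:
  assumes G: "group G" and H: "characteristic_subgroup H G" and N: "characteristic_subgroup N G"
    and f: "f \<in> auto G"
  defines "Q \<equiv> G\<lparr>carrier := H\<rparr> Mod N"
  shows "\<exists>g\<in>auto Q. \<forall>z\<in>H. g (N #>\<^bsub>G\<^esub> z) = N #>\<^bsub>G\<^esub> f z"
    and "\<And>C D. C \<in> carrier Q \<Longrightarrow> D \<in> carrier Q \<Longrightarrow> C \<otimes>\<^bsub>Q\<^esub> D \<in> carrier Q"
proof -
  interpret group G by fact
  interpret N: normal N G by (rule characteristic_normal[OF G N])
  have sH: "subgroup H G" and fH: "f ` H = H" and fN: "f ` N = N"
    using H N f by (auto simp: characteristic_subgroup_def)
  have hom: "f \<in> hom G G" and bij: "bij_betw f (carrier G) (carrier G)" using f by (auto simp: auto_def Bij_def)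
  have Hc: "z \<in> carrier G" if "z \<in> H" for z using subgroup.mem_carrier[OF sH that] .
  have car: "carrier Q = (\<lambda>z. N #>\<^bsub>G\<^esub> z) ` H"
    by (auto simp: Q_def FactGroup_def RCOSETS_def r_coset_def)
  have mult: "(N #>\<^bsub>G\<^esub> x) \<otimes>\<^bsub>Q\<^esub> (N #>\<^bsub>G\<^esub> y) = N #>\<^bsub>G\<^esub> (x \<otimes>\<^bsub>G\<^esub> y)" if "x \<in> H" "y \<in> H" for x y
    using N.rcos_sum[OF Hc Hc, OF that] by (simp add: Q_def FactGroup_def set_mult_def)
  have Hm: "x \<otimes>\<^bsub>G\<^esub> y \<in> H" if "x \<in> H" "y \<in> H" for x y using subgroup.m_closed[OF sH that] .
  show "C \<otimes>\<^bsub>Q\<^esub> D \<in> carrier Q" if CD: "C \<in> carrier Q" "D \<in> carrier Q" for C D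
  proof -
    obtain x y where "x \<in> H" "y \<in> H" "C = N #>\<^bsub>G\<^esub> x" "D = N #>\<^bsub>G\<^esub> y" using CD unfolding car by blast
    then show ?thesis using mult Hm unfolding car by simp
  qed
  have im: "f ` (N #>\<^bsub>G\<^esub> x) = N #>\<^bsub>G\<^esub> f x" if "x \<in> carrier G" for x
  proof -
    have eq: "N #>\<^bsub>G\<^esub> y = (\<lambda>h. h \<otimes>\<^bsub>G\<^esub> y) ` N" for y by (auto simp: r_coset_def)
    have "f ` (N #>\<^bsub>G\<^esub> x) = (\<lambda>h. f h \<otimes>\<^bsub>G\<^esub> f x) ` N"
      unfolding eq image_image by (rule image_cong) (simp_all add: hom_mult[OF hom N.mem_carrier that])
    also have "\<dots> = (\<lambda>h. h \<otimes>\<^bsub>G\<^esub> f x) ` f ` N" by (simp add: image_image)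
    finally show ?thesis unfolding fN eq .
  qed
  define g where "g = (\<lambda>C\<in>carrier Q. f ` C)"
  have g: "g (N #>\<^bsub>G\<^esub> z) = N #>\<^bsub>G\<^esub> f z" if "z \<in> H" for z using that im[OF Hc[OF that]] by (simp add: g_def car)
  have fH': "f z \<in> H" if "z \<in> H" for z using fH that by blast
  have "g \<in> hom Q Q"
  proof (rule homI)
    fix C assume "C \<in> carrier Q"
    then obtain z where "z \<in> H" "C = N #>\<^bsub>G\<^esub> z" unfolding car by blast
    then show "g C \<in> carrier Q" using g fH' car by simp
    fix D assume "D \<in> carrier Q"
    then obtain y where "y \<in> H" "D = N #>\<^bsub>G\<^esub> y" unfolding car by blast
    with \<open>z \<in> H\<close> \<open>C = N #>\<^bsub>G\<^esub> z\<close> show "g (C \<otimes>\<^bsub>Q\<^esub> D) = g C \<otimes>\<^bsub>Q\<^esub> g D"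
      using g fH' Hm Hc hom_mult[OF hom, of z y] by (simp add: mult)
  qed
  moreover have "bij_betw g (carrier Q) (carrier Q)"
  proof (rule bij_betw_imageI)
    show "inj_on g (carrier Q)"
    proof (rule inj_onI)
      fix C D assume CD: "C \<in> carrier Q" "D \<in> carrier Q" "g C = g D"
      have sub: "E \<subseteq> carrier G" if "E \<in> carrier Q" for E
        using that Hc r_coset_subset_G[OF N.subset] unfolding car by blast
      have "f ` C = f ` D" using CD by (simp add: g_def)
      then show "C = D" using inj_on_image_eq_iff[OF bij_betw_imp_inj_on[OF bij] sub sub, OF CD(1,2)] by simp
    qed
    have "g ` carrier Q = (\<lambda>z. N #>\<^bsub>G\<^esub> f z) ` H" unfolding car by (simp add: image_image g cong: image_cong)
    also have "\<dots> = (\<lambda>z. N #>\<^bsub>G\<^esub> z) ` f ` H" by (simp add: image_image)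
    finally show "g ` carrier Q = carrier Q" unfolding fH car .
  qed
  ultimately have "g \<in> auto Q" by (simp add: auto_def Bij_def g_def)
  then show "\<exists>g\<in>auto Q. \<forall>z\<in>H. g (N #>\<^bsub>G\<^esub> z) = N #>\<^bsub>G\<^esub> f z" using g by blast
qed

text \<open>On elements of the form \<open>\<phi> x\<close> the map is \<open>\<phi> (g x)\<close>,
  and every element of the target has this form; closure of \<open>Q\<close> makes this available
  for products.\<close>

lemma auto_conjugate:
  assumes closed: "\<And>x y. x \<in> carrier Q \<Longrightarrow> y \<in> carrier Q \<Longrightarrow> x \<otimes>\<^bsub>Q\<^esub> y \<in> carrier Q"
    and g: "g \<in> auto Q" and \<phi>: "\<phi> \<in> iso Q P"
  shows "(\<lambda>y\<in>carrier P. \<phi> (g (inv_into (carrier Q) \<phi> y))) \<in> auto P"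
proof -
  let ?i = "inv_into (carrier Q) \<phi>"
  let ?h = "\<lambda>y\<in>carrier P. \<phi> (g (?i y))"
  have gh: "g \<in> hom Q Q" and gb: "bij_betw g (carrier Q) (carrier Q)" using g by (auto simp: auto_def Bij_def)
  have ph: "\<phi> \<in> hom Q P" and pb: "bij_betw \<phi> (carrier Q) (carrier P)" using \<phi> by (auto simp: iso_def)
  have i: "?i (\<phi> x) = x" if "x \<in> carrier Q" for x using that pb by (simp add: bij_betw_def)
  have h: "?h (\<phi> x) = \<phi> (g x)" if "x \<in> carrier Q" for x using that hom_in_carrier[OF ph that] i by simp
  have "bij_betw (\<lambda>y. \<phi> (g (?i y))) (carrier P) (carrier P)"
    using bij_betw_trans[OF bij_betw_trans[OF bij_betw_inv_into[OF pb] gb] pb] by (simp add: comp_def)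
  then have hb: "bij_betw ?h (carrier P) (carrier P)" by (simp cong: bij_betw_cong)
  have "?h \<in> hom P P"
  proof (rule homI)
    fix y assume y: "y \<in> carrier P"
    then show "?h y \<in> carrier P" using hb by (rule bij_betw_apply[rotated])
    fix z assume "z \<in> carrier P"
    then obtain u v where uv: "u \<in> carrier Q" "v \<in> carrier Q" "y = \<phi> u" "z = \<phi> v"
      using y bij_betw_imp_surj_on[OF pb] by blast
    have "?h (y \<otimes>\<^bsub>P\<^esub> z) = ?h (\<phi> (u \<otimes>\<^bsub>Q\<^esub> v))" using uv hom_mult[OF ph uv(1,2)] by simp
    also have "\<dots> = \<phi> (g u \<otimes>\<^bsub>Q\<^esub> g v)" using h[OF closed[OF uv(1,2)]] hom_mult[OF gh uv(1,2)] by simp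
    also have "\<dots> = \<phi> (g u) \<otimes>\<^bsub>P\<^esub> \<phi> (g v)" using uv by (intro hom_mult[OF ph] hom_in_carrier[OF gh])
    also have "\<dots> = ?h y \<otimes>\<^bsub>P\<^esub> ?h z" using h uv by simp
    finally show "?h (y \<otimes>\<^bsub>P\<^esub> z) = ?h y \<otimes>\<^bsub>P\<^esub> ?h z" .
  qed
  then show ?thesis using hb by (simp add: auto_def Bij_def)
qed

theorem theorem1p1:
  fixes n :: nat
  assumes "n \<ge> 2"
  shows "characteristic_subgroup (Z n) (pure_braid_group n) \<and>
    characteristic_subgroup (Bd n) (pure_braid_group n) \<and>
    (\<forall>f\<in>auto (pure_braid_group n).
       \<exists>g\<in>auto (Z_mod_Bd n).
         (\<forall>z\<in>Z n. g (Bd n #>\<^bsub>pure_braid_group n\<^esub> z) = Bd n #>\<^bsub>pure_braid_group n\<^esub> f z) \<and>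
         (\<forall>p\<in>topspace (nsphere 2). \<forall>\<phi>\<in>iso (Z_mod_Bd n) (homotopy_group n (nsphere 2) p).
            (\<lambda>y\<in>carrier (homotopy_group n (nsphere 2) p).
               \<phi> (g (inv_into (carrier (Z_mod_Bd n)) \<phi> y)))
            \<in> auto (homotopy_group n (nsphere 2) p)))"
proof (intro conjI ballI)
  show Z: "characteristic_subgroup (Z n) (pure_braid_group n)" by (rule characteristic_Z[OF assms])
  show Bd: "characteristic_subgroup (Bd n) (pure_braid_group n)" by (rule characteristic_Bd[OF assms])
  fix f assume f: "f \<in> auto (pure_braid_group n)"
  note Q = auto_quotient[OF group_pure Z Bd f, folded Z_mod_Bd_def]
  obtain g where g: "g \<in> auto (Z_mod_Bd n)"
    "\<forall>z\<in>Z n. g (Bd n #>\<^bsub>pure_braid_group n\<^esub> z) = Bd n #>\<^bsub>pure_braid_group n\<^esub> f z"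
    using Q(1) by blast
  show "\<exists>g\<in>auto (Z_mod_Bd n).
         (\<forall>z\<in>Z n. g (Bd n #>\<^bsub>pure_braid_group n\<^esub> z) = Bd n #>\<^bsub>pure_braid_group n\<^esub> f z) \<and>
         (\<forall>p\<in>topspace (nsphere 2). \<forall>\<phi>\<in>iso (Z_mod_Bd n) (homotopy_group n (nsphere 2) p).
            (\<lambda>y\<in>carrier (homotopy_group n (nsphere 2) p).
               \<phi> (g (inv_into (carrier (Z_mod_Bd n)) \<phi> y)))
            \<in> auto (homotopy_group n (nsphere 2) p))"
    using g auto_conjugate[OF Q(2) g(1)] by blast
qed

end
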